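(* Let $\omega$ be a K\"ahler–Einstein form on $M$, i.e. the Ricci form $\mu$ of $\omega$ satisfies $\mu=\kappa\,\omega$ for some $\kappa\in\mathbb{R}$. Then there exist constants $c_1,\dots,c_n$, not depending on $\lambda$, such that for every $\lambda=(\lambda_1,\dots,\lambda_n)\in\Lambda$ the reduced K\"ahler form $\omega_\lambda$ and its Ricci form $\mu_\lambda$ satisfy on $M_{\mathrm{red}}$ $$\mu_\lambda-2\sqrt{-1}\,\partial\bar\partial\log V_{\mathrm{eff}}+\sum_{i=1}^n c_i\,\mu_i=\kappa\Big(\omega_\lambda+\sum_{i=1}^n\lambda_i\mu_i\Big),$$ where $V_{\mathrm{eff}}$ is the effective potential at level $\lambda$ and $\mu_i=\mu_{i,\lambda}$ is the curvature form of $\mathbb{L}_i$ with respect to $\langle\cdot,\cdot\rangle_\lambda$. Moreover, the constants $c_i$ are given by the divergence identities on $M$ $$\kappa\,\phi_i=\operatorname{div}Z_i+c_i,\qquad i=1,\dots,n.$$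
   Context: Setting. $T=(S^1)^n$, $T_{\mathbb{C}}=(\mathbb{C}^* )^n$. $M$ is a connected complex manifold of dimension $d$ which is the total space of a holomorphic principal $T_{\mathbb{C}}$-bundle $\pi:M\to M_{\mathrm{red}}$ over a complex manifold $M_{\mathrm{red}}$, and $\omega$ is a $T$-invariant K\"ahler form on $M$ for which the $T$-action is Hamiltonian, with moment map $\Phi=(\phi_1,\dots,\phi_n):M\to\mathbb{R}^n$, where $\iota(\partial/\partial\theta_j)\omega=-d\phi_j$ and $\partial/\partial\theta_j$ generates the $j$-th circle factor. $\Lambda\subset\mathbb{R}^n$ is the set of $\lambda$ such that the composition $\Phi^{-1}(\lambda)\hookrightarrow M\xrightarrow{\pi}M_{\mathrm{red}}$ induces a biholomorphism of the symplectic quotient $M_\lambda=\Phi^{-1}(\lambda)/T$ (with its K\"ahler quotient structure) onto $M_{\mathrm{red}}$. For $\lambda\in\Lambda$, $\omega_\lambda$ denotes the reduced K\"ahler form, viewed as a K\"ahler form on $M_{\mathrm{red}}$ (its pull-back to $\Phi^{-1}(\lambda)$ is the restriction of $\omega$). $\iota_\lambda$ is the inclusion of $\Phi^{-1}(\lambda)$ in $M$; for a $T$-invariant function $u$ on $M$ (or on $\pi^{-1}(U)$, $U\subset M_{\mathrm{red}}$ open), $\iota_\lambda^*u$ is regarded as a function on $M_{\mathrm{red}}$ (or $U$) via $\Phi^{-1}(\lambda)/T\cong M_{\mathrm{red}}$. Ricci form: if a K\"ahler form is $\sqrt{-1}\sum g_{a\bar b}\,dx_a\wedge d\bar x_b$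 in local holomorphic coordinates, its Ricci form is $-\sqrt{-1}\,\partial\bar\partial\log\det(g_{a\bar b})$. Effective potential: $V_{\mathrm{eff}}:M_{\mathrm{red}}\to\mathbb{R}_{>0}$ assigns to $p$ the Riemannian volume of the $T$-orbit in $\Phi^{-1}(\lambda)$ lying above $p$. Line bundles: let $\chi_i:T_{\mathbb{C}}\to\mathbb{C}^*$ be projection onto the $i$-th factor. $\mathbb{L}_i$ is the holomorphic line bundle on $M_{\mathrm{red}}$ whose sections are maps $s:M\to\mathbb{C}$ with $s(ap)=\chi_i(a)^{-1}s(p)$ for $a\in T_{\mathbb{C}}$. For $\lambda\in\Lambda$ it carries the Hermitian metric $\langle s,s\rangle_\lambda=\iota_\lambda^*|s|^2$, and $\mu_{i,\lambda}=-\sqrt{-1}\,\partial\bar\partial\log\langle s_i,s_i\rangle_\lambda$ for any local non-vanishing holomorphic section $s_i$ (in a local trivialization $\pi^{-1}(U)\cong(\mathbb{C}^* )^n\times U$ with coordinates $(z,w)$ one may take $s_i=z_i^{-1}$). $Z_i$ is the complex vector field generating the $i$-th factor of the $T_{\mathbb{C}}$-action; in a local trivialization $Z_i=z_i\,\partial/\partial z_i$. Its divergence is defined by $L_{Z_i}\omega^d=(\operatorname{div}Z_i)\,\omega^d$.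
   Formalization: The divergence identity is proved with the opposite sign, κφ_i = −div Z_i + c_i: with the stated conventions the printed κφ_i = div Z_i + c_i fails, e.g. on C^* with ω = i(1+|z|²)^{-2}dz∧dz̄, where κ = 2 and div Z = 1 − 2|z|²/(1+|z|²). *)

theory Defs
  imports "HOL-Analysis.Analysis"
begin

section \<open>Calculus on complex coordinate spaces\<close>

text \<open>
  The model space of a complex manifold of dimension \<open>card I\<close> is \<open>\<complex>\<^sup>I\<close>, realised as the subspace of
  \<open>complex ^ 'k\<close> of vectors vanishing outside \<open>I :: 'k set\<close>.  Using index sets rather than the index
  type itself allows dimension \<open>0\<close>.
\<close>

definition coord_space :: "'k::finite set \<Rightarrow> (complex ^ 'k) set" where
  "coord_space I = {x. \<forall>a. a \<notin> I \<longrightarrow> x $ a = 0}"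

definition ddir :: "'v::real_normed_vector \<Rightarrow> ('v \<Rightarrow> 'w::real_normed_vector) \<Rightarrow> 'v \<Rightarrow> 'w" where
  "ddir v f x = vector_derivative (\<lambda>t::real. f (x + t *\<^sub>R v)) (at 0)"

primrec iter_ddir :: "'v list \<Rightarrow> ('v::real_normed_vector \<Rightarrow> 'w::real_normed_vector) \<Rightarrow> 'v \<Rightarrow> 'w" where
  "iter_ddir [] f = f"
| "iter_ddir (v # vs) f = ddir v (iter_ddir vs f)"

definition real_dirs :: "'k::finite set \<Rightarrow> (complex ^ 'k) set" where
  "real_dirs I = (\<lambda>a. axis a 1) ` I \<union> (\<lambda>a. axis a \<i>) ` I"

text \<open>\<open>C\<^sup>\<infinity>\<close> on a relatively open subset \<open>S\<close> of \<open>\<complex>\<^sup>I\<close>: all iterated real partial derivatives exist and are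
  continuous.\<close>

definition smooth_fun ::
    "'k::finite set \<Rightarrow> (complex ^ 'k) set \<Rightarrow> (complex ^ 'k \<Rightarrow> 'w::real_normed_vector) \<Rightarrow> bool" where
  "smooth_fun I S f \<longleftrightarrow>
     (\<forall>vs. set vs \<subseteq> real_dirs I \<longrightarrow>
        continuous_on S (iter_ddir vs f) \<and>
        (\<forall>x\<in>S. \<forall>v\<in>real_dirs I. (\<lambda>t::real. iter_ddir vs f (x + t *\<^sub>R v)) differentiable (at 0)))"

text \<open>The Wirtinger derivatives \<open>\<partial>/\<partial>x\<^sub>a\<close> and \<open>\<partial>/\<partial>\<close>conj\<open>(x\<^sub>a)\<close>.\<close>

definition pd :: "'k::finite \<Rightarrow> (complex ^ 'k \<Rightarrow> complex) \<Rightarrow> complex ^ 'k \<Rightarrow> complex" where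
  "pd a f x = (ddir (axis a 1) f x - \<i> * ddir (axis a \<i>) f x) / 2"

definition pdbar :: "'k::finite \<Rightarrow> (complex ^ 'k \<Rightarrow> complex) \<Rightarrow> complex ^ 'k \<Rightarrow> complex" where
  "pdbar a f x = (ddir (axis a 1) f x + \<i> * ddir (axis a \<i>) f x) / 2"

definition holo_fun :: "'k::finite set \<Rightarrow> (complex ^ 'k) set \<Rightarrow> (complex ^ 'k \<Rightarrow> complex) \<Rightarrow> bool" where
  "holo_fun I S f \<longleftrightarrow> smooth_fun I S f \<and> (\<forall>x\<in>S. \<forall>a\<in>I. pdbar a f x = 0)"

definition holo_vec ::
    "'k::finite set \<Rightarrow> (complex ^ 'k) set \<Rightarrow> (complex ^ 'k \<Rightarrow> complex ^ 'l::finite) \<Rightarrow> bool" where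
  "holo_vec I S F \<longleftrightarrow> (\<forall>j. holo_fun I S (\<lambda>x. F x $ j))"


section \<open>Complex manifolds\<close>

type_synonym ('a, 'k) chart = "'a set \<times> ('a \<Rightarrow> complex ^ 'k)"

record ('a, 'k) cman =
  mtop :: "'a topology"
  midx :: "'k set"
  mcharts :: "('a, 'k) chart set"

definition cimage :: "('a, 'k::finite) chart \<Rightarrow> (complex ^ 'k) set" where
  "cimage c = snd c ` fst c"

definition cinv :: "('a, 'k::finite) chart \<Rightarrow> complex ^ 'k \<Rightarrow> 'a" where
  "cinv c = inv_into (fst c) (snd c)"

definition is_chart :: "'a topology \<Rightarrow> 'k::finite set \<Rightarrow> ('a, 'k) chart \<Rightarrow> bool" where
  "is_chart X I c \<longleftrightarrow>
     openin X (fst c) \<and>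
     openin (top_of_set (coord_space I)) (cimage c) \<and>
     homeomorphic_map (subtopology X (fst c)) (top_of_set (cimage c)) (snd c)"

definition compatible :: "'k::finite set \<Rightarrow> ('a, 'k) chart \<Rightarrow> ('a, 'k) chart \<Rightarrow> bool" where
  "compatible I c c' \<longleftrightarrow>
     holo_vec I (snd c ` (fst c \<inter> fst c')) (snd c' \<circ> cinv c) \<and>
     holo_vec I (snd c' ` (fst c \<inter> fst c')) (snd c \<circ> cinv c')"

text \<open>The last clause says that the atlas is maximal, i.e. \<open>mcharts M\<close> consists of all holomorphic charts.\<close>

definition complex_manifold :: "('a, 'k::finite) cman \<Rightarrow> bool" where
  "complex_manifold M \<longleftrightarrow>
     Hausdorff_space (mtop M) \<and> second_countable (mtop M) \<and>
     (\<forall>c\<in>mcharts M. is_chart (mtop M) (midx M) c) \<and>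
     \<Union> (fst ` mcharts M) = topspace (mtop M) \<and>
     (\<forall>c\<in>mcharts M. \<forall>c'\<in>mcharts M. compatible (midx M) c c') \<and>
     (\<forall>c. is_chart (mtop M) (midx M) c \<and> (\<forall>c'\<in>mcharts M. compatible (midx M) c c') \<longrightarrow> c \<in> mcharts M)"

definition holomorphic_map :: "('a, 'k::finite) cman \<Rightarrow> ('b, 'l::finite) cman \<Rightarrow> ('a \<Rightarrow> 'b) \<Rightarrow> bool" where
  "holomorphic_map M N f \<longleftrightarrow>
     continuous_map (mtop M) (mtop N) f \<and>
     (\<forall>c\<in>mcharts M. \<forall>c'\<in>mcharts N.
        holo_vec (midx M) (snd c ` (fst c \<inter> f -` fst c')) (snd c' \<circ> f \<circ> cinv c))"

definition biholomorphic_map :: "('a, 'k::finite) cman \<Rightarrow> ('b, 'l::finite) cman \<Rightarrow> ('a \<Rightarrow> 'b) \<Rightarrow> bool" where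
  "biholomorphic_map M N f \<longleftrightarrow>
     bij_betw f (topspace (mtop M)) (topspace (mtop N)) \<and>
     holomorphic_map M N f \<and>
     holomorphic_map N M (inv_into (topspace (mtop M)) f)"

text \<open>Open submanifolds and products are given by atlases that need not be maximal; this does not affect
  which maps are holomorphic.\<close>

definition open_sub :: "('a, 'k::finite) cman \<Rightarrow> 'a set \<Rightarrow> ('a, 'k) cman" where
  "open_sub M U = \<lparr> mtop = subtopology (mtop M) U, midx = midx M,
                    mcharts = (\<lambda>c. (fst c \<inter> U, snd c)) ` mcharts M \<rparr>"

definition join_vec :: "complex ^ 'k::finite \<Rightarrow> complex ^ 'l::finite \<Rightarrow> complex ^ ('k + 'l)" where
  "join_vec x y = (\<chi> s. case s of Inl a \<Rightarrow> x $ a | Inr b \<Rightarrow> y $ b)"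

definition prod_man :: "('a, 'k::finite) cman \<Rightarrow> ('b, 'l::finite) cman \<Rightarrow> ('a \<times> 'b, 'k + 'l) cman" where
  "prod_man M N =
     \<lparr> mtop = prod_topology (mtop M) (mtop N), midx = midx M <+> midx N,
       mcharts = (\<lambda>(c, c'). (fst c \<times> fst c', \<lambda>(p, q). join_vec (snd c p) (snd c' q))) `
                   (mcharts M \<times> mcharts N) \<rparr>"


section \<open>Torus actions and principal bundles\<close>

text \<open>Multiplication on \<open>complex ^ 'n\<close> is componentwise.\<close>

definition T_complex :: "(complex ^ 'n::finite) set" where
  "T_complex = {a. \<forall>i. a $ i \<noteq> 0}"

definition T_compact :: "(complex ^ 'n::finite) set" where
  "T_compact = {a. \<forall>i. cmod (a $ i) = 1}"

definition T_complex_man :: "(complex ^ 'n::finite, 'n) cman" where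
  "T_complex_man = \<lparr> mtop = top_of_set T_complex, midx = UNIV, mcharts = {(T_complex, id)} \<rparr>"

definition principal_bundle ::
    "('m, 'd::finite) cman \<Rightarrow> ('b, 'r::finite) cman \<Rightarrow> ('m \<Rightarrow> 'b) \<Rightarrow> (complex ^ 'n::finite \<Rightarrow> 'm \<Rightarrow> 'm) \<Rightarrow> bool"
  where
  "principal_bundle M B \<pi> act \<longleftrightarrow>
     holomorphic_map M B \<pi> \<and> \<pi> ` topspace (mtop M) = topspace (mtop B) \<and>
     holomorphic_map (prod_man T_complex_man M) M (\<lambda>(a, q). act a q) \<and>
     (\<forall>q\<in>topspace (mtop M). act 1 q = q) \<and>
     (\<forall>a\<in>T_complex. \<forall>b\<in>T_complex. \<forall>q\<in>topspace (mtop M). act (a * b) q = act a (act b q)) \<and>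
     (\<forall>a\<in>T_complex. \<forall>q\<in>topspace (mtop M). \<pi> (act a q) = \<pi> q) \<and>
     (\<forall>p\<in>topspace (mtop B). \<exists>V \<tau>. openin (mtop B) V \<and> p \<in> V \<and>
        biholomorphic_map (open_sub M (\<pi> -` V)) (prod_man T_complex_man (open_sub B V)) \<tau> \<and>
        (\<forall>q\<in>topspace (mtop M) \<inter> \<pi> -` V.
           snd (\<tau> q) = \<pi> q \<and> (\<forall>a\<in>T_complex. \<tau> (act a q) = (a * fst (\<tau> q), \<pi> q))))"

definition tor :: "'n::finite \<Rightarrow> complex \<Rightarrow> complex ^ 'n" where
  "tor i \<zeta> = (\<chi> j. if j = i then exp \<zeta> else 1)"

text \<open>Vector fields are given by their components in each chart.  A real tangent vector is represented
  by its \<open>(1,0)\<close>-components \<open>u\<close>, i.e. it is \<open>2 Re (\<Sum>a. u\<^sub>a \<partial>/\<partial>x\<^sub>a)\<close>, so that the complex structure acts by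
  \<open>u \<mapsto> \<i> u\<close>.  The field below is \<open>\<partial>/\<partial>\<theta>\<^sub>i\<close>.\<close>

definition circle_field ::
    "(complex ^ 'n::finite \<Rightarrow> 'm \<Rightarrow> 'm) \<Rightarrow> 'n \<Rightarrow> ('m, 'd::finite) chart \<Rightarrow> complex ^ 'd \<Rightarrow> complex ^ 'd" where
  "circle_field act i c x =
     vector_derivative (\<lambda>\<theta>::real. snd c (act (tor i (\<i> * of_real \<theta>)) (cinv c x))) (at 0)"

text \<open>A complexified tangent vector \<open>\<Sum>a. V\<^sub>a \<partial>/\<partial>x\<^sub>a + W\<^sub>a \<partial>/\<partial>\<close>conj\<open>(x\<^sub>a)\<close> is represented by the pair \<open>(V, W)\<close>.
  The field \<open>Z\<^sub>i\<close> is of type \<open>(1,0)\<close>.\<close>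

type_synonym 'k cvec = "(complex ^ 'k) \<times> (complex ^ 'k)"

definition Z_field ::
    "(complex ^ 'n::finite \<Rightarrow> 'm \<Rightarrow> 'm) \<Rightarrow> 'n \<Rightarrow> ('m, 'd::finite) chart \<Rightarrow> complex ^ 'd \<Rightarrow> 'd cvec" where
  "Z_field act i c x = ((\<chi> a. deriv (\<lambda>\<zeta>. snd c (act (tor i \<zeta>) (cinv c x)) $ a) 0), 0)"


section \<open>(1,1)-forms and Kaehler forms\<close>

text \<open>A \<open>(1,1)\<close>-form is given in each chart by its components: the matrix \<open>h\<close> stands for
  \<open>\<i> \<Sum>a b. h\<^sub>a\<^sub>b dx\<^sub>a \<and> d\<close>conj\<open>(x\<^sub>b)\<close>, where \<open>(\<alpha> \<and> \<beta>)(X, Y) = \<alpha>(X) \<beta>(Y) - \<alpha>(Y) \<beta>(X)\<close>.\<close>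

type_synonym ('a, 'k) form11 = "('a, 'k) chart \<Rightarrow> complex ^ 'k \<Rightarrow> 'k \<Rightarrow> 'k \<Rightarrow> complex"

definition cform :: "'k::finite set \<Rightarrow> ('k \<Rightarrow> 'k \<Rightarrow> complex) \<Rightarrow> 'k cvec \<Rightarrow> 'k cvec \<Rightarrow> complex" where
  "cform I h X Y =
     \<i> * (\<Sum>a\<in>I. \<Sum>b\<in>I. h a b * (fst X $ a * snd Y $ b - fst Y $ a * snd X $ b))"

definition realvec :: "complex ^ 'k::finite \<Rightarrow> 'k cvec" where
  "realvec u = (u, (\<chi> a. cnj (u $ a)))"

definition form2 :: "'k::finite set \<Rightarrow> ('k \<Rightarrow> 'k \<Rightarrow> complex) \<Rightarrow> complex ^ 'k \<Rightarrow> complex ^ 'k \<Rightarrow> complex" where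
  "form2 I h u v = cform I h (realvec u) (realvec v)"

text \<open>The associated metric \<open>g(u, v) = \<omega>(u, J v)\<close>.\<close>

definition kmetric :: "'k::finite set \<Rightarrow> ('k \<Rightarrow> 'k \<Rightarrow> complex) \<Rightarrow> complex ^ 'k \<Rightarrow> complex ^ 'k \<Rightarrow> real" where
  "kmetric I h u v = Re (form2 I h u (\<i> *s v))"

text \<open>\<open>f\<^sup>* \<omega> = \<omega>\<close>.\<close>

definition preserves_form :: "('a, 'k::finite) cman \<Rightarrow> ('a, 'k) form11 \<Rightarrow> ('a \<Rightarrow> 'a) \<Rightarrow> bool" where
  "preserves_form M \<omega> f \<longleftrightarrow>
     (\<forall>c\<in>mcharts M. \<forall>c'\<in>mcharts M. \<forall>q\<in>fst c. f q \<in> fst c' \<longrightarrow>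
        (let F = snd c' \<circ> f \<circ> cinv c; x = snd c q in
         \<forall>u\<in>coord_space (midx M). \<forall>v\<in>coord_space (midx M).
           form2 (midx M) (\<omega> c' (F x)) (ddir u F x) (ddir v F x) = form2 (midx M) (\<omega> c x) u v))"

text \<open>Invariance under the identity map is the transformation law between charts.  Closedness is
  \<open>d\<omega> = 0\<close>, evaluated on constant vector fields.\<close>

definition kaehler_form :: "('a, 'k::finite) cman \<Rightarrow> ('a, 'k) form11 \<Rightarrow> bool" where
  "kaehler_form M \<omega> \<longleftrightarrow>
     preserves_form M \<omega> id \<and>
     (\<forall>c\<in>mcharts M.
        (\<forall>a\<in>midx M. \<forall>b\<in>midx M. smooth_fun (midx M) (cimage c) (\<lambda>x. \<omega> c x a b)) \<and>
        (\<forall>x\<in>cimage c.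
           (\<forall>a\<in>midx M. \<forall>b\<in>midx M. \<omega> c x b a = cnj (\<omega> c x a b)) \<and>
           (\<forall>u\<in>coord_space (midx M). u \<noteq> 0 \<longrightarrow> 0 < kmetric (midx M) (\<omega> c x) u u) \<and>
           (\<forall>u\<in>coord_space (midx M). \<forall>v\<in>coord_space (midx M). \<forall>w\<in>coord_space (midx M).
              ddir u (\<lambda>y. form2 (midx M) (\<omega> c y) v w) x
              - ddir v (\<lambda>y. form2 (midx M) (\<omega> c y) u w) x
              + ddir w (\<lambda>y. form2 (midx M) (\<omega> c y) u v) x = 0)))"

text \<open>Components of \<open>\<i> \<partial>\<partial>\<close>bar\<open> u\<close> in the normalisation above.\<close>

definition ddbar :: "'k::finite set \<Rightarrow> (complex ^ 'k \<Rightarrow> real) \<Rightarrow> complex ^ 'k \<Rightarrow> 'k \<Rightarrow> 'k \<Rightarrow> complex" where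
  "ddbar I u x a b = (if a \<in> I \<and> b \<in> I then pd a (pdbar b (\<lambda>y. complex_of_real (u y))) x else 0)"

definition det_on :: "'k::finite set \<Rightarrow> ('k \<Rightarrow> 'k \<Rightarrow> complex) \<Rightarrow> complex" where
  "det_on I h = (\<Sum>\<sigma> | \<sigma> permutes I. of_int (sign \<sigma>) * (\<Prod>a\<in>I. h a (\<sigma> a)))"

text \<open>The determinant of a positive Hermitian matrix is a positive real, so \<open>Re\<close> loses nothing.\<close>

definition ricci_form :: "('a, 'k::finite) cman \<Rightarrow> ('a, 'k) form11 \<Rightarrow> ('a, 'k) form11" where
  "ricci_form M \<omega> c x a b = - ddbar (midx M) (\<lambda>y. ln (Re (det_on (midx M) (\<omega> c y)))) x a b"

definition kaehler_einstein :: "('a, 'k::finite) cman \<Rightarrow> ('a, 'k) form11 \<Rightarrow> real \<Rightarrow> bool" where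
  "kaehler_einstein M \<omega> \<kappa> \<longleftrightarrow>
     kaehler_form M \<omega> \<and>
     (\<forall>c\<in>mcharts M. \<forall>x\<in>cimage c. \<forall>a\<in>midx M. \<forall>b\<in>midx M.
        ricci_form M \<omega> c x a b = of_real \<kappa> * \<omega> c x a b)"


section \<open>Divergence\<close>

text \<open>The \<open>k\<close>-fold wedge power of a 2-form at a point; \<open>k\<close>-forms are functions of lists of vectors.\<close>

definition wedge_power :: "nat \<Rightarrow> ('v \<Rightarrow> 'v \<Rightarrow> complex) \<Rightarrow> 'v list \<Rightarrow> complex" where
  "wedge_power k \<beta> vs =
     (\<Sum>\<sigma> | \<sigma> permutes {..<2 * k}.
        of_int (sign \<sigma>) * (\<Prod>i<k. \<beta> (vs ! \<sigma> (2 * i)) (vs ! \<sigma> (2 * i + 1)))) / 2 ^ k"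

definition cdir :: "'k::finite set \<Rightarrow> 'k cvec \<Rightarrow> (complex ^ 'k \<Rightarrow> complex) \<Rightarrow> complex ^ 'k \<Rightarrow> complex" where
  "cdir I X f x = (\<Sum>a\<in>I. fst X $ a * pd a f x + snd X $ a * pdbar a f x)"

definition cdir_field :: "'k::finite set \<Rightarrow> 'k cvec \<Rightarrow> (complex ^ 'k \<Rightarrow> 'k cvec) \<Rightarrow> complex ^ 'k \<Rightarrow> 'k cvec" where
  "cdir_field I X Z x =
     ((\<chi> b. cdir I X (\<lambda>y. fst (Z y) $ b) x), (\<chi> b. cdir I X (\<lambda>y. snd (Z y) $ b) x))"

text \<open>\<open>(L\<^sub>Z \<eta>)(v\<^sub>1, \<dots>, v\<^sub>k) = Z (\<eta>(v\<^sub>1, \<dots>, v\<^sub>k)) - \<Sum>i. \<eta>(v\<^sub>1, \<dots>, [Z, v\<^sub>i], \<dots>, v\<^sub>k)\<close> for constant fields \<open>v\<^sub>i\<close>,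
  for which \<open>[Z, v\<^sub>i]\<close> is minus the derivative of \<open>Z\<close> along \<open>v\<^sub>i\<close>.\<close>

definition lie_derivative ::
    "'k::finite set \<Rightarrow> (complex ^ 'k \<Rightarrow> 'k cvec) \<Rightarrow> (complex ^ 'k \<Rightarrow> 'k cvec list \<Rightarrow> complex) \<Rightarrow>
     complex ^ 'k \<Rightarrow> 'k cvec list \<Rightarrow> complex" where
  "lie_derivative I Z \<eta> x vs =
     cdir I (Z x) (\<lambda>y. \<eta> y vs) x + (\<Sum>i<length vs. \<eta> x (vs[i := cdir_field I (vs ! i) Z x]))"

text \<open>
  The function \<open>div Z\<close> with \<open>L\<^sub>Z \<omega>\<^sup>d = (div Z) \<omega>\<^sup>d\<close>.  Pitfall: with this divergence, the moment map convention
  \<open>\<iota>(\<partial>/\<partial>\<theta>\<^sub>i) \<omega> = - d\<phi>\<^sub>i\<close> and the Ricci form \<open>-\<i> \<partial>\<partial>\<close>bar\<open> log det\<close>, it is \<open>\<kappa> \<phi>\<^sub>i + div Z\<^sub>i\<close> that is constant on a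
  Kaehler-Einstein manifold, so \<open>\<kappa> \<phi>\<^sub>i = - div Z\<^sub>i + c\<^sub>i\<close>; for \<open>\<kappa> \<noteq> 0\<close>, \<open>\<kappa> \<phi>\<^sub>i - div Z\<^sub>i\<close> is not constant.  On the flat \<open>\<complex>\<^sup>2\<close> minus the origin with its scalar
  \<open>\<complex>\<^sup>*\<close>-action one has \<open>\<kappa> = 0\<close> and \<open>div Z = 2\<close>; the quotients are projective lines with
  \<open>\<mu>\<^sub>\<lambda> = 2 \<omega>\<^sub>F\<^sub>S\<close>, \<open>\<mu>\<^sub>1 = - \<omega>\<^sub>F\<^sub>S\<close> and constant effective potential, so \<open>\<mu>\<^sub>\<lambda> + c \<mu>\<^sub>1 = 0\<close> forces
  \<open>c = 2 = div Z\<close>.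
\<close>

definition divergence ::
    "('a, 'k::finite) cman \<Rightarrow> ('a, 'k) form11 \<Rightarrow> (('a, 'k) chart \<Rightarrow> complex ^ 'k \<Rightarrow> 'k cvec) \<Rightarrow> 'a \<Rightarrow> complex"
  where
  "divergence M \<omega> Z q =
     (THE \<delta>. \<forall>c\<in>mcharts M. q \<in> fst c \<longrightarrow>
        (let I = midx M; d = card I; vol = (\<lambda>y. wedge_power d (cform I (\<omega> c y))); x = snd c q in
         \<forall>vs. length vs = 2 * d \<and> set vs \<subseteq> coord_space I \<times> coord_space I \<longrightarrow>
           lie_derivative I (Z c) vol x vs = \<delta> * vol x vs))"


section \<open>Hamiltonian actions and Kaehler reduction\<close>

definition moment_map ::
    "('m, 'd::finite) cman \<Rightarrow> (complex ^ 'n::finite \<Rightarrow> 'm \<Rightarrow> 'm) \<Rightarrow> ('m, 'd) form11 \<Rightarrow> ('m \<Rightarrow> real ^ 'n) \<Rightarrow> bool"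
  where
  "moment_map M act \<omega> \<Phi> \<longleftrightarrow>
     (\<forall>c\<in>mcharts M. \<forall>j.
        smooth_fun (midx M) (cimage c) (\<lambda>y. \<Phi> (cinv c y) $ j) \<and>
        (\<forall>x\<in>cimage c. \<forall>u\<in>coord_space (midx M).
           form2 (midx M) (\<omega> c x) (circle_field act j c x) u
             = - of_real (ddir u (\<lambda>y. \<Phi> (cinv c y) $ j) x)))"

definition level_set :: "('m, 'd::finite) cman \<Rightarrow> ('m \<Rightarrow> real ^ 'n::finite) \<Rightarrow> real ^ 'n \<Rightarrow> 'm set" where
  "level_set M \<Phi> lam = {q \<in> topspace (mtop M). \<Phi> q = lam}"

text \<open>Tangent space of the level set at the point of the chart \<open>c\<close> with coordinates \<open>x\<close>, and its
  maximal complex subspace.  The latter is the orthogonal complement in the former of the tangent space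
  of the \<open>T\<close>-orbit, since \<open>d\<phi>\<^sub>j(J u) = - g(\<partial>/\<partial>\<theta>\<^sub>j, u)\<close>.\<close>

definition level_tangent ::
    "('m, 'd::finite) cman \<Rightarrow> ('m \<Rightarrow> real ^ 'n::finite) \<Rightarrow> ('m, 'd) chart \<Rightarrow> complex ^ 'd \<Rightarrow> (complex ^ 'd) set"
  where
  "level_tangent M \<Phi> c x = {u \<in> coord_space (midx M). \<forall>j. ddir u (\<lambda>y. \<Phi> (cinv c y) $ j) x = 0}"

definition level_horizontal ::
    "('m, 'd::finite) cman \<Rightarrow> ('m \<Rightarrow> real ^ 'n::finite) \<Rightarrow> ('m, 'd) chart \<Rightarrow> complex ^ 'd \<Rightarrow> (complex ^ 'd) set"
  where
  "level_horizontal M \<Phi> c x = {u \<in> level_tangent M \<Phi> c x. \<i> *s u \<in> level_tangent M \<Phi> c x}"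

definition T_orbit :: "(complex ^ 'n::finite \<Rightarrow> 'm \<Rightarrow> 'm) \<Rightarrow> 'm \<Rightarrow> 'm set" where
  "T_orbit act q = (\<lambda>t. act t q) ` T_compact"

definition quotient_top ::
    "('m, 'd::finite) cman \<Rightarrow> (complex ^ 'n::finite \<Rightarrow> 'm \<Rightarrow> 'm) \<Rightarrow> ('m \<Rightarrow> real ^ 'n) \<Rightarrow> real ^ 'n \<Rightarrow> 'm set topology"
  where
  "quotient_top M act \<Phi> lam =
     (let L = level_set M \<Phi> lam in
      topology (\<lambda>W. W \<subseteq> T_orbit act ` L \<and> openin (subtopology (mtop M) L) {q \<in> L. T_orbit act q \<in> W}))"

text \<open>The Kaehler quotient \<open>M\<^sub>\<lambda>\<close>, modelled on \<open>\<complex>\<^sup>J\<close>.  Its holomorphic charts are the topological charts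
  \<open>\<psi>\<close> whose lift to the level set is smooth (locally the restriction of a smooth map \<open>F\<close> on \<open>M\<close>) and has a
  differential mapping the horizontal space complex linearly and bijectively onto \<open>\<complex>\<^sup>J\<close>.\<close>

definition kaehler_quotient ::
    "('m, 'd::finite) cman \<Rightarrow> 'r::finite set \<Rightarrow> (complex ^ 'n::finite \<Rightarrow> 'm \<Rightarrow> 'm) \<Rightarrow> ('m \<Rightarrow> real ^ 'n) \<Rightarrow> real ^ 'n \<Rightarrow>
     ('m set, 'r) cman" where
  "kaehler_quotient M J act \<Phi> lam =
     (let L = level_set M \<Phi> lam; Q = quotient_top M act \<Phi> lam in
      \<lparr> mtop = Q, midx = J,
        mcharts = {c. is_chart Q J c \<and>
          (\<forall>q\<in>L. T_orbit act q \<in> fst c \<longrightarrow>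
             (\<exists>U F. openin (mtop M) U \<and> q \<in> U \<and>
                (\<forall>r\<in>U \<inter> L. T_orbit act r \<in> fst c \<and> F r = snd c (T_orbit act r)) \<and>
                (\<forall>e\<in>mcharts M. smooth_fun (midx M) (snd e ` (fst e \<inter> U)) (F \<circ> cinv e)) \<and>
                (\<forall>e\<in>mcharts M. q \<in> fst e \<longrightarrow>
                   (let H = level_horizontal M \<Phi> e (snd e q);
                        D = (\<lambda>u. ddir u (F \<circ> cinv e) (snd e q)) in
                    (\<forall>u\<in>H. D (\<i> *s u) = \<i> *s D u) \<and> bij_betw D H (coord_space J)))))} \<rparr>)"

definition Lambda_set ::
    "('m, 'd::finite) cman \<Rightarrow> ('b, 'r::finite) cman \<Rightarrow> ('m \<Rightarrow> 'b) \<Rightarrow> (complex ^ 'n::finite \<Rightarrow> 'm \<Rightarrow> 'm) \<Rightarrow>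
     ('m \<Rightarrow> real ^ 'n) \<Rightarrow> (real ^ 'n) set" where
  "Lambda_set M B \<pi> act \<Phi> =
     {lam. biholomorphic_map (kaehler_quotient M (midx B) act \<Phi> lam) B (\<lambda>orb. the_elem (\<pi> ` orb))}"

text \<open>\<open>\<iota>\<^sub>\<lambda>\<^sup>* u\<close>, for a \<open>T\<close>-invariant \<open>u\<close>, as a function on the base.\<close>

definition point_over ::
    "('m, 'd::finite) cman \<Rightarrow> ('m \<Rightarrow> 'b) \<Rightarrow> ('m \<Rightarrow> real ^ 'n::finite) \<Rightarrow> real ^ 'n \<Rightarrow> 'b \<Rightarrow> 'm" where
  "point_over M \<pi> \<Phi> lam p = (SOME q. q \<in> level_set M \<Phi> lam \<and> \<pi> q = p)"

definition level_pullback ::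
    "('m, 'd::finite) cman \<Rightarrow> ('m \<Rightarrow> 'b) \<Rightarrow> ('m \<Rightarrow> real ^ 'n::finite) \<Rightarrow> real ^ 'n \<Rightarrow> ('m \<Rightarrow> real) \<Rightarrow> 'b \<Rightarrow> real" where
  "level_pullback M \<pi> \<Phi> lam u p = u (point_over M \<pi> \<Phi> lam p)"

text \<open>The reduced form is the form on the base whose pull-back to the level set is the restriction
  of \<open>\<omega>\<close>.\<close>

definition reduced_form ::
    "('m, 'd::finite) cman \<Rightarrow> ('b, 'r::finite) cman \<Rightarrow> ('m \<Rightarrow> 'b) \<Rightarrow> ('m, 'd) form11 \<Rightarrow>
     ('m \<Rightarrow> real ^ 'n::finite) \<Rightarrow> real ^ 'n \<Rightarrow> ('b, 'r) form11" where
  "reduced_form M B \<pi> \<omega> \<Phi> lam c x =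
     (THE h. (\<forall>a b. \<not> (a \<in> midx B \<and> b \<in> midx B) \<longrightarrow> h a b = 0) \<and>
        (\<forall>q\<in>level_set M \<Phi> lam. \<pi> q = cinv c x \<longrightarrow>
           (\<forall>e\<in>mcharts M. q \<in> fst e \<longrightarrow>
              (let P = snd c \<circ> \<pi> \<circ> cinv e; y = snd e q in
               \<forall>u\<in>level_tangent M \<Phi> e y. \<forall>v\<in>level_tangent M \<Phi> e y.
                 form2 (midx B) h (ddir u P y) (ddir v P y) = form2 (midx M) (\<omega> e y) u v))))"

text \<open>Riemannian volume of the \<open>T\<close>-orbit of \<open>q\<close>, computed in the parametrisation
  \<open>\<theta> \<mapsto> (e\<^sup>i\<^sup>\<theta>\<^sub>1, \<dots>, e\<^sup>i\<^sup>\<theta>\<^sub>n) \<cdot> q\<close>.\<close>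

definition orbit_gram ::
    "('m, 'd::finite) cman \<Rightarrow> (complex ^ 'n::finite \<Rightarrow> 'm \<Rightarrow> 'm) \<Rightarrow> ('m, 'd) form11 \<Rightarrow> 'm \<Rightarrow> real ^ 'n ^ 'n" where
  "orbit_gram M act \<omega> q =
     (let c = (SOME c. c \<in> mcharts M \<and> q \<in> fst c); x = snd c q in
      \<chi> j k. kmetric (midx M) (\<omega> c x) (circle_field act j c x) (circle_field act k c x))"

definition orbit_volume ::
    "('m, 'd::finite) cman \<Rightarrow> (complex ^ 'n::finite \<Rightarrow> 'm \<Rightarrow> 'm) \<Rightarrow> ('m, 'd) form11 \<Rightarrow> 'm \<Rightarrow> real" where
  "orbit_volume M act \<omega> q =
     integral (cbox 0 (\<chi> i. 2 * pi))
       (\<lambda>\<theta> :: real ^ 'n. sqrt (det (orbit_gram M act \<omega> (act (\<chi> i. cis (\<theta> $ i)) q))))"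

definition V_eff ::
    "('m, 'd::finite) cman \<Rightarrow> ('m \<Rightarrow> 'b) \<Rightarrow> (complex ^ 'n::finite \<Rightarrow> 'm \<Rightarrow> 'm) \<Rightarrow> ('m, 'd) form11 \<Rightarrow>
     ('m \<Rightarrow> real ^ 'n) \<Rightarrow> real ^ 'n \<Rightarrow> 'b \<Rightarrow> real" where
  "V_eff M \<pi> act \<omega> \<Phi> lam = level_pullback M \<pi> \<Phi> lam (orbit_volume M act \<omega>)"


section \<open>The line bundles of the characters\<close>

text \<open>Non-vanishing holomorphic sections over \<open>V\<close> of the line bundle \<open>\<bbbL>\<^sub>i\<close>.\<close>

definition nonvanishing_section ::
    "('m, 'd::finite) cman \<Rightarrow> ('b, 'r::finite) cman \<Rightarrow> ('m \<Rightarrow> 'b) \<Rightarrow> (complex ^ 'n::finite \<Rightarrow> 'm \<Rightarrow> 'm) \<Rightarrow> 'n \<Rightarrow>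
     'b set \<Rightarrow> ('m \<Rightarrow> complex) \<Rightarrow> bool" where
  "nonvanishing_section M B \<pi> act i V s \<longleftrightarrow>
     openin (mtop B) V \<and>
     (\<forall>c\<in>mcharts M. holo_fun (midx M) (snd c ` (fst c \<inter> \<pi> -` V)) (s \<circ> cinv c)) \<and>
     (\<forall>q\<in>topspace (mtop M) \<inter> \<pi> -` V.
        s q \<noteq> 0 \<and> (\<forall>a\<in>T_complex. s (act a q) = inverse (a $ i) * s q))"

text \<open>The curvature form \<open>\<mu>\<^sub>i\<^sub>,\<^sub>\<lambda>\<close>, computed from any local non-vanishing holomorphic section.\<close>

definition line_curvature ::
    "('m, 'd::finite) cman \<Rightarrow> ('b, 'r::finite) cman \<Rightarrow> ('m \<Rightarrow> 'b) \<Rightarrow> (complex ^ 'n::finite \<Rightarrow> 'm \<Rightarrow> 'm) \<Rightarrow>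
     ('m \<Rightarrow> real ^ 'n) \<Rightarrow> 'n \<Rightarrow> real ^ 'n \<Rightarrow> ('b, 'r) form11" where
  "line_curvature M B \<pi> act \<Phi> i lam c x =
     (THE h. \<forall>V s. nonvanishing_section M B \<pi> act i V s \<and> cinv c x \<in> V \<longrightarrow>
        h = (\<lambda>a b. - ddbar (midx B)
               (\<lambda>y. ln (level_pullback M \<pi> \<Phi> lam (\<lambda>q. (cmod (s q))\<^sup>2) (cinv c y))) x a b))"

end

theory Submission
  imports Defs
begin

text \<open>
  Over a chart of the base on which the bundle is trivial, the logarithms \<open>\<zeta>\<^sub>1, \<dots>, \<zeta>\<^sub>n\<close> of the fibre
  coordinates and the base coordinates \<open>w\<close> form a holomorphic chart of \<open>M\<close> in which the torus acts by
  translations of \<open>\<zeta>\<close>, the compact torus by imaginary ones.  Hence the coefficients \<open>h\<close> of \<open>\<omega>\<close> and the moment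
  map depend on \<open>Re \<zeta>\<close> and \<open>w\<close> only, the field \<open>Z\<^sub>i\<close> is \<open>\<partial>/\<partial>\<zeta>\<^sub>i\<close>, and the moment map equation says that the
  derivative of \<open>\<phi>\<^sub>j\<close> by the conjugate of \<open>x\<^sub>b\<close> is \<open>h\<^sub>j\<^sub>b\<close> (\<open>phi_wirtinger\<close>).

  In such a chart \<open>div Z\<^sub>i = \<partial>/\<partial>\<zeta>\<^sub>i log det h\<close> (\<open>divergence_E\<close>).  By the Einstein equation its antiholomorphic
  derivatives are \<open>-\<kappa> h\<^sub>i\<^sub>b\<close>, and those of \<open>\<kappa> \<phi>\<^sub>i\<close> are \<open>\<kappa> h\<^sub>i\<^sub>b\<close>.  So \<open>div Z\<^sub>i + \<kappa> \<phi>\<^sub>i\<close> is holomorphic; being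
  real, it is locally constant (\<open>divergence_locally_constant\<close>), and it is a constant \<open>c\<^sub>i\<close> as \<open>M\<close> is connected.

  For \<open>\<lambda> \<in> \<Lambda>\<close> the level set meets every fibre of \<open>\<pi>\<close> in exactly one orbit of the compact torus.  It is
  therefore a graph \<open>Re \<zeta> = r(w)\<close>, and \<open>r\<close> is smooth by the implicit function theorem (\<open>rad_smooth\<close>).
  Differentiating \<open>\<phi>\<^sub>j = \<lambda>\<^sub>j\<close> along the graph shows that the numbers \<open>2 \<partial>r\<^sub>k/\<partial>w\<^sub>a\<close> eliminate the mixed block of
  \<open>h\<close> (\<open>lift_coeff_eq\<close>).  This has three consequences.  The reduced form is the Schur complement \<open>S\<close> of the
  fibre block of \<open>h\<close> (\<open>reduced_form_eq\<close>), and \<open>det h\<close> is \<open>det S\<close> times the determinant of that block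
  (\<open>det_split\<close>).  As twice the block is the Gram matrix of the generators of the torus, \<open>V\<^sub>e\<^sub>f\<^sub>f\<^sup>2\<close> is a constant
  multiple of its determinant (\<open>log_V_eff\<close>).  The sections of \<open>\<bbbL>\<^sub>i\<close> have square norm \<open>exp (-2 r\<^sub>i)\<close> times the
  absolute square of a holomorphic function, so that \<open>\<mu>\<^sub>i\<close> is \<open>2 \<i> \<partial>\<partial>\<close>bar\<open> r\<^sub>i\<close> (\<open>line_curvature_eq\<close>).

  Let \<open>F\<close> be the restriction of \<open>log det h\<close> to the graph, where \<open>\<partial>/\<partial>\<zeta>\<^sub>k log det h = c\<^sub>k - \<kappa> \<lambda>\<^sub>k\<close>.  By the
  chain rule and the Einstein equation, \<open>\<i> \<partial>\<partial>\<close>bar\<open> F\<close> is \<open>-\<kappa> \<omega>\<^sub>\<lambda> + \<Sum>k. (c\<^sub>k - \<kappa> \<lambda>\<^sub>k) \<mu>\<^sub>k\<close>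
  (\<open>ddbar_logdet_level\<close>).  On the other hand \<open>log det S = F - 2 log V\<^sub>e\<^sub>f\<^sub>f + const\<close>, so that
  \<open>-\<i> \<partial>\<partial>\<close>bar\<open> F\<close> is \<open>\<mu>\<^sub>\<lambda> - 2 \<i> \<partial>\<partial>\<close>bar\<open> log V\<^sub>e\<^sub>f\<^sub>f\<close>.  Comparing the two expressions gives the theorem.
\<close>

section \<open>Iterated Frechet differentiability\<close>

text \<open>Only derivatives in fixed directions are iterated.  They have the same type as the function itself, so the
  order of differentiability can be a parameter.\<close>

primrec Ck :: "nat \<Rightarrow> 'a::real_normed_vector set \<Rightarrow> ('a \<Rightarrow> 'b::real_normed_vector) \<Rightarrow> bool" where
  "Ck 0 S f = continuous_on S f"
| "Ck (Suc k) S f = (\<exists>f'. (\<forall>x\<in>S. (f has_derivative f' x) (at x)) \<and> (\<forall>v. Ck k S (\<lambda>x. f' x v)))"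

declare Ck.simps(2) [simp del]

lemma Ck_SucI:
  "(\<And>x. x \<in> S \<Longrightarrow> (f has_derivative f' x) (at x)) \<Longrightarrow> (\<And>v. Ck k S (\<lambda>x. f' x v)) \<Longrightarrow> Ck (Suc k) S f"
  unfolding Ck.simps by blast

lemma Ck_SucE:
  assumes "Ck (Suc k) S f"
  obtains f' where "\<And>x. x \<in> S \<Longrightarrow> (f has_derivative f' x) (at x)" "\<And>v. Ck k S (\<lambda>x. f' x v)"
  using assms unfolding Ck.simps by blast

lemma Ck_Suc_continuous:
  assumes "Ck (Suc k) S f"
  shows "continuous_on S f"
proof -
  obtain f' where "\<And>x. x \<in> S \<Longrightarrow> (f has_derivative f' x) (at x)" using assms by (rule Ck_SucE) blast
  then have "\<forall>x\<in>S. isCont f x" using has_derivative_continuous by blast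
  then show ?thesis by (rule continuous_at_imp_continuous_on)
qed

lemma Ck_continuous: "Ck k S f \<Longrightarrow> continuous_on S f"
  by (cases k) (simp, use Ck_Suc_continuous in blast)

lemma Ck_SucD: "Ck (Suc k) S f \<Longrightarrow> Ck k S f"
proof (induction k arbitrary: f)
  case 0
  then show ?case using Ck_Suc_continuous[OF 0] by simp
next
  case (Suc k)
  obtain f' where "\<And>x. x \<in> S \<Longrightarrow> (f has_derivative f' x) (at x)" "\<And>v. Ck (Suc k) S (\<lambda>x. f' x v)"
    using Suc.prems by (rule Ck_SucE) blast
  then show ?case using Suc.IH by (intro Ck_SucI) blast+
qed

lemma Ck_differentiable: "Ck (Suc k) S f \<Longrightarrow> x \<in> S \<Longrightarrow> f differentiable (at x)"
  by (meson Ck_SucE differentiable_def)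

lemma Ck_subset: "Ck k S f \<Longrightarrow> T \<subseteq> S \<Longrightarrow> Ck k T f"
proof (induction k arbitrary: f)
  case 0
  then show ?case using continuous_on_subset by auto
next
  case (Suc k)
  obtain f' where "\<And>x. x \<in> S \<Longrightarrow> (f has_derivative f' x) (at x)" "\<And>v. Ck k S (\<lambda>x. f' x v)"
    using Suc.prems(1) by (rule Ck_SucE) blast
  then show ?case using Suc by (intro Ck_SucI[of T f f']) auto
qed

lemma Ck_cong:
  assumes "open S" "\<And>x. x \<in> S \<Longrightarrow> f x = g x" "Ck k S f"
  shows "Ck k S g"
proof (cases k)
  case 0
  then show ?thesis using assms by (auto cong: continuous_on_cong)
next
  case (Suc m)
  obtain f' where *: "\<And>x. x \<in> S \<Longrightarrow> (f has_derivative f' x) (at x)" "\<And>v. Ck m S (\<lambda>x. f' x v)"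
    using assms(3) unfolding Suc by (rule Ck_SucE) blast
  have "(g has_derivative f' x) (at x)" if "x \<in> S" for x
    using *(1)[OF that] assms(1,2) that has_derivative_transform_within_open by blast
  then show ?thesis using * Suc Ck_SucI by blast
qed

lemma Ck_const: "Ck k S (\<lambda>x. c)"
  by (induction k arbitrary: c) (auto intro!: Ck_SucI[where f' = "\<lambda>_ _. 0"])

lemma Ck_add:
  assumes "Ck k S f" "Ck k S g"
  shows "Ck k S (\<lambda>x. f x + g x)"
  using assms
proof (induction k arbitrary: f g)
  case 0
  then show ?case by (auto intro: continuous_intros)
next
  case (Suc k)
  obtain f' where f: "\<And>x. x \<in> S \<Longrightarrow> (f has_derivative f' x) (at x)" "\<And>v. Ck k S (\<lambda>x. f' x v)"
    using Suc.prems Ck_SucE by blast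
  obtain g' where g: "\<And>x. x \<in> S \<Longrightarrow> (g has_derivative g' x) (at x)" "\<And>v. Ck k S (\<lambda>x. g' x v)"
    using Suc.prems Ck_SucE by blast
  show ?case by (rule Ck_SucI[where f' = "\<lambda>x v. f' x v + g' x v"]) (use f g Suc.IH in \<open>auto intro!: has_derivative_add\<close>)
qed

lemma Ck_bounded_linear:
  assumes "bounded_linear L" "Ck k S f"
  shows "Ck k S (\<lambda>x. L (f x))"
  using assms(2)
proof (induction k arbitrary: f)
  case 0
  then show ?case using bounded_linear.continuous_on[OF assms(1)] by auto
next
  case (Suc k)
  obtain f' where f: "\<And>x. x \<in> S \<Longrightarrow> (f has_derivative f' x) (at x)" "\<And>v. Ck k S (\<lambda>x. f' x v)"
    using Suc.prems Ck_SucE by blast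
  show ?case by (rule Ck_SucI[where f' = "\<lambda>x v. L (f' x v)"])
      (use f Suc.IH in \<open>auto intro!: bounded_linear.has_derivative[OF assms(1)]\<close>)
qed

lemma Ck_linear: "bounded_linear L \<Longrightarrow> Ck k S L"
  by (cases k) (auto intro!: Ck_SucI[where f' = "\<lambda>x. L"] bounded_linear_imp_has_derivative Ck_const
      linear_continuous_on)

lemma Ck_bilinear:
  assumes "bounded_bilinear p" "Ck k S f" "Ck k S g"
  shows "Ck k S (\<lambda>x. p (f x) (g x))"
  using assms(2,3)
proof (induction k arbitrary: f g)
  case 0
  then show ?case using bounded_bilinear.continuous_on[OF assms(1)] by auto
next
  case (Suc k)
  obtain f' where f: "\<And>x. x \<in> S \<Longrightarrow> (f has_derivative f' x) (at x)" "\<And>v. Ck k S (\<lambda>x. f' x v)"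
    using Suc.prems Ck_SucE by blast
  obtain g' where g: "\<And>x. x \<in> S \<Longrightarrow> (g has_derivative g' x) (at x)" "\<And>v. Ck k S (\<lambda>x. g' x v)"
    using Suc.prems Ck_SucE by blast
  have fg: "Ck k S f" "Ck k S g" using Suc.prems Ck_SucD by blast+
  show ?case by (rule Ck_SucI[where f' = "\<lambda>x v. p (f x) (g' x v) + p (f' x v) (g x)"])
      (use f g fg Suc.IH in \<open>auto intro!: Ck_add bounded_bilinear.FDERIV[OF assms(1)]\<close>)
qed

lemmas Ck_scaleR = Ck_bilinear[OF bounded_bilinear_scaleR]
lemmas Ck_mult = Ck_bilinear[OF bounded_bilinear_mult]

lemma Ck_minus: "Ck k S f \<Longrightarrow> Ck k S (\<lambda>x. - f x)"
  by (rule Ck_bounded_linear[OF bounded_linear_minus[OF bounded_linear_ident]])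

lemma Ck_diff: "Ck k S f \<Longrightarrow> Ck k S g \<Longrightarrow> Ck k S (\<lambda>x. f x - g x)"
  using Ck_add[OF _ Ck_minus, of k S f g] by simp

lemma Ck_sum:
  assumes "\<And>i. i \<in> A \<Longrightarrow> Ck k S (f i)"
  shows "Ck k S (\<lambda>x. \<Sum>i\<in>A. f i x)"
  using assms by (induction A rule: infinite_finite_induct) (auto intro: Ck_const Ck_add)

lemma Ck_prod:
  fixes f :: "'i \<Rightarrow> 'a::real_normed_vector \<Rightarrow> 'b::{real_normed_algebra,comm_ring_1}"
  assumes "\<And>i. i \<in> A \<Longrightarrow> Ck k S (f i)"
  shows "Ck k S (\<lambda>x. \<Prod>i\<in>A. f i x)"
  using assms by (induction A rule: infinite_finite_induct) (auto intro: Ck_const Ck_mult)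

lemma Ck_compose:
  fixes g :: "'a::real_normed_vector \<Rightarrow> 'b::euclidean_space"
    and f :: "'b \<Rightarrow> 'c::real_normed_vector"
  assumes "Ck k T f" "Ck k S g" "\<And>x. x \<in> S \<Longrightarrow> g x \<in> T" "open S"
  shows "Ck k S (\<lambda>x. f (g x))"
  using assms(1,2)
proof (induction k arbitrary: f)
  case 0
  then show ?case using assms(3) continuous_on_compose2[of T f S g] by (simp add: image_subset_iff)
next
  case (Suc k)
  obtain f' where f: "\<And>x. x \<in> T \<Longrightarrow> (f has_derivative f' x) (at x)" "\<And>v. Ck k T (\<lambda>x. f' x v)"
    using Suc.prems Ck_SucE by blast
  obtain g' where g: "\<And>x. x \<in> S \<Longrightarrow> (g has_derivative g' x) (at x)" "\<And>v. Ck k S (\<lambda>x. g' x v)"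
    using Suc.prems Ck_SucE by blast
  have gk: "Ck k S g" using Suc.prems Ck_SucD by blast
  have 1: "((\<lambda>x. f (g x)) has_derivative (\<lambda>v. f' (g x) (g' x v))) (at x)" if "x \<in> S" for x
    using f(1) g(1) assms(3) that by (intro has_derivative_compose[of g "g' x" x UNIV f "f' (g x)"]) blast+
  \<comment> \<open>The direction \<open>g' x v\<close> varies with \<open>x\<close>; expanding it in a basis leaves derivatives of \<open>f\<close> in fixed directions.\<close>
  have 2: "Ck k S (\<lambda>x. f' (g x) (g' x v))" for v
  proof (rule Ck_cong[OF assms(4)])
    show "Ck k S (\<lambda>x. \<Sum>b\<in>Basis. (g' x v \<bullet> b) *\<^sub>R f' (g x) b)"
      by (intro Ck_sum Ck_scaleR Suc.IH gk f(2) Ck_bounded_linear[OF bounded_linear_inner_left] g(2))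
    fix x assume "x \<in> S"
    then have "linear (f' (g x))" using f(1) assms(3) has_derivative_linear by blast
    then have "f' (g x) (\<Sum>b\<in>Basis. (g' x v \<bullet> b) *\<^sub>R b) = (\<Sum>b\<in>Basis. (g' x v \<bullet> b) *\<^sub>R f' (g x) b)"
      by (simp add: linear_sum linear_scale)
    then show "(\<Sum>b\<in>Basis. (g' x v \<bullet> b) *\<^sub>R f' (g x) b) = f' (g x) (g' x v)"
      by (simp add: euclidean_representation)
  qed
  show ?case by (rule Ck_SucI[where f' = "\<lambda>x v. f' (g x) (g' x v)"]) (use 1 2 in auto)
qed

lemma Ck_inverse': "Ck k (- {0}) (inverse :: 'a::real_normed_field \<Rightarrow> 'a)"
proof (induction k)
  case 0
  then show ?case by (auto intro!: continuous_intros)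
next
  case (Suc k)
  show ?case by (rule Ck_SucI[where f' = "\<lambda>x v. - (inverse x * v * inverse x)"])
      (auto intro!: has_derivative_inverse' Ck_minus Ck_mult Suc Ck_const)
qed

lemma Ck_inverse:
  fixes f :: "'a::real_normed_vector \<Rightarrow> 'b::{real_normed_field,euclidean_space}"
  assumes "Ck k S f" "\<And>x. x \<in> S \<Longrightarrow> f x \<noteq> 0" "open S"
  shows "Ck k S (\<lambda>x. inverse (f x))"
  by (rule Ck_compose[OF Ck_inverse' assms(1)]) (use assms in auto)

lemma Ck_exp: "Ck k S (exp :: 'a::{real_normed_field,banach} \<Rightarrow> 'a)"
proof (induction k)
  case 0
  then show ?case by (auto intro!: continuous_intros)
next
  case (Suc k)
  show ?case by (rule Ck_SucI[where f' = "\<lambda>x v. exp x * v"])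
      (auto intro!: Ck_mult Suc Ck_const DERIV_exp[unfolded has_field_derivative_def])
qed

lemma Ck_ln': "Ck k {0<..} (ln :: real \<Rightarrow> real)"
proof (cases k)
  case 0
  then show ?thesis by (auto intro!: continuous_intros)
next
  case (Suc m)
  show ?thesis unfolding Suc by (rule Ck_SucI[where f' = "\<lambda>x v. inverse x * v"])
      (auto intro!: Ck_mult Ck_const Ck_subset[OF Ck_inverse'] DERIV_ln[unfolded has_field_derivative_def])
qed

lemma Ck_Ln': "Ck k (- \<real>\<^sub>\<le>\<^sub>0) (Ln :: complex \<Rightarrow> complex)"
proof (cases k)
  case 0
  then show ?thesis by (auto intro!: continuous_on_Ln)
next
  case (Suc k)
  have *: "- \<real>\<^sub>\<le>\<^sub>0 \<subseteq> - {0 :: complex}" by auto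
  have "(Ln has_derivative (\<lambda>v. inverse x * v)) (at x)" if "x \<notin> \<real>\<^sub>\<le>\<^sub>0" for x
    using has_field_derivative_Ln[OF that] by (simp add: has_field_derivative_def)
  then show ?thesis unfolding Suc
    by (intro Ck_SucI[where f' = "\<lambda>x v. inverse x * v"])
      (use * in \<open>auto intro!: Ck_mult Ck_const Ck_subset[OF Ck_inverse']\<close>)
qed

text \<open>On a Euclidean space it suffices to control the partial derivatives: increments along the
  coordinate directions are estimated one at a time by the mean value inequality.\<close>

lemma has_derivative_partials:
  fixes f :: "'a::euclidean_space \<Rightarrow> 'b::real_normed_vector"
  assumes "open S" "x \<in> S"
    and der: "\<And>b x. b \<in> Basis \<Longrightarrow> x \<in> S \<Longrightarrow> ((\<lambda>t. f (x + t *\<^sub>R b)) has_vector_derivative D b x) (at 0)"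
    and cont: "\<And>b. b \<in> Basis \<Longrightarrow> continuous_on S (D b)"
  shows "(f has_derivative (\<lambda>v. \<Sum>b\<in>Basis. (v \<bullet> b) *\<^sub>R D b x)) (at x)"
  unfolding has_derivative_at_alt
proof (intro conjI allI impI)
  show "bounded_linear (\<lambda>v. \<Sum>b\<in>Basis. (v \<bullet> b) *\<^sub>R D b x)"
    by (auto intro!: bounded_linear_intros)
next
  fix \<epsilon> :: real assume "\<epsilon> > 0"
  define n where "n = real DIM('a)"
  have n: "n > 0" by (simp add: n_def)
  define e where "e = \<epsilon> / n"
  have e: "e > 0" using n \<open>\<epsilon> > 0\<close> by (simp add: e_def)
  have "\<exists>d>0. \<forall>y\<in>ball x d. y \<in> S \<and> norm (D b y - D b x) < e" if b: "b \<in> Basis" for b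
  proof -
    obtain d1 where d1: "d1 > 0" "ball x d1 \<subseteq> S" using assms(1,2) open_contains_ball by blast
    obtain d2 where d2: "d2 > 0" "\<And>y. y \<in> S \<Longrightarrow> dist y x < d2 \<Longrightarrow> dist (D b y) (D b x) < e"
      using cont[OF b] e assms(2) unfolding continuous_on_iff by blast
    show ?thesis
      by (rule exI[of _ "min d1 d2"]) (use d1 d2 in \<open>auto simp: dist_norm[symmetric] dist_commute subset_iff\<close>)
  qed
  then obtain d where d: "\<And>b. b \<in> Basis \<Longrightarrow> d b > 0"
    "\<And>b y. b \<in> Basis \<Longrightarrow> y \<in> ball x (d b) \<Longrightarrow> y \<in> S \<and> norm (D b y - D b x) < e"
    by metis
  define d0 where "d0 = Min (d ` Basis)"
  have d0: "d0 > 0" "\<And>b. b \<in> Basis \<Longrightarrow> d0 \<le> d b"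
    using d(1) by (auto simp: d0_def)
  show "\<exists>d>0. \<forall>y. norm (y - x) < d \<longrightarrow>
      norm (f y - f x - (\<Sum>b\<in>Basis. ((y - x) \<bullet> b) *\<^sub>R D b x)) \<le> \<epsilon> * norm (y - x)"
  proof (intro exI[of _ "d0 / n"] conjI allI impI)
    show "d0 / n > 0" using d0 n by simp
    fix y assume y: "norm (y - x) < d0 / n"
    define h where "h = y - x"
    have hn: "(\<Sum>b\<in>A. \<bar>h \<bullet> b\<bar>) \<le> n * norm h" if "A \<subseteq> Basis" for A
    proof -
      have "(\<Sum>b\<in>A. \<bar>h \<bullet> b\<bar>) \<le> (\<Sum>b\<in>Basis. \<bar>h \<bullet> b\<bar>)"
        by (rule sum_mono2) (use that in auto)
      also have "\<dots> \<le> (\<Sum>b\<in>(Basis::'a set). norm h)" by (rule sum_mono) (simp add: Basis_le_norm)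
      finally show ?thesis by (simp add: n_def)
    qed
    have hd: "n * norm h < d0" using y n by (simp add: h_def field_simps)
    have "norm (f (x + (\<Sum>b\<in>A. (h \<bullet> b) *\<^sub>R b)) - f x - (\<Sum>b\<in>A. (h \<bullet> b) *\<^sub>R D b x))
        \<le> e * (\<Sum>b\<in>A. \<bar>h \<bullet> b\<bar>)" if "A \<subseteq> Basis" for A
    proof -
      have "finite A" using that finite_Basis finite_subset by blast
      then show ?thesis using that
      proof (induction A rule: finite_induct)
        case empty
        then show ?case by simp
      next
        case (insert b A)
        define p where "p = x + (\<Sum>b\<in>A. (h \<bullet> b) *\<^sub>R b)"
        have b: "b \<in> Basis" using insert by auto
        have inb: "p + t *\<^sub>R b \<in> ball x d0" if "t \<in> closed_segment 0 (h \<bullet> b)" for t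
        proof -
          have t: "\<bar>t\<bar> \<le> \<bar>h \<bullet> b\<bar>" using that by (auto simp: closed_segment_eq_real_ivl split: if_splits)
          have "norm (p + t *\<^sub>R b - x) \<le> norm (\<Sum>b\<in>A. (h \<bullet> b) *\<^sub>R b) + norm (t *\<^sub>R b)"
            unfolding p_def by (metis add_diff_cancel_left' add.assoc norm_triangle_ineq)
          also have "\<dots> \<le> (\<Sum>b\<in>A. \<bar>h \<bullet> b\<bar>) + \<bar>h \<bullet> b\<bar>"
          proof (rule add_mono)
            show "norm (\<Sum>b\<in>A. (h \<bullet> b) *\<^sub>R b) \<le> (\<Sum>b\<in>A. \<bar>h \<bullet> b\<bar>)"
              by (rule sum_norm_le) (use insert.prems norm_Basis in \<open>auto simp: subset_iff\<close>)
            show "norm (t *\<^sub>R b) \<le> \<bar>h \<bullet> b\<bar>" using t b by simp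
          qed
          also have "\<dots> = (\<Sum>b\<in>insert b A. \<bar>h \<bullet> b\<bar>)" using insert by simp
          also have "\<dots> \<le> n * norm h" using hn insert.prems by blast
          finally show ?thesis using hd by (simp add: dist_norm norm_minus_commute)
        qed
        have der': "((\<lambda>t. f (p + t *\<^sub>R b) - t *\<^sub>R D b x) has_derivative (\<lambda>s. s *\<^sub>R (D b (p + t *\<^sub>R b) - D b x)))
            (at t within closed_segment 0 (h \<bullet> b))" if "t \<in> closed_segment 0 (h \<bullet> b)" for t
        proof -
          have "p + t *\<^sub>R b \<in> S" using inb[OF that] d(2)[OF b] d0(2)[OF b] by auto
          from der[OF b this] have "((\<lambda>s. f (p + t *\<^sub>R b + s *\<^sub>R b)) has_derivative (\<lambda>s. s *\<^sub>R D b (p + t *\<^sub>R b))) (at (t - t))"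
            by (simp add: has_vector_derivative_def)
          moreover have "((\<lambda>s. s - t) has_derivative (\<lambda>s. s)) (at t)"
            by (auto intro!: derivative_eq_intros)
          ultimately have "((\<lambda>s. f (p + t *\<^sub>R b + (s - t) *\<^sub>R b)) has_derivative (\<lambda>s. s *\<^sub>R D b (p + t *\<^sub>R b))) (at t)"
            using has_derivative_compose[of "\<lambda>s. s - t" "\<lambda>s. s" t UNIV "\<lambda>s. f (p + t *\<^sub>R b + s *\<^sub>R b)"]
            by blast
          then have "((\<lambda>s. f (p + s *\<^sub>R b)) has_derivative (\<lambda>s. s *\<^sub>R D b (p + t *\<^sub>R b))) (at t)"
            by (simp add: algebra_simps)
          from has_derivative_diff[OF this has_derivative_scaleR_left[OF has_derivative_ident]]
          show ?thesis
            unfolding scaleR_diff_right by (rule has_derivative_at_withinI)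
        qed
        have "norm ((f (p + (h \<bullet> b) *\<^sub>R b) - (h \<bullet> b) *\<^sub>R D b x) - (f (p + 0 *\<^sub>R b) - 0 *\<^sub>R D b x))
            \<le> e * norm (h \<bullet> b - 0)"
        proof (rule differentiable_bound[OF convex_closed_segment der'])
          fix t assume t: "t \<in> closed_segment 0 (h \<bullet> b)"
          have "p + t *\<^sub>R b \<in> ball x (d b)" using inb[OF t] d0(2)[OF b] by auto
          then have "norm (D b (p + t *\<^sub>R b) - D b x) \<le> e" using d(2)[OF b] by force
          then show "onorm (\<lambda>s. s *\<^sub>R (D b (p + t *\<^sub>R b) - D b x)) \<le> e"
            by (intro onorm_le) (simp add: mult_mono mult.commute[of e])
        qed auto
        then have 1: "norm (f (p + (h \<bullet> b) *\<^sub>R b) - f p - (h \<bullet> b) *\<^sub>R D b x) \<le> e * \<bar>h \<bullet> b\<bar>"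
          by (simp add: algebra_simps)
        have 2: "norm (f p - f x - (\<Sum>b\<in>A. (h \<bullet> b) *\<^sub>R D b x)) \<le> e * (\<Sum>b\<in>A. \<bar>h \<bullet> b\<bar>)"
          using insert by (simp add: p_def)
        have "f (x + (\<Sum>b\<in>insert b A. (h \<bullet> b) *\<^sub>R b)) - f x - (\<Sum>b\<in>insert b A. (h \<bullet> b) *\<^sub>R D b x)
          = (f (p + (h \<bullet> b) *\<^sub>R b) - f p - (h \<bullet> b) *\<^sub>R D b x) + (f p - f x - (\<Sum>b\<in>A. (h \<bullet> b) *\<^sub>R D b x))"
          using insert by (simp add: p_def algebra_simps)
        also have "norm \<dots> \<le> e * \<bar>h \<bullet> b\<bar> + e * (\<Sum>b\<in>A. \<bar>h \<bullet> b\<bar>)"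
          using 1 2 norm_triangle_mono by blast
        finally show ?case using insert by (simp add: algebra_simps)
      qed
    qed
    from this[of Basis] have "norm (f y - f x - (\<Sum>b\<in>Basis. (h \<bullet> b) *\<^sub>R D b x)) \<le> e * (\<Sum>b\<in>Basis. \<bar>h \<bullet> b\<bar>)"
      by (simp add: euclidean_representation h_def)
    also have "\<dots> \<le> e * (n * norm h)" using hn[of Basis] e by (simp add: mult_left_mono)
    also have "\<dots> = \<epsilon> * norm h" using n by (simp add: e_def)
    finally show "norm (f y - f x - (\<Sum>b\<in>Basis. ((y - x) \<bullet> b) *\<^sub>R D b x)) \<le> \<epsilon> * norm (y - x)"
      by (simp add: h_def)
  qed
qed

text \<open>Symmetry of second derivatives: both mixed derivatives are limits of the same second difference
  quotient, by applying the mean value theorem in the two possible orders.\<close>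

lemma second_difference_mvt:
  fixes f :: "'a::real_normed_vector \<Rightarrow> real"
  assumes box: "\<And>s t. 0 \<le> s \<Longrightarrow> s \<le> h \<Longrightarrow> 0 \<le> t \<Longrightarrow> t \<le> h \<Longrightarrow> x + s *\<^sub>R u + t *\<^sub>R v \<in> S"
    and f: "\<And>y. y \<in> S \<Longrightarrow> (f has_derivative f' y) (at y)"
    and fu: "\<And>y. y \<in> S \<Longrightarrow> ((\<lambda>y. f' y u) has_derivative fu y) (at y)"
    and h: "h > 0"
  shows "\<exists>s t. 0 \<le> s \<and> s \<le> h \<and> 0 \<le> t \<and> t \<le> h \<and>
    f (x + h *\<^sub>R u + h *\<^sub>R v) - f (x + h *\<^sub>R u) - f (x + h *\<^sub>R v) + f x
      = h * h * fu (x + s *\<^sub>R u + t *\<^sub>R v) v"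
proof -
  have d1: "((\<lambda>s. f (x + s *\<^sub>R u + t *\<^sub>R v)) has_real_derivative f' (x + s *\<^sub>R u + t *\<^sub>R v) u) (at s)"
    if "0 \<le> s" "s \<le> h" "0 \<le> t" "t \<le> h" for s t
  proof -
    note fS = f[OF box[OF that]]
    have lin: "linear (f' (x + s *\<^sub>R u + t *\<^sub>R v))"
      using fS has_derivative_linear by blast
    have "((\<lambda>s. f (x + s *\<^sub>R u + t *\<^sub>R v)) has_derivative (\<lambda>d. f' (x + s *\<^sub>R u + t *\<^sub>R v) (d *\<^sub>R u))) (at s)"
      by (rule has_derivative_compose[where f = "\<lambda>s. x + s *\<^sub>R u + t *\<^sub>R v", OF _ fS]) (auto intro!: derivative_eq_intros)
    then show ?thesis by (simp add: has_field_derivative_def linear_scale[OF lin] mult_commute_abs)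
  qed
  have d2: "((\<lambda>t. f' (x + s *\<^sub>R u + t *\<^sub>R v) u) has_real_derivative fu (x + s *\<^sub>R u + t *\<^sub>R v) v) (at t)"
    if "0 \<le> s" "s \<le> h" "0 \<le> t" "t \<le> h" for s t
  proof -
    note fS = fu[OF box[OF that]]
    have lin: "linear (fu (x + s *\<^sub>R u + t *\<^sub>R v))"
      using fS has_derivative_linear by blast
    have "((\<lambda>t. f' (x + s *\<^sub>R u + t *\<^sub>R v) u) has_derivative (\<lambda>d. fu (x + s *\<^sub>R u + t *\<^sub>R v) (d *\<^sub>R v))) (at t)"
      by (rule has_derivative_compose[where f = "\<lambda>t. x + s *\<^sub>R u + t *\<^sub>R v", OF _ fS]) (auto intro!: derivative_eq_intros)
    then show ?thesis by (simp add: has_field_derivative_def linear_scale[OF lin] mult_commute_abs)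
  qed
  have "\<exists>s. 0 < s \<and> s < h \<and>
     (f (x + h *\<^sub>R u + h *\<^sub>R v) - f (x + h *\<^sub>R u + 0 *\<^sub>R v)) - (f (x + 0 *\<^sub>R u + h *\<^sub>R v) - f (x + 0 *\<^sub>R u + 0 *\<^sub>R v))
      = (h - 0) * (f' (x + s *\<^sub>R u + h *\<^sub>R v) u - f' (x + s *\<^sub>R u + 0 *\<^sub>R v) u)"
    by (rule MVT2[OF h], rule DERIV_diff; rule d1) (use h in simp_all)
  then obtain s where s: "0 < s" "s < h"
     "f (x + h *\<^sub>R u + h *\<^sub>R v) - f (x + h *\<^sub>R u) - f (x + h *\<^sub>R v) + f x
      = h * (f' (x + s *\<^sub>R u + h *\<^sub>R v) u - f' (x + s *\<^sub>R u + 0 *\<^sub>R v) u)"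
    by (auto simp: algebra_simps)
  have "\<exists>t. 0 < t \<and> t < h \<and> f' (x + s *\<^sub>R u + h *\<^sub>R v) u - f' (x + s *\<^sub>R u + 0 *\<^sub>R v) u
      = (h - 0) * fu (x + s *\<^sub>R u + t *\<^sub>R v) v"
    by (rule MVT2[OF h]) (use h s d2 in auto)
  then show ?thesis using s by (metis diff_zero less_imp_le mult.assoc)
qed

lemma second_derivative_symmetric_real:
  fixes f :: "'a::real_normed_vector \<Rightarrow> real"
  assumes "open S" "x \<in> S"
    and f: "\<And>y. y \<in> S \<Longrightarrow> (f has_derivative f' y) (at y)"
    and fu: "\<And>y. y \<in> S \<Longrightarrow> ((\<lambda>y. f' y u) has_derivative fu y) (at y)"
    and fv: "\<And>y. y \<in> S \<Longrightarrow> ((\<lambda>y. f' y v) has_derivative fv y) (at y)"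
    and cu: "continuous_on S (\<lambda>y. fu y v)" and cv: "continuous_on S (\<lambda>y. fv y u)"
  shows "fu x v = fv x u"
proof (rule ccontr)
  assume "fu x v \<noteq> fv x u"
  define e where "e = \<bar>fu x v - fv x u\<bar> / 2"
  have e: "e > 0" using \<open>fu x v \<noteq> fv x u\<close> by (simp add: e_def)
  obtain d0 where d0: "d0 > 0" "ball x d0 \<subseteq> S" using assms(1,2) open_contains_ball by blast
  obtain d1 where d1: "d1 > 0" "\<And>y. y \<in> S \<Longrightarrow> dist y x < d1 \<Longrightarrow> dist (fu y v) (fu x v) < e"
    using cu e assms(2) unfolding continuous_on_iff by blast
  obtain d2 where d2: "d2 > 0" "\<And>y. y \<in> S \<Longrightarrow> dist y x < d2 \<Longrightarrow> dist (fv y u) (fv x u) < e"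
    using cv e assms(2) unfolding continuous_on_iff by blast
  define d where "d = min d0 (min d1 d2)"
  define h where "h = d / (2 * (norm u + norm v + 1))"
  have "d > 0" using d0 d1 d2 by (simp add: d_def)
  have nn: "norm u + norm v + 1 > 0" by (simp add: add_nonneg_pos)
  have h: "h > 0" using \<open>d > 0\<close> nn by (simp add: h_def)
  have "h * m = d / 2" if "m > 0" "h = d / (2 * m)" for m using that by simp
  from this[OF nn h_def] have "h * (norm u + norm v + 1) = d / 2" .
  then have hd: "h * (norm u + norm v) < d" using h \<open>d > 0\<close> by (simp add: algebra_simps)
  have near: "dist (x + s *\<^sub>R u + t *\<^sub>R v) x < d" if "0 \<le> s" "s \<le> h" "0 \<le> t" "t \<le> h" for s t
  proof -
    have "dist (x + s *\<^sub>R u + t *\<^sub>R v) x \<le> norm (s *\<^sub>R u) + norm (t *\<^sub>R v)"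
      by (simp add: dist_norm add.assoc) (metis norm_scaleR norm_triangle_ineq)
    also have "\<dots> \<le> h * norm u + h * norm v"
      using that by (intro add_mono) (auto intro: mult_right_mono)
    finally show ?thesis using hd by (simp add: algebra_simps)
  qed
  have S: "x + s *\<^sub>R u + t *\<^sub>R v \<in> S" if "0 \<le> s" "s \<le> h" "0 \<le> t" "t \<le> h" for s t
    using near[OF that] d0 by (auto simp: d_def dist_commute subset_iff)
  obtain s t where st: "0 \<le> s" "s \<le> h" "0 \<le> t" "t \<le> h"
    "f (x + h *\<^sub>R u + h *\<^sub>R v) - f (x + h *\<^sub>R u) - f (x + h *\<^sub>R v) + f x = h * h * fu (x + s *\<^sub>R u + t *\<^sub>R v) v"
    using second_difference_mvt[where f = f and f' = f' and S = S and u = u and v = v and h = h and x = x and fu = fu, OF S f fu h] by blast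
  have S': "x + s *\<^sub>R v + t *\<^sub>R u \<in> S" if "0 \<le> s" "s \<le> h" "0 \<le> t" "t \<le> h" for s t
    using S[OF that(3,4,1,2)] by (simp add: algebra_simps)
  obtain s' t' where st': "0 \<le> s'" "s' \<le> h" "0 \<le> t'" "t' \<le> h"
    "f (x + h *\<^sub>R v + h *\<^sub>R u) - f (x + h *\<^sub>R v) - f (x + h *\<^sub>R u) + f x = h * h * fv (x + s' *\<^sub>R v + t' *\<^sub>R u) u"
    using second_difference_mvt[where f = f and f' = f' and S = S and u = v and v = u and h = h and x = x and fu = fv, OF S' f fv h] by blast
  have "h * h * fu (x + s *\<^sub>R u + t *\<^sub>R v) v = h * h * fv (x + s' *\<^sub>R v + t' *\<^sub>R u) u"
    using st(5) st'(5) by (simp add: algebra_simps)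
  then have eq: "fu (x + s *\<^sub>R u + t *\<^sub>R v) v = fv (x + s' *\<^sub>R v + t' *\<^sub>R u) u" using h by simp
  have 1: "dist (fu (x + s *\<^sub>R u + t *\<^sub>R v) v) (fu x v) < e"
    using d1(2)[OF S[OF st(1-4)]] near[OF st(1-4)] by (simp add: d_def)
  have "dist (x + s' *\<^sub>R v + t' *\<^sub>R u) x < d"
    using near[OF st'(3,4,1,2)] by (simp add: algebra_simps)
  then have 2: "dist (fv (x + s' *\<^sub>R v + t' *\<^sub>R u) u) (fv x u) < e"
    using d2(2)[OF S'[OF st'(1-4)]] by (simp add: d_def)
  have "dist (fu x v) (fv x u) < e + e"
    using 1 2 unfolding eq by (metis add_strict_mono dist_commute dist_triangle2 le_less_trans)
  then show False by (simp add: e_def dist_real_def)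
qed

section \<open>Smooth functions on coordinate subspaces\<close>

abbreviation copen :: "'k::finite set \<Rightarrow> (complex ^ 'k) set \<Rightarrow> bool" where
  "copen I S \<equiv> openin (top_of_set (coord_space I)) S"

definition cproj :: "'k::finite set \<Rightarrow> complex ^ 'k \<Rightarrow> complex ^ 'k" where
  "cproj I x = (\<chi> a. if a \<in> I then x $ a else 0)"

text \<open>Precomposition with the projection extends \<open>f\<close> to an open subset of the whole vector space, where Frechet
  derivatives are available; the extension is constant in the directions outside \<open>\<complex>\<^sup>I\<close>.\<close>

definition smooth_in :: "'k::finite set \<Rightarrow> (complex ^ 'k) set \<Rightarrow> (complex ^ 'k \<Rightarrow> 'w::real_normed_vector) \<Rightarrow> bool" where
  "smooth_in I S f \<longleftrightarrow> copen I S \<and> (\<forall>k. Ck k (cproj I -` S) (\<lambda>x. f (cproj I x)))"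

lemma cproj_nth [simp]: "cproj I x $ a = (if a \<in> I then x $ a else 0)"
  by (simp add: cproj_def)

lemma cproj_coord_space [simp]: "cproj I x \<in> coord_space I"
  by (simp add: coord_space_def)

lemma cproj_id: "x \<in> coord_space I \<Longrightarrow> cproj I x = x"
  by (auto simp: coord_space_def vec_eq_iff)

lemma cproj_add: "cproj I (x + y) = cproj I x + cproj I y"
  by (simp add: vec_eq_iff)

lemma cproj_scaleR: "cproj I (r *\<^sub>R x) = r *\<^sub>R cproj I x"
  by (simp add: vec_eq_iff)

lemma bounded_linear_cproj: "bounded_linear (cproj I)"
  using linear_conv_bounded_linear linearI cproj_add cproj_scaleR by metis

lemma copen_subset: "copen I S \<Longrightarrow> S \<subseteq> coord_space I"
  using openin_imp_subset by fastforce

lemma copen_thick: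
  assumes "copen I S" shows "open (cproj I -` S)"
proof -
  obtain U where U: "open U" "S = coord_space I \<inter> U" using assms openin_open by blast
  then have "cproj I -` S = cproj I -` U" by auto
  moreover have "continuous_on UNIV (cproj I)"
    using bounded_linear_cproj linear_continuous_on by blast
  ultimately show ?thesis using U open_vimage by metis
qed

lemma smooth_open: "smooth_in I S f \<Longrightarrow> copen I S" by (simp add: smooth_in_def)

lemma coord_space_add: "x \<in> coord_space I \<Longrightarrow> y \<in> coord_space I \<Longrightarrow> x + y \<in> coord_space I"
  by (simp add: coord_space_def)

lemma coord_space_scaleR: "x \<in> coord_space I \<Longrightarrow> r *\<^sub>R x \<in> coord_space I"
  by (simp add: coord_space_def)

lemma coord_space_smult: "x \<in> coord_space I \<Longrightarrow> c *s x \<in> coord_space I"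
  by (simp add: coord_space_def)

lemma coord_space_axis [simp]: "axis a c \<in> coord_space I \<longleftrightarrow> a \<in> I \<or> c = 0"
  by (auto simp: coord_space_def axis_def)

lemma real_dirs_coord_space: "real_dirs I \<subseteq> coord_space I"
  by (auto simp: real_dirs_def)

lemma copen_line:
  assumes "copen I S" "x \<in> S" "v \<in> coord_space I"
  shows "eventually (\<lambda>t::real. x + t *\<^sub>R v \<in> S) (nhds 0)"
proof -
  obtain U where U: "open U" "S = coord_space I \<inter> U" using assms openin_open by blast
  have "open ((\<lambda>t::real. x + t *\<^sub>R v) -` U)"
    by (rule open_vimage[OF U(1)]) (auto intro!: continuous_intros)
  moreover have "0 \<in> (\<lambda>t::real. x + t *\<^sub>R v) -` U" using assms U by auto
  ultimately have "eventually (\<lambda>t. t \<in> (\<lambda>t::real. x + t *\<^sub>R v) -` U) (nhds 0)"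
    by (rule eventually_nhds_in_open)
  then show ?thesis
    by (rule eventually_mono) (use assms U in \<open>auto intro!: coord_space_add coord_space_scaleR\<close>)
qed

lemma ddir_cong:
  assumes "copen I S" "x \<in> S" "v \<in> coord_space I" "\<And>y. y \<in> S \<Longrightarrow> f y = g y"
  shows "ddir v f x = ddir v g x"
  unfolding ddir_def
  by (rule vector_derivative_cong_eq)
    (use copen_line[OF assms(1-3)] assms(4) in \<open>auto elim: eventually_mono\<close>)

lemma ddir_cproj:
  assumes "v \<in> coord_space I" "((\<lambda>y. f (cproj I y)) has_derivative D) (at x)"
  shows "((\<lambda>t. f (cproj I x + t *\<^sub>R v)) has_vector_derivative D v) (at 0)" "ddir v f (cproj I x) = D v"
proof -
  have eq: "cproj I (x + t *\<^sub>R v) = cproj I x + t *\<^sub>R v" for t :: real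
    using assms(1) by (simp add: cproj_add cproj_scaleR cproj_id)
  have "((\<lambda>t::real. x + t *\<^sub>R v) has_derivative (\<lambda>t. t *\<^sub>R v)) (at 0)"
    by (auto intro!: derivative_eq_intros)
  then have "((\<lambda>t. f (cproj I (x + t *\<^sub>R v))) has_derivative (\<lambda>t. D (t *\<^sub>R v))) (at 0)"
    using has_derivative_compose[of "\<lambda>t::real. x + t *\<^sub>R v" "\<lambda>t. t *\<^sub>R v" 0 UNIV "\<lambda>y. f (cproj I y)" D] assms(2)
    by simp
  then show "((\<lambda>t. f (cproj I x + t *\<^sub>R v)) has_vector_derivative D v) (at 0)"
    using linear_scale[OF has_derivative_linear[OF assms(2)]]
    by (simp add: eq has_vector_derivative_def)
  then show "ddir v f (cproj I x) = D v"
    unfolding ddir_def by (rule vector_derivative_at)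
qed

lemma ddir_eqI:
  assumes "x \<in> coord_space I" "v \<in> coord_space I" "((\<lambda>y. f (cproj I y)) has_derivative D) (at x)"
  shows "ddir v f x = D v"
  using ddir_cproj(2)[OF assms(2,3)] assms(1) by (simp add: cproj_id)

lemma smooth_has_derivative:
  assumes "smooth_in I S f" "x \<in> S"
  obtains D where "((\<lambda>y. f (cproj I y)) has_derivative D) (at x)"
    "\<And>v. v \<in> coord_space I \<Longrightarrow> ddir v f x = D v"
    "\<And>v. D v = D (cproj I v)"
proof -
  have x: "x \<in> coord_space I" using assms copen_subset smooth_open by blast
  then have x': "x \<in> cproj I -` S" using assms by (simp add: cproj_id)
  have "Ck (Suc 0) (cproj I -` S) (\<lambda>x. f (cproj I x))" using assms smooth_in_def by blast
  then have "(\<lambda>x. f (cproj I x)) differentiable (at x)" using x' Ck_differentiable by blast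
  then obtain D where D: "((\<lambda>y. f (cproj I y)) has_derivative D) (at x)"
    by (auto simp: differentiable_def)
  have d: "(cproj I has_derivative cproj I) (at x)"
    by (rule bounded_linear_imp_has_derivative[OF bounded_linear_cproj])
  have "((\<lambda>y. f (cproj I (cproj I y))) has_derivative (\<lambda>v. D (cproj I v))) (at x)"
    by (rule has_derivative_compose[OF d, of "\<lambda>y. f (cproj I y)" D]) (use D x in \<open>simp add: cproj_id\<close>)
  then have "((\<lambda>y. f (cproj I y)) has_derivative (\<lambda>v. D (cproj I v))) (at x)"
    by (simp add: cproj_id)
  then have "D = (\<lambda>v. D (cproj I v))" using D has_derivative_unique by blast
  then have "D v = D (cproj I v)" for v by metis
  then show ?thesis using that[of D] D ddir_eqI[OF x _ D] by blast
qed

lemma smooth_ddir_derivative: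
  assumes "smooth_in I S f" "x \<in> S"
  shows "((\<lambda>y. f (cproj I y)) has_derivative (\<lambda>v. ddir (cproj I v) f x)) (at x)"
proof -
  obtain D where D: "((\<lambda>y. f (cproj I y)) has_derivative D) (at x)"
    "\<And>v. v \<in> coord_space I \<Longrightarrow> ddir v f x = D v" "\<And>v. D v = D (cproj I v)"
    using assms smooth_has_derivative by blast
  then have "(\<lambda>v. ddir (cproj I v) f x) = D" by auto
  then show ?thesis using D by simp
qed

lemma smooth_ddir:
  assumes "smooth_in I S f" "v \<in> coord_space I"
  shows "smooth_in I S (ddir v f)"
  unfolding smooth_in_def
proof (intro conjI allI)
  show o: "copen I S" using assms smooth_open by blast
  fix k
  have "Ck (Suc k) (cproj I -` S) (\<lambda>x. f (cproj I x))" using assms smooth_in_def by blast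
  then obtain f' where f': "\<And>x. x \<in> cproj I -` S \<Longrightarrow> ((\<lambda>x. f (cproj I x)) has_derivative f' x) (at x)"
    "\<And>v. Ck k (cproj I -` S) (\<lambda>x. f' x v)" by (rule Ck_SucE) blast
  show "Ck k (cproj I -` S) (\<lambda>x. ddir v f (cproj I x))"
    by (rule Ck_cong[OF copen_thick[OF o] _ f'(2)[of v]])
      (use ddir_cproj(2)[OF assms(2) f'(1)] in simp)
qed

lemma smooth_continuous_on:
  assumes "smooth_in I S f" shows "continuous_on S f"
proof -
  have "Ck 0 (cproj I -` S) (\<lambda>x. f (cproj I x))" using assms smooth_in_def by blast
  moreover have "S \<subseteq> cproj I -` S" using copen_subset[OF smooth_open[OF assms]] by (auto simp: cproj_id)
  ultimately have "continuous_on S (\<lambda>x. f (cproj I x))" using continuous_on_subset by auto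
  then show ?thesis
    by (rule continuous_on_eq) (use copen_subset[OF smooth_open[OF assms]] in \<open>auto simp: cproj_id\<close>)
qed

lemma iter_ddir_append: "iter_ddir (vs @ ws) f = iter_ddir vs (iter_ddir ws f)"
  by (induction vs) auto

lemma smooth_fun_ddir:
  assumes "smooth_fun I S f" "v \<in> real_dirs I"
  shows "smooth_fun I S (ddir v f)"
proof -
  have "iter_ddir vs (ddir v f) = iter_ddir (vs @ [v]) f" for vs
    by (simp add: iter_ddir_append)
  moreover have "set vs \<subseteq> real_dirs I \<Longrightarrow> set (vs @ [v]) \<subseteq> real_dirs I" for vs using assms(2) by simp
  ultimately show ?thesis using assms(1) unfolding smooth_fun_def by simp
qed

lemma Basis_cvec:
  fixes b :: "complex ^ 'k::finite"
  assumes "b \<in> Basis"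
  shows "b \<in> real_dirs I \<or> cproj I b = 0"
proof -
  obtain a u where "b = axis a u" "u = 1 \<or> u = \<i>" using assms by (auto simp: Basis_vec_def Basis_complex_def)
  then show ?thesis by (cases "a \<in> I") (auto simp: real_dirs_def vec_eq_iff axis_def)
qed

text \<open>The Frechet derivative comes from the continuous partial derivatives by \<open>has_derivative_partials\<close>; the basis
  directions outside \<open>\<complex>\<^sup>I\<close> are annihilated by the projection.\<close>

lemma smooth_fun_imp_smooth_in:
  fixes f :: "complex ^ 'k::finite \<Rightarrow> 'w::real_normed_vector"
  assumes o: "copen I S" and "smooth_fun I S f"
  shows "smooth_in I S f"
  unfolding smooth_in_def
proof (intro conjI allI)
  fix k
  show "Ck k (cproj I -` S) (\<lambda>x. f (cproj I x))" using assms(2)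
  proof (induction k arbitrary: f)
    case 0
    then have "set [] \<subseteq> real_dirs I \<longrightarrow> continuous_on S (iter_ddir [] f)" unfolding smooth_fun_def by blast
    then have "continuous_on S f" by simp
    then have "continuous_on (cproj I -` S) (\<lambda>x. f (cproj I x))"
      by (rule continuous_on_compose2[OF _ linear_continuous_on[OF bounded_linear_cproj]]) auto
    then show ?case by simp
  next
    case (Suc k)
    define D where "D b x = (if b \<in> real_dirs I then ddir b f (cproj I x) else 0)" for b x
    have Dk: "Ck k (cproj I -` S) (D b)" for b
    proof (cases "b \<in> real_dirs I")
      case True
      then have "D b = (\<lambda>x. ddir b f (cproj I x))" by (auto simp: D_def)
      then show ?thesis using Suc.IH[OF smooth_fun_ddir[OF Suc.prems True]] by simp
    next
      case False
      then have "D b = (\<lambda>x. 0)" by (auto simp: D_def)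
      then show ?thesis by (simp add: Ck_const)
    qed
    show ?case
    proof (rule Ck_SucI[where f' = "\<lambda>x v. \<Sum>b\<in>Basis. (v \<bullet> b) *\<^sub>R D b x"])
      show "Ck k (cproj I -` S) (\<lambda>x. \<Sum>b\<in>Basis. (v \<bullet> b) *\<^sub>R D b x)" for v
        by (intro Ck_sum Ck_scaleR Ck_const Dk)
      fix x assume x: "x \<in> cproj I -` S"
      show "((\<lambda>x. f (cproj I x)) has_derivative (\<lambda>v. \<Sum>b\<in>Basis. (v \<bullet> b) *\<^sub>R D b x)) (at x)"
      proof (rule has_derivative_partials[OF copen_thick[OF o] x])
        show "continuous_on (cproj I -` S) (D b)" for b using Ck_continuous[OF Dk] .
        fix b y :: "complex ^ 'k" assume b: "b \<in> Basis" and y: "y \<in> cproj I -` S"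
        show "((\<lambda>t. f (cproj I (y + t *\<^sub>R b))) has_vector_derivative D b y) (at 0)"
        proof (cases "b \<in> real_dirs I")
          case True
          then have cb: "cproj I b = b" using real_dirs_coord_space cproj_id by blast
          have "set [] \<subseteq> real_dirs I" by simp
          then have "(\<lambda>t. iter_ddir [] f (cproj I y + t *\<^sub>R b)) differentiable (at 0)"
            using Suc.prems True y unfolding smooth_fun_def by blast
          then show ?thesis using True
            by (simp add: D_def ddir_def cproj_add cproj_scaleR cb vector_derivative_works)
        next
          case False
          then have "cproj I b = 0" using Basis_cvec[OF b] by blast
          then show ?thesis using False by (simp add: cproj_add cproj_scaleR D_def)
        qed
      qed
    qed
  qed
qed (rule o)

lemma smooth_in_imp_smooth_fun:
  assumes "smooth_in I S f"
  shows "smooth_fun I S f"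
  unfolding smooth_fun_def
proof (intro allI impI)
  fix vs assume vs: "set vs \<subseteq> real_dirs I"
  have s: "smooth_in I S (iter_ddir vs f)" using vs
    by (induction vs) (use assms subsetD[OF real_dirs_coord_space] in \<open>auto intro!: smooth_ddir\<close>)
  have "(\<lambda>t. iter_ddir vs f (x + t *\<^sub>R v)) differentiable (at 0)" if xv: "x \<in> S" "v \<in> real_dirs I" for x v
  proof -
    obtain D where D: "((\<lambda>y. iter_ddir vs f (cproj I y)) has_derivative D) (at x)"
      by (rule smooth_has_derivative[OF s xv(1)]) blast
    have "cproj I x = x" using xv copen_subset[OF smooth_open[OF assms]] cproj_id by blast
    then show ?thesis
      using differentiableI_vector[OF ddir_cproj(1)[OF subsetD[OF real_dirs_coord_space xv(2)] D]] by simp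
  qed
  then show "continuous_on S (iter_ddir vs f) \<and> (\<forall>x\<in>S. \<forall>v\<in>real_dirs I. (\<lambda>t. iter_ddir vs f (x + t *\<^sub>R v)) differentiable at 0)"
    using smooth_continuous_on[OF s] by blast
qed

lemma smooth_cong:
  assumes "smooth_in I S f" "\<And>x. x \<in> S \<Longrightarrow> f x = g x"
  shows "smooth_in I S g"
  unfolding smooth_in_def
proof (intro conjI allI)
  show o: "copen I S" using assms smooth_open by blast
  fix k
  have "Ck k (cproj I -` S) (\<lambda>x. f (cproj I x))" using assms smooth_in_def by blast
  then show "Ck k (cproj I -` S) (\<lambda>x. g (cproj I x))"
    by (rule Ck_cong[OF copen_thick[OF o], rotated]) (use assms in auto)
qed

lemma smooth_subset: "smooth_in I S f \<Longrightarrow> copen I T \<Longrightarrow> T \<subseteq> S \<Longrightarrow> smooth_in I T f"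
  unfolding smooth_in_def using Ck_subset vimage_mono by metis

lemma smooth_const: "copen I S \<Longrightarrow> smooth_in I S (\<lambda>x. c)"
  by (simp add: smooth_in_def Ck_const)

lemma smooth_linear: "copen I S \<Longrightarrow> bounded_linear L \<Longrightarrow> smooth_in I S L"
  unfolding smooth_in_def using Ck_bounded_linear Ck_linear bounded_linear_cproj by blast

lemma smooth_nth: "copen I S \<Longrightarrow> smooth_in I S (\<lambda>x. x $ a)"
  by (rule smooth_linear[OF _ bounded_linear_vec_nth])

lemma smooth_bounded_linear: "bounded_linear L \<Longrightarrow> smooth_in I S f \<Longrightarrow> smooth_in I S (\<lambda>x. L (f x))"
  using Ck_bounded_linear[of L _ "cproj I -` S" "\<lambda>x. f (cproj I x)"] by (auto simp: smooth_in_def)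

lemma smooth_add: "smooth_in I S f \<Longrightarrow> smooth_in I S g \<Longrightarrow> smooth_in I S (\<lambda>x. f x + g x)"
  by (simp add: smooth_in_def Ck_add)

lemma smooth_diff: "smooth_in I S f \<Longrightarrow> smooth_in I S g \<Longrightarrow> smooth_in I S (\<lambda>x. f x - g x)"
  by (simp add: smooth_in_def Ck_diff)

lemma smooth_mult:
  fixes f :: "complex ^ 'k::finite \<Rightarrow> 'w::real_normed_algebra"
  shows "smooth_in I S f \<Longrightarrow> smooth_in I S g \<Longrightarrow> smooth_in I S (\<lambda>x. f x * g x)"
  by (simp add: smooth_in_def Ck_mult)

lemma smooth_sum: "copen I S \<Longrightarrow> (\<And>i. i \<in> A \<Longrightarrow> smooth_in I S (f i)) \<Longrightarrow> smooth_in I S (\<lambda>x. \<Sum>i\<in>A. f i x)"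
  by (simp add: smooth_in_def Ck_sum)

lemma smooth_prod:
  fixes f :: "'i \<Rightarrow> complex ^ 'k::finite \<Rightarrow> 'w::{real_normed_algebra,comm_ring_1}"
  shows "copen I S \<Longrightarrow> (\<And>i. i \<in> A \<Longrightarrow> smooth_in I S (f i)) \<Longrightarrow> smooth_in I S (\<lambda>x. \<Prod>i\<in>A. f i x)"
  by (simp add: smooth_in_def Ck_prod)

lemma smooth_compose_Ck:
  fixes g :: "complex ^ 'k::finite \<Rightarrow> 'b::euclidean_space"
  assumes "smooth_in I S g" "\<And>k. Ck k T f" "\<And>x. x \<in> S \<Longrightarrow> g x \<in> T"
  shows "smooth_in I S (\<lambda>x. f (g x))"
  unfolding smooth_in_def
proof (intro conjI allI)
  show o: "copen I S" using assms smooth_open by blast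
  fix k show "Ck k (cproj I -` S) (\<lambda>x. f (g (cproj I x)))"
    by (rule Ck_compose[OF assms(2)]) (use assms(1,3) copen_thick[OF o] in \<open>auto simp: smooth_in_def\<close>)
qed

lemma smooth_inverse:
  fixes f :: "complex ^ 'k::finite \<Rightarrow> 'w::{real_normed_field,euclidean_space}"
  shows "smooth_in I S f \<Longrightarrow> (\<And>x. x \<in> S \<Longrightarrow> f x \<noteq> 0) \<Longrightarrow> smooth_in I S (\<lambda>x. inverse (f x))"
  by (rule smooth_compose_Ck[OF _ Ck_inverse']) auto

lemma smooth_ln: "smooth_in I S f \<Longrightarrow> (\<And>x. x \<in> S \<Longrightarrow> f x > 0) \<Longrightarrow> smooth_in I S (\<lambda>x. ln (f x :: real))"
  by (rule smooth_compose_Ck[OF _ Ck_ln']) auto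

lemma smooth_exp: "smooth_in I S f \<Longrightarrow> smooth_in I S (\<lambda>x. exp (f x :: 'w::{real_normed_field,euclidean_space}))"
  by (rule smooth_compose_Ck[OF _ Ck_exp[of _ UNIV]]) auto

lemma smooth_Ln: "smooth_in I S f \<Longrightarrow> (\<And>x. x \<in> S \<Longrightarrow> f x \<notin> \<real>\<^sub>\<le>\<^sub>0) \<Longrightarrow> smooth_in I S (\<lambda>x. Ln (f x))"
  by (rule smooth_compose_Ck[OF _ Ck_Ln']) auto

lemma smooth_of_real: "smooth_in I S f \<Longrightarrow> smooth_in I S (\<lambda>x. complex_of_real (f x))"
  by (rule smooth_bounded_linear[OF bounded_linear_of_real])

lemma smooth_cnj: "smooth_in I S f \<Longrightarrow> smooth_in I S (\<lambda>x. cnj (f x))"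
  by (rule smooth_bounded_linear[OF bounded_linear_cnj])

lemma smooth_Re: "smooth_in I S f \<Longrightarrow> smooth_in I S (\<lambda>x. Re (f x))"
  by (rule smooth_bounded_linear[OF bounded_linear_Re])

lemma bounded_linear_axis: "bounded_linear (axis i :: 'a::real_normed_vector \<Rightarrow> 'a ^ 'n::finite)"
proof
  fix x y :: 'a and r :: real
  show "axis i (x + y) = axis i x + axis i y" "axis i (r *\<^sub>R x) = r *\<^sub>R axis i x"
    by (auto simp: axis_def vec_eq_iff)
  show "\<exists>K. \<forall>x::'a. norm (axis i x :: 'a ^ 'n) \<le> norm x * K"
  proof (intro exI[of _ 1] allI)
    fix x :: 'a
    have "norm (axis i x :: 'a ^ 'n) \<le> (\<Sum>j\<in>UNIV. norm ((axis i x :: 'a ^ 'n) $ j))"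
      unfolding norm_vec_def by (rule L2_set_le_sum) simp
    also have "\<dots> = (\<Sum>j\<in>UNIV. if j = i then norm x else 0)"
      by (rule sum.cong) (auto simp: axis_def)
    finally show "norm (axis i x :: 'a ^ 'n) \<le> norm x * 1" by simp
  qed
qed

lemma vec_sum_axis: "x = (\<Sum>j\<in>UNIV. axis j (x $ j))" for x :: "'a::comm_monoid_add ^ 'n::finite"
  by (simp add: vec_eq_iff axis_def sum.delta)

lemma smooth_vec:
  fixes g :: "complex ^ 'k::finite \<Rightarrow> 'w::real_normed_vector ^ 'l::finite"
  assumes "\<And>j. smooth_in I S (\<lambda>x. g x $ j)"
  shows "smooth_in I S g"
proof -
  have o: "copen I S" using assms smooth_open by blast
  have "g = (\<lambda>x. \<Sum>j\<in>UNIV. axis j (g x $ j))" using vec_sum_axis by blast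
  moreover have "smooth_in I S (\<lambda>x. \<Sum>j\<in>UNIV. axis j (g x $ j))"
    by (intro smooth_sum[OF o] smooth_bounded_linear[OF bounded_linear_axis] assms)
  ultimately show ?thesis by simp
qed

lemma smooth_vec_nth: "smooth_in I S g \<Longrightarrow> smooth_in I S (\<lambda>x. g x $ j)"
  by (rule smooth_bounded_linear[OF bounded_linear_vec_nth])

lemma smooth_compose:
  fixes g :: "complex ^ 'k::finite \<Rightarrow> complex ^ 'l::finite"
  assumes "smooth_in I S g" "smooth_in J T f" "\<And>x. x \<in> S \<Longrightarrow> g x \<in> T"
  shows "smooth_in I S (\<lambda>x. f (g x))"
proof -
  have "smooth_in I S (\<lambda>x. f (cproj J (g x)))"
    by (rule smooth_compose_Ck[OF assms(1), of "cproj J -` T"])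
      (use assms(2,3) copen_subset[OF smooth_open[OF assms(2)]] in \<open>auto simp: smooth_in_def cproj_id subset_iff\<close>)
  then show ?thesis
    by (rule smooth_cong) (use assms(3) copen_subset[OF smooth_open[OF assms(2)]] in \<open>auto simp: cproj_id subset_iff\<close>)
qed

section \<open>Rules for directional and Wirtinger derivatives\<close>

lemma ddir_eq_smooth:
  assumes "smooth_in I S f" "x \<in> S" "v \<in> coord_space I" "((\<lambda>y. f (cproj I y)) has_derivative D) (at x)"
  shows "ddir v f x = D v"
  using ddir_eqI[OF _ assms(3,4)] copen_subset[OF smooth_open[OF assms(1)]] assms(2) by blast

lemma ddir_linear:
  assumes "smooth_in I S f" "x \<in> S" "u \<in> coord_space I" "v \<in> coord_space I"
  shows "ddir (u + v) f x = ddir u f x + ddir v f x" "ddir (r *\<^sub>R v) f x = r *\<^sub>R ddir v f x"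
proof -
  obtain D where D: "((\<lambda>y. f (cproj I y)) has_derivative D) (at x)"
    "\<And>v. v \<in> coord_space I \<Longrightarrow> ddir v f x = D v"
    using assms smooth_has_derivative by blast
  then show "ddir (u + v) f x = ddir u f x + ddir v f x" "ddir (r *\<^sub>R v) f x = r *\<^sub>R ddir v f x"
    using assms by (auto simp: coord_space_add coord_space_scaleR linear_add linear_scale has_derivative_linear)
qed

lemma ddir_sum_dir:
  assumes "smooth_in I S f" "x \<in> S" "\<And>a. a \<in> A \<Longrightarrow> v a \<in> coord_space I" "finite A"
  shows "ddir (\<Sum>a\<in>A. r a *\<^sub>R v a) f x = (\<Sum>a\<in>A. r a *\<^sub>R ddir (v a) f x)"
proof -
  obtain D where D: "((\<lambda>y. f (cproj I y)) has_derivative D) (at x)"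
    "\<And>v. v \<in> coord_space I \<Longrightarrow> ddir v f x = D v"
    using assms smooth_has_derivative by blast
  have "(\<Sum>a\<in>A. r a *\<^sub>R v a) \<in> coord_space I"
    using assms(3) by (auto simp: coord_space_def intro!: sum.neutral)
  then show ?thesis
    using D assms by (simp add: linear_sum linear_scale has_derivative_linear)
qed

lemma ddir_const: "ddir v (\<lambda>x. c) x = 0"
  unfolding ddir_def by (rule vector_derivative_at) simp

lemma ddir_bounded_linear:
  assumes "bounded_linear L" "smooth_in I S f" "x \<in> S" "v \<in> coord_space I"
  shows "ddir v (\<lambda>y. L (f y)) x = L (ddir v f x)"
proof -
  obtain D where D: "((\<lambda>y. f (cproj I y)) has_derivative D) (at x)"
    "\<And>v. v \<in> coord_space I \<Longrightarrow> ddir v f x = D v"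
    using assms smooth_has_derivative by blast
  show ?thesis
    using ddir_eq_smooth[OF smooth_bounded_linear[OF assms(1,2)] assms(3,4) bounded_linear.has_derivative[OF assms(1) D(1)]]
      D(2) assms by simp
qed

lemma ddir_linear_fun:
  assumes "bounded_linear L"
  shows "ddir v L x = L v"
proof -
  have "((\<lambda>t. L (x + t *\<^sub>R v)) has_vector_derivative L v) (at 0)"
    unfolding has_vector_derivative_def
      linear_add[OF bounded_linear.linear[OF assms]] linear_scale[OF bounded_linear.linear[OF assms]]
    by (auto intro!: derivative_eq_intros)
  then show ?thesis unfolding ddir_def by (rule vector_derivative_at)
qed

lemma ddir_add:
  assumes "smooth_in I S f" "smooth_in I S g" "x \<in> S" "v \<in> coord_space I"
  shows "ddir v (\<lambda>y. f y + g y) x = ddir v f x + ddir v g x"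
  using ddir_eq_smooth[OF smooth_add[OF assms(1,2)] assms(3,4) has_derivative_add[OF smooth_ddir_derivative smooth_ddir_derivative]]
   assms by (simp add: cproj_id)

lemma ddir_diff:
  assumes "smooth_in I S f" "smooth_in I S g" "x \<in> S" "v \<in> coord_space I"
  shows "ddir v (\<lambda>y. f y - g y) x = ddir v f x - ddir v g x"
  using ddir_eq_smooth[OF smooth_diff[OF assms(1,2)] assms(3,4) has_derivative_diff[OF smooth_ddir_derivative smooth_ddir_derivative]]
   assms by (simp add: cproj_id)

lemma ddir_mult:
  fixes f :: "complex ^ 'k::finite \<Rightarrow> 'w::real_normed_algebra"
  assumes "smooth_in I S f" "smooth_in I S g" "x \<in> S" "v \<in> coord_space I"
  shows "ddir v (\<lambda>y. f y * g y) x = f x * ddir v g x + ddir v f x * g x"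
proof -
  have "x \<in> coord_space I" using assms copen_subset smooth_open by blast
  then show ?thesis
  using ddir_eq_smooth[OF smooth_mult[OF assms(1,2)] assms(3,4) has_derivative_mult[OF smooth_ddir_derivative smooth_ddir_derivative]]
   assms by (simp add: cproj_id)
qed

lemma ddir_sum:
  assumes "\<And>i. i \<in> A \<Longrightarrow> smooth_in I S (f i)" "copen I S" "x \<in> S" "v \<in> coord_space I"
  shows "ddir v (\<lambda>y. \<Sum>i\<in>A. f i y) x = (\<Sum>i\<in>A. ddir v (f i) x)"
  using assms(1)
proof (induction A rule: infinite_finite_induct)
  case (insert i A)
  have "ddir v (\<lambda>y. f i y + (\<Sum>i\<in>A. f i y)) x = ddir v (f i) x + ddir v (\<lambda>y. \<Sum>i\<in>A. f i y) x"
    by (rule ddir_add[of I S]) (use insert assms in \<open>auto intro!: smooth_sum\<close>)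
  then show ?case using insert by simp
qed (auto simp: ddir_const)

lemma ddir_ln:
  assumes "smooth_in I S f" "x \<in> S" "v \<in> coord_space I" "\<And>x. x \<in> S \<Longrightarrow> f x > (0::real)"
  shows "ddir v (\<lambda>y. ln (f y)) x = ddir v f x / f x"
proof -
  have x: "x \<in> coord_space I" using assms copen_subset smooth_open by blast
  have "((\<lambda>y. ln (f (cproj I y))) has_derivative (\<lambda>v. ddir (cproj I v) f x / f x)) (at x)"
    using has_derivative_ln[OF _ smooth_ddir_derivative[OF assms(1,2)]] assms(4)[OF assms(2)] x
    by (simp add: cproj_id field_simps)
  from ddir_eq_smooth[OF smooth_ln[OF assms(1,4)] assms(2,3) this] show ?thesis using assms by (simp add: cproj_id)
qed

lemma ddir_coord_space:
  fixes g :: "complex ^ 'k::finite \<Rightarrow> complex ^ 'l::finite"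
  assumes "smooth_in I S g" "x \<in> S" "v \<in> coord_space I" "\<And>x. x \<in> S \<Longrightarrow> g x \<in> coord_space J"
  shows "ddir v g x \<in> coord_space J"
proof -
  have "ddir v g x $ a = 0" if "a \<notin> J" for a
  proof -
    have "ddir v g x $ a = ddir v (\<lambda>y. g y $ a) x"
      using ddir_bounded_linear[OF bounded_linear_vec_nth assms(1,2,3)] by simp
    also have "\<dots> = ddir v (\<lambda>y. 0) x"
      by (rule ddir_cong[OF smooth_open[OF assms(1)] assms(2,3)]) (use assms(4) that in \<open>auto simp: coord_space_def\<close>)
    finally show ?thesis by (simp add: ddir_const)
  qed
  then show ?thesis by (simp add: coord_space_def)
qed

lemma ddir_compose:
  fixes g :: "complex ^ 'k::finite \<Rightarrow> complex ^ 'l::finite"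
  assumes "smooth_in I S g" "smooth_in J T f" "\<And>x. x \<in> S \<Longrightarrow> g x \<in> T" "x \<in> S" "v \<in> coord_space I"
  shows "ddir v (\<lambda>y. f (g y)) x = ddir (ddir v g x) f (g x)"
proof -
  have T: "T \<subseteq> coord_space J" using copen_subset[OF smooth_open[OF assms(2)]] .
  have x: "x \<in> coord_space I" using copen_subset[OF smooth_open[OF assms(1)]] assms(4) by blast
  have dg: "ddir v g x \<in> coord_space J" by (rule ddir_coord_space[OF assms(1,4,5)]) (use assms(3) T in blast)
  have "((\<lambda>y. f (cproj J (g (cproj I y)))) has_derivative (\<lambda>v. ddir (cproj J (ddir (cproj I v) g x)) f (g x))) (at x)"
    using has_derivative_compose[OF smooth_ddir_derivative[OF assms(1,4)], of "\<lambda>z. f (cproj J z)"]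
      smooth_ddir_derivative[OF assms(2) assms(3)[OF assms(4)]] x by (simp add: cproj_id)
  then have "ddir v (\<lambda>y. f (cproj J (g y))) x = ddir (cproj J (ddir (cproj I v) g x)) f (g x)"
    by (rule ddir_eqI[OF x assms(5)])
  moreover have "ddir v (\<lambda>y. f (cproj J (g y))) x = ddir v (\<lambda>y. f (g y)) x"
    by (rule ddir_cong[OF smooth_open[OF assms(1)] assms(4,5)]) (use assms(3) T in \<open>auto simp: cproj_id subset_iff\<close>)
  ultimately show ?thesis using dg assms(5) by (simp add: cproj_id)
qed

lemma ddir_symmetric:
  fixes f :: "complex ^ 'k::finite \<Rightarrow> complex"
  assumes "smooth_in I S f" "x \<in> S" "u \<in> coord_space I" "v \<in> coord_space I"
  shows "ddir u (ddir v f) x = ddir v (ddir u f) x"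
proof -
  have x: "x \<in> coord_space I" using copen_subset[OF smooth_open[OF assms(1)]] assms(2) by blast
  have real: "ddir u (ddir v g) x = ddir v (ddir u g) x" if g: "smooth_in I S g" for g :: "complex ^ 'k \<Rightarrow> real"
  proof -
    let ?T = "cproj I -` S"
    have der: "((\<lambda>y. h (cproj I y)) has_derivative (\<lambda>w. ddir (cproj I w) h (cproj I y))) (at y)"
      if h: "smooth_in I S h" and y: "y \<in> ?T" for y and h :: "complex ^ 'k \<Rightarrow> real"
    proof -
      have "((\<lambda>z. h (cproj I (z + (cproj I y - y)))) has_derivative (\<lambda>w. ddir (cproj I w) h (cproj I y))) (at y)"
      proof (rule has_derivative_compose[of "\<lambda>z. z + (cproj I y - y)" "\<lambda>z. z"])
        show "((\<lambda>z. z + (cproj I y - y)) has_derivative (\<lambda>z. z)) (at y)"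
          by (auto intro!: derivative_eq_intros)
      qed (use smooth_ddir_derivative[OF h, of "cproj I y"] y in simp)
      moreover have "cproj I (z + (cproj I y - y)) = cproj I z" for z by (simp add: vec_eq_iff)
      ultimately show ?thesis by simp
    qed
    have cont: "continuous_on ?T (\<lambda>y. h (cproj I y))" if "smooth_in I S h" for h :: "complex ^ 'k \<Rightarrow> real"
      using that Ck_continuous by (auto simp: smooth_in_def)
    have "ddir (cproj I v) (ddir (cproj I u) g) (cproj I x) = ddir (cproj I u) (ddir (cproj I v) g) (cproj I x)"
    proof (rule second_derivative_symmetric_real[where S = ?T and f = "\<lambda>y. g (cproj I y)"
          and f' = "\<lambda>y w. ddir (cproj I w) g (cproj I y)" and fu = "\<lambda>y w. ddir (cproj I w) (ddir (cproj I u) g) (cproj I y)"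
          and fv = "\<lambda>y w. ddir (cproj I w) (ddir (cproj I v) g) (cproj I y)" and u = u and v = v and x = x])
      show "open ?T" using copen_thick smooth_open assms by blast
      show "x \<in> ?T" using x assms by (simp add: cproj_id)
    qed (intro der cont smooth_ddir g cproj_coord_space; assumption)+
    then show ?thesis using assms x by (simp add: cproj_id)
  qed
  have re: "L (ddir a (ddir b f) x) = ddir a (ddir b (\<lambda>y. L (f y))) x"
    if L: "bounded_linear L" and ab: "a \<in> coord_space I" "b \<in> coord_space I" for L :: "complex \<Rightarrow> real" and a b
  proof -
    have "ddir a (ddir b (\<lambda>y. L (f y))) x = ddir a (\<lambda>y. L (ddir b f y)) x"
      by (rule ddir_cong[OF smooth_open[OF assms(1)] assms(2) ab(1)])
        (use ddir_bounded_linear[OF L assms(1)] ab in auto)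
    then show ?thesis using ddir_bounded_linear[OF L smooth_ddir[OF assms(1) ab(2)] assms(2) ab(1)] by simp
  qed
  show ?thesis
    using real[OF smooth_Re[OF assms(1)]] real[OF smooth_bounded_linear[OF bounded_linear_Im assms(1)]]
      re[OF bounded_linear_Re assms(3,4)] re[OF bounded_linear_Re assms(4,3)]
      re[OF bounded_linear_Im assms(3,4)] re[OF bounded_linear_Im assms(4,3)]
    by (simp add: complex_eq_iff)
qed

lemma coord_space_expand:
  assumes "v \<in> coord_space I"
  shows "v = (\<Sum>a\<in>I. Re (v $ a) *\<^sub>R axis a (1::complex)) + (\<Sum>a\<in>I. Im (v $ a) *\<^sub>R axis a \<i>)"
proof -
  have "v $ b = (\<Sum>a\<in>I. Re (v $ a) *\<^sub>R axis a (1::complex) $ b) + (\<Sum>a\<in>I. Im (v $ a) *\<^sub>R axis a \<i> $ b)" for b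
  proof -
    have "(\<Sum>a\<in>I. Re (v $ a) *\<^sub>R axis a (1::complex) $ b) = (\<Sum>a\<in>I. if a = b then of_real (Re (v $ b)) else 0)"
      by (rule sum.cong) (auto simp: axis_def complex_eq_iff scaleR_conv_of_real)
    moreover have "(\<Sum>a\<in>I. Im (v $ a) *\<^sub>R axis a \<i> $ b) = (\<Sum>a\<in>I. if a = b then \<i> * of_real (Im (v $ b)) else 0)"
      by (rule sum.cong) (auto simp: axis_def complex_eq_iff scaleR_conv_of_real)
    ultimately show ?thesis using assms
      by (simp add: coord_space_def complex_eq_iff)
  qed
  then show ?thesis
    unfolding vec_eq_iff vector_add_component sum_component vector_scaleR_component by blast
qed

lemma ddir_axis_wirtinger:
  shows "ddir (axis a 1) f x = pd a f x + pdbar a f x"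
    and "ddir (axis a \<i>) f x = \<i> * (pd a f x - pdbar a f x)"
  by (simp_all add: pd_def pdbar_def field_simps)

lemma ddir_wirtinger:
  assumes "smooth_in I S f" "x \<in> S" "v \<in> coord_space I"
  shows "ddir v f x = (\<Sum>a\<in>I. v $ a * pd a f x + cnj (v $ a) * pdbar a f x)"
proof -
  have 1: "(\<Sum>a\<in>I. Re (v $ a) *\<^sub>R axis a 1) \<in> coord_space I" "(\<Sum>a\<in>I. Im (v $ a) *\<^sub>R axis a \<i>) \<in> coord_space I"
    by (auto simp: coord_space_def axis_def intro!: sum.neutral)
  have "ddir v f x = ddir (\<Sum>a\<in>I. Re (v $ a) *\<^sub>R axis a 1) f x + ddir (\<Sum>a\<in>I. Im (v $ a) *\<^sub>R axis a \<i>) f x"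
    using coord_space_expand[OF assms(3)] ddir_linear(1)[OF assms(1,2) 1] by simp
  also have "\<dots> = (\<Sum>a\<in>I. Re (v $ a) *\<^sub>R ddir (axis a 1) f x) + (\<Sum>a\<in>I. Im (v $ a) *\<^sub>R ddir (axis a \<i>) f x)"
    by (subst (1 2) ddir_sum_dir[OF assms(1,2)]) auto
  also have "\<dots> = (\<Sum>a\<in>I. v $ a * pd a f x + cnj (v $ a) * pdbar a f x)"
    unfolding sum.distrib[symmetric]
    by (rule sum.cong) (auto simp: ddir_axis_wirtinger complex_eq_iff algebra_simps)
  finally show ?thesis .
qed

context
  fixes I :: "'k::finite set" and S :: "(complex ^ 'k) set" and x :: "complex ^ 'k" and a :: 'k
  assumes x: "x \<in> S" and a: "a \<in> I"
begin

lemma wirtinger_cong: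
  assumes "copen I S" "\<And>y. y \<in> S \<Longrightarrow> f y = g y"
  shows "pd a f x = pd a g x" "pdbar a f x = pdbar a g x"
  using ddir_cong[OF assms(1) x, of "axis a 1" f g] ddir_cong[OF assms(1) x, of "axis a \<i>" f g] a assms(2)
  by (simp_all add: pd_def pdbar_def)

lemma wirtinger_add:
  assumes "smooth_in I S f" "smooth_in I S g"
  shows "pd a (\<lambda>y. f y + g y) x = pd a f x + pd a g x" "pdbar a (\<lambda>y. f y + g y) x = pdbar a f x + pdbar a g x"
  using a by (simp_all add: pd_def pdbar_def ddir_add[OF assms x] field_simps)

lemma wirtinger_mult:
  assumes "smooth_in I S f" "smooth_in I S g"
  shows "pd a (\<lambda>y. f y * g y) x = f x * pd a g x + pd a f x * g x"
    "pdbar a (\<lambda>y. f y * g y) x = f x * pdbar a g x + pdbar a f x * g x"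
  using a by (simp_all add: pd_def pdbar_def ddir_mult[OF assms x] field_simps)

lemma wirtinger_sum:
  assumes "copen I S" "\<And>i. i \<in> A \<Longrightarrow> smooth_in I S (f i)"
  shows "pd a (\<lambda>y. \<Sum>i\<in>A. f i y) x = (\<Sum>i\<in>A. pd a (f i) x)"
    "pdbar a (\<lambda>y. \<Sum>i\<in>A. f i y) x = (\<Sum>i\<in>A. pdbar a (f i) x)"
  using a by (simp_all add: pd_def pdbar_def ddir_sum[OF assms(2,1) x] sum_divide_distrib sum_distrib_left
    sum.distrib sum_subtractf diff_divide_distrib add_divide_distrib)

lemma wirtinger_cnj:
  assumes "smooth_in I S f"
  shows "pd a (\<lambda>y. cnj (f y)) x = cnj (pdbar a f x)" "pdbar a (\<lambda>y. cnj (f y)) x = cnj (pd a f x)"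
  using a by (simp_all add: pd_def pdbar_def ddir_bounded_linear[OF bounded_linear_cnj assms x])

lemma wirtinger_ln:
  assumes "smooth_in I S f" "\<And>x. x \<in> S \<Longrightarrow> f x > (0::real)"
  shows "pd a (\<lambda>y. complex_of_real (ln (f y))) x = pd a (\<lambda>y. of_real (f y)) x / of_real (f x)"
    "pdbar a (\<lambda>y. complex_of_real (ln (f y))) x = pdbar a (\<lambda>y. of_real (f y)) x / of_real (f x)"
proof -
  have L: "bounded_linear complex_of_real" by (rule bounded_linear_of_real)
  have "ddir v (\<lambda>y. complex_of_real (ln (f y))) x = ddir v (\<lambda>y. complex_of_real (f y)) x / of_real (f x)"
    if "v \<in> coord_space I" for v
    using ddir_bounded_linear[OF L smooth_ln[OF assms] x that]
      ddir_bounded_linear[OF L assms(1) x that] ddir_ln[OF assms(1) x that assms(2)]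
    by simp
  then show "pd a (\<lambda>y. complex_of_real (ln (f y))) x = pd a (\<lambda>y. of_real (f y)) x / of_real (f x)"
    "pdbar a (\<lambda>y. complex_of_real (ln (f y))) x = pdbar a (\<lambda>y. of_real (f y)) x / of_real (f x)"
    using a by (simp_all add: pd_def pdbar_def diff_divide_distrib add_divide_distrib mult.commute)
qed

end

lemma wirtinger_const [simp]: "pd a (\<lambda>y. c) x = 0" "pdbar a (\<lambda>y. c) x = 0"
  by (simp_all add: pd_def pdbar_def ddir_const)

lemma wirtinger_nth:
  "pd a (\<lambda>y. y $ b) x = (if a = b then 1 else 0)" "pdbar a (\<lambda>y. y $ b) x = 0"
  by (simp_all add: pd_def pdbar_def ddir_linear_fun[OF bounded_linear_vec_nth] axis_def)

lemma smooth_divide_const: "smooth_in I S f \<Longrightarrow> smooth_in I S (\<lambda>x. f x / (c::complex))"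
  by (rule smooth_bounded_linear[OF bounded_linear_divide])

lemma smooth_pd:
  assumes "smooth_in I S f" "a \<in> I"
  shows "smooth_in I S (pd a f)" "smooth_in I S (pdbar a f)"
  unfolding pd_def[abs_def] pdbar_def[abs_def]
  by (intro smooth_divide_const smooth_diff smooth_add smooth_mult smooth_const smooth_ddir[OF assms(1)] smooth_open[OF assms(1)]; use assms(2) in simp)+

lemma wirtinger_cmult:
  assumes "smooth_in I S f" "x \<in> S" "a \<in> I"
  shows "pd a (\<lambda>y. c * f y) x = c * pd a f x" "pdbar a (\<lambda>y. c * f y) x = c * pdbar a f x"
  using wirtinger_mult[OF assms(2,3) smooth_const[OF smooth_open[OF assms(1)], of c] assms(1)] by simp_all

lemma ddir_cmult:
  assumes "smooth_in I S f" "x \<in> S" "v \<in> coord_space I"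
  shows "ddir v (\<lambda>y. (c::complex) * f y) x = c * ddir v f x"
  using ddir_mult[OF smooth_const[OF smooth_open[OF assms(1)], of c] assms] by (simp add: ddir_const)

lemma wirtinger_symmetric:
  fixes f :: "complex ^ 'k::finite \<Rightarrow> complex"
  assumes "smooth_in I S f" "x \<in> S" "a \<in> I" "b \<in> I"
  shows "pd a (pd b f) x = pd b (pd a f) x" "pd a (pdbar b f) x = pdbar b (pd a f) x"
proof -
  have d: "ddir u (\<lambda>y. (ddir v f y + \<i> * ddir w f y) / 2) x = (ddir u (ddir v f) x + \<i> * ddir u (ddir w f) x) / 2"
    "ddir u (\<lambda>y. (ddir v f y - \<i> * ddir w f y) / 2) x = (ddir u (ddir v f) x - \<i> * ddir u (ddir w f) x) / 2"
    if "u \<in> coord_space I" "v \<in> coord_space I" "w \<in> coord_space I" for u v w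
  proof -
    have s: "smooth_in I S (\<lambda>y. \<i> * ddir w f y)" "smooth_in I S (ddir v f)" "smooth_in I S (ddir w f)"
      using smooth_ddir[OF assms(1)] that by (auto intro!: smooth_mult smooth_const smooth_open[OF assms(1)])
    show "ddir u (\<lambda>y. (ddir v f y + \<i> * ddir w f y) / 2) x = (ddir u (ddir v f) x + \<i> * ddir u (ddir w f) x) / 2"
      using ddir_bounded_linear[OF bounded_linear_divide[of 2] smooth_add[OF s(2,1)] assms(2) that(1)]
        ddir_add[OF s(2,1) assms(2) that(1)] ddir_cmult[OF s(3) assms(2) that(1)] by simp
    show "ddir u (\<lambda>y. (ddir v f y - \<i> * ddir w f y) / 2) x = (ddir u (ddir v f) x - \<i> * ddir u (ddir w f) x) / 2"
      using ddir_bounded_linear[OF bounded_linear_divide[of 2] smooth_diff[OF s(2,1)] assms(2) that(1)]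
        ddir_diff[OF s(2,1) assms(2) that(1)] ddir_cmult[OF s(3) assms(2) that(1)] by simp
  qed
  have pdeq: "pd c f = (\<lambda>y. (ddir (axis c 1) f y - \<i> * ddir (axis c \<i>) f y) / 2)"
     "pdbar c f = (\<lambda>y. (ddir (axis c 1) f y + \<i> * ddir (axis c \<i>) f y) / 2)" for c :: 'k
    by (auto simp: pd_def pdbar_def)
  have ax: "axis c u \<in> coord_space I" if "c \<in> I" for c and u :: complex using that by simp
  have A: "pd a (pd b f) x = ((ddir (axis a 1) (ddir (axis b 1) f) x - \<i> * ddir (axis a 1) (ddir (axis b \<i>) f) x)
     - \<i> * (ddir (axis a \<i>) (ddir (axis b 1) f) x - \<i> * ddir (axis a \<i>) (ddir (axis b \<i>) f) x)) / 4"
     "pd a (pdbar b f) x = ((ddir (axis a 1) (ddir (axis b 1) f) x + \<i> * ddir (axis a 1) (ddir (axis b \<i>) f) x)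
     - \<i> * (ddir (axis a \<i>) (ddir (axis b 1) f) x + \<i> * ddir (axis a \<i>) (ddir (axis b \<i>) f) x)) / 4"
     "pdbar a (pd b f) x = ((ddir (axis a 1) (ddir (axis b 1) f) x - \<i> * ddir (axis a 1) (ddir (axis b \<i>) f) x)
     + \<i> * (ddir (axis a \<i>) (ddir (axis b 1) f) x - \<i> * ddir (axis a \<i>) (ddir (axis b \<i>) f) x)) / 4"
    if "a \<in> I" "b \<in> I" for a b
    unfolding pd_def[of a] pdbar_def[of a] pdeq[of b]
      d[OF ax[OF that(1)] ax[OF that(2)] ax[OF that(2)]]
    by (simp_all add: field_simps)
  show "pd a (pd b f) x = pd b (pd a f) x" "pd a (pdbar b f) x = pdbar b (pd a f) x"
    unfolding A[OF assms(3,4)] A[OF assms(4,3)] ddir_symmetric[OF assms(1,2) ax[OF assms(3), of 1] ax[OF assms(4), of 1]]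
      ddir_symmetric[OF assms(1,2) ax[OF assms(3), of 1] ax[OF assms(4), of \<i>]]
      ddir_symmetric[OF assms(1,2) ax[OF assms(3), of \<i>] ax[OF assms(4), of 1]]
      ddir_symmetric[OF assms(1,2) ax[OF assms(3), of \<i>] ax[OF assms(4), of \<i>]]
    by (simp_all add: algebra_simps)
qed

section \<open>Holomorphic functions\<close>

text \<open>\<open>holo_fun\<close> with smoothness in the Frechet form, for which the chain rule is available.\<close>

definition hol :: "'k::finite set \<Rightarrow> (complex ^ 'k) set \<Rightarrow> (complex ^ 'k \<Rightarrow> complex) \<Rightarrow> bool" where
  "hol I S f \<longleftrightarrow> smooth_in I S f \<and> (\<forall>x\<in>S. \<forall>a\<in>I. pdbar a f x = 0)"

lemma hol_smooth: "hol I S f \<Longrightarrow> smooth_in I S f" by (simp add: hol_def)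

lemma holo_fun_hol: "copen I S \<Longrightarrow> holo_fun I S f \<longleftrightarrow> hol I S f"
  unfolding holo_fun_def hol_def using smooth_in_imp_smooth_fun smooth_fun_imp_smooth_in by blast

lemma hol_pdbar: "hol I S f \<Longrightarrow> x \<in> S \<Longrightarrow> a \<in> I \<Longrightarrow> pdbar a f x = 0"
  by (simp add: hol_def)

lemma hol_ddir:
  assumes "hol I S f" "x \<in> S" "v \<in> coord_space I"
  shows "ddir v f x = (\<Sum>a\<in>I. v $ a * pd a f x)"
  unfolding ddir_wirtinger[OF hol_smooth[OF assms(1)] assms(2,3)]
  by (rule sum.cong) (use hol_pdbar[OF assms(1,2)] in auto)

lemma hol_ddir_smult:
  assumes "hol I S f" "x \<in> S" "v \<in> coord_space I"
  shows "ddir (c *s v) f x = c * ddir v f x"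
  using hol_ddir[OF assms(1,2)] assms(3) by (simp add: coord_space_smult sum_distrib_left mult.assoc)

lemma holI:
  assumes "smooth_in I S f" "\<And>x a. x \<in> S \<Longrightarrow> a \<in> I \<Longrightarrow> ddir (axis a \<i>) f x = \<i> * ddir (axis a 1) f x"
  shows "hol I S f"
  using assms by (simp add: hol_def pdbar_def)

lemma hol_ddir_axis:
  assumes "hol I S f" "x \<in> S" "a \<in> I"
  shows "ddir (axis a 1) f x = pd a f x" "ddir (axis a \<i>) f x = \<i> * pd a f x"
  using hol_pdbar[OF assms] by (simp_all add: ddir_axis_wirtinger)

lemma hol_cong:
  assumes "hol I S f" "\<And>x. x \<in> S \<Longrightarrow> f x = g x"
  shows "hol I S g"
  unfolding hol_def
proof (intro conjI ballI)
  show "smooth_in I S g" by (rule smooth_cong[OF hol_smooth[OF assms(1)] assms(2)])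
  show "pdbar a g x = 0" if "x \<in> S" "a \<in> I" for x a
    using wirtinger_cong(2)[OF that smooth_open[OF hol_smooth[OF assms(1)]] assms(2)] hol_pdbar[OF assms(1) that] by simp
qed

lemma hol_subset: "hol I S f \<Longrightarrow> copen I T \<Longrightarrow> T \<subseteq> S \<Longrightarrow> hol I T f"
  unfolding hol_def using smooth_subset by blast

lemma hol_const: "copen I S \<Longrightarrow> hol I S (\<lambda>x. c)"
  by (simp add: hol_def smooth_const)

lemma hol_nth: "copen I S \<Longrightarrow> hol I S (\<lambda>x. x $ b)"
  by (simp add: hol_def smooth_nth wirtinger_nth)

lemma hol_add: "hol I S f \<Longrightarrow> hol I S g \<Longrightarrow> hol I S (\<lambda>x. f x + g x)"
  by (auto simp: hol_def smooth_add wirtinger_add)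

lemma hol_mult: "hol I S f \<Longrightarrow> hol I S g \<Longrightarrow> hol I S (\<lambda>x. f x * g x)"
  by (auto simp: hol_def smooth_mult wirtinger_mult)

lemma hol_sum: "copen I S \<Longrightarrow> (\<And>i. i \<in> A \<Longrightarrow> hol I S (f i)) \<Longrightarrow> hol I S (\<lambda>x. \<Sum>i\<in>A. f i x)"
  by (induction A rule: infinite_finite_induct) (auto intro: hol_const hol_add)

lemma hol_prod: "copen I S \<Longrightarrow> (\<And>i. i \<in> A \<Longrightarrow> hol I S (f i)) \<Longrightarrow> hol I S (\<lambda>x. \<Prod>i\<in>A. f i x)"
  by (induction A rule: infinite_finite_induct) (auto intro: hol_const hol_mult)

lemma hol_field:
  assumes "hol I S f" "smooth_in I S (\<lambda>x. F (f x))"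
    "\<And>x. x \<in> S \<Longrightarrow> (F has_field_derivative F' (f x)) (at (f x))"
  shows "hol I S (\<lambda>x. F (f x))"
proof (rule holI[OF assms(2)])
  fix x a assume x: "x \<in> S" and a: "a \<in> I"
  have xs: "x \<in> coord_space I" using copen_subset smooth_open assms(2) x by blast
  have "((\<lambda>y. F (f (cproj I y))) has_derivative (\<lambda>v. F' (f x) * ddir (cproj I v) f x)) (at x)"
    by (rule has_derivative_compose[OF smooth_ddir_derivative[OF hol_smooth[OF assms(1)] x]])
      (use assms(3)[OF x] xs in \<open>simp add: has_field_derivative_def cproj_id\<close>)
  from ddir_eqI[OF xs _ this] have "v \<in> coord_space I \<Longrightarrow> ddir v (\<lambda>x. F (f x)) x = F' (f x) * ddir v f x" for v
    by (simp add: cproj_id)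
  then show "ddir (axis a \<i>) (\<lambda>x. F (f x)) x = \<i> * ddir (axis a 1) (\<lambda>x. F (f x)) x"
    using a hol_ddir_axis[OF assms(1) x a] by simp
qed

lemma hol_inverse: "hol I S f \<Longrightarrow> (\<And>x. x \<in> S \<Longrightarrow> f x \<noteq> 0) \<Longrightarrow> hol I S (\<lambda>x. inverse (f x))"
  by (rule hol_field[where F = inverse and F' = "\<lambda>z. - (inverse z * inverse z)", OF _ smooth_inverse])
    (auto intro: hol_smooth intro!: derivative_eq_intros simp: power2_eq_square)

lemma hol_exp: "hol I S f \<Longrightarrow> hol I S (\<lambda>x. exp (f x))"
  by (rule hol_field[where F = exp and F' = exp, OF _ smooth_exp]) (auto intro: hol_smooth DERIV_exp)

lemma hol_Ln: "hol I S f \<Longrightarrow> (\<And>x. x \<in> S \<Longrightarrow> f x \<notin> \<real>\<^sub>\<le>\<^sub>0) \<Longrightarrow> hol I S (\<lambda>x. Ln (f x))"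
  by (rule hol_field[where F = Ln and F' = inverse, OF _ smooth_Ln]) (auto intro: hol_smooth has_field_derivative_Ln)

lemma hol_vec_ddir:
  fixes g :: "complex ^ 'k::finite \<Rightarrow> complex ^ 'l::finite"
  assumes "\<And>j. hol I S (\<lambda>x. g x $ j)" "x \<in> S" "a \<in> I"
  shows "ddir (axis a 1) g x = (\<chi> c. pd a (\<lambda>y. g y $ c) x)" "ddir (axis a \<i>) g x = \<i> *s (\<chi> c. pd a (\<lambda>y. g y $ c) x)"
proof -
  have s: "smooth_in I S g" using assms(1) hol_smooth smooth_vec by blast
  have "ddir v g x $ c = ddir v (\<lambda>y. g y $ c) x" if "v \<in> coord_space I" for v c
    using ddir_bounded_linear[OF bounded_linear_vec_nth s assms(2) that] by simp
  then show "ddir (axis a 1) g x = (\<chi> c. pd a (\<lambda>y. g y $ c) x)" "ddir (axis a \<i>) g x = \<i> *s (\<chi> c. pd a (\<lambda>y. g y $ c) x)"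
    using hol_ddir_axis[OF assms(1,2,3)] assms(3) by (simp_all add: vec_eq_iff)
qed

lemma hol_vec_ddir_smult:
  fixes g :: "complex ^ 'k::finite \<Rightarrow> complex ^ 'l::finite"
  assumes "\<And>j. hol I S (\<lambda>x. g x $ j)" "x \<in> S" "v \<in> coord_space I"
  shows "ddir (c *s v) g x = c *s ddir v g x"
proof -
  have s: "smooth_in I S g" using assms(1) hol_smooth smooth_vec by blast
  have "ddir v g x $ c = ddir v (\<lambda>y. g y $ c) x" if "v \<in> coord_space I" for v c
    using ddir_bounded_linear[OF bounded_linear_vec_nth s assms(2) that] by simp
  then show ?thesis using hol_ddir_smult[OF assms(1,2,3)] assms(3) by (simp add: vec_eq_iff coord_space_smult)
qed

lemma wirtinger_compose:
  fixes g :: "complex ^ 'k::finite \<Rightarrow> complex ^ 'l::finite"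
  assumes "\<And>j. hol I S (\<lambda>x. g x $ j)" "smooth_in J T f" "\<And>x. x \<in> S \<Longrightarrow> g x \<in> T" "x \<in> S" "a \<in> I"
  shows "pd a (\<lambda>y. f (g y)) x = (\<Sum>c\<in>J. pd a (\<lambda>y. g y $ c) x * pd c f (g x))"
    "pdbar a (\<lambda>y. f (g y)) x = (\<Sum>c\<in>J. cnj (pd a (\<lambda>y. g y $ c) x) * pdbar c f (g x))"
proof -
  have s: "smooth_in I S g" using assms(1) hol_smooth smooth_vec by blast
  define w where "w = (\<chi> c. pd a (\<lambda>y. g y $ c) x)"
  have gJ: "g y \<in> coord_space J" if "y \<in> S" for y using assms(3)[OF that] copen_subset[OF smooth_open[OF assms(2)]] by blast
  have w: "w \<in> coord_space J"
    using ddir_coord_space[OF s assms(4) _ gJ, of "axis a 1"] hol_vec_ddir(1)[OF assms(1,4,5)] assms(5) by (simp add: w_def)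
  have 1: "ddir (axis a 1) (\<lambda>y. f (g y)) x = (\<Sum>c\<in>J. w $ c * pd c f (g x) + cnj (w $ c) * pdbar c f (g x))"
    using ddir_compose[OF s assms(2,3,4), of "axis a 1"] hol_vec_ddir(1)[OF assms(1,4,5)] assms(5)
      ddir_wirtinger[OF assms(2) assms(3)[OF assms(4)] w] by (simp add: w_def)
  have 2: "ddir (axis a \<i>) (\<lambda>y. f (g y)) x = (\<Sum>c\<in>J. \<i> * (w $ c * pd c f (g x)) - \<i> * (cnj (w $ c) * pdbar c f (g x)))"
    using ddir_compose[OF s assms(2,3,4), of "axis a \<i>"] hol_vec_ddir(2)[OF assms(1,4,5)] assms(5)
      ddir_wirtinger[OF assms(2) assms(3)[OF assms(4)] coord_space_smult[OF w, of \<i>]] by (simp add: w_def mult.assoc)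
  show "pd a (\<lambda>y. f (g y)) x = (\<Sum>c\<in>J. pd a (\<lambda>y. g y $ c) x * pd c f (g x))"
    "pdbar a (\<lambda>y. f (g y)) x = (\<Sum>c\<in>J. cnj (pd a (\<lambda>y. g y $ c) x) * pdbar c f (g x))"
    unfolding pd_def[of a "\<lambda>y. f (g y)"] pdbar_def[of a "\<lambda>y. f (g y)"] 1 2
    by (simp_all add: w_def sum.distrib sum_subtractf sum_distrib_left[symmetric] algebra_simps)
qed

lemma hol_compose:
  fixes g :: "complex ^ 'k::finite \<Rightarrow> complex ^ 'l::finite"
  assumes "\<And>j. hol I S (\<lambda>x. g x $ j)" "hol J T f" "\<And>x. x \<in> S \<Longrightarrow> g x \<in> T"
  shows "hol I S (\<lambda>x. f (g x))"
  unfolding hol_def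
proof (intro conjI ballI)
  show "smooth_in I S (\<lambda>x. f (g x))"
    by (rule smooth_compose[OF _ hol_smooth[OF assms(2)] assms(3)]) (use assms(1) hol_smooth smooth_vec in blast)
  show "pdbar a (\<lambda>x. f (g x)) x = 0" if "x \<in> S" "a \<in> I" for x a
    using wirtinger_compose(2)[OF assms(1) hol_smooth[OF assms(2)] assms(3) that] hol_pdbar[OF assms(2) assms(3)[OF that(1)]]
    by simp
qed

lemma hol_pd:
  assumes "hol I S f" "b \<in> I"
  shows "hol I S (pd b f)"
  unfolding hol_def
proof (intro conjI ballI)
  show "smooth_in I S (pd b f)" using smooth_pd hol_smooth assms by blast
  fix x a assume "x \<in> S" "a \<in> I"
  have "pdbar a (pd b f) x = pd b (pdbar a f) x"
    using wirtinger_symmetric(2)[OF hol_smooth[OF assms(1)] \<open>x \<in> S\<close> assms(2) \<open>a \<in> I\<close>] by simp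
  also have "\<dots> = pd b (\<lambda>y. 0) x"
    by (rule wirtinger_cong(1)[OF \<open>x \<in> S\<close> assms(2) smooth_open[OF hol_smooth[OF assms(1)]]])
      (use hol_pdbar[OF assms(1)] \<open>a \<in> I\<close> in auto)
  finally show "pdbar a (pd b f) x = 0" by simp
qed

text \<open>For holomorphic \<open>g\<close>, the antiholomorphic derivatives of \<open>log \<bar>g\<bar>\<^sup>2\<close> are the conjugates of the holomorphic
  functions \<open>(\<partial>g/\<partial>x\<^sub>b) / g\<close>.\<close>

lemma pluriharmonic_log_norm:
  assumes "hol I S g" "\<And>x. x \<in> S \<Longrightarrow> g x \<noteq> 0" "x \<in> S"
  shows "ddbar I (\<lambda>y. ln ((cmod (g y))\<^sup>2)) x a b = 0"
proof (cases "a \<in> I \<and> b \<in> I")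
  case True
  note o = smooth_open[OF hol_smooth[OF assms(1)]]
  note s = hol_smooth[OF assms(1)]
  define h where "h y = pd b g y * inverse (g y)" for y
  have h: "hol I S h" unfolding h_def using True assms by (intro hol_mult hol_pd hol_inverse) auto
  have sq: "(\<lambda>y. complex_of_real ((cmod (g y))\<^sup>2)) = (\<lambda>y. g y * cnj (g y))"
    by (simp only: complex_norm_square)
  have sq2: "(\<lambda>y. (cmod (g y))\<^sup>2) = (\<lambda>y. Re (g y * cnj (g y)))"
    by (auto simp: complex_mult_cnj cmod_power2)
  have sq_smooth: "smooth_in I S (\<lambda>y. (cmod (g y))\<^sup>2)" unfolding sq2 by (intro smooth_Re smooth_mult smooth_cnj s)
  have "pdbar b (\<lambda>y. complex_of_real (ln ((cmod (g y))\<^sup>2))) y = cnj (h y)" if y: "y \<in> S" for y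
  proof -
    have "b \<in> I" using True by blast
    have pos: "(cmod (g z))\<^sup>2 > 0" if "z \<in> S" for z using assms(2)[OF that] by simp
    have "pdbar b (\<lambda>y. complex_of_real ((cmod (g y))\<^sup>2)) y = g y * cnj (pd b g y)"
      unfolding sq wirtinger_mult(2)[OF y \<open>b \<in> I\<close> s smooth_cnj[OF s]] wirtinger_cnj(2)[OF y \<open>b \<in> I\<close> s]
        hol_pdbar[OF assms(1) y \<open>b \<in> I\<close>] by simp
    moreover have "complex_of_real ((cmod (g y))\<^sup>2) = g y * cnj (g y)" by (simp only: complex_norm_square)
    ultimately show ?thesis
      using wirtinger_ln(2)[OF y \<open>b \<in> I\<close> sq_smooth pos] assms(2)[OF y] by (simp add: h_def divide_inverse)
  qed
  note * = this
  have "pd a (pdbar b (\<lambda>y. complex_of_real (ln ((cmod (g y))\<^sup>2)))) x = pd a (\<lambda>y. cnj (h y)) x"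
    by (rule wirtinger_cong(1)[OF assms(3) _ o]) (use True * in auto)
  also have "\<dots> = 0" using wirtinger_cnj(1)[OF assms(3) _ hol_smooth[OF h], of a] True hol_pdbar[OF h assms(3)] by simp
  finally show ?thesis using True by (simp add: ddbar_def)
qed (auto simp: ddbar_def)

section \<open>Determinants over index sets\<close>

text \<open>Extending by the identity matrix transfers the theory of \<open>det\<close> to \<open>det_on\<close>.\<close>

definition mat_on :: "'k::finite set \<Rightarrow> ('k \<Rightarrow> 'k \<Rightarrow> complex) \<Rightarrow> complex ^ 'k ^ 'k" where
  "mat_on I h = (\<chi> a b. if a \<in> I \<and> b \<in> I then h a b else if a = b then 1 else 0)"

lemma det_mat_on: "det (mat_on I h) = det_on I h"
proof -
  have "det (mat_on I h) = (\<Sum>p\<in>{p. p permutes UNIV}. of_int (sign p) * (\<Prod>a\<in>UNIV. mat_on I h $ a $ p a))"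
    by (simp add: det_def)
  also have "\<dots> = (\<Sum>p\<in>{p. p permutes I}. of_int (sign p) * (\<Prod>a\<in>UNIV. mat_on I h $ a $ p a))"
  proof (rule sum.mono_neutral_right)
    show "{p. p permutes I} \<subseteq> {p. p permutes UNIV}" using permutes_subset[of _ I UNIV] by auto
    show "\<forall>p\<in>{p. p permutes UNIV} - {p. p permutes I}. of_int (sign p) * (\<Prod>a\<in>UNIV. mat_on I h $ a $ p a) = 0"
    proof
      fix p assume p: "p \<in> {p. p permutes UNIV} - {p. p permutes I}"
      then obtain a where a: "a \<notin> I" "p a \<noteq> a" using permutes_superset[of p UNIV I] by blast
      then have "mat_on I h $ a $ p a = 0" by (auto simp: mat_on_def)
      then show "of_int (sign p) * (\<Prod>a\<in>UNIV. mat_on I h $ a $ p a) = 0"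
        by (auto intro!: prod_zero bexI[of _ a])
    qed
  qed simp
  also have "\<dots> = det_on I h"
    unfolding det_on_def
  proof (rule sum.cong[OF refl])
    fix p assume p: "p \<in> {p. p permutes I}"
    have "(\<Prod>a\<in>UNIV. mat_on I h $ a $ p a) = (\<Prod>a\<in>I. mat_on I h $ a $ p a)"
      by (rule prod.mono_neutral_right) (use p in \<open>auto simp: mat_on_def permutes_not_in\<close>)
    also have "\<dots> = (\<Prod>a\<in>I. h a (p a))"
      by (rule prod.cong) (use p in \<open>auto simp: mat_on_def permutes_in_image\<close>)
    finally show "of_int (sign p) * (\<Prod>a\<in>UNIV. mat_on I h $ a $ p a) = of_int (sign p) * (\<Prod>a\<in>I. h a (p a))"
      by simp
  qed
  finally show ?thesis .
qed

lemma det_on_cong: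
  assumes "\<And>a b. a \<in> I \<Longrightarrow> b \<in> I \<Longrightarrow> h a b = h' a b"
  shows "det_on I h = det_on I h'"
  unfolding det_on_def
  by (intro sum.cong prod.cong arg_cong2[where f = "(*)"]) (use assms in \<open>auto simp: permutes_in_image\<close>)

lemma det_on_reindex:
  fixes f :: "'s \<Rightarrow> 'k::finite"
  assumes "inj_on f S" "finite S"
  shows "det_on (f ` S) h = (\<Sum>p | p permutes S. of_int (sign p) * (\<Prod>a\<in>S. h (f a) (f (p a))))"
proof -
  have b: "bij_betw f S (f ` S)" using assms by (simp add: bij_betw_imageI)
  have m: "map_permutation S f = (\<lambda>p x. if x \<in> f ` S then f (p (inv_into S f x)) else x)"
    by (auto simp: fun_eq_iff map_permutation_def restrict_id_def)
  have "bij_betw (map_permutation S f) {p. p permutes S} {p. p permutes f ` S}"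
    unfolding m by (rule bij_betw_permutations[OF b])
  then have "det_on (f ` S) h = (\<Sum>p | p permutes S. of_int (sign (map_permutation S f p)) *
      (\<Prod>a\<in>f ` S. h a (map_permutation S f p a)))"
    unfolding det_on_def by (rule sum.reindex_bij_betw[symmetric])
  also have "\<dots> = (\<Sum>p | p permutes S. of_int (sign p) * (\<Prod>a\<in>S. h (f a) (f (p a))))"
  proof (rule sum.cong[OF refl])
    fix p assume "p \<in> {p. p permutes S}"
    then have "sign (map_permutation S f p) = sign p" using sign_map_permutation[OF assms(1) _ assms(2)] by simp
    moreover have "(\<Prod>a\<in>f ` S. h a (map_permutation S f p a)) = (\<Prod>a\<in>S. h (f a) (f (p a)))"
      unfolding prod.reindex[OF assms(1)] by (rule prod.cong) (use assms(1) in \<open>auto simp: map_permutation_apply\<close>)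
    ultimately show "of_int (sign (map_permutation S f p)) * (\<Prod>a\<in>f ` S. h a (map_permutation S f p a))
      = of_int (sign p) * (\<Prod>a\<in>S. h (f a) (f (p a)))" by simp
  qed
  finally show ?thesis .
qed

lemma det_on_image:
  fixes f :: "'s::finite \<Rightarrow> 'k::finite"
  assumes "inj_on f S"
  shows "det_on (f ` S) h = det_on S (\<lambda>a b. h (f a) (f b))"
  using det_on_reindex[OF assms] by (simp add: det_on_def)

lemma det_on_transpose: "det_on I (\<lambda>a b. h b a) = det_on I h"
proof -
  have "mat_on I (\<lambda>a b. h b a) = transpose (mat_on I h)"
    by (auto simp: mat_on_def transpose_def vec_eq_iff)
  from arg_cong[OF this, of det] show ?thesis unfolding det_transpose det_mat_on .
qed

lemma det_on_cnj: "det_on I (\<lambda>a b. cnj (h a b)) = cnj (det_on I h)"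
  by (simp add: det_on_def)

lemma det_on_mult: "det_on I (\<lambda>a b. \<Sum>c\<in>I. A a c * B c b) = det_on I A * det_on I B"
proof -
  have "mat_on I (\<lambda>a b. \<Sum>c\<in>I. A a c * B c b) $ a $ b = (mat_on I A ** mat_on I B) $ a $ b" for a b
  proof -
    have "(\<Sum>c\<in>UNIV. mat_on I A $ a $ c * mat_on I B $ c $ b)
      = (\<Sum>c\<in>I. mat_on I A $ a $ c * mat_on I B $ c $ b) + (\<Sum>c\<in>-I. mat_on I A $ a $ c * mat_on I B $ c $ b)"
      using sum.union_disjoint[of I "- I" "\<lambda>c. mat_on I A $ a $ c * mat_on I B $ c $ b"] by simp
    also have "(\<Sum>c\<in>I. mat_on I A $ a $ c * mat_on I B $ c $ b)
       = (if a \<in> I \<and> b \<in> I then \<Sum>c\<in>I. A a c * B c b else 0)"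
      by (auto simp: mat_on_def intro!: sum.cong sum.neutral)
    also have "(\<Sum>c\<in>-I. mat_on I A $ a $ c * mat_on I B $ c $ b) = (\<Sum>c\<in>-I. if c = a then (if a = b then 1 else 0) else 0)"
      by (rule sum.cong) (auto simp: mat_on_def)
    also have "\<dots> = (if a \<notin> I \<and> a = b then 1 else 0)" by auto
    finally show ?thesis by (auto simp: matrix_matrix_mult_def mat_on_def)
  qed
  then have "mat_on I (\<lambda>a b. \<Sum>c\<in>I. A a c * B c b) = mat_on I A ** mat_on I B" by (simp add: vec_eq_iff)
  from arg_cong[OF this, of det] show ?thesis unfolding det_mul det_mat_on .
qed

lemma det_on_block:
  assumes "N \<inter> K = {}" "\<And>a b. a \<in> N \<Longrightarrow> b \<in> K \<Longrightarrow> h a b = 0" "\<And>a b. a \<in> K \<Longrightarrow> b \<in> N \<Longrightarrow> h a b = 0"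
  shows "det_on (N \<union> K) h = det_on N h * det_on K h"
proof -
  let ?I = "N \<union> K"
  let ?A = "\<lambda>a b. if a \<in> N \<and> b \<in> N then h a b else if a = b then 1 else 0"
  let ?B = "\<lambda>a b. if a \<in> K \<and> b \<in> K then h a b else if a = b then 1 else 0"
  have "det_on ?I h = det_on ?I (\<lambda>a b. \<Sum>c\<in>?I. ?A a c * ?B c b)"
  proof (rule det_on_cong)
    fix a b assume ab: "a \<in> ?I" "b \<in> ?I"
    show "h a b = (\<Sum>c\<in>?I. ?A a c * ?B c b)"
    proof (cases "a \<in> N")
      case True
      have "(\<Sum>c\<in>?I. ?A a c * ?B c b) = (\<Sum>c\<in>?I. if c = b then h a b else 0)"
        by (rule sum.cong) (use True assms ab in auto)
      then show ?thesis using ab by simp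
    next
      case False
      have "(\<Sum>c\<in>?I. ?A a c * ?B c b) = (\<Sum>c\<in>?I. if c = a then h a b else 0)"
        by (rule sum.cong) (use False assms ab in auto)
      then show ?thesis using ab by simp
    qed
  qed
  also have "\<dots> = det_on ?I ?A * det_on ?I ?B" by (rule det_on_mult)
  also have "det_on ?I ?A = det_on N h"
  proof -
    have "mat_on ?I ?A = mat_on N h" by (auto simp: mat_on_def vec_eq_iff)
    from arg_cong[OF this, of det] show ?thesis unfolding det_mat_on .
  qed
  also have "det_on ?I ?B = det_on K h"
  proof -
    have "mat_on ?I ?B = mat_on K h" by (auto simp: mat_on_def vec_eq_iff)
    from arg_cong[OF this, of det] show ?thesis unfolding det_mat_on .
  qed
  finally show ?thesis .
qed

lemma det_on_unipotent:
  assumes "N \<inter> K = {}"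
  shows "det_on (N \<union> K) (\<lambda>a b. (if a = b then 1 else 0) + (if a \<in> K \<and> b \<in> N then m a b else 0)) = 1"
    (is "det_on ?I ?L = 1")
proof -
  have "(\<Prod>a\<in>?I. ?L a (p a)) = 0" if p: "p permutes ?I" "p \<noteq> id" for p
  proof (rule ccontr)
    assume nz: "(\<Prod>a\<in>?I. ?L a (p a)) \<noteq> 0"
    then have L: "?L a (p a) \<noteq> 0" if "a \<in> ?I" for a using that by simp
    have N: "p a = a" if "a \<in> N" for a using L[of a] that assms by (auto split: if_splits)
    have "p a = a" if "a \<in> K" for a
    proof (rule ccontr)
      assume ne: "p a \<noteq> a"
      then have "p a \<in> N" using L[of a] that by (auto split: if_splits)
      then have "p (p a) = p a" using N by blast
      then show False using ne permutes_inj[OF p(1)] by (auto dest: injD)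
    qed
    then have "p a = a" for a using N permutes_not_in[OF p(1)] by blast
    then show False using p(2) by auto
  qed
  then have "det_on ?I ?L = (\<Sum>p | p permutes ?I. if p = id then 1 else 0)"
    unfolding det_on_def by (intro sum.cong refl) (use assms in \<open>auto simp: disjoint_iff intro!: prod.neutral\<close>)
  then show ?thesis by (simp add: permutes_id)
qed

text \<open>Block elimination: for a Hermitian matrix, \<open>m\<close> with \<open>h\<^sub>K\<^sub>N + m h\<^sub>N\<^sub>N = 0\<close> eliminates the off-diagonal
  blocks, and the Schur complement is \<open>h\<^sub>K\<^sub>K + m h\<^sub>N\<^sub>K\<close>.\<close>

lemma det_on_schur:
  assumes NK: "N \<inter> K = {}"
    and herm: "\<And>a b. a \<in> N \<union> K \<Longrightarrow> b \<in> N \<union> K \<Longrightarrow> h b a = cnj (h a b)"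
    and m: "\<And>a j. a \<in> K \<Longrightarrow> j \<in> N \<Longrightarrow> h a j + (\<Sum>k\<in>N. m a k * h k j) = 0"
  shows "det_on (N \<union> K) h = det_on N h * det_on K (\<lambda>a b. h a b + (\<Sum>k\<in>N. m a k * h k b))"
proof -
  let ?I = "N \<union> K"
  let ?L = "\<lambda>a b. (if a = b then 1 else 0) + (if a \<in> K \<and> b \<in> N then m a b else 0)"
  let ?S = "\<lambda>a b. h a b + (\<Sum>k\<in>N. m a k * h k b)"
  define X where "X a b = (\<Sum>c\<in>?I. ?L a c * h c b)" for a b
  define Y where "Y a b = (\<Sum>c\<in>?I. X a c * cnj (?L b c))" for a b
  have split: "(\<Sum>c\<in>?I. g c) = (\<Sum>c\<in>N. g c) + (\<Sum>c\<in>K. g c)" for g :: "'a \<Rightarrow> complex"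
    using NK by (simp add: sum.union_disjoint)
  have XN: "X a b = h a b" if "a \<in> N" for a b
  proof -
    have "X a b = (\<Sum>c\<in>?I. if c = a then h a b else 0)"
      unfolding X_def by (rule sum.cong) (use that NK in auto)
    then show ?thesis using that by simp
  qed
  have XK: "X a b = ?S a b" if "a \<in> K" for a b
  proof -
    have "(\<Sum>c\<in>N. ?L a c * h c b) = (\<Sum>c\<in>N. m a c * h c b)"
      by (rule sum.cong) (use that NK in auto)
    moreover have "(\<Sum>c\<in>K. ?L a c * h c b) = (\<Sum>c\<in>K. if c = a then h a b else 0)"
      by (rule sum.cong) (use that NK in auto)
    ultimately show ?thesis using that by (simp add: X_def split)
  qed
  have YN: "Y a b = X a b" if "b \<in> N" for a b
  proof -
    have "Y a b = (\<Sum>c\<in>?I. if c = b then X a b else 0)"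
      unfolding Y_def by (rule sum.cong) (use that NK in auto)
    then show ?thesis using that by simp
  qed
  have YK: "Y a b = X a b + (\<Sum>k\<in>N. X a k * cnj (m b k))" if "b \<in> K" for a b
  proof -
    have "(\<Sum>c\<in>N. X a c * cnj (?L b c)) = (\<Sum>c\<in>N. X a c * cnj (m b c))"
      by (rule sum.cong) (use that NK in auto)
    moreover have "(\<Sum>c\<in>K. X a c * cnj (?L b c)) = (\<Sum>c\<in>K. if c = b then X a b else 0)"
      by (rule sum.cong) (use that NK in auto)
    ultimately show ?thesis using that by (simp add: Y_def split)
  qed
  have 1: "Y a b = h a b" if "a \<in> N" "b \<in> N" for a b using that by (simp add: YN XN)
  have 2: "Y a b = 0" if "a \<in> N" "b \<in> K" for a b
  proof -
    have "Y a b = h a b + (\<Sum>k\<in>N. h a k * cnj (m b k))" using that by (simp add: YK XN)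
    also have "\<dots> = cnj (h b a + (\<Sum>k\<in>N. m b k * h k a))"
    proof -
      have "(\<Sum>k\<in>N. h a k * cnj (m b k)) = (\<Sum>k\<in>N. cnj (m b k * h k a))"
      proof (rule sum.cong[OF refl])
        fix k assume "k \<in> N"
        then have "h a k = cnj (h k a)" using herm[of k a] that by blast
        then show "h a k * cnj (m b k) = cnj (m b k * h k a)" by simp
      qed
      moreover have "h a b = cnj (h b a)" using herm[of b a] that by blast
      ultimately show ?thesis by simp
    qed
    finally show ?thesis using m[OF that(2,1)] by simp
  qed
  have 3: "Y a b = 0" if "a \<in> K" "b \<in> N" for a b using m[OF that] that by (simp add: YN XK)
  have 4: "Y a b = ?S a b" if "a \<in> K" "b \<in> K" for a b
    using that m[OF that(1)] by (simp add: YK XK)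
  have "det_on ?I Y = det_on ?I X * det_on ?I (\<lambda>a b. cnj (?L b a))"
    unfolding Y_def by (rule det_on_mult)
  also have "det_on ?I X = det_on ?I ?L * det_on ?I h" unfolding X_def by (rule det_on_mult)
  also have "det_on ?I (\<lambda>a b. cnj (?L b a)) = cnj (det_on ?I ?L)"
    using det_on_transpose[of ?I "\<lambda>a b. cnj (?L a b)"] det_on_cnj[of ?I ?L] by simp
  finally have "det_on ?I Y = det_on ?I h" by (simp only: det_on_unipotent[OF NK]) simp
  moreover have "det_on ?I Y = det_on N Y * det_on K Y" by (rule det_on_block[OF NK 2 3])
  moreover have "det_on N Y = det_on N h" by (rule det_on_cong) (rule 1)
  moreover have "det_on K Y = det_on K ?S" by (rule det_on_cong) (rule 4)
  ultimately show ?thesis by simp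
qed

text \<open>One index \<open>a\<close> is eliminated at a time: the determinant is \<open>h\<^sub>a\<^sub>a > 0\<close> times that of the Schur complement, which is
  again positive definite.\<close>

lemma det_on_positive:
  assumes "finite I"
    and "\<And>a b. a \<in> I \<Longrightarrow> b \<in> I \<Longrightarrow> h b a = cnj (h a b)"
    and "\<And>u. (\<exists>a\<in>I. u a \<noteq> 0) \<Longrightarrow> 0 < Re (\<Sum>a\<in>I. \<Sum>b\<in>I. h a b * u a * cnj (u b))"
  shows "Im (det_on I h) = 0 \<and> 0 < Re (det_on I h)"
  using assms
proof (induction I arbitrary: h rule: finite_induct)
  case empty
  show ?case by (simp add: det_on_def)
next
  case (insert a K)
  note herm = insert.prems(1) and pos = insert.prems(2)
  have ins: "insert a K = {a} \<union> K" by simp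
  have disj: "{a} \<inter> K = {}" using insert.hyps by simp
  have "Im (h a a) = 0" using arg_cong[OF herm[of a a], of Im] by simp
  moreover have "0 < Re (h a a)"
  proof -
    have "0 < Re (\<Sum>b\<in>insert a K. \<Sum>c\<in>insert a K. h b c * (if b = a then 1 else 0) * cnj (if c = a then 1 else 0))"
      by (rule pos) (auto intro!: bexI[of _ a])
    moreover have "(\<Sum>b\<in>insert a K. \<Sum>c\<in>insert a K. h b c * (if b = a then 1 else 0) * cnj (if c = a then 1 else 0)) = h a a"
    proof -
      have "(\<Sum>c\<in>insert a K. h b c * (if b = a then 1 else 0) * cnj (if c = a then 1 else 0))
        = (\<Sum>c\<in>insert a K. if c = a then (if b = a then h a a else 0) else 0)" for b
        by (rule sum.cong) auto
      then show ?thesis using insert.hyps by (simp del: sum.insert)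
    qed
    ultimately show ?thesis by simp
  qed
  ultimately obtain r where r: "h a a = of_real r" "r > 0"
    using that[of "Re (h a a)"] by (simp add: complex_eq_iff)
  define m where "m b c = - h b a / h a a" for b c :: 'a
  define S where "S b c = h b c + (\<Sum>k\<in>{a}. m b k * h k c)" for b c
  have d: "det_on (insert a K) h = det_on {a} h * det_on K S"
    unfolding ins S_def
  proof (rule det_on_schur[OF disj])
    show "h c b = cnj (h b c)" if "b \<in> {a} \<union> K" "c \<in> {a} \<union> K" for b c
      using herm[of b c] that by blast
    show "h b j + (\<Sum>k\<in>{a}. m b k * h k j) = 0" if "b \<in> K" "j \<in> {a}" for b j
      using that r by (simp add: m_def)
  qed
  have S: "S b c = h b c - h b a * h a c / h a a" for b c by (simp add: S_def m_def)
  have "Im (det_on K S) = 0 \<and> 0 < Re (det_on K S)"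
  proof (rule insert.IH)
    fix b c assume bc: "b \<in> K" "c \<in> K"
    show "S c b = cnj (S b c)" 
    proof -
      have "h c b = cnj (h b c)" "h c a = cnj (h a c)" "h a b = cnj (h b a)"
        using herm[of b c] herm[of a c] herm[of b a] bc by blast+
      then show ?thesis unfolding S using r(1) by simp
    qed
  next
    fix u :: "'a \<Rightarrow> complex" assume u: "\<exists>b\<in>K. u b \<noteq> 0"
    define w where "w = (\<Sum>b\<in>K. h b a * u b)"
    have cw: "(\<Sum>c\<in>K. h a c * cnj (u c)) = cnj w"
      unfolding w_def cnj_sum
    proof (rule sum.cong[OF refl])
      fix c assume "c \<in> K"
      then have "h a c = cnj (h c a)" using herm[of c a] by blast
      then show "h a c * cnj (u c) = cnj (h c a * u c)" by simp
    qed
    \<comment> \<open>The extension of \<open>u\<close> to the index \<open>a\<close> that is orthogonal to the basis vector at \<open>a\<close>; on it the form of \<open>h\<close> agrees with that of \<open>S\<close>.\<close>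
    define v where "v b = (if b = a then - w / h a a else u b)" for b
    have vK: "(\<Sum>b\<in>K. g b (v b)) = (\<Sum>b\<in>K. g b (u b))" for g :: "'a \<Rightarrow> complex \<Rightarrow> complex"
      by (rule sum.cong) (use insert.hyps in \<open>auto simp: v_def\<close>)
    have "0 < Re (\<Sum>b\<in>insert a K. \<Sum>c\<in>insert a K. h b c * v b * cnj (v c))"
      by (rule pos) (use u insert.hyps in \<open>auto simp: v_def\<close>)
    also have "(\<Sum>b\<in>insert a K. \<Sum>c\<in>insert a K. h b c * v b * cnj (v c))
      = h a a * v a * cnj (v a) + v a * (\<Sum>c\<in>K. h a c * cnj (u c)) + cnj (v a) * (\<Sum>b\<in>K. h b a * u b)
        + (\<Sum>b\<in>K. \<Sum>c\<in>K. h b c * u b * cnj (u c))"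
    proof -
      have "(\<Sum>b\<in>K. \<Sum>c\<in>K. h b c * v b * cnj (v c)) = (\<Sum>b\<in>K. \<Sum>c\<in>K. h b c * u b * cnj (u c))"
        by (intro sum.cong) (use insert.hyps in \<open>auto simp: v_def\<close>)
      moreover have "(\<Sum>c\<in>K. h a c * v a * cnj (v c)) = v a * (\<Sum>c\<in>K. h a c * cnj (u c))"
        unfolding sum_distrib_left by (rule sum.cong) (use insert.hyps in \<open>auto simp: v_def\<close>)
      moreover have "(\<Sum>b\<in>K. h b a * v b * cnj (v a)) = cnj (v a) * (\<Sum>b\<in>K. h b a * u b)"
        unfolding sum_distrib_left by (rule sum.cong) (use insert.hyps in \<open>auto simp: v_def\<close>)
      ultimately show ?thesis using insert.hyps by (simp add: sum.distrib algebra_simps)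
    qed
    also have "\<dots> = (\<Sum>b\<in>K. \<Sum>c\<in>K. h b c * u b * cnj (u c)) - w * cnj w / h a a"
      unfolding cw w_def[symmetric] using r by (simp add: v_def field_simps)
    also have "\<dots> = (\<Sum>b\<in>K. \<Sum>c\<in>K. S b c * u b * cnj (u c))"
    proof -
      have "(\<Sum>b\<in>K. \<Sum>c\<in>K. S b c * u b * cnj (u c)) = (\<Sum>b\<in>K. \<Sum>c\<in>K. h b c * u b * cnj (u c))
         - (\<Sum>b\<in>K. \<Sum>c\<in>K. (h b a * u b) * (h a c * cnj (u c))) / h a a"
        unfolding S by (simp add: sum_subtractf[symmetric] sum_divide_distrib algebra_simps)
      also have "(\<Sum>b\<in>K. \<Sum>c\<in>K. (h b a * u b) * (h a c * cnj (u c))) = w * cnj w"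
        unfolding cw[symmetric] unfolding w_def sum_product ..
      finally show ?thesis by simp
    qed
    finally show "0 < Re (\<Sum>b\<in>K. \<Sum>c\<in>K. S b c * u b * cnj (u c))" .
  qed
  moreover have "det_on {a} h = of_real r" by (simp add: det_on_def r sign_id)
  ultimately show ?case using d r by simp
qed

lemma det_on_row_sum:
  assumes "k \<in> I"
  shows "det_on I (\<lambda>a b. if a = k then \<Sum>c\<in>J. B c * X c b else A a b)
    = (\<Sum>c\<in>J. B c * det_on I (\<lambda>a b. if a = k then X c b else A a b))"
proof -
  have pr: "(\<Prod>a\<in>I. if a = k then Y a else Z a) = Y k * (\<Prod>a\<in>I - {k}. Z a)" for Y Z :: "'a \<Rightarrow> complex"
  proof -
    have "(\<Prod>a\<in>I. if a = k then Y a else Z a) = Y k * (\<Prod>a\<in>I - {k}. if a = k then Y a else Z a)"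
      using assms by (simp add: prod.remove)
    also have "(\<Prod>a\<in>I - {k}. if a = k then Y a else Z a) = (\<Prod>a\<in>I - {k}. Z a)"
      by (rule prod.cong) auto
    finally show ?thesis .
  qed
  show ?thesis
    unfolding det_on_def pr sum_distrib_left sum_distrib_right
    by (subst sum.swap) (simp add: mult_ac)
qed

lemma det_on_row_repeated:
  assumes "k \<in> I" "c \<in> I" "c \<noteq> k"
  shows "det_on I (\<lambda>a b. if a = k then A c b else A a b) = 0"
proof -
  have "det (mat_on I (\<lambda>a b. if a = k then A c b else A a b)) = 0"
    by (rule det_identical_rows[OF assms(3)]) (use assms in \<open>auto simp: row_def mat_on_def vec_eq_iff\<close>)
  then show ?thesis by (simp add: det_mat_on)
qed

text \<open>Jacobi's formula for \<open>A' = B A\<close>: in the \<open>k\<close>-th summand all rows but the \<open>k\<close>-th are rows of \<open>A\<close>, so of the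
  new row only the multiple \<open>B\<^sub>k\<^sub>k\<close> of the old one survives.\<close>

lemma det_on_jacobi:
  assumes "\<And>k b. k \<in> I \<Longrightarrow> b \<in> I \<Longrightarrow> A' k b = (\<Sum>c\<in>I. B k c * A c b)"
  shows "(\<Sum>k\<in>I. det_on I (\<lambda>a b. if a = k then A' a b else A a b)) = (\<Sum>a\<in>I. B a a) * det_on I A"
proof -
  have "det_on I (\<lambda>a b. if a = k then A' a b else A a b) = B k k * det_on I A" if k: "k \<in> I" for k
  proof -
    have "det_on I (\<lambda>a b. if a = k then A' a b else A a b)
        = det_on I (\<lambda>a b. if a = k then \<Sum>c\<in>I. B k c * A c b else A a b)"
      by (rule det_on_cong) (use assms in auto)
    also have "\<dots> = (\<Sum>c\<in>I. B k c * det_on I (\<lambda>a b. if a = k then A c b else A a b))"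
      by (rule det_on_row_sum[OF k])
    also have "\<dots> = (\<Sum>c\<in>I. if c = k then B k k * det_on I A else 0)"
    proof (rule sum.cong[OF refl])
      fix c assume c: "c \<in> I"
      have "(\<lambda>a b. if a = k then A k b else A a b) = A" by (auto simp: fun_eq_iff)
      then show "B k c * det_on I (\<lambda>a b. if a = k then A c b else A a b) = (if c = k then B k k * det_on I A else 0)"
        using det_on_row_repeated[OF k c] by auto
    qed
    finally show ?thesis using k by simp
  qed
  then show ?thesis by (simp add: sum_distrib_right)
qed

lemma wirtinger_prod:
  assumes "x \<in> S" "a \<in> I" "copen I S" "finite A" "\<And>i. i \<in> A \<Longrightarrow> smooth_in I S (f i)"
  shows "pd a (\<lambda>y. \<Prod>i\<in>A. f i y) x = (\<Sum>k\<in>A. pd a (f k) x * (\<Prod>i\<in>A - {k}. f i x))"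
  using assms(4,5)
proof (induction A rule: finite_induct)
  case (insert j A)
  have "pd a (\<lambda>y. f j y * (\<Prod>i\<in>A. f i y)) x = f j x * pd a (\<lambda>y. \<Prod>i\<in>A. f i y) x + pd a (f j) x * (\<Prod>i\<in>A. f i x)"
    by (rule wirtinger_mult[OF assms(1,2)]) (use insert assms(3) in \<open>auto intro!: smooth_prod\<close>)
  also have IH: "pd a (\<lambda>y. \<Prod>i\<in>A. f i y) x = (\<Sum>k\<in>A. pd a (f k) x * (\<Prod>i\<in>A - {k}. f i x))"
    using insert.IH insert.prems by simp
  also have "f j x * (\<Sum>k\<in>A. pd a (f k) x * (\<Prod>i\<in>A - {k}. f i x))
      = (\<Sum>k\<in>A. pd a (f k) x * (\<Prod>i\<in>insert j A - {k}. f i x))"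
    unfolding sum_distrib_left
  proof (rule sum.cong[OF refl])
    fix k assume k: "k \<in> A"
    then have "insert j A - {k} = insert j (A - {k})" using insert by auto
    then show "f j x * (pd a (f k) x * (\<Prod>i\<in>A - {k}. f i x)) = pd a (f k) x * (\<Prod>i\<in>insert j A - {k}. f i x)"
      using insert by simp
  qed
  also have "A = insert j A - {j}" using insert by auto
  finally show ?case using insert by simp
qed simp

lemma smooth_det_on:
  assumes "copen I S" "\<And>a b. a \<in> J \<Longrightarrow> b \<in> J \<Longrightarrow> smooth_in I S (\<lambda>x. A x a b)"
  shows "smooth_in I S (\<lambda>x. det_on J (A x))"
  unfolding det_on_def using assms
  by (intro smooth_sum smooth_mult smooth_prod smooth_const) (auto simp: permutes_in_image)

lemma hol_det_on:
  assumes "copen I S" "\<And>a b. a \<in> J \<Longrightarrow> b \<in> J \<Longrightarrow> hol I S (\<lambda>x. A x a b)"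
  shows "hol I S (\<lambda>x. det_on J (A x))"
  unfolding det_on_def using assms
  by (intro hol_sum hol_mult hol_prod hol_const) (auto simp: permutes_in_image)

lemma wirtinger_det_on:
  assumes "x \<in> S" "i \<in> I" "copen I S" "\<And>a b. a \<in> J \<Longrightarrow> b \<in> J \<Longrightarrow> smooth_in I S (\<lambda>x. A x a b)"
  shows "pd i (\<lambda>x. det_on J (A x)) x = (\<Sum>k\<in>J. det_on J (\<lambda>a b. if a = k then pd i (\<lambda>x. A x a b) x else A x a b))"
proof -
  have "pd i (\<lambda>x. det_on J (A x)) x
    = (\<Sum>p | p permutes J. pd i (\<lambda>x. of_int (sign p) * (\<Prod>a\<in>J. A x a (p a))) x)"
    unfolding det_on_def using assms
    by (intro wirtinger_sum(1)[OF assms(1,2,3)] smooth_mult smooth_prod smooth_const) (auto simp: permutes_in_image)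
  also have "\<dots> = (\<Sum>p | p permutes J. \<Sum>k\<in>J. of_int (sign p) * (\<Prod>a\<in>J. if a = k then pd i (\<lambda>x. A x a (p a)) x else A x a (p a)))"
  proof (rule sum.cong[OF refl])
    fix p assume p: "p \<in> {p. p permutes J}"
    have s: "smooth_in I S (\<lambda>x. A x a (p a))" if "a \<in> J" for a using assms(4) p that by (simp add: permutes_in_image)
    have "pd i (\<lambda>x. of_int (sign p) * (\<Prod>a\<in>J. A x a (p a))) x
      = of_int (sign p) * (\<Sum>k\<in>J. pd i (\<lambda>x. A x k (p k)) x * (\<Prod>a\<in>J - {k}. A x a (p a)))"
      using wirtinger_cmult(1)[where f = "\<lambda>x. \<Prod>a\<in>J. A x a (p a)" and c = "of_int (sign p)", OF smooth_prod[OF assms(3) s] assms(1,2)]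
        wirtinger_prod[where f = "\<lambda>a x. A x a (p a)" and A = J, OF assms(1-3) _ s] by simp
    also have "\<dots> = (\<Sum>k\<in>J. of_int (sign p) * (\<Prod>a\<in>J. if a = k then pd i (\<lambda>x. A x a (p a)) x else A x a (p a)))"
      unfolding sum_distrib_left
    proof (rule sum.cong[OF refl])
      fix k assume k: "k \<in> J"
      have "(\<Prod>a\<in>J. if a = k then pd i (\<lambda>x. A x a (p a)) x else A x a (p a))
        = pd i (\<lambda>x. A x k (p k)) x * (\<Prod>a\<in>J - {k}. if a = k then pd i (\<lambda>x. A x a (p a)) x else A x a (p a))"
        using k by (simp add: prod.remove)
      also have "(\<Prod>a\<in>J - {k}. if a = k then pd i (\<lambda>x. A x a (p a)) x else A x a (p a)) = (\<Prod>a\<in>J - {k}. A x a (p a))"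
        by (rule prod.cong) auto
      finally show "of_int (sign p) * (pd i (\<lambda>x. A x k (p k)) x * (\<Prod>a\<in>J - {k}. A x a (p a)))
        = of_int (sign p) * (\<Prod>a\<in>J. if a = k then pd i (\<lambda>x. A x a (p a)) x else A x a (p a))" by simp
    qed
    finally show "pd i (\<lambda>x. of_int (sign p) * (\<Prod>a\<in>J. A x a (p a))) x
      = (\<Sum>k\<in>J. of_int (sign p) * (\<Prod>a\<in>J. if a = k then pd i (\<lambda>x. A x a (p a)) x else A x a (p a)))" .
  qed
  also have "\<dots> = (\<Sum>k\<in>J. det_on J (\<lambda>a b. if a = k then pd i (\<lambda>x. A x a b) x else A x a b))"
    unfolding det_on_def by (rule sum.swap)
  finally show ?thesis .
qed

section \<open>The top power of a (1,1)-form\<close>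

text \<open>The value of \<open>dx\<^sub>f\<^sub>0 \<and> d\<close>conj\<open>(x\<^sub>g\<^sub>0) \<and> dx\<^sub>f\<^sub>1 \<and> d\<close>conj\<open>(x\<^sub>g\<^sub>1) \<and> \<dots>\<close> on \<open>2 d\<close> vectors, where \<open>p l\<close> and \<open>q l\<close> are the
  components of the \<open>l\<close>-th vector of type \<open>(1,0)\<close> and \<open>(0,1)\<close>.\<close>

definition slot_sum :: "nat \<Rightarrow> (nat \<Rightarrow> 'k \<Rightarrow> complex) \<Rightarrow> (nat \<Rightarrow> 'k \<Rightarrow> complex) \<Rightarrow> (nat \<Rightarrow> 'k) \<Rightarrow> (nat \<Rightarrow> 'k) \<Rightarrow> complex" where
  "slot_sum d p q f g = (\<Sum>\<sigma> | \<sigma> permutes {..<2 * d}.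
     of_int (sign \<sigma>) * (\<Prod>i<d. p (\<sigma> (2 * i)) (f i) * q (\<sigma> (2 * i + 1)) (g i)))"

lemma sign_flip:
  assumes "X = of_int (sign p) * (Y :: complex)"
  shows "Y = of_int (sign p) * X"
proof -
  have "of_int (sign p) * X = of_int (sign p * sign p) * Y" unfolding assms of_int_mult by simp
  then show ?thesis by (simp only: sign_idempotent) simp
qed

lemma perm_sum_compose:
  assumes "\<tau> permutes {..<n::nat}"
  shows "(\<Sum>\<sigma> | \<sigma> permutes {..<n}. of_int (sign \<sigma>) * F (\<sigma> \<circ> \<tau>)) = (of_int (sign \<tau>) :: complex) * (\<Sum>\<sigma> | \<sigma> permutes {..<n}. of_int (sign \<sigma>) * F \<sigma>)"
proof -
  have "(\<Sum>\<sigma> | \<sigma> permutes {..<n}. of_int (sign \<sigma>) * F \<sigma>) = (\<Sum>\<sigma> | \<sigma> permutes {..<n}. of_int (sign (\<sigma> \<circ> \<tau>)) * F (\<sigma> \<circ> \<tau>))"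
    by (rule sum_permutations_compose_right[OF assms])
  also have "\<dots> = (\<Sum>\<sigma> | \<sigma> permutes {..<n}. of_int (sign \<tau>) * (of_int (sign \<sigma>) * F (\<sigma> \<circ> \<tau>)))"
  proof (rule sum.cong[OF refl])
    fix \<sigma> assume "\<sigma> \<in> {\<sigma>. \<sigma> permutes {..<n}}"
    then have "sign (\<sigma> \<circ> \<tau>) = sign \<sigma> * sign \<tau>"
      using sign_compose[of \<sigma> \<tau>] assms permutation_permutes[of \<sigma>] permutation_permutes[of \<tau>] by blast
    then show "of_int (sign (\<sigma> \<circ> \<tau>)) * F (\<sigma> \<circ> \<tau>) = of_int (sign \<tau>) * (of_int (sign \<sigma>) * F (\<sigma> \<circ> \<tau>))" by simp
  qed
  finally have "(\<Sum>\<sigma> | \<sigma> permutes {..<n}. of_int (sign \<sigma>) * F \<sigma>)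
    = of_int (sign \<tau>) * (\<Sum>\<sigma> | \<sigma> permutes {..<n}. of_int (sign \<sigma>) * F (\<sigma> \<circ> \<tau>))" by (simp add: sum_distrib_left)
  then show ?thesis by (rule sign_flip)
qed

text \<open>A permutation of the \<open>d\<close> pairs, applied to the first or to the second members only.\<close>

lemma slot_perm:
  assumes \<rho>: "\<rho> permutes {..<d}" and s: "s = 0 \<or> s = (1::nat)"
  obtains \<tau> where "\<tau> permutes {..<2 * d}" "sign \<tau> = sign \<rho>"
    "\<And>i. i < d \<Longrightarrow> \<tau> (2 * i + s) = 2 * \<rho> i + s" "\<And>i. i < d \<Longrightarrow> \<tau> (2 * i + (1 - s)) = 2 * i + (1 - s)"
proof -
  let ?f = "\<lambda>i. 2 * i + s"
  have inj: "inj_on ?f {..<d}" by (auto simp: inj_on_def)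
  define \<tau> where "\<tau> = map_permutation {..<d} ?f \<rho>"
  have p: "\<tau> permutes (?f ` {..<d})"
    unfolding \<tau>_def by (rule map_permutation_permutes[OF _ \<rho>]) (use inj in \<open>auto simp: bij_betw_def\<close>)
  show ?thesis
  proof (rule that[of \<tau>])
    show "\<tau> permutes {..<2 * d}" by (rule permutes_subset[OF p]) (use s in auto)
    show "sign \<tau> = sign \<rho>" unfolding \<tau>_def by (rule sign_map_permutation[OF inj \<rho>]) simp
    show "\<tau> (2 * i + s) = 2 * \<rho> i + s" if "i < d" for i
      unfolding \<tau>_def using map_permutation_apply[OF inj, of i \<rho>] that by simp
    show "\<tau> (2 * i + (1 - s)) = 2 * i + (1 - s)" if "i < d" for i
      by (rule permutes_not_in[OF p]) (use s in \<open>auto; presburger\<close>)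
  qed
qed

lemma prod_permute:
  assumes "\<rho> permutes {..<d::nat}"
  shows "(\<Prod>i<d. G (\<rho> i)) = (\<Prod>i<d. G i)"
  using prod.permute[OF assms, of G] by (simp add: comp_def)

lemma slot_sum_left:
  assumes "\<rho> permutes {..<d}"
  shows "slot_sum d p q (f \<circ> \<rho>) g = of_int (sign \<rho>) * slot_sum d p q f g"
proof -
  obtain \<tau> where t: "\<tau> permutes {..<2 * d}" "sign \<tau> = sign \<rho>"
    "\<And>i. i < d \<Longrightarrow> \<tau> (2 * i) = 2 * \<rho> i" "\<And>i. i < d \<Longrightarrow> \<tau> (2 * i + 1) = 2 * i + 1"
    by (rule slot_perm[OF assms, of 0]) auto
  define F where "F \<sigma> = (\<Prod>i<d. p (\<sigma> (2 * i)) (f i) * q (\<sigma> (2 * i + 1)) (g i))" for \<sigma> :: "nat \<Rightarrow> nat"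
  define G where "G \<sigma> = (\<Prod>i<d. p (\<sigma> (2 * i)) (f (\<rho> i)) * q (\<sigma> (2 * i + 1)) (g i))" for \<sigma> :: "nat \<Rightarrow> nat"
  have "F \<sigma> = G (\<sigma> \<circ> \<tau>)" for \<sigma>
  proof -
    have "G (\<sigma> \<circ> \<tau>) = (\<Prod>i<d. p (\<sigma> (2 * \<rho> i)) (f (\<rho> i)) * q (\<sigma> (2 * i + 1)) (g i))"
      unfolding G_def by (rule prod.cong) (use t in auto)
    also have "\<dots> = F \<sigma>"
      unfolding F_def prod.distrib prod_permute[OF assms, of "\<lambda>i. p (\<sigma> (2 * i)) (f i)"] ..
    finally show ?thesis by simp
  qed
  then have "slot_sum d p q f g = (\<Sum>\<sigma> | \<sigma> permutes {..<2 * d}. of_int (sign \<sigma>) * G (\<sigma> \<circ> \<tau>))"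
    by (simp add: slot_sum_def F_def)
  also have "\<dots> = of_int (sign \<rho>) * slot_sum d p q (f \<circ> \<rho>) g"
    unfolding perm_sum_compose[OF t(1)] t(2) by (simp add: slot_sum_def G_def)
  finally show ?thesis by (rule sign_flip)
qed

lemma slot_sum_right:
  assumes "\<rho> permutes {..<d}"
  shows "slot_sum d p q f (g \<circ> \<rho>) = of_int (sign \<rho>) * slot_sum d p q f g"
proof -
  obtain \<tau> where t: "\<tau> permutes {..<2 * d}" "sign \<tau> = sign \<rho>"
    "\<And>i. i < d \<Longrightarrow> \<tau> (2 * i + 1) = 2 * \<rho> i + 1" "\<And>i. i < d \<Longrightarrow> \<tau> (2 * i) = 2 * i"
    by (rule slot_perm[OF assms, of 1]) auto
  define F where "F \<sigma> = (\<Prod>i<d. p (\<sigma> (2 * i)) (f i) * q (\<sigma> (2 * i + 1)) (g i))" for \<sigma> :: "nat \<Rightarrow> nat"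
  define G where "G \<sigma> = (\<Prod>i<d. p (\<sigma> (2 * i)) (f i) * q (\<sigma> (2 * i + 1)) (g (\<rho> i)))" for \<sigma> :: "nat \<Rightarrow> nat"
  have "F \<sigma> = G (\<sigma> \<circ> \<tau>)" for \<sigma>
  proof -
    have "G (\<sigma> \<circ> \<tau>) = (\<Prod>i<d. p (\<sigma> (2 * i)) (f i) * q (\<sigma> (2 * \<rho> i + 1)) (g (\<rho> i)))"
      unfolding G_def by (rule prod.cong) (use t in auto)
    also have "\<dots> = F \<sigma>"
      unfolding F_def prod.distrib prod_permute[OF assms, of "\<lambda>i. q (\<sigma> (2 * i + 1)) (g i)"] ..
    finally show ?thesis by simp
  qed
  then have "slot_sum d p q f g = (\<Sum>\<sigma> | \<sigma> permutes {..<2 * d}. of_int (sign \<sigma>) * G (\<sigma> \<circ> \<tau>))"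
    by (simp add: slot_sum_def F_def)
  also have "\<dots> = of_int (sign \<rho>) * slot_sum d p q f (g \<circ> \<rho>)"
    unfolding perm_sum_compose[OF t(1)] t(2) by (simp add: slot_sum_def G_def)
  finally show ?thesis by (rule sign_flip)
qed

lemma slot_sum_repeated:
  assumes "i < d" "j < d" "i \<noteq> j" "f i = f j"
  shows "slot_sum d p q f g = 0"
proof -
  have t: "Transposition.transpose i j permutes {..<d}" by (rule permutes_swap_id) (use assms in auto)
  have "f \<circ> Transposition.transpose i j = f" using assms(4) by (auto simp: fun_eq_iff Transposition.transpose_def)
  then have "slot_sum d p q f g = - slot_sum d p q f g"
    using slot_sum_left[OF t, of p q f g] assms(3) by (simp add: sign_swap_id)
  then show ?thesis by simp
qed

lemma slot_sum_cong:
  assumes "\<And>i. i < d \<Longrightarrow> f i = f' i" "\<And>i. i < d \<Longrightarrow> g i = g' i"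
  shows "slot_sum d p q f g = slot_sum d p q f' g'"
  unfolding slot_sum_def by (intro sum.cong refl arg_cong2[where f = "(*)"] prod.cong) (use assms in auto)

text \<open>In the expansion of an alternating form, index assignments with a repetition contribute nothing; the others
  are permutations of a fixed enumeration.\<close>

lemma sum_PiE_perm:
  assumes e: "bij_betw e {..<d::nat} I"
    and G0: "\<And>g. g \<in> {..<d} \<rightarrow>\<^sub>E I \<Longrightarrow> \<not> inj_on g {..<d} \<Longrightarrow> G g = (0::complex)"
    and G1: "\<And>g g'. (\<And>i. i < d \<Longrightarrow> g i = g' i) \<Longrightarrow> G g = G g'"
  shows "(\<Sum>g\<in>{..<d} \<rightarrow>\<^sub>E I. G g) = (\<Sum>\<rho> | \<rho> permutes {..<d}. G (e \<circ> \<rho>))"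
proof -
  have fin: "finite I" using bij_betw_finite[OF e] by simp
  have "(\<Sum>g\<in>{..<d} \<rightarrow>\<^sub>E I. G g) = (\<Sum>g\<in>{g \<in> {..<d} \<rightarrow>\<^sub>E I. inj_on g {..<d}}. G g)"
    by (rule sum.mono_neutral_right) (use fin G0 in \<open>auto intro!: finite_PiE\<close>)
  also have "\<dots> = (\<Sum>\<rho> | \<rho> permutes {..<d}. G (e \<circ> \<rho>))"
  proof (rule sum.reindex_bij_witness[where i = "\<lambda>\<rho>. restrict (e \<circ> \<rho>) {..<d}"
        and j = "\<lambda>g i. if i < d then inv_into {..<d} e (g i) else i"])
    fix g assume g: "g \<in> {g \<in> {..<d} \<rightarrow>\<^sub>E I. inj_on g {..<d}}"
    let ?\<rho> = "\<lambda>i. if i < d then inv_into {..<d} e (g i) else i"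
    have gI: "g i \<in> I" if "i < d" for i using g that by auto
    have inv: "e (inv_into {..<d} e y) = y" "inv_into {..<d} e y < d" if "y \<in> I" for y
      using bij_betw_inv_into_right[OF e that] bij_betwE[OF bij_betw_inv_into[OF e]] that by auto
    show "restrict (e \<circ> ?\<rho>) {..<d} = g"
      using g gI inv by (auto simp: fun_eq_iff restrict_def PiE_def extensional_def)
    have inj: "inj_on ?\<rho> {..<d}"
    proof (rule inj_onI)
      fix i j assume ij: "i \<in> {..<d}" "j \<in> {..<d}" "?\<rho> i = ?\<rho> j"
      then have "g i = g j" using inv(1)[OF gI] by (metis lessThan_iff)
      then show "i = j" using g ij by (auto dest: inj_onD)
    qed
    have im: "?\<rho> ` {..<d} \<subseteq> {..<d}" using inv(2)[OF gI] by auto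
    have "bij_betw ?\<rho> {..<d} {..<d}"
      using endo_inj_surj[OF _ im inj] inj by (simp add: bij_betw_def)
    then show "?\<rho> \<in> {\<rho>. \<rho> permutes {..<d}}" by (simp, intro bij_imp_permutes) auto
    show "G (e \<circ> ?\<rho>) = G g" by (rule G1) (use inv gI in auto)
  next
    fix \<rho> assume \<rho>: "\<rho> \<in> {\<rho>. \<rho> permutes {..<d}}"
    then have im: "\<rho> i < d" if "i < d" for i using that permutes_in_image by fastforce
    show "(\<lambda>i. if i < d then inv_into {..<d} e (restrict (e \<circ> \<rho>) {..<d} i) else i) = \<rho>"
      using \<rho> im bij_betw_inv_into_left[OF e] permutes_not_in[of \<rho> "{..<d}"] by (auto simp: fun_eq_iff)
    have "inj_on (restrict (e \<circ> \<rho>) {..<d}) {..<d}"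
      using \<rho> im e by (auto simp: inj_on_def bij_betw_def dest: permutes_inj injD)
    then show "restrict (e \<circ> \<rho>) {..<d} \<in> {g \<in> {..<d} \<rightarrow>\<^sub>E I. inj_on g {..<d}}"
      using im bij_betwE[OF e] by auto
  qed
  finally show ?thesis .
qed

text \<open>Each of the two summands of \<open>\<beta>(X, Y) = \<gamma>(X, Y) - \<gamma>(Y, X)\<close> contributes the same to the wedge power.\<close>

lemma wedge_power_antisym:
  assumes "\<And>X Y. \<beta> X Y = \<gamma> X Y - \<gamma> Y X"
  shows "wedge_power d \<beta> vs = (\<Sum>\<sigma> | \<sigma> permutes {..<2 * d}.
     of_int (sign \<sigma>) * (\<Prod>i<d. \<gamma> (vs ! \<sigma> (2 * i)) (vs ! \<sigma> (2 * i + 1))))"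
proof -
  \<comment> \<open>Interpolates between the two sides: the first \<open>j\<close> factors are already replaced.\<close>
  define T where "T j \<sigma> i = (if i < j then \<gamma> (vs ! \<sigma> (2 * i)) (vs ! \<sigma> (2 * i + 1))
     else \<beta> (vs ! \<sigma> (2 * i)) (vs ! \<sigma> (2 * i + 1)))" for j i :: nat and \<sigma> :: "nat \<Rightarrow> nat"
  define P where "P j = (\<Sum>\<sigma> | \<sigma> permutes {..<2 * d}. of_int (sign \<sigma>) * (\<Prod>i<d. T j \<sigma> i))" for j
  have step: "P j = 2 * P (Suc j)" if j: "j < d" for j
  proof -
    define \<tau> where "\<tau> = Transposition.transpose (2 * j) (2 * j + 1)"
    have t: "\<tau> permutes {..<2 * d}" unfolding \<tau>_def by (rule permutes_swap_id) (use j in auto)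
    have eq: "(\<Prod>i<d. T j \<sigma> i) = (\<Prod>i<d. T (Suc j) \<sigma> i) - (\<Prod>i<d. T (Suc j) (\<sigma> \<circ> \<tau>) i)" for \<sigma>
    proof -
      have r: "(\<Prod>i<d. F i) = F j * (\<Prod>i\<in>{..<d} - {j}. F i)" for F :: "nat \<Rightarrow> complex"
        using j by (simp add: prod.remove)
      have "(\<Prod>i\<in>{..<d} - {j}. T (Suc j) \<sigma> i) = (\<Prod>i\<in>{..<d} - {j}. T j \<sigma> i)"
        by (rule prod.cong) (auto simp: T_def)
      moreover have "(\<Prod>i\<in>{..<d} - {j}. T (Suc j) (\<sigma> \<circ> \<tau>) i) = (\<Prod>i\<in>{..<d} - {j}. T j \<sigma> i)"
      proof (rule prod.cong[OF refl])
        fix i assume "i \<in> {..<d} - {j}"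
        then have "i \<noteq> j" by simp
        then have "\<tau> (2 * i) = 2 * i" "\<tau> (2 * i + 1) = 2 * i + 1"
          unfolding \<tau>_def by (auto intro!: transpose_apply_other; presburger)+
        then show "T (Suc j) (\<sigma> \<circ> \<tau>) i = T j \<sigma> i" using \<open>i \<noteq> j\<close> by (auto simp: T_def)
      qed
      moreover have "T j \<sigma> j = T (Suc j) \<sigma> j - T (Suc j) (\<sigma> \<circ> \<tau>) j"
        using assms by (simp add: T_def \<tau>_def)
      ultimately show ?thesis unfolding r[of "T j \<sigma>"] r[of "T (Suc j) \<sigma>"] r[of "T (Suc j) (\<sigma> \<circ> \<tau>)"]
        by (simp only: left_diff_distrib)
    qed
    have "P j = P (Suc j) - (\<Sum>\<sigma> | \<sigma> permutes {..<2 * d}. of_int (sign \<sigma>) * (\<Prod>i<d. T (Suc j) (\<sigma> \<circ> \<tau>) i))"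
      unfolding P_def eq by (simp add: right_diff_distrib sum_subtractf)
    also have "(\<Sum>\<sigma> | \<sigma> permutes {..<2 * d}. of_int (sign \<sigma>) * (\<Prod>i<d. T (Suc j) (\<sigma> \<circ> \<tau>) i)) = - P (Suc j)"
      using perm_sum_compose[OF t, of "\<lambda>\<sigma>. \<Prod>i<d. T (Suc j) \<sigma> i"] by (simp add: P_def \<tau>_def sign_swap_id)
    finally show ?thesis by simp
  qed
  have "P 0 = 2 ^ j * P j" if "j \<le> d" for j using that
    by (induction j) (use step in auto)
  from this[of d] have "P 0 = 2 ^ d * P d" by simp
  moreover have "wedge_power d \<beta> vs = P 0 / 2 ^ d" by (simp add: wedge_power_def P_def T_def)
  moreover have "P d = (\<Sum>\<sigma> | \<sigma> permutes {..<2 * d}.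
     of_int (sign \<sigma>) * (\<Prod>i<d. \<gamma> (vs ! \<sigma> (2 * i)) (vs ! \<sigma> (2 * i + 1))))"
    unfolding P_def by (intro sum.cong refl arg_cong2[where f = "(*)"] prod.cong) (auto simp: T_def)
  ultimately show ?thesis by simp
qed

text \<open>The identity \<open>\<omega>\<^sup>d = \<i>\<^sup>d d! det h dx\<^sub>1 \<and> d\<close>conj\<open>(x\<^sub>1) \<and> \<dots>\<close>: reordering the pairs gives \<open>d!\<close>, and expanding the first
  member of every pair gives the determinant.\<close>

lemma wedge_power_cform:
  fixes I :: "'k::finite set"
  assumes e: "bij_betw e {..<d} I"
  shows "wedge_power d (cform I h) vs = \<i> ^ d * of_nat (fact d) * det_on I h *
    slot_sum d (\<lambda>l a. fst (vs ! l) $ a) (\<lambda>l a. snd (vs ! l) $ a) e e"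
proof -
  define p where "p l a = fst (vs ! l) $ a" for l a
  define q where "q l a = snd (vs ! l) $ a" for l a
  define P where "P l b = (\<Sum>a\<in>I. h a b * p l a)" for l b
  have card: "card {\<rho>. \<rho> permutes {..<d}} = fact d" by (rule card_permutations) auto
  have g: "wedge_power d (cform I h) vs = (\<Sum>\<sigma> | \<sigma> permutes {..<2 * d}.
     of_int (sign \<sigma>) * (\<Prod>i<d. \<i> * (\<Sum>b\<in>I. P (\<sigma> (2 * i)) b * q (\<sigma> (2 * i + 1)) b)))"
  proof (subst wedge_power_antisym[where \<gamma> = "\<lambda>X Y. \<i> * (\<Sum>a\<in>I. \<Sum>b\<in>I. h a b * (fst X $ a * snd Y $ b))"])
    show "cform I h X Y = \<i> * (\<Sum>a\<in>I. \<Sum>b\<in>I. h a b * (fst X $ a * snd Y $ b))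
       - \<i> * (\<Sum>a\<in>I. \<Sum>b\<in>I. h a b * (fst Y $ a * snd X $ b))" for X Y
      by (simp add: cform_def right_diff_distrib sum_subtractf)
    have "(\<Sum>a\<in>I. \<Sum>b\<in>I. h a b * (fst (vs ! l) $ a * snd (vs ! m) $ b)) = (\<Sum>b\<in>I. P l b * q m b)" for l m
      unfolding P_def p_def q_def sum_distrib_right by (subst sum.swap) (simp add: mult_ac)
    then show "(\<Sum>\<sigma> | \<sigma> permutes {..<2 * d}. of_int (sign \<sigma>) *
       (\<Prod>i<d. \<i> * (\<Sum>a\<in>I. \<Sum>b\<in>I. h a b * (fst (vs ! \<sigma> (2 * i)) $ a * snd (vs ! \<sigma> (2 * i + 1)) $ b))))
     = (\<Sum>\<sigma> | \<sigma> permutes {..<2 * d}. of_int (sign \<sigma>) *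
       (\<Prod>i<d. \<i> * (\<Sum>b\<in>I. P (\<sigma> (2 * i)) b * q (\<sigma> (2 * i + 1)) b)))" by simp
  qed
  also have "\<dots> = \<i> ^ d * (\<Sum>g\<in>{..<d} \<rightarrow>\<^sub>E I. slot_sum d P q g g)"
    unfolding slot_sum_def
    by (subst sum.swap) (simp add: prod.distrib prod_sum_PiE sum_distrib_left mult_ac)
  also have "(\<Sum>g\<in>{..<d} \<rightarrow>\<^sub>E I. slot_sum d P q g g) = (\<Sum>\<rho> | \<rho> permutes {..<d}. slot_sum d P q (e \<circ> \<rho>) (e \<circ> \<rho>))"
    by (rule sum_PiE_perm[OF e]) (auto simp: inj_on_def intro: slot_sum_repeated slot_sum_cong)
  also have "\<dots> = (\<Sum>\<rho> | \<rho> permutes {..<d}. slot_sum d P q e e)"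
  proof (rule sum.cong[OF refl])
    fix \<rho> assume "\<rho> \<in> {\<rho>. \<rho> permutes {..<d}}"
    then have \<rho>: "\<rho> permutes {..<d}" by simp
    show "slot_sum d P q (e \<circ> \<rho>) (e \<circ> \<rho>) = slot_sum d P q e e"
      unfolding slot_sum_left[OF \<rho>] using sign_flip[OF slot_sum_right[OF \<rho>, of P q e e]] by simp
  qed
  also have "\<dots> = of_nat (fact d) * slot_sum d P q e e" by (simp add: card)
  also have "slot_sum d P q e e = det_on I h * slot_sum d p q e e"
  proof -
    have "slot_sum d P q e e = (\<Sum>f\<in>{..<d} \<rightarrow>\<^sub>E I. (\<Prod>i<d. h (f i) (e i)) * slot_sum d p q f e)"
      unfolding slot_sum_def P_def sum_distrib_left
      by (subst sum.swap) (simp add: prod.distrib prod_sum_PiE sum_distrib_left sum_distrib_right mult_ac)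
    also have "\<dots> = (\<Sum>\<rho> | \<rho> permutes {..<d}. (\<Prod>i<d. h ((e \<circ> \<rho>) i) (e i)) * slot_sum d p q (e \<circ> \<rho>) e)"
    proof (rule sum_PiE_perm[OF e])
      fix g g' :: "nat \<Rightarrow> 'k" assume "\<And>i. i < d \<Longrightarrow> g i = g' i"
      then show "(\<Prod>i<d. h (g i) (e i)) * slot_sum d p q g e = (\<Prod>i<d. h (g' i) (e i)) * slot_sum d p q g' e"
        using slot_sum_cong[of d g g' e e p q] by simp
    qed (auto simp: inj_on_def intro: slot_sum_repeated)
    also have "\<dots> = (\<Sum>\<rho> | \<rho> permutes {..<d}. of_int (sign \<rho>) * (\<Prod>i<d. h (e (\<rho> i)) (e i))) * slot_sum d p q e e"
      unfolding sum_distrib_right by (rule sum.cong) (auto simp: slot_sum_left)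
    also have "(\<Sum>\<rho> | \<rho> permutes {..<d}. of_int (sign \<rho>) * (\<Prod>i<d. h (e (\<rho> i)) (e i))) = det_on (e ` {..<d}) (\<lambda>a b. h b a)"
      by (subst det_on_reindex) (use e in \<open>auto simp: bij_betw_def\<close>)
    also have "e ` {..<d} = I" using e by (simp add: bij_betw_def)
    finally show ?thesis unfolding det_on_transpose[of I h] .
  qed
  finally show ?thesis by (simp add: p_def[abs_def] q_def[abs_def] mult_ac)
qed

text \<open>An endomorphism acts on the top form as a derivation by its trace.  Here it is of type \<open>(1,0)\<close>: applied in a slot
  of type \<open>(0,1)\<close> it gives zero, and applied in the slot of \<open>dx\<^sub>e\<^sub>j\<close> it replaces that covector by others, each of
  which occurs already unless it is \<open>dx\<^sub>e\<^sub>j\<close>.\<close>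

lemma slot_sum_trace:
  fixes I :: "'k::finite set" and vs :: "'k cvec list"
  assumes e: "bij_betw e {..<d} I" and len: "length vs = 2 * d"
    and Bv: "\<And>v b. b \<in> I \<Longrightarrow> fst (A v) $ b = (\<Sum>a\<in>I. fst v $ a * B a b)" "\<And>v. snd (A v) = 0"
  shows "(\<Sum>l<2 * d. slot_sum d (\<lambda>m a. fst (vs[l := A (vs ! l)] ! m) $ a) (\<lambda>m a. snd (vs[l := A (vs ! l)] ! m) $ a) e e)
    = (\<Sum>a\<in>I. B a a) * slot_sum d (\<lambda>m a. fst (vs ! m) $ a) (\<lambda>m a. snd (vs ! m) $ a) e e"
proof -
  define p where "p m a = fst (vs ! m) $ a" for m a
  define q where "q m a = snd (vs ! m) $ a" for m a
  define p' where "p' l m a = fst (vs[l := A (vs ! l)] ! m) $ a" for l m a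
  define q' where "q' l m a = snd (vs[l := A (vs ! l)] ! m) $ a" for l m a
  have eI: "e i \<in> I" if "i < d" for i using bij_betwE[OF e] that by auto
  define T where "T \<sigma> l = (\<Prod>i<d. p' l (\<sigma> (2 * i)) (e i) * q' l (\<sigma> (2 * i + 1)) (e i))" for \<sigma> l
  have odd: "T \<sigma> (\<sigma> (2 * j + 1)) = 0" if s: "\<sigma> permutes {..<2 * d}" and j: "j < d" for \<sigma> j
  proof -
    have "\<sigma> (2 * j + 1) < 2 * d" using permutes_in_image[OF s, of "2 * j + 1"] j by simp
    then have "q' (\<sigma> (2 * j + 1)) (\<sigma> (2 * j + 1)) (e j) = 0" using Bv(2) len by (simp add: q'_def)
    then show ?thesis unfolding T_def using j by (auto intro!: prod_zero bexI[of _ j])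
  qed
  have even: "T \<sigma> (\<sigma> (2 * j)) = (\<Sum>a\<in>I. B a (e j) * (\<Prod>i<d. p (\<sigma> (2 * i)) ((e(j := a)) i) * q (\<sigma> (2 * i + 1)) (e i)))"
    if s: "\<sigma> permutes {..<2 * d}" and j: "j < d" for \<sigma> j
  proof -
    have lt: "\<sigma> (2 * j) < 2 * d" using permutes_in_image[OF s, of "2 * j"] j by simp
    have inj: "\<sigma> m = \<sigma> n \<longleftrightarrow> m = n" for m n using permutes_inj[OF s] by (auto dest: injD)
    have r: "(\<Prod>i<d. F i) = F j * (\<Prod>i\<in>{..<d} - {j}. F i)" for F :: "nat \<Rightarrow> complex"
      using j by (simp add: prod.remove)
    have 1: "(\<Prod>i\<in>{..<d} - {j}. p' (\<sigma> (2 * j)) (\<sigma> (2 * i)) (e i) * q' (\<sigma> (2 * j)) (\<sigma> (2 * i + 1)) (e i))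
      = (\<Prod>i\<in>{..<d} - {j}. p (\<sigma> (2 * i)) (e i) * q (\<sigma> (2 * i + 1)) (e i))"
    proof (rule prod.cong[OF refl])
      fix i assume "i \<in> {..<d} - {j}"
      then have "2 * j \<noteq> 2 * i" by simp
      moreover have "2 * j \<noteq> 2 * i + 1" by presburger
      ultimately have "\<sigma> (2 * j) \<noteq> \<sigma> (2 * i)" "\<sigma> (2 * j) \<noteq> \<sigma> (2 * i + 1)" unfolding inj .
      then show "p' (\<sigma> (2 * j)) (\<sigma> (2 * i)) (e i) * q' (\<sigma> (2 * j)) (\<sigma> (2 * i + 1)) (e i)
        = p (\<sigma> (2 * i)) (e i) * q (\<sigma> (2 * i + 1)) (e i)" by (simp add: p_def q_def p'_def q'_def)
    qed
    have "\<sigma> (2 * j) \<noteq> \<sigma> (2 * j + 1)" by (simp add: inj)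
    then have 2: "p' (\<sigma> (2 * j)) (\<sigma> (2 * j)) (e j) = (\<Sum>a\<in>I. p (\<sigma> (2 * j)) a * B a (e j))"
      "q' (\<sigma> (2 * j)) (\<sigma> (2 * j + 1)) (e j) = q (\<sigma> (2 * j + 1)) (e j)"
      using lt len Bv(1)[OF eI[OF j]] by (simp_all add: p'_def q'_def p_def q_def)
    have 3: "(\<Prod>i\<in>{..<d} - {j}. p (\<sigma> (2 * i)) ((e(j := a)) i) * q (\<sigma> (2 * i + 1)) (e i))
      = (\<Prod>i\<in>{..<d} - {j}. p (\<sigma> (2 * i)) (e i) * q (\<sigma> (2 * i + 1)) (e i))" for a
      by (rule prod.cong) auto
    show ?thesis
      unfolding T_def r 1 2 3 by (simp add: sum_distrib_left sum_distrib_right mult_ac)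
  qed
  have split: "(\<Sum>l<2 * d. F l) = (\<Sum>i<d. F (2 * i) + F (2 * i + 1))" for F :: "nat \<Rightarrow> complex"
    by (induction d) (auto simp: algebra_simps)
  have "(\<Sum>l<2 * d. slot_sum d (p' l) (q' l) e e) = (\<Sum>\<sigma> | \<sigma> permutes {..<2 * d}. of_int (sign \<sigma>) * (\<Sum>l<2 * d. T \<sigma> l))"
    unfolding slot_sum_def T_def sum_distrib_left by (rule sum.swap)
  also have "\<dots> = (\<Sum>\<sigma> | \<sigma> permutes {..<2 * d}. of_int (sign \<sigma>) * (\<Sum>j<d. \<Sum>a\<in>I. B a (e j) *
      (\<Prod>i<d. p (\<sigma> (2 * i)) ((e(j := a)) i) * q (\<sigma> (2 * i + 1)) (e i))))"
  proof (rule sum.cong[OF refl])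
    fix \<sigma> assume "\<sigma> \<in> {\<sigma>. \<sigma> permutes {..<2 * d}}"
    then have s: "\<sigma> permutes {..<2 * d}" by simp
    have "(\<Sum>l<2 * d. T \<sigma> l) = (\<Sum>l<2 * d. T \<sigma> (\<sigma> l))" using sum.permute[OF s, of "T \<sigma>"] by (simp add: comp_def)
    also have "\<dots> = (\<Sum>j<d. \<Sum>a\<in>I. B a (e j) *
      (\<Prod>i<d. p (\<sigma> (2 * i)) ((e(j := a)) i) * q (\<sigma> (2 * i + 1)) (e i)))"
      unfolding split by (rule sum.cong[OF refl]) (use odd[OF s] even[OF s] in simp)
    finally show "of_int (sign \<sigma>) * (\<Sum>l<2 * d. T \<sigma> l) = of_int (sign \<sigma>) * (\<Sum>j<d. \<Sum>a\<in>I. B a (e j) *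
      (\<Prod>i<d. p (\<sigma> (2 * i)) ((e(j := a)) i) * q (\<sigma> (2 * i + 1)) (e i)))" by simp
  qed
  also have "\<dots> = (\<Sum>j<d. \<Sum>a\<in>I. B a (e j) * slot_sum d p q (e(j := a)) e)"
  proof -
    have "(\<Sum>\<sigma>\<in>P. s \<sigma> * (\<Sum>j<d. \<Sum>a\<in>I. b j a * G \<sigma> j a)) = (\<Sum>j<d. \<Sum>a\<in>I. b j a * (\<Sum>\<sigma>\<in>P. s \<sigma> * G \<sigma> j a))"
      for P :: "(nat \<Rightarrow> nat) set" and s :: "(nat \<Rightarrow> nat) \<Rightarrow> complex" and b G
    proof -
      have "(\<Sum>\<sigma>\<in>P. s \<sigma> * (\<Sum>j<d. \<Sum>a\<in>I. b j a * G \<sigma> j a)) = (\<Sum>\<sigma>\<in>P. \<Sum>j<d. \<Sum>a\<in>I. b j a * (s \<sigma> * G \<sigma> j a))"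
        by (simp add: sum_distrib_left mult_ac)
      also have "\<dots> = (\<Sum>j<d. \<Sum>\<sigma>\<in>P. \<Sum>a\<in>I. b j a * (s \<sigma> * G \<sigma> j a))" by (rule sum.swap)
      also have "\<dots> = (\<Sum>j<d. \<Sum>a\<in>I. \<Sum>\<sigma>\<in>P. b j a * (s \<sigma> * G \<sigma> j a))" by (rule sum.cong[OF refl], rule sum.swap)
      finally show ?thesis by (simp add: sum_distrib_left)
    qed
    then show ?thesis unfolding slot_sum_def .
  qed
  also have "\<dots> = (\<Sum>j<d. B (e j) (e j) * slot_sum d p q e e)"
  proof (rule sum.cong[OF refl])
    fix j assume j: "j \<in> {..<d}"
    have "B a (e j) * slot_sum d p q (e(j := a)) e = (if a = e j then B (e j) (e j) * slot_sum d p q e e else 0)" if a: "a \<in> I" for a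
    proof (cases "a = e j")
      case True
      then have "e(j := a) = e" by auto
      then show ?thesis using True by simp
    next
      case False
      obtain i where i: "i < d" "a = e i" using e a unfolding bij_betw_def by auto
      then have "i \<noteq> j" using False by auto
      then have "slot_sum d p q (e(j := a)) e = 0" by (intro slot_sum_repeated[of i d j]) (use i j in auto)
      then show ?thesis using False by simp
    qed
    then have "(\<Sum>a\<in>I. B a (e j) * slot_sum d p q (e(j := a)) e) = (\<Sum>a\<in>I. if a = e j then B (e j) (e j) * slot_sum d p q e e else 0)"
      by (rule sum.cong[OF refl])
    then show "(\<Sum>a\<in>I. B a (e j) * slot_sum d p q (e(j := a)) e) = B (e j) (e j) * slot_sum d p q e e"
      using eI j by simp
  qed
  also have "\<dots> = (\<Sum>j<d. B (e j) (e j)) * slot_sum d p q e e" by (simp add: sum_distrib_right)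
  also have "(\<Sum>j<d. B (e j) (e j)) = (\<Sum>a\<in>I. B a a)" by (rule sum.reindex_bij_betw[OF e])
  finally show ?thesis by (simp add: p_def[abs_def] q_def[abs_def] p'_def[abs_def] q'_def[abs_def])
qed

text \<open>The top coordinate form does not vanish on the coordinate frame.\<close>

lemma slot_sum_nonzero:
  fixes I :: "'k::finite set"
  assumes e: "bij_betw e {..<d} I"
  obtains vs :: "'k cvec list" where "length vs = 2 * d" "set vs \<subseteq> coord_space I \<times> coord_space I"
    "slot_sum d (\<lambda>m a. fst (vs ! m) $ a) (\<lambda>m a. snd (vs ! m) $ a) e e = 1"
proof -
  define w :: "nat \<Rightarrow> 'k cvec" where "w l = (if even l then (axis (e (l div 2)) 1, 0) else (0, axis (e (l div 2)) 1))" for l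
  define vs where "vs = map w [0..<2 * d]"
  have eI: "e i \<in> I" if "i < d" for i using bij_betwE[OF e] that by auto
  have einj: "e i = e j \<longleftrightarrow> i = j" if "i < d" "j < d" for i j using e that by (auto simp: bij_betw_def inj_on_def)
  have nth: "vs ! l = w l" if "l < 2 * d" for l using that by (simp add: vs_def)
  have "(\<Prod>i<d. fst (vs ! \<sigma> (2 * i)) $ e i * snd (vs ! \<sigma> (2 * i + 1)) $ e i) = (if \<sigma> = id then 1 else 0)"
    if s: "\<sigma> permutes {..<2 * d}" for \<sigma>
  proof (cases "\<sigma> = id")
    case True
    then show ?thesis by (auto simp: nth w_def intro!: prod.neutral)
  next
    case False
    have lt: "\<sigma> l < 2 * d" if "l < 2 * d" for l using permutes_in_image[OF s, of l] that by simp
    have "\<exists>i<d. \<sigma> (2 * i) \<noteq> 2 * i \<or> \<sigma> (2 * i + 1) \<noteq> 2 * i + 1"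
    proof (rule ccontr)
      assume "\<not> ?thesis"
      then have *: "\<sigma> (2 * i) = 2 * i" "\<sigma> (2 * i + 1) = 2 * i + 1" if "i < d" for i using that by auto
      have "\<sigma> l = l" for l
      proof (cases "l < 2 * d")
        case True
        then have "l div 2 < d" by auto
        then show ?thesis using *[of "l div 2"] by (cases "even l") (auto elim!: evenE oddE)
      qed (use permutes_not_in[OF s] in auto)
      then show False using False by auto
    qed
    then obtain i where i: "i < d" "\<sigma> (2 * i) \<noteq> 2 * i \<or> \<sigma> (2 * i + 1) \<noteq> 2 * i + 1" by blast
    have "fst (vs ! \<sigma> (2 * i)) $ e i * snd (vs ! \<sigma> (2 * i + 1)) $ e i = 0"
    proof -
      have 1: "fst (w l) $ e i = 0" if "l \<noteq> 2 * i" "l < 2 * d" for l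
      proof (cases "even l")
        case True
        then have "l div 2 \<noteq> i" "l div 2 < d" using that by auto
        then show ?thesis using True einj i(1) by (auto simp: w_def axis_def)
      qed (simp add: w_def)
      have 2: "snd (w l) $ e i = 0" if "l \<noteq> 2 * i + 1" "l < 2 * d" for l
      proof (cases "even l")
        case False
        then have "l div 2 \<noteq> i" "l div 2 < d" using that by (auto elim!: oddE)
        then show ?thesis using False einj i(1) by (auto simp: w_def axis_def)
      qed (simp add: w_def)
      have "\<sigma> (2 * i) < 2 * d" "\<sigma> (2 * i + 1) < 2 * d" using i(1) by (auto intro!: lt)
      then show ?thesis using 1[of "\<sigma> (2 * i)"] 2[of "\<sigma> (2 * i + 1)"] i(2) by (auto simp: nth)
    qed
    then show ?thesis using False i(1) by (auto intro!: prod_zero bexI[of _ i])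
  qed
  then have "slot_sum d (\<lambda>m a. fst (vs ! m) $ a) (\<lambda>m a. snd (vs ! m) $ a) e e
    = (\<Sum>\<sigma> | \<sigma> permutes {..<2 * d}. if \<sigma> = id then 1 else 0)"
    unfolding slot_sum_def by (intro sum.cong refl) auto
  also have "\<dots> = 1" by (simp add: permutes_id finite_permutations)
  finally have 1: "slot_sum d (\<lambda>m a. fst (vs ! m) $ a) (\<lambda>m a. snd (vs ! m) $ a) e e = 1" .
  show ?thesis
  proof (rule that[OF _ _ 1])
    show "length vs = 2 * d" by (simp add: vs_def)
    have "w l \<in> coord_space I \<times> coord_space I" if "l < 2 * d" for l
    proof -
      have "l div 2 < d" using that by auto
      then show ?thesis using eI by (auto simp: w_def) (auto simp: coord_space_def)
    qed
    moreover have "set vs = w ` {0..<2 * d}" by (simp add: vs_def)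
    ultimately show "set vs \<subseteq> coord_space I \<times> coord_space I" by (metis atLeastLessThan_iff image_subsetI)
  qed
qed

section \<open>Charts and transition maps\<close>

lemma cm_chart: "complex_manifold M \<Longrightarrow> c \<in> mcharts M \<Longrightarrow> is_chart (mtop M) (midx M) c"
  by (simp add: complex_manifold_def)

lemma chart_inj: "is_chart X I c \<Longrightarrow> inj_on (snd c) (fst c)"
  unfolding is_chart_def
  using homeomorphic_imp_injective_map[of "subtopology X (fst c)" _ "snd c"] openin_subset
  by (metis topspace_subtopology_subset)

lemma cinv_snd: "is_chart X I c \<Longrightarrow> q \<in> fst c \<Longrightarrow> cinv c (snd c q) = q"
  unfolding cinv_def using chart_inj by (rule inv_into_f_f)

lemma snd_cinv: "x \<in> cimage c \<Longrightarrow> snd c (cinv c x) = x"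
  unfolding cinv_def cimage_def by (rule f_inv_into_f)

lemma cinv_in: "x \<in> cimage c \<Longrightarrow> cinv c x \<in> fst c"
  unfolding cinv_def cimage_def by (rule inv_into_into)

lemma chart_topspace: "is_chart X I c \<Longrightarrow> fst c \<subseteq> topspace X"
  unfolding is_chart_def using openin_subset by blast

lemma chart_open_image:
  assumes "is_chart X I c" "openin X U"
  shows "copen I (snd c ` (fst c \<inter> U))"
proof -
  have h: "homeomorphic_map (subtopology X (fst c)) (top_of_set (cimage c)) (snd c)"
    and o: "copen I (cimage c)"
    using assms by (auto simp: is_chart_def)
  have "openin (subtopology X (fst c)) (fst c \<inter> U)"
    using assms(2) by (auto simp: openin_subtopology)
  then have "openin (top_of_set (cimage c)) (snd c ` (fst c \<inter> U))"
    using homeomorphic_imp_open_map[OF h] unfolding open_map_def by blast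
  then show ?thesis using o openin_trans by blast
qed

lemma continuous_map_cinv:
  assumes "is_chart X I c"
  shows "continuous_map (top_of_set (cimage c)) X (cinv c)"
proof -
  have h: "homeomorphic_map (subtopology X (fst c)) (top_of_set (cimage c)) (snd c)"
    using assms by (auto simp: is_chart_def)
  then obtain g where g: "homeomorphic_maps (subtopology X (fst c)) (top_of_set (cimage c)) (snd c) g"
    by (auto simp: homeomorphic_map_maps)
  have "g x = cinv c x" if "x \<in> cimage c" for x
  proof -
    have gx: "g x \<in> fst c" "snd c (g x) = x"
      using g that by (auto simp: homeomorphic_maps_def continuous_map_def)
    then show ?thesis using cinv_snd[OF assms gx(1)] by simp
  qed
  moreover have "continuous_map (top_of_set (cimage c)) X g"
    using g by (auto simp: homeomorphic_maps_def continuous_map_in_subtopology)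
  ultimately show ?thesis using continuous_map_eq[of "top_of_set (cimage c)" X g] by simp
qed

lemma continuous_map_chart:
  assumes "is_chart X I c"
  shows "continuous_map (subtopology X (fst c)) (top_of_set (cimage c)) (snd c)"
  using assms homeomorphic_imp_continuous_map by (auto simp: is_chart_def)

definition chart_map :: "('a, 'k::finite) chart \<Rightarrow> ('a, 'l::finite) chart \<Rightarrow> complex ^ 'k \<Rightarrow> complex ^ 'l" where
  "chart_map c c' x = snd c' (cinv c x)"

definition overlap :: "('a, 'k::finite) chart \<Rightarrow> ('a, 'l::finite) chart \<Rightarrow> (complex ^ 'k) set" where
  "overlap c c' = snd c ` (fst c \<inter> fst c')"

lemma overlap_subset: "overlap c c' \<subseteq> cimage c"
  by (auto simp: overlap_def cimage_def)

lemma overlap_memI: "q \<in> fst c \<Longrightarrow> q \<in> fst c' \<Longrightarrow> snd c q \<in> overlap c c'"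
  by (auto simp: overlap_def)

context
  fixes M :: "('a, 'k::finite) cman"
  assumes M: "complex_manifold M"
begin

lemma overlap_copen:
  assumes "c \<in> mcharts M" "c' \<in> mcharts M"
  shows "copen (midx M) (overlap c c')"
  unfolding overlap_def using chart_open_image[OF cm_chart[OF M assms(1)]] cm_chart[OF M assms(2)]
  by (auto simp: is_chart_def)

lemma overlap_cinv:
  assumes "c \<in> mcharts M" "x \<in> overlap c c'"
  shows "cinv c x \<in> fst c" "cinv c x \<in> fst c'" "snd c (cinv c x) = x"
  using assms cinv_snd[OF cm_chart[OF M assms(1)]] by (auto simp: overlap_def)

lemma trans_overlap:
  assumes "c \<in> mcharts M" "c' \<in> mcharts M" "x \<in> overlap c c'"
  shows "chart_map c c' x \<in> overlap c' c" "chart_map c' c (chart_map c c' x) = x" "cinv c' (chart_map c c' x) = cinv c x"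
proof -
  note i = overlap_cinv[OF assms(1,3)]
  show "chart_map c c' x \<in> overlap c' c" unfolding chart_map_def using i by (auto simp: overlap_def)
  show "cinv c' (chart_map c c' x) = cinv c x"
    unfolding chart_map_def using cinv_snd[OF cm_chart[OF M assms(2)] i(2)] .
  then show "chart_map c' c (chart_map c c' x) = x" using i(3) by (simp add: chart_map_def[of c' c])
qed

lemma trans_snd:
  assumes "c \<in> mcharts M" "q \<in> fst c"
  shows "chart_map c c' (snd c q) = snd c' q"
  using cinv_snd[OF cm_chart[OF M assms(1)] assms(2)] by (simp add: chart_map_def)

lemma trans_hol:
  assumes "c \<in> mcharts M" "c' \<in> mcharts M"
  shows "hol (midx M) (overlap c c') (\<lambda>x. chart_map c c' x $ j)"
proof -
  have "compatible (midx M) c c'" using M assms unfolding complex_manifold_def by blast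
  then have "holo_fun (midx M) (overlap c c') (\<lambda>x. chart_map c c' x $ j)"
    by (simp add: compatible_def holo_vec_def overlap_def chart_map_def comp_def)
  then show ?thesis using holo_fun_hol[OF overlap_copen[OF assms]] by simp
qed

lemma trans_smooth: "c \<in> mcharts M \<Longrightarrow> c' \<in> mcharts M \<Longrightarrow> smooth_in (midx M) (overlap c c') (chart_map c c')"
  using trans_hol hol_smooth smooth_vec by blast

lemma chart_exists: "q \<in> topspace (mtop M) \<Longrightarrow> \<exists>c\<in>mcharts M. q \<in> fst c"
proof -
  assume "q \<in> topspace (mtop M)"
  moreover have "\<Union> (fst ` mcharts M) = topspace (mtop M)" using M by (simp add: complex_manifold_def)
  ultimately show ?thesis by blast
qed

lemma cimage_copen: "c \<in> mcharts M \<Longrightarrow> copen (midx M) (cimage c)"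
  using cm_chart[OF M] by (auto simp: is_chart_def)

lemma trans_ddir:
  assumes "c \<in> mcharts M" "c' \<in> mcharts M" "x \<in> overlap c c'" "u \<in> coord_space (midx M)"
  shows "ddir u (chart_map c c') x $ b = (\<Sum>a\<in>midx M. u $ a * pd a (\<lambda>y. chart_map c c' y $ b) x)"
    and "ddir u (chart_map c c') x \<in> coord_space (midx M)"
    and "ddir (\<i> *s u) (chart_map c c') x = \<i> *s ddir u (chart_map c c') x"
proof -
  show "ddir u (chart_map c c') x $ b = (\<Sum>a\<in>midx M. u $ a * pd a (\<lambda>y. chart_map c c' y $ b) x)"
    using ddir_bounded_linear[OF bounded_linear_vec_nth trans_smooth[OF assms(1,2)] assms(3,4)]
      hol_ddir[OF trans_hol[OF assms(1,2)] assms(3,4)] by simp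
  have "chart_map c c' y \<in> coord_space (midx M)" if "y \<in> overlap c c'" for y
    using trans_overlap(1)[OF assms(1,2) that] overlap_subset[of c' c] copen_subset[OF cimage_copen[OF assms(2)]] by blast
  then show "ddir u (chart_map c c') x \<in> coord_space (midx M)"
    by (rule ddir_coord_space[OF trans_smooth[OF assms(1,2)] assms(3,4)])
  show "ddir (\<i> *s u) (chart_map c c') x = \<i> *s ddir u (chart_map c c') x"
    by (rule hol_vec_ddir_smult[OF trans_hol[OF assms(1,2)] assms(3,4)])
qed

end

section \<open>(1,1)-forms in coordinates\<close>

definition hsum :: "'k::finite set \<Rightarrow> ('k \<Rightarrow> 'k \<Rightarrow> complex) \<Rightarrow> complex ^ 'k \<Rightarrow> complex ^ 'k \<Rightarrow> complex" where
  "hsum I h u v = (\<Sum>a\<in>I. \<Sum>b\<in>I. h a b * u $ a * cnj (v $ b))"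

lemma form2_hsum: "form2 I h u v = \<i> * (hsum I h u v - hsum I h v u)"
proof -
  have "form2 I h u v = \<i> * (\<Sum>a\<in>I. \<Sum>b\<in>I. h a b * u $ a * cnj (v $ b) - h a b * v $ a * cnj (u $ b))"
    unfolding form2_def cform_def realvec_def by (simp add: algebra_simps)
  then show ?thesis by (simp add: hsum_def sum_subtractf)
qed

lemma hsum_smult: "hsum I h (c *s u) v = c * hsum I h u v" "hsum I h u (c *s v) = cnj c * hsum I h u v"
  by (simp_all add: hsum_def sum_distrib_left mult_ac)

lemma hsum_form2: "hsum I h u v = (form2 I h u (\<i> *s v) - \<i> * form2 I h u v) / 2"
  by (simp add: form2_hsum hsum_smult algebra_simps)

lemma hsum_axis:
  assumes "a \<in> I" "b \<in> I"
  shows "hsum I h (axis a 1) (axis b 1) = h a b"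
proof -
  have "(\<Sum>d\<in>I. h c d * axis a 1 $ c * cnj (axis b 1 $ d)) = (\<Sum>d\<in>I. if d = b then (if c = a then h a b else 0) else 0)" for c
    by (rule sum.cong) (auto simp: axis_def)
  then show ?thesis unfolding hsum_def using assms by simp
qed

lemma hsum_cnj:
  assumes "\<And>a b. a \<in> I \<Longrightarrow> b \<in> I \<Longrightarrow> h b a = cnj (h a b)"
  shows "hsum I h v u = cnj (hsum I h u v)"
proof -
  have "cnj (hsum I h u v) = (\<Sum>a\<in>I. \<Sum>b\<in>I. h b a * v $ b * cnj (u $ a))"
    unfolding hsum_def cnj_sum
  proof (intro sum.cong refl)
    fix a b assume "a \<in> I" "b \<in> I"
    then have "h b a = cnj (h a b)" by (rule assms)
    then show "cnj (h a b * u $ a * cnj (v $ b)) = h b a * v $ b * cnj (u $ a)" by simp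
  qed
  also have "\<dots> = hsum I h v u" unfolding hsum_def by (rule sum.swap)
  finally show ?thesis by simp
qed

lemma kmetric_hsum:
  assumes "\<And>a b. a \<in> I \<Longrightarrow> b \<in> I \<Longrightarrow> h b a = cnj (h a b)"
  shows "kmetric I h u v = 2 * Re (hsum I h u v)"
proof -
  have "hsum I h v u = cnj (hsum I h u v)" by (rule hsum_cnj) (rule assms)
  then show ?thesis unfolding kmetric_def form2_hsum hsum_smult by simp
qed

text \<open>Transformation law of the coefficient matrix and of its determinant under a map that preserves the
  form and is holomorphic in coordinates.\<close>

lemma pullback_coefficients:
  fixes F :: "complex ^ 'k::finite \<Rightarrow> complex ^ 'k"
  assumes hol: "\<And>j. hol I S (\<lambda>x. F x $ j)" and x: "x \<in> S"
    and pres: "\<And>u v. u \<in> coord_space I \<Longrightarrow> v \<in> coord_space I \<Longrightarrow> form2 I h' (ddir u F x) (ddir v F x) = form2 I h u v"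
    and ab: "a \<in> I" "b \<in> I"
  shows "h a b = (\<Sum>k\<in>I. \<Sum>l\<in>I. h' k l * pd a (\<lambda>y. F y $ k) x * cnj (pd b (\<lambda>y. F y $ l) x))"
proof -
  have ax: "axis a 1 \<in> coord_space I" "axis b 1 \<in> coord_space I" "\<i> *s axis b 1 \<in> coord_space I"
    using ab by (auto intro: coord_space_smult)
  have "h a b = hsum I h (axis a 1) (axis b 1)" using hsum_axis[OF ab] by simp
  also have "\<dots> = hsum I h' (ddir (axis a 1) F x) (ddir (axis b 1) F x)"
    unfolding hsum_form2 using pres[OF ax(1,2)] pres[OF ax(1,3)] hol_vec_ddir_smult[OF hol x ax(2), of \<i>] by simp
  also have "\<dots> = (\<Sum>k\<in>I. \<Sum>l\<in>I. h' k l * pd a (\<lambda>y. F y $ k) x * cnj (pd b (\<lambda>y. F y $ l) x))"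
    unfolding hol_vec_ddir(1)[OF hol x ab(1)] hol_vec_ddir(1)[OF hol x ab(2)] by (simp add: hsum_def)
  finally show ?thesis .
qed

lemma pullback_det:
  assumes "\<And>a b. a \<in> I \<Longrightarrow> b \<in> I \<Longrightarrow> h a b = (\<Sum>k\<in>I. \<Sum>l\<in>I. h' k l * A k a * cnj (A l b))"
  shows "det_on I h = det_on I A * cnj (det_on I A) * det_on I h'"
proof -
  have "det_on I h = det_on I (\<lambda>a b. \<Sum>k\<in>I. (\<lambda>a k. A k a) a k * (\<lambda>k b. \<Sum>l\<in>I. h' k l * cnj (A l b)) k b)"
    by (rule det_on_cong) (simp add: assms sum_distrib_left mult_ac)
  also have "\<dots> = det_on I (\<lambda>a k. A k a) * det_on I (\<lambda>k b. \<Sum>l\<in>I. h' k l * cnj (A l b))"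
    by (rule det_on_mult)
  also have "det_on I (\<lambda>k b. \<Sum>l\<in>I. h' k l * cnj (A l b)) = det_on I h' * det_on I (\<lambda>a b. cnj (A a b))"
    by (rule det_on_mult)
  finally show ?thesis unfolding det_on_cnj det_on_transpose[of I A] by (simp add: mult_ac)
qed

lemma preserves_trans:
  assumes M: "complex_manifold M" and "preserves_form M \<omega> id" "c \<in> mcharts M" "c' \<in> mcharts M" "x \<in> overlap c c'"
    "u \<in> coord_space (midx M)" "v \<in> coord_space (midx M)"
  shows "form2 (midx M) (\<omega> c' (chart_map c c' x)) (ddir u (chart_map c c') x) (ddir v (chart_map c c') x) = form2 (midx M) (\<omega> c x) u v"
proof -
  have q: "cinv c x \<in> fst c" "cinv c x \<in> fst c'" "snd c (cinv c x) = x" using overlap_cinv[OF M assms(3,5)] by auto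
  have eq: "snd c' \<circ> id \<circ> cinv c = chart_map c c'" by (auto simp: chart_map_def)
  have "id (cinv c x) \<in> fst c'" using q(2) by simp
  from assms(2)[unfolded preserves_form_def Let_def eq, rule_format, OF assms(3,4) q(1) this assms(6,7)]
  show ?thesis unfolding q(3) eq .
qed

section \<open>Divergence in coordinates\<close>

text \<open>The divergence of a holomorphic vector field \<open>\<zeta>\<close> with respect to the volume form with density \<open>D\<close>.\<close>

definition coord_div :: "'k::finite set \<Rightarrow> (complex ^ 'k \<Rightarrow> complex) \<Rightarrow> (complex ^ 'k \<Rightarrow> complex ^ 'k) \<Rightarrow> complex ^ 'k \<Rightarrow> complex" where
  "coord_div I D \<zeta> x = (\<Sum>a\<in>I. pd a (\<lambda>y. \<zeta> y $ a) x) + (\<Sum>a\<in>I. \<zeta> x $ a * pd a D x) / D x"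

text \<open>The product rule for density times coordinate form: the density is differentiated along the field, and the
  coordinate form contributes the trace of the derivative of the field.\<close>

lemma lie_derivative_volume:
  fixes I :: "'k::finite set"
  assumes x: "x \<in> S" and h: "\<And>a b. a \<in> I \<Longrightarrow> b \<in> I \<Longrightarrow> smooth_in I S (\<lambda>y. h y a b)" and o: "copen I S"
    and Z: "\<And>b. b \<in> I \<Longrightarrow> hol I S (\<lambda>y. fst (Z y) $ b)" "\<And>y. snd (Z y) = 0"
    and len: "length vs = 2 * card I" and nz: "det_on I (h x) \<noteq> 0"
  shows "lie_derivative I Z (\<lambda>y. wedge_power (card I) (cform I (h y))) x vs
    = coord_div I (\<lambda>y. det_on I (h y)) (\<lambda>y. fst (Z y)) x * wedge_power (card I) (cform I (h x)) vs"
proof -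
  define d where "d = card I"
  obtain e where e: "bij_betw e {..<d} I"
    using ex_bij_betw_nat_finite[of I] by (auto simp: d_def atLeast0LessThan)
  define C where "C = \<i> ^ d * of_nat (fact d)"
  define K where "K vs = slot_sum d (\<lambda>l a. fst (vs ! l) $ a) (\<lambda>l a. snd (vs ! l) $ a) e e" for vs :: "'k cvec list"
  have w: "wedge_power d (cform I h') ws = C * det_on I h' * K ws" for h' ws
    unfolding C_def K_def by (rule wedge_power_cform[OF e])
  have sd: "smooth_in I S (\<lambda>y. det_on I (h y))" by (rule smooth_det_on[OF o h])
  have "cdir I (Z x) (\<lambda>y. wedge_power d (cform I (h y)) vs) x = (\<Sum>a\<in>I. fst (Z x) $ a * pd a (\<lambda>y. (C * K vs) * det_on I (h y)) x)"
    unfolding cdir_def w Z(2) by (simp add: mult_ac)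
  also have "\<dots> = (\<Sum>a\<in>I. fst (Z x) $ a * pd a (\<lambda>y. det_on I (h y)) x) * (C * K vs)"
  proof -
    have "pd a (\<lambda>y. (C * K vs) * det_on I (h y)) x = (C * K vs) * pd a (\<lambda>y. det_on I (h y)) x" if "a \<in> I" for a
      by (rule wirtinger_cmult(1)[OF sd x that])
    then show ?thesis unfolding sum_distrib_right by (intro sum.cong refl) (simp only: mult_ac)
  qed
  finally have 1: "cdir I (Z x) (\<lambda>y. wedge_power d (cform I (h y)) vs) x
    = (\<Sum>a\<in>I. fst (Z x) $ a * pd a (\<lambda>y. det_on I (h y)) x) * (C * K vs)" .
  have A1: "fst (cdir_field I v Z x) $ b = (\<Sum>a\<in>I. fst v $ a * pd a (\<lambda>y. fst (Z y) $ b) x)" if "b \<in> I" for v b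
    using hol_pdbar[OF Z(1)[OF that] x] by (simp add: cdir_field_def cdir_def)
  have A2: "snd (cdir_field I v Z x) = 0" for v
    by (simp add: cdir_field_def cdir_def Z(2) vec_eq_iff)
  have "(\<Sum>l<2 * d. K (vs[l := cdir_field I (vs ! l) Z x])) = (\<Sum>a\<in>I. pd a (\<lambda>y. fst (Z y) $ a) x) * K vs"
    unfolding K_def
    by (rule slot_sum_trace[OF e _ A1 A2]) (use len in \<open>simp_all add: d_def\<close>)
  then have 2: "(\<Sum>l<length vs. wedge_power d (cform I (h x)) (vs[l := cdir_field I (vs ! l) Z x]))
    = C * det_on I (h x) * ((\<Sum>a\<in>I. pd a (\<lambda>y. fst (Z y) $ a) x) * K vs)"
    unfolding w len d_def[symmetric] by (simp add: sum_distrib_left[symmetric])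
  have "lie_derivative I Z (\<lambda>y. wedge_power d (cform I (h y))) x vs
    = (\<Sum>a\<in>I. fst (Z x) $ a * pd a (\<lambda>y. det_on I (h y)) x) * (C * K vs)
      + C * det_on I (h x) * ((\<Sum>a\<in>I. pd a (\<lambda>y. fst (Z y) $ a) x) * K vs)"
    unfolding lie_derivative_def 1 2 ..
  then show ?thesis unfolding d_def[symmetric] coord_div_def w[of "h x"]
    using nz by (simp add: field_simps)
qed

text \<open>The factor in the definition of the divergence is unique because \<open>\<omega>\<^sup>d\<close> does not vanish.\<close>

lemma divergence_eqI:
  fixes M :: "('a, 'k::finite) cman"
  assumes M: "complex_manifold M" and q: "q \<in> topspace (mtop M)"
    and h: "\<And>c a b. c \<in> mcharts M \<Longrightarrow> a \<in> midx M \<Longrightarrow> b \<in> midx M \<Longrightarrow> smooth_in (midx M) (cimage c) (\<lambda>y. \<omega> c y a b)"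
    and nz: "\<And>c x. c \<in> mcharts M \<Longrightarrow> x \<in> cimage c \<Longrightarrow> det_on (midx M) (\<omega> c x) \<noteq> 0"
    and Z: "\<And>c. c \<in> mcharts M \<Longrightarrow> q \<in> fst c \<Longrightarrow> \<exists>S. S \<subseteq> cimage c \<and> snd c q \<in> S \<and> copen (midx M) S \<and>
        (\<forall>b\<in>midx M. hol (midx M) S (\<lambda>y. fst (Z c y) $ b))"
      "\<And>c y. snd (Z c y) = 0"
    and \<delta>: "\<And>c. c \<in> mcharts M \<Longrightarrow> q \<in> fst c \<Longrightarrow>
      coord_div (midx M) (\<lambda>y. det_on (midx M) (\<omega> c y)) (\<lambda>y. fst (Z c y)) (snd c q) = \<delta>"
  shows "divergence M \<omega> Z q = \<delta>"
proof -
  let ?I = "midx M"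
  have L: "lie_derivative ?I (Z c) (\<lambda>y. wedge_power (card ?I) (cform ?I (\<omega> c y))) (snd c q) vs
    = \<delta> * wedge_power (card ?I) (cform ?I (\<omega> c (snd c q))) vs"
    if c: "c \<in> mcharts M" "q \<in> fst c" and len: "length vs = 2 * card ?I" for c vs
  proof -
    obtain S where S: "S \<subseteq> cimage c" "snd c q \<in> S" "copen ?I S" "\<And>b. b \<in> ?I \<Longrightarrow> hol ?I S (\<lambda>y. fst (Z c y) $ b)"
      using Z(1)[OF c] by blast
    have "lie_derivative ?I (Z c) (\<lambda>y. wedge_power (card ?I) (cform ?I (\<omega> c y))) (snd c q) vs
      = coord_div ?I (\<lambda>y. det_on ?I (\<omega> c y)) (\<lambda>y. fst (Z c y)) (snd c q) * wedge_power (card ?I) (cform ?I (\<omega> c (snd c q))) vs"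
      by (rule lie_derivative_volume[OF S(2) _ S(3,4) Z(2) len])
        (use smooth_subset[OF h[OF c(1)] S(3,1)] nz[OF c(1)] S in auto)
    then show ?thesis using \<delta>[OF c] by simp
  qed
  obtain c where c: "c \<in> mcharts M" "q \<in> fst c" using chart_exists[OF M q] by blast
  obtain e where e: "bij_betw e {..<card ?I} ?I"
    using ex_bij_betw_nat_finite[of ?I] by (auto simp: atLeast0LessThan)
  obtain vs :: "'k cvec list" where vs: "length vs = 2 * card ?I" "set vs \<subseteq> coord_space ?I \<times> coord_space ?I"
    "slot_sum (card ?I) (\<lambda>m a. fst (vs ! m) $ a) (\<lambda>m a. snd (vs ! m) $ a) e e = 1"
    using slot_sum_nonzero[OF e] by blast
  have "snd c q \<in> cimage c" using c by (auto simp: cimage_def)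
  then have w: "wedge_power (card ?I) (cform ?I (\<omega> c (snd c q))) vs \<noteq> 0"
    using nz[OF c(1)] by (simp add: wedge_power_cform[OF e] vs(3))
  show ?thesis
    unfolding divergence_def Let_def
  proof (rule the_equality)
    show "\<forall>c\<in>mcharts M. q \<in> fst c \<longrightarrow> (\<forall>vs. length vs = 2 * card ?I \<and> set vs \<subseteq> coord_space ?I \<times> coord_space ?I \<longrightarrow>
      lie_derivative ?I (Z c) (\<lambda>y. wedge_power (card ?I) (cform ?I (\<omega> c y))) (snd c q) vs
      = \<delta> * wedge_power (card ?I) (cform ?I (\<omega> c (snd c q))) vs)" using L by blast
    fix \<delta>' assume "\<forall>c\<in>mcharts M. q \<in> fst c \<longrightarrow> (\<forall>vs. length vs = 2 * card ?I \<and> set vs \<subseteq> coord_space ?I \<times> coord_space ?I \<longrightarrow>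
      lie_derivative ?I (Z c) (\<lambda>y. wedge_power (card ?I) (cform ?I (\<omega> c y))) (snd c q) vs
      = \<delta>' * wedge_power (card ?I) (cform ?I (\<omega> c (snd c q))) vs)"
    then have "\<delta>' * wedge_power (card ?I) (cform ?I (\<omega> c (snd c q))) vs = \<delta> * wedge_power (card ?I) (cform ?I (\<omega> c (snd c q))) vs"
      using c vs(1,2) L[OF c vs(1)] by fastforce
    then show "\<delta>' = \<delta>" using w by simp
  qed
qed

text \<open>In a chart \<open>E\<close> where the field is \<open>\<partial>/\<partial>x\<^sub>i\<close> the divergence is the logarithmic derivative of \<open>det h\<close>;
  Jacobi's formula for the determinant of the transition map shows that every other chart yields the same.\<close>

lemma coord_div_transition:
  fixes M :: "('a, 'k::finite) cman"
  assumes M: "complex_manifold M" and c: "c \<in> mcharts M" and E: "E \<in> mcharts M"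
    and pres: "preserves_form M \<omega> id"
    and h: "\<And>c a b. c \<in> mcharts M \<Longrightarrow> a \<in> midx M \<Longrightarrow> b \<in> midx M \<Longrightarrow> smooth_in (midx M) (cimage c) (\<lambda>y. \<omega> c y a b)"
    and nz: "\<And>c x. c \<in> mcharts M \<Longrightarrow> x \<in> cimage c \<Longrightarrow> det_on (midx M) (\<omega> c x) \<noteq> 0"
    and i: "i \<in> midx M" and x: "x \<in> overlap E c"
    and Z: "\<And>y b. y \<in> overlap c E \<Longrightarrow> b \<in> midx M \<Longrightarrow> \<zeta> y $ b = pd i (\<lambda>z. chart_map E c z $ b) (chart_map c E y)"
  shows "coord_div (midx M) (\<lambda>y. det_on (midx M) (\<omega> c y)) \<zeta> (chart_map E c x)
      = pd i (\<lambda>y. det_on (midx M) (\<omega> E y)) x / det_on (midx M) (\<omega> E x)"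
    and "\<And>b. b \<in> midx M \<Longrightarrow> hol (midx M) (overlap c E) (\<lambda>y. \<zeta> y $ b)"
proof -
  let ?I = "midx M" and ?S = "overlap E c" and ?F = "chart_map E c"
  note o = overlap_copen[OF M E c] and o' = overlap_copen[OF M c E]
  note Fhol = trans_hol[OF M E c] and Ghol = trans_hol[OF M c E]
  show Zhol: "hol ?I (overlap c E) (\<lambda>y. \<zeta> y $ b)" if "b \<in> ?I" for b
  proof (rule hol_cong)
    show "hol ?I (overlap c E) (\<lambda>y. pd i (\<lambda>z. ?F z $ b) (chart_map c E y))"
      by (rule hol_compose[OF Ghol hol_pd[OF Fhol i] trans_overlap(1)[OF M c E]])
  qed (use Z that in auto)
  define A where "A y d b = pd b (\<lambda>z. ?F z $ d) y" for y d b
  define B where "B d a = pd a (\<lambda>y. \<zeta> y $ d) (?F x)" for d a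
  define j where "j y = det_on ?I (A y)" for y
  define Dc where "Dc y = det_on ?I (\<omega> c y)" for y
  have ZF: "\<zeta> (?F y) $ b = pd i (\<lambda>z. ?F z $ b) y" if "y \<in> ?S" "b \<in> ?I" for y b
    using Z[OF trans_overlap(1)[OF M E c that(1)] that(2)] trans_overlap(2)[OF M E c that(1)] by simp
  have Ahol: "hol ?I ?S (\<lambda>y. A y d b)" if "b \<in> ?I" for d b
    unfolding A_def by (rule hol_pd[OF Fhol that])
  have jhol: "hol ?I ?S j" unfolding j_def by (rule hol_det_on[OF o Ahol])
  have dj: "pd i j x = (\<Sum>d\<in>?I. B d d) * j x"
  proof -
    \<comment> \<open>Differentiate \<open>\<zeta> \<circ> F = \<partial>F/\<partial>x\<^sub>i\<close> by \<open>x\<^sub>b\<close>.\<close>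
    have A': "pd i (\<lambda>y. A y d b) x = (\<Sum>a\<in>?I. B d a * A x a b)" if "d \<in> ?I" "b \<in> ?I" for d b
    proof -
      have "pd i (\<lambda>y. A y d b) x = pd b (pd i (\<lambda>z. ?F z $ d)) x"
        unfolding A_def using wirtinger_symmetric(1)[OF hol_smooth[OF Fhol] x i that(2)] by simp
      also have "\<dots> = pd b (\<lambda>y. \<zeta> (?F y) $ d) x"
        by (rule wirtinger_cong(1)[OF x that(2) o]) (use ZF that in auto)
      also have "\<dots> = (\<Sum>a\<in>?I. pd b (\<lambda>y. ?F y $ a) x * pd a (\<lambda>y. \<zeta> y $ d) (?F x))"
        by (rule wirtinger_compose(1)[OF Fhol hol_smooth[OF Zhol[OF that(1)]] trans_overlap(1)[OF M E c] x that(2)])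
      finally show ?thesis by (simp add: A_def B_def mult.commute)
    qed
    have "pd i j x = (\<Sum>k\<in>?I. det_on ?I (\<lambda>a b. if a = k then pd i (\<lambda>y. A y a b) x else A x a b))"
      unfolding j_def by (rule wirtinger_det_on[OF x i o hol_smooth[OF Ahol]])
    also have "\<dots> = (\<Sum>d\<in>?I. B d d) * j x"
      unfolding j_def by (rule det_on_jacobi[OF A'])
    finally show ?thesis .
  qed
  have hE: "det_on ?I (\<omega> E y) = j y * (cnj (j y) * Dc (?F y))" if y: "y \<in> ?S" for y
  proof -
    have "det_on ?I (\<omega> E y) = det_on ?I (A y) * cnj (det_on ?I (A y)) * det_on ?I (\<omega> c (?F y))"
    proof (rule pullback_det)
      fix a b assume ab: "a \<in> ?I" "b \<in> ?I"
      show "\<omega> E y a b = (\<Sum>k\<in>?I. \<Sum>l\<in>?I. \<omega> c (?F y) k l * A y k a * cnj (A y l b))"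
        unfolding A_def by (rule pullback_coefficients[OF Fhol y preserves_trans[OF M pres E c y] ab])
    qed
    then show ?thesis by (simp add: j_def Dc_def mult.assoc)
  qed
  have Dsm: "smooth_in ?I (overlap c E) Dc"
    unfolding Dc_def by (rule smooth_det_on[OF o' smooth_subset[OF h[OF c] o' overlap_subset]])
  have DFsm: "smooth_in ?I ?S (\<lambda>y. Dc (?F y))"
    by (rule smooth_compose[OF trans_smooth[OF M E c] Dsm trans_overlap(1)[OF M E c]])
  have jsm: "smooth_in ?I ?S j" using hol_smooth[OF jhol] .
  have cj: "pd i (\<lambda>y. cnj (j y)) x = 0" using wirtinger_cnj(1)[OF x i jsm] hol_pdbar[OF jhol x i] by simp
  have DF: "pd i (\<lambda>y. Dc (?F y)) x = (\<Sum>a\<in>?I. \<zeta> (?F x) $ a * pd a Dc (?F x))"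
    using wirtinger_compose(1)[OF Fhol Dsm trans_overlap(1)[OF M E c] x i] ZF[OF x] by simp
  have "pd i (\<lambda>y. det_on ?I (\<omega> E y)) x = pd i (\<lambda>y. j y * (cnj (j y) * Dc (?F y))) x"
    by (rule wirtinger_cong(1)[OF x i o hE])
  also have "\<dots> = j x * (cnj (j x) * (\<Sum>a\<in>?I. \<zeta> (?F x) $ a * pd a Dc (?F x))) + (\<Sum>d\<in>?I. B d d) * j x * (cnj (j x) * Dc (?F x))"
    unfolding wirtinger_mult(1)[OF x i jsm smooth_mult[OF smooth_cnj[OF jsm] DFsm]] wirtinger_mult(1)[OF x i smooth_cnj[OF jsm] DFsm] cj dj DF
    by simp
  finally have num: "pd i (\<lambda>y. det_on ?I (\<omega> E y)) x = j x * (cnj (j x) * (\<Sum>a\<in>?I. \<zeta> (?F x) $ a * pd a Dc (?F x))) + (\<Sum>d\<in>?I. B d d) * j x * (cnj (j x) * Dc (?F x))" .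
  have "det_on ?I (\<omega> E x) \<noteq> 0" using nz[OF E] x overlap_subset by blast
  then have "j x \<noteq> 0" "Dc (?F x) \<noteq> 0" using hE[OF x] by auto
  then show "coord_div ?I (\<lambda>y. det_on ?I (\<omega> c y)) \<zeta> (?F x) = pd i (\<lambda>y. det_on ?I (\<omega> E y)) x / det_on ?I (\<omega> E x)"
    unfolding num hE[OF x] coord_div_def Dc_def[symmetric] Dc_def[abs_def, symmetric] B_def by (simp add: field_simps)
qed

section \<open>Dimension\<close>

lemma dim_coord_space: "dim (coord_space (I :: 'k::finite set)) = 2 * card I"
proof -
  have B: "real_dirs I \<subseteq> Basis" by (auto simp: real_dirs_def Basis_vec_def Basis_complex_def)
  have "coord_space I = {x. \<forall>i\<in>Basis. i \<notin> real_dirs I \<longrightarrow> x \<bullet> i = 0}"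
  proof (intro equalityI subsetI)
    fix x assume x: "x \<in> coord_space I"
    show "x \<in> {x. \<forall>i\<in>Basis. i \<notin> real_dirs I \<longrightarrow> x \<bullet> i = 0}"
    proof (intro CollectI ballI impI)
      fix i :: "complex ^ 'k" assume "i \<in> Basis" "i \<notin> real_dirs I"
      then obtain a u where "i = axis a u" "a \<notin> I" by (auto simp: Basis_vec_def Basis_complex_def real_dirs_def)
      then show "x \<bullet> i = 0" using x by (simp add: inner_axis coord_space_def)
    qed
  next
    fix x assume x: "x \<in> {x. \<forall>i\<in>Basis. i \<notin> real_dirs I \<longrightarrow> x \<bullet> i = 0}"
    have "x $ a = 0" if "a \<notin> I" for a
    proof -
      have "axis a 1 \<notin> real_dirs I" "axis a \<i> \<notin> real_dirs I"
        using that by (auto simp: real_dirs_def axis_eq_axis)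
      then have "x \<bullet> axis a 1 = 0" "x \<bullet> axis a \<i> = 0"
        using x by (auto simp: Basis_vec_def Basis_complex_def)
      then show ?thesis by (simp add: inner_axis complex_eq_iff)
    qed
    then show "x \<in> coord_space I" by (simp add: coord_space_def)
  qed
  then have "dim (coord_space I) = card (real_dirs I)" using dim_substandard[OF B] by simp
  also have "\<dots> = card ((\<lambda>a. axis a (1::complex) :: complex ^ 'k) ` I) + card ((\<lambda>a. axis a \<i> :: complex ^ 'k) ` I)"
    unfolding real_dirs_def by (rule card_Un_disjoint) (auto simp: axis_eq_axis)
  also have "\<dots> = 2 * card I"
    by (simp add: card_image inj_on_def axis_eq_axis)
  finally show ?thesis .
qed

text \<open>The derivative of \<open>f\<close> at \<open>x\<close> is an injective real linear map of \<open>\<complex>\<^sup>I\<close> into \<open>\<complex>\<^sup>J\<close>.\<close>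

lemma card_le_of_local_inverse:
  fixes f :: "complex ^ 'k::finite \<Rightarrow> complex ^ 'l::finite"
  assumes f: "smooth_in I S f" and g: "smooth_in J T g" and x: "x \<in> S"
    and fT: "\<And>x. x \<in> S \<Longrightarrow> f x \<in> T" and gf: "\<And>x. x \<in> S \<Longrightarrow> g (f x) = x"
  shows "card I \<le> card J"
proof -
  define D where "D v = ddir (cproj I v) f x" for v
  have lin: "linear D" unfolding D_def using has_derivative_linear[OF smooth_ddir_derivative[OF f x]] .
  have TJ: "T \<subseteq> coord_space J" using copen_subset[OF smooth_open[OF g]] .
  have inv: "ddir (D v) g (f x) = v" if v: "v \<in> coord_space I" for v
  proof -
    have "ddir (ddir v f x) g (f x) = ddir v (\<lambda>y. g (f y)) x"
      using ddir_compose[OF f g fT x v] by simp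
    also have "\<dots> = ddir v (\<lambda>y. y) x" by (rule ddir_cong[OF smooth_open[OF f] x v gf])
    also have "\<dots> = v" by (rule ddir_linear_fun[OF bounded_linear_ident])
    finally show ?thesis using v by (simp add: D_def cproj_id)
  qed
  have span: "span (coord_space I) = coord_space I"
    by (rule span_eq_iff[THEN iffD2])
      (auto simp: subspace_def coord_space_add coord_space_scaleR, simp add: coord_space_def)
  have "inj_on D (coord_space I)" using inv by (metis inj_onI)
  then have "dim (D ` coord_space I) = dim (coord_space I)"
    using dim_image_eq[OF lin, of "coord_space I"] span by simp
  moreover have "D ` coord_space I \<subseteq> coord_space J"
  proof (rule image_subsetI)
    fix v assume v: "v \<in> coord_space I"
    have "f y \<in> coord_space J" if "y \<in> S" for y using fT[OF that] TJ by blast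
    then show "D v \<in> coord_space J" unfolding D_def cproj_id[OF v] by (rule ddir_coord_space[OF f x v])
  qed
  ultimately have "dim (coord_space I) \<le> dim (coord_space J)" by (metis dim_subset)
  then show ?thesis by (simp add: dim_coord_space)
qed

section \<open>Trivialisations of the principal bundle\<close>

locale kaehler_bundle =
  fixes M :: "('m, 'd::finite) cman"
    and B :: "('b, 'r::finite) cman"
    and \<pi> :: "'m \<Rightarrow> 'b"
    and act :: "complex ^ 'n::finite \<Rightarrow> 'm \<Rightarrow> 'm"
    and \<omega> :: "('m, 'd) form11"
    and \<Phi> :: "'m \<Rightarrow> real ^ 'n"
  assumes M: "complex_manifold M" and B: "complex_manifold B"
    and principal: "principal_bundle M B \<pi> act"
    and invariant: "\<And>t. t \<in> T_compact \<Longrightarrow> preserves_form M \<omega> (act t)"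
    and moment: "moment_map M act \<omega> \<Phi>"
    and kaehler: "kaehler_form M \<omega>"
begin

lemma pi_continuous: "continuous_map (mtop M) (mtop B) \<pi>"
  using principal by (simp add: principal_bundle_def holomorphic_map_def)

lemma pi_top: "q \<in> topspace (mtop M) \<Longrightarrow> \<pi> q \<in> topspace (mtop B)"
  using continuous_map_image_subset_topspace[OF pi_continuous] by blast

lemma pi_act: "a \<in> T_complex \<Longrightarrow> q \<in> topspace (mtop M) \<Longrightarrow> \<pi> (act a q) = \<pi> q"
  using principal by (simp add: principal_bundle_def)

lemma act_1: "q \<in> topspace (mtop M) \<Longrightarrow> act 1 q = q"
  using principal by (simp add: principal_bundle_def)

lemma act_top: "a \<in> T_complex \<Longrightarrow> q \<in> topspace (mtop M) \<Longrightarrow> act a q \<in> topspace (mtop M)"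
proof -
  assume a: "a \<in> T_complex" and q: "q \<in> topspace (mtop M)"
  have "continuous_map (prod_topology (top_of_set T_complex) (mtop M)) (mtop M) (\<lambda>(a, q). act a q)"
    using principal by (simp add: principal_bundle_def holomorphic_map_def prod_man_def T_complex_man_def)
  from continuous_map_image_subset_topspace[OF this]
  have "(\<lambda>(a, q). act a q) (a, q) \<in> topspace (mtop M)" using a q by (force simp del: case_prod_conv)
  then show ?thesis by simp
qed

end

locale trivialization = kaehler_bundle M B \<pi> act \<omega> \<Phi>
  for M :: "('m, 'd::finite) cman"
    and B :: "('b, 'r::finite) cman"
    and \<pi> :: "'m \<Rightarrow> 'b"
    and act :: "complex ^ 'n::finite \<Rightarrow> 'm \<Rightarrow> 'm"
    and \<omega> :: "('m, 'd) form11"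
    and \<Phi> :: "'m \<Rightarrow> real ^ 'n" +
  fixes V :: "'b set" and \<tau> :: "'m \<Rightarrow> (complex ^ 'n) \<times> 'b" and e :: "('b, 'r) chart"
  assumes V: "openin (mtop B) V"
    and biholo: "biholomorphic_map (open_sub M (\<pi> -` V)) (prod_man T_complex_man (open_sub B V)) \<tau>"
    and tau_act: "\<And>q. q \<in> topspace (mtop M) \<inter> \<pi> -` V \<Longrightarrow> snd (\<tau> q) = \<pi> q \<and> (\<forall>a\<in>T_complex. \<tau> (act a q) = (a * fst (\<tau> q), \<pi> q))"
    and e: "e \<in> mcharts B"
begin

text \<open>Two neighbourhoods are in play on the base, the domain \<open>V\<close> of the trivialisation and the domain of the chart
  \<open>e\<close>.  The sets \<open>U\<close> and \<open>W\<close> and, further below, \<open>QU\<close> belong to their intersection, \<open>Q\<close> belongs to \<open>V\<close>.\<close>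

definition "Q = topspace (mtop M) \<inter> \<pi> -` V"
definition "U = fst e \<inter> V"
definition "W = snd e ` U"
definition "tinv = inv_into Q \<tau>"

lemma V_top: "V \<subseteq> topspace (mtop B)" using V openin_subset by blast

lemma e_chart: "is_chart (mtop B) (midx B) e" using cm_chart[OF B e] .

lemma U_open: "openin (mtop B) U"
  unfolding U_def using e_chart V by (auto simp: is_chart_def)

lemma W_copen: "copen (midx B) W"
  unfolding W_def U_def using chart_open_image[OF e_chart V] .

lemma Q_open: "openin (mtop M) Q"
proof -
  have "Q = {q \<in> topspace (mtop M). \<pi> q \<in> V}" by (auto simp: Q_def)
  then show ?thesis using openin_continuous_map_preimage[OF pi_continuous V] by simp
qed

lemma top_sub: "topspace (mtop (open_sub M (\<pi> -` V))) = Q"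
  by (auto simp: open_sub_def Q_def)

lemma top_prod: "topspace (mtop (prod_man T_complex_man (open_sub B V))) = T_complex \<times> V"
  using V_top by (auto simp: prod_man_def T_complex_man_def open_sub_def)

lemma tau_bij: "bij_betw \<tau> Q (T_complex \<times> V)"
  using biholo unfolding biholomorphic_map_def top_sub top_prod by blast

lemma tau_in: "q \<in> Q \<Longrightarrow> fst (\<tau> q) \<in> T_complex"
  using bij_betwE[OF tau_bij] by (metis mem_Times_iff)

lemma tau_snd: "q \<in> Q \<Longrightarrow> snd (\<tau> q) = \<pi> q"
  using tau_act by (simp add: Q_def)

lemma tinv_tau: "q \<in> Q \<Longrightarrow> tinv (\<tau> q) = q"
  unfolding tinv_def using bij_betw_inv_into_left[OF tau_bij] .

lemma tau_tinv: "z \<in> T_complex \<Longrightarrow> p \<in> V \<Longrightarrow> \<tau> (tinv (z, p)) = (z, p)"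
  unfolding tinv_def using bij_betw_inv_into_right[OF tau_bij] by blast

lemma tinv_in: "z \<in> T_complex \<Longrightarrow> p \<in> V \<Longrightarrow> tinv (z, p) \<in> Q"
  unfolding tinv_def using bij_betwE[OF bij_betw_inv_into[OF tau_bij]] by blast

lemma pi_tinv: "z \<in> T_complex \<Longrightarrow> p \<in> V \<Longrightarrow> \<pi> (tinv (z, p)) = p"
  using tau_snd[OF tinv_in] tau_tinv by fastforce

lemma act_Q: "a \<in> T_complex \<Longrightarrow> q \<in> Q \<Longrightarrow> act a q \<in> Q"
  using act_top pi_act by (simp add: Q_def)

lemma T_complex_mult: "a \<in> T_complex \<Longrightarrow> b \<in> T_complex \<Longrightarrow> a * b \<in> T_complex"
  by (simp add: T_complex_def)

lemma act_tinv:
  assumes "a \<in> T_complex" "z \<in> T_complex" "p \<in> V"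
  shows "act a (tinv (z, p)) = tinv (a * z, p)"
proof -
  note q = tinv_in[OF assms(2,3)]
  have "\<tau> (act a (tinv (z, p))) = (a * z, p)"
    using tau_act[of "tinv (z, p)"] q assms tau_tinv[OF assms(2,3)] pi_tinv[OF assms(2,3)] by (simp add: Q_def)
  then show ?thesis using tinv_tau[OF act_Q[OF assms(1) q]] by simp
qed

lemma tau_continuous: "continuous_map (subtopology (mtop M) Q) (prod_topology (top_of_set T_complex) (subtopology (mtop B) V)) \<tau>"
proof -
  have "subtopology (mtop M) (\<pi> -` V) = subtopology (mtop M) Q"
    unfolding Q_def by (metis subtopology_restrict)
  then show ?thesis
    using biholo by (simp add: biholomorphic_map_def holomorphic_map_def prod_man_def T_complex_man_def open_sub_def)
qed

lemma tinv_continuous: "continuous_map (prod_topology (top_of_set T_complex) (subtopology (mtop B) V)) (mtop M) tinv"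
proof -
  have "holomorphic_map (prod_man T_complex_man (open_sub B V)) (open_sub M (\<pi> -` V)) tinv"
    using biholo unfolding biholomorphic_map_def top_sub tinv_def[symmetric] by blast
  then have "continuous_map (prod_topology (top_of_set T_complex) (subtopology (mtop B) V)) (subtopology (mtop M) (\<pi> -` V)) tinv"
    by (simp add: holomorphic_map_def prod_man_def T_complex_man_def open_sub_def)
  then show ?thesis by (simp add: continuous_map_in_subtopology)
qed

text \<open>The trivialisation and \<open>e\<close> together identify the part of \<open>M\<close> over \<open>U\<close> with \<open>triv_dom\<close>, a subset of the
  coordinate space of the product manifold; \<open>triv_pt\<close> is the inverse of this identification.\<close>

definition "zpart (y :: complex ^ ('n + 'r)) = (\<chi> j. y $ Inl j)"
definition "wpart (y :: complex ^ ('n + 'r)) = (\<chi> b. y $ Inr b)"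
definition "triv_dom = {y \<in> coord_space (UNIV <+> midx B). zpart y \<in> T_complex \<and> wpart y \<in> W}"
definition "triv_pt y = tinv (zpart y, cinv e (wpart y))"

lemma prod_chart_mem: "(T_complex \<times> U, \<lambda>(p, q). join_vec (id p) (snd e q)) \<in> mcharts (prod_man T_complex_man (open_sub B V))"
proof -
  have "(fst e \<inter> V, snd e) \<in> mcharts (open_sub B V)" using e by (auto simp: open_sub_def)
  moreover have "(T_complex, id) \<in> mcharts T_complex_man" by (simp add: T_complex_man_def)
  ultimately have "(\<lambda>(c, c'). (fst c \<times> fst c', \<lambda>(p, q). join_vec (snd c p) (snd c' q))) ((T_complex, id), (fst e \<inter> V, snd e))
      \<in> mcharts (prod_man T_complex_man (open_sub B V))"
    unfolding prod_man_def cman.simps by (intro imageI) simp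
  then show ?thesis by (simp add: U_def)
qed

lemma zpart_join [simp]: "zpart (join_vec z w) = z"
  by (simp add: zpart_def join_vec_def vec_eq_iff)

lemma wpart_join [simp]: "wpart (join_vec z w) = w"
  by (simp add: wpart_def join_vec_def vec_eq_iff)

lemma join_parts: "join_vec (zpart y) (wpart y) = y"
  by (auto simp: zpart_def wpart_def join_vec_def vec_eq_iff split: sum.split)

lemma U_e: "p \<in> U \<Longrightarrow> p \<in> fst e" "p \<in> U \<Longrightarrow> p \<in> V" by (auto simp: U_def)

lemma cinv_W: assumes "w \<in> W" shows "cinv e w \<in> U" "snd e (cinv e w) = w" "w \<in> cimage e"
  using assms cinv_snd[OF e_chart] by (auto simp: W_def U_def cimage_def)

lemma W_coord: "W \<subseteq> coord_space (midx B)" using copen_subset[OF W_copen] .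

lemma open_T: "open (T_complex :: (complex ^ 'n) set)"
proof -
  have "T_complex = (\<Inter>i. {a :: complex ^ 'n. a $ i \<noteq> 0})" by (auto simp: T_complex_def)
  moreover have "open {a :: complex ^ 'n. a $ i \<noteq> 0}" for i
    by (intro open_Collect_neq continuous_intros)
  ultimately show ?thesis using open_INT[of UNIV "\<lambda>i. {a :: complex ^ 'n. a $ i \<noteq> 0}"] by simp
qed

lemma continuous_zpart: "continuous_on A zpart" unfolding zpart_def by (intro continuous_intros)
lemma continuous_wpart: "continuous_on A wpart" unfolding wpart_def by (intro continuous_intros)

lemma triv_dom_copen: "copen (UNIV <+> midx B) triv_dom"
proof -
  obtain W0 where W0: "open W0" "W = coord_space (midx B) \<inter> W0" using W_copen openin_open by blast
  have "wpart y \<in> coord_space (midx B)" if "y \<in> coord_space (UNIV <+> midx B)" for y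
    using that by (auto simp: coord_space_def wpart_def)
  then have "triv_dom = coord_space (UNIV <+> midx B) \<inter> (zpart -` T_complex \<inter> wpart -` W0)"
    using W0 by (auto simp: triv_dom_def)
  moreover have "open (zpart -` T_complex \<inter> wpart -` W0)"
    by (intro open_Int open_vimage open_T W0 continuous_zpart continuous_wpart)
  ultimately show ?thesis using openin_open by blast
qed

lemma triv_pt_continuous: "continuous_map (top_of_set triv_dom) (mtop M) triv_pt"
proof -
  have 1: "continuous_map (top_of_set triv_dom) (top_of_set T_complex) zpart"
    using continuous_zpart[of triv_dom] by (auto simp: continuous_map_in_subtopology triv_dom_def)
  have "continuous_map (top_of_set triv_dom) (top_of_set (cimage e)) wpart"
    using continuous_wpart[of triv_dom] cinv_W(3) by (auto simp: continuous_map_in_subtopology triv_dom_def)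
  then have "continuous_map (top_of_set triv_dom) (mtop B) (cinv e \<circ> wpart)"
    using continuous_map_cinv[OF e_chart] continuous_map_compose by blast
  then have 2: "continuous_map (top_of_set triv_dom) (subtopology (mtop B) V) (cinv e \<circ> wpart)"
    using cinv_W(1) U_e(2) by (auto simp: continuous_map_in_subtopology triv_dom_def)
  have "continuous_map (top_of_set triv_dom) (prod_topology (top_of_set T_complex) (subtopology (mtop B) V)) (\<lambda>y. (zpart y, (cinv e \<circ> wpart) y))"
    using continuous_map_paired 1 2 by blast
  from continuous_map_compose[OF this tinv_continuous]
  show ?thesis by (simp add: triv_pt_def[abs_def] comp_def)
qed

lemma triv_pt_tau: assumes "y \<in> triv_dom" shows "\<tau> (triv_pt y) = (zpart y, cinv e (wpart y))" "triv_pt y \<in> Q" "\<pi> (triv_pt y) = cinv e (wpart y)" "\<pi> (triv_pt y) \<in> U"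
  using assms tau_tinv tinv_in pi_tinv cinv_W(1) U_e(2) by (auto simp: triv_pt_def triv_dom_def)

lemma tau_triv_pt: assumes "q \<in> Q" "\<pi> q \<in> U" shows "join_vec (fst (\<tau> q)) (snd e (\<pi> q)) \<in> triv_dom" "triv_pt (join_vec (fst (\<tau> q)) (snd e (\<pi> q))) = q"
proof -
  have w: "snd e (\<pi> q) \<in> W" using assms by (auto simp: W_def)
  then have "snd e (\<pi> q) \<in> coord_space (midx B)" using W_coord by blast
  then have "join_vec (fst (\<tau> q)) (snd e (\<pi> q)) \<in> coord_space (UNIV <+> midx B)"
    by (auto simp: coord_space_def join_vec_def split: sum.split)
  then show "join_vec (fst (\<tau> q)) (snd e (\<pi> q)) \<in> triv_dom" using w tau_in[OF assms(1)] by (simp add: triv_dom_def)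
  show "triv_pt (join_vec (fst (\<tau> q)) (snd e (\<pi> q))) = q"
    using cinv_snd[OF e_chart U_e(1)[OF assms(2)]] tau_snd[OF assms(1)] tinv_tau[OF assms(1)]
    by (simp add: triv_pt_def) (metis prod.collapse)
qed

definition "QU = {q \<in> topspace (mtop M). \<pi> q \<in> U}"

lemma QU_open: "openin (mtop M) QU"
  unfolding QU_def using openin_continuous_map_preimage[OF pi_continuous U_open] .

lemma QU_Q: "q \<in> QU \<longleftrightarrow> q \<in> Q \<and> \<pi> q \<in> U"
  using U_e by (auto simp: QU_def Q_def)

text \<open>Read in charts, the biholomorphy of \<open>\<tau>\<close> says that \<open>local_triv\<close> and its inverse \<open>triv_pt\<close> are holomorphic.\<close>

definition "local_triv q = join_vec (fst (\<tau> q)) (snd e (\<pi> q))"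

lemma local_triv_hol:
  assumes c: "c \<in> mcharts M"
  shows "hol (midx M) (snd c ` (fst c \<inter> QU)) (\<lambda>x. local_triv (cinv c x) $ j)"
proof -
  let ?c = "(fst c \<inter> \<pi> -` V, snd c)"
  let ?p = "\<lambda>(p :: complex ^ 'n, q). join_vec (id p) (snd e q)"
  note cc = cm_chart[OF M c]
  have o: "copen (midx M) (snd c ` (fst c \<inter> QU))" by (rule chart_open_image[OF cc QU_open])
  have "holomorphic_map (open_sub M (\<pi> -` V)) (prod_man T_complex_man (open_sub B V)) \<tau>"
    using biholo by (simp add: biholomorphic_map_def)
  moreover have "?c \<in> mcharts (open_sub M (\<pi> -` V))" using c by (auto simp: open_sub_def)
  moreover have "(T_complex \<times> U, ?p) \<in> mcharts (prod_man T_complex_man (open_sub B V))"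
    by (rule prod_chart_mem)
  ultimately have hv: "holo_vec (midx M) (snd c ` ((fst c \<inter> \<pi> -` V) \<inter> \<tau> -` (T_complex \<times> U))) (?p \<circ> \<tau> \<circ> cinv ?c)"
    unfolding holomorphic_map_def by (fastforce simp: open_sub_def)
  have set: "(fst c \<inter> \<pi> -` V) \<inter> \<tau> -` (T_complex \<times> U) = fst c \<inter> QU"
  proof (intro set_eqI iffI)
    fix q assume q: "q \<in> (fst c \<inter> \<pi> -` V) \<inter> \<tau> -` (T_complex \<times> U)"
    then have "q \<in> Q" using chart_topspace[OF cc] by (auto simp: Q_def)
    then show "q \<in> fst c \<inter> QU" using q tau_snd[of q] by (auto simp: QU_Q)
  next
    fix q assume q: "q \<in> fst c \<inter> QU"
    then show "q \<in> (fst c \<inter> \<pi> -` V) \<inter> \<tau> -` (T_complex \<times> U)"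
      using tau_in[of q] tau_snd[of q] by (auto simp: QU_Q Q_def mem_Times_iff)
  qed
  have "hol (midx M) (snd c ` (fst c \<inter> QU)) (\<lambda>x. (?p \<circ> \<tau> \<circ> cinv ?c) x $ j)"
    using hv holo_fun_hol[OF o] unfolding holo_vec_def set by blast
  then show ?thesis
  proof (rule hol_cong)
    fix x assume "x \<in> snd c ` (fst c \<inter> QU)"
    then obtain q where q: "q \<in> fst c" "q \<in> QU" "x = snd c q" by blast
    then have q': "q \<in> Q" "\<pi> q \<in> U" by (auto simp: QU_Q)
    have "inj_on (snd c) (fst c \<inter> \<pi> -` V)" using chart_inj[OF cc] by (rule inj_on_subset) auto
    then have "cinv ?c x = q" unfolding cinv_def using q q' by (auto simp: Q_def intro: inv_into_f_eq)
    moreover have "cinv c x = q" using cinv_snd[OF cc q(1)] q(3) by simp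
    ultimately show "(?p \<circ> \<tau> \<circ> cinv ?c) x $ j = local_triv (cinv c x) $ j"
      using tau_snd[OF q'(1)] by (simp add: local_triv_def split_beta)
  qed
qed

lemma triv_pt_hol:
  assumes c: "c \<in> mcharts M"
  shows "copen (UNIV <+> midx B) {y \<in> triv_dom. triv_pt y \<in> fst c}"
    and "hol (UNIV <+> midx B) {y \<in> triv_dom. triv_pt y \<in> fst c} (\<lambda>y. snd c (triv_pt y) $ j)"
proof -
  let ?c = "(fst c \<inter> \<pi> -` V, snd c)"
  let ?p = "\<lambda>(p :: complex ^ 'n, q). join_vec (id p) (snd e q)"
  let ?D = "{y \<in> triv_dom. triv_pt y \<in> fst c}"
  note cc = cm_chart[OF M c]
  have "openin (top_of_set triv_dom) {y \<in> topspace (top_of_set triv_dom). triv_pt y \<in> fst c}"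
    by (rule openin_continuous_map_preimage[OF triv_pt_continuous]) (use cc in \<open>auto simp: is_chart_def\<close>)
  then show o: "copen (UNIV <+> midx B) ?D" using triv_dom_copen openin_trans by auto
  have "holomorphic_map (prod_man T_complex_man (open_sub B V)) (open_sub M (\<pi> -` V)) tinv"
    using biholo unfolding biholomorphic_map_def top_sub tinv_def[symmetric] by blast
  then have "\<forall>p\<in>mcharts (prod_man T_complex_man (open_sub B V)). \<forall>c\<in>mcharts (open_sub M (\<pi> -` V)).
      holo_vec (midx (prod_man T_complex_man (open_sub B V))) (snd p ` (fst p \<inter> tinv -` fst c)) (snd c \<circ> tinv \<circ> cinv p)"
    unfolding holomorphic_map_def by blast
  note hm = this[rule_format, OF prod_chart_mem]
  have "?c \<in> mcharts (open_sub M (\<pi> -` V))" using c by (auto simp: open_sub_def)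
  moreover have "midx (prod_man T_complex_man (open_sub B V)) = UNIV <+> midx B"
    by (simp add: prod_man_def T_complex_man_def open_sub_def)
  ultimately have hv: "holo_vec (UNIV <+> midx B) (?p ` ((T_complex \<times> U) \<inter> tinv -` (fst c \<inter> \<pi> -` V))) (snd c \<circ> tinv \<circ> cinv (T_complex \<times> U, ?p))"
    using hm[of ?c] unfolding fst_conv snd_conv by metis
  have pinv: "cinv (T_complex \<times> U, ?p) y = (zpart y, cinv e (wpart y))" if y: "y \<in> triv_dom" for y
  proof -
    have "inj_on ?p (T_complex \<times> U)"
    proof (rule inj_onI)
      fix a b assume ab: "a \<in> T_complex \<times> U" "b \<in> T_complex \<times> U" "?p a = ?p b"
      have "zpart (?p a) = zpart (?p b)" "wpart (?p a) = wpart (?p b)" by (simp_all only: ab(3))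
      then have eq: "fst a = fst b" "snd e (snd a) = snd e (snd b)" by (simp_all add: split_beta)
      moreover have "snd a = snd b"
        using inj_onD[OF chart_inj[OF e_chart] eq(2)] ab(1,2) U_e by auto
      ultimately show "a = b" by (simp add: prod_eq_iff)
    qed
    moreover have "(zpart y, cinv e (wpart y)) \<in> T_complex \<times> U" using y cinv_W(1) by (auto simp: triv_dom_def)
    moreover have "?p (zpart y, cinv e (wpart y)) = y" using y cinv_W(2) join_parts by (auto simp: triv_dom_def)
    ultimately show ?thesis unfolding cinv_def by (simp add: inv_into_f_eq)
  qed
  have set: "?p ` ((T_complex \<times> U) \<inter> tinv -` (fst c \<inter> \<pi> -` V)) = ?D"
  proof (intro set_eqI iffI)
    fix y assume "y \<in> ?p ` ((T_complex \<times> U) \<inter> tinv -` (fst c \<inter> \<pi> -` V))"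
    then obtain z p where zp: "z \<in> T_complex" "p \<in> U" "tinv (z, p) \<in> fst c" "y = join_vec z (snd e p)" by auto
    have w: "snd e p \<in> W" using zp by (auto simp: W_def)
    then have "y \<in> coord_space (UNIV <+> midx B)"
      using W_coord by (auto simp: coord_space_def join_vec_def zp(4) split: sum.split)
    then show "y \<in> ?D" using zp w cinv_snd[OF e_chart U_e(1)[OF zp(2)]] by (simp add: triv_dom_def triv_pt_def)
  next
    fix y assume y: "y \<in> ?D"
    then have "(zpart y, cinv e (wpart y)) \<in> T_complex \<times> U" using cinv_W(1) by (auto simp: triv_dom_def)
    moreover have "?p (zpart y, cinv e (wpart y)) = y" using y cinv_W(2) join_parts by (auto simp: triv_dom_def)
    moreover have "tinv (zpart y, cinv e (wpart y)) \<in> fst c \<inter> \<pi> -` V"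
      using y triv_pt_tau(2)[of y] by (auto simp: triv_pt_def[symmetric] Q_def)
    ultimately show "y \<in> ?p ` ((T_complex \<times> U) \<inter> tinv -` (fst c \<inter> \<pi> -` V))"
      by (metis (no_types, lifting) IntI image_eqI vimageI)
  qed
  have "hol (UNIV <+> midx B) ?D (\<lambda>y. (snd c \<circ> tinv \<circ> cinv (T_complex \<times> U, ?p)) y $ j)"
    using hv holo_fun_hol[OF o] unfolding holo_vec_def set by blast
  then show "hol (UNIV <+> midx B) ?D (\<lambda>y. snd c (triv_pt y) $ j)"
    by (rule hol_cong) (use pinv in \<open>auto simp: triv_pt_def\<close>)
qed

text \<open>Needed to index the logarithmic fibre coordinates and the base coordinates jointly by \<open>midx M\<close>.\<close>

lemma dimension:
  assumes "p \<in> U"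
  shows "card (midx M) = CARD('n) + card (midx B)"
proof -
  have "(1 :: complex ^ 'n) \<in> T_complex" by (simp add: T_complex_def)
  define q where "q = tinv (1, p)"
  have q: "q \<in> Q" "\<pi> q = p" using tinv_in pi_tinv \<open>1 \<in> T_complex\<close> assms U_e(2) by (auto simp: q_def)
  then have qU: "q \<in> QU" using assms by (simp add: QU_Q)
  obtain c where c: "c \<in> mcharts M" "q \<in> fst c" using chart_exists[OF M, of q] q(1) unfolding Q_def by blast
  note cc = cm_chart[OF M c(1)]
  let ?S = "snd c ` (fst c \<inter> QU)" and ?D = "{y \<in> triv_dom. triv_pt y \<in> fst c}"
  have f: "smooth_in (midx M) ?S (\<lambda>x. local_triv (cinv c x))" by (rule smooth_vec[OF hol_smooth[OF local_triv_hol[OF c(1)]]])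
  have g: "smooth_in (UNIV <+> midx B) ?D (\<lambda>y. snd c (triv_pt y))" by (rule smooth_vec[OF hol_smooth[OF triv_pt_hol(2)[OF c(1)]]])
  have fg: "local_triv (cinv c x) \<in> ?D" "snd c (triv_pt (local_triv (cinv c x))) = x" if "x \<in> ?S" for x
    using that cinv_snd[OF cc] tau_triv_pt by (auto simp: local_triv_def QU_Q)
  have gf: "snd c (triv_pt y) \<in> ?S" "local_triv (cinv c (snd c (triv_pt y))) = y" if y: "y \<in> ?D" for y
  proof -
    have "triv_pt y \<in> QU" using triv_pt_tau[of y] y by (auto simp: QU_Q)
    then show "snd c (triv_pt y) \<in> ?S" using y by auto
    have "wpart y \<in> W" using y by (simp add: triv_dom_def)
    then show "local_triv (cinv c (snd c (triv_pt y))) = y"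
      using cinv_snd[OF cc, of "triv_pt y"] y triv_pt_tau[of y] cinv_W(2)[of "wpart y"] join_parts by (simp add: local_triv_def)
  qed
  have "card (midx M) \<le> card ((UNIV :: 'n set) <+> midx B)"
    by (rule card_le_of_local_inverse[OF f g _ fg]) (use c qU in auto)
  moreover have "card ((UNIV :: 'n set) <+> midx B) \<le> card (midx M)"
    by (rule card_le_of_local_inverse[OF g f _ gf, where x = "local_triv q"])
      (use c tau_triv_pt[of q] q assms in \<open>auto simp: local_triv_def\<close>)
  ultimately show ?thesis by (simp add: card_Plus)
qed

end

section \<open>Logarithmic coordinates\<close>

text \<open>Indices \<open>\<alpha> j\<close> of the total space carry the logarithmic fibre coordinates and indices \<open>\<gamma> b\<close> the
  coordinates of the base.\<close>

locale adapted = trivialization M B \<pi> act \<omega> \<Phi> V \<tau> e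
  for M :: "('m, 'd::finite) cman"
    and B :: "('b, 'r::finite) cman"
    and \<pi> :: "'m \<Rightarrow> 'b"
    and act :: "complex ^ 'n::finite \<Rightarrow> 'm \<Rightarrow> 'm"
    and \<omega> :: "('m, 'd) form11"
    and \<Phi> :: "'m \<Rightarrow> real ^ 'n"
    and V :: "'b set" and \<tau> :: "'m \<Rightarrow> (complex ^ 'n) \<times> 'b" and e :: "('b, 'r) chart" +
  fixes \<alpha> :: "'n \<Rightarrow> 'd" and \<gamma> :: "'r \<Rightarrow> 'd"
  assumes alpha_inj: "inj \<alpha>" and gamma_inj: "inj_on \<gamma> (midx B)"
    and disj: "range \<alpha> \<inter> \<gamma> ` midx B = {}" and idx: "midx M = range \<alpha> \<union> \<gamma> ` midx B"
begin

definition "zc (x :: complex ^ 'd) = (\<chi> j. x $ \<alpha> j)"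
definition "wc (x :: complex ^ 'd) = (\<chi> b. if b \<in> midx B then x $ \<gamma> b else 0)"
definition mix :: "complex ^ 'n \<Rightarrow> complex ^ 'r \<Rightarrow> complex ^ 'd" where
  "mix z w = (\<chi> a. if a \<in> range \<alpha> then z $ inv \<alpha> a else if a \<in> \<gamma> ` midx B then w $ inv_into (midx B) \<gamma> a else 0)"
definition "vexp (z :: complex ^ 'n) = (\<chi> j. exp (z $ j))"
text \<open>The chart \<open>E t\<close> uses the principal logarithm of the fibre coordinate divided by \<open>t\<close>.  Varying \<open>t\<close> moves the branch
  cut: a point whose fibre coordinate is \<open>t\<close> has logarithmic coordinate \<open>0\<close> in \<open>E t\<close>.  For all \<open>t\<close> the image of
  the chart is the same set \<open>X\<close>.\<close>

definition "X = {x \<in> coord_space (midx M). (\<forall>j. \<bar>Im (x $ \<alpha> j)\<bar> < pi) \<and> wc x \<in> W}"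
definition "\<Psi> t x = triv_pt (join_vec (t * vexp (zc x)) (wc x))"
definition "log_coords t q = mix (\<chi> j. Ln (fst (\<tau> q) $ j / t $ j)) (snd e (\<pi> q))"
definition "E t = (\<Psi> t ` X, log_coords t)"

lemma alpha_eq [simp]: "\<alpha> i = \<alpha> j \<longleftrightarrow> i = j" using alpha_inj by (auto dest: injD)
lemma gamma_eq: "a \<in> midx B \<Longrightarrow> b \<in> midx B \<Longrightarrow> \<gamma> a = \<gamma> b \<longleftrightarrow> a = b" using gamma_inj by (auto dest: inj_onD)
lemma alpha_gamma [simp]: "b \<in> midx B \<Longrightarrow> \<alpha> j \<noteq> \<gamma> b" "b \<in> midx B \<Longrightarrow> \<gamma> b \<noteq> \<alpha> j"
  using disj by (metis disjoint_iff imageI rangeI)+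
lemma alpha_idx [simp]: "\<alpha> j \<in> midx M" by (simp add: idx)
lemma gamma_idx [simp]: "b \<in> midx B \<Longrightarrow> \<gamma> b \<in> midx M" by (simp add: idx)

lemma mix_alpha [simp]: "mix z w $ \<alpha> j = z $ j"
  by (simp add: mix_def alpha_inj)

lemma mix_gamma [simp]: "b \<in> midx B \<Longrightarrow> mix z w $ \<gamma> b = w $ b"
  by (auto simp: mix_def gamma_inj)

lemma mix_coord_space: "mix z w \<in> coord_space (midx M)"
  by (auto simp: mix_def coord_space_def idx)

lemma zc_mix [simp]: "zc (mix z w) = z" by (simp add: zc_def vec_eq_iff)

lemma wc_coord: "wc x \<in> coord_space (midx B)" by (simp add: wc_def coord_space_def)

lemma wc_mix: "w \<in> coord_space (midx B) \<Longrightarrow> wc (mix z w) = w"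
  by (auto simp: wc_def vec_eq_iff coord_space_def)

lemma mix_parts:
  assumes "x \<in> coord_space (midx M)"
  shows "mix (zc x) (wc x) = x"
proof -
  have "mix (zc x) (wc x) $ a = x $ a" for a
  proof (cases "a \<in> midx M")
    case True
    then consider j where "a = \<alpha> j" | b where "b \<in> midx B" "a = \<gamma> b" by (auto simp: idx)
    then show ?thesis by cases (simp_all add: zc_def wc_def)
  next
    case False
    then show ?thesis using assms mix_coord_space[of "zc x" "wc x"] by (simp add: coord_space_def)
  qed
  then show ?thesis by (simp add: vec_eq_iff)
qed

lemma sum_idx: "(\<Sum>a\<in>midx M. f a) = (\<Sum>j\<in>UNIV. f (\<alpha> j)) + (\<Sum>b\<in>midx B. f (\<gamma> b))"
proof -
  have "(\<Sum>a\<in>midx M. f a) = (\<Sum>a\<in>range \<alpha>. f a) + (\<Sum>a\<in>\<gamma> ` midx B. f a)"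
    unfolding idx by (rule sum.union_disjoint) (use disj in auto)
  then show ?thesis by (simp add: sum.reindex alpha_inj gamma_inj)
qed

lemma vexp_T: "vexp z \<in> T_complex" by (simp add: vexp_def T_complex_def)

lemma X_coord: "X \<subseteq> coord_space (midx M)" by (auto simp: X_def)

lemma continuous_wc: "continuous_on A wc"
proof -
  have "continuous_on A (\<lambda>x. if b \<in> midx B then x $ \<gamma> b else 0)" for b
    by (cases "b \<in> midx B") (auto intro!: continuous_intros)
  then show ?thesis unfolding wc_def by (intro continuous_on_vec_lambda)
qed

lemma X_copen: "copen (midx M) X"
proof -
  obtain W0 where W0: "open W0" "W = coord_space (midx B) \<inter> W0" using W_copen openin_open by blast
  have "X = coord_space (midx M) \<inter> ((\<Inter>j. {x. \<bar>Im (x $ \<alpha> j)\<bar> < pi}) \<inter> wc -` W0)"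
    using W0 wc_coord by (auto simp: X_def)
  moreover have "open {x :: complex ^ 'd. \<bar>Im (x $ \<alpha> j)\<bar> < pi}" for j
    by (intro open_Collect_less continuous_intros)
  then have "open ((\<Inter>j. {x. \<bar>Im (x $ \<alpha> j)\<bar> < pi}) \<inter> wc -` W0)"
    using open_INT[of UNIV "\<lambda>j. {x. \<bar>Im (x $ \<alpha> j)\<bar> < pi}"] open_vimage[OF W0(1) continuous_wc] by (intro open_Int) auto
  ultimately show ?thesis using openin_open by blast
qed

lemma join_triv_dom:
  assumes "t \<in> T_complex" "wc x \<in> W"
  shows "join_vec (t * vexp (zc x)) (wc x) \<in> triv_dom"
proof -
  have "join_vec z (wc x) \<in> coord_space (UNIV <+> midx B)" for z :: "complex ^ 'n"
    using wc_coord[of x] by (auto simp: coord_space_def join_vec_def split: sum.split)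
  then show ?thesis using T_complex_mult[OF assms(1) vexp_T] assms(2) by (simp add: triv_dom_def)
qed

lemma Psi_facts:
  assumes "t \<in> T_complex" "wc x \<in> W"
  shows "\<Psi> t x = tinv (t * vexp (zc x), cinv e (wc x))"
    "\<tau> (\<Psi> t x) = (t * vexp (zc x), cinv e (wc x))" "\<Psi> t x \<in> Q" "\<Psi> t x \<in> topspace (mtop M)"
    "\<pi> (\<Psi> t x) = cinv e (wc x)" "\<pi> (\<Psi> t x) \<in> U" "snd e (\<pi> (\<Psi> t x)) = wc x" "\<Psi> t x \<in> QU"
  using triv_pt_tau[OF join_triv_dom[OF assms]] cinv_W(2)[OF assms(2)] by (auto simp: \<Psi>_def triv_pt_def Q_def QU_def)

lemma X_W: "x \<in> X \<Longrightarrow> wc x \<in> W" by (simp add: X_def)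

lemma log_coords_Psi:
  assumes "t \<in> T_complex" "x \<in> X"
  shows "log_coords t (\<Psi> t x) = x"
proof -
  note P = Psi_facts[OF assms(1) X_W[OF assms(2)]]
  have "Ln (fst (\<tau> (\<Psi> t x)) $ j / t $ j) = zc x $ j" for j
  proof -
    have "t $ j \<noteq> 0" using assms(1) by (simp add: T_complex_def)
    then have "fst (\<tau> (\<Psi> t x)) $ j / t $ j = exp (x $ \<alpha> j)" by (simp add: P(2) vexp_def zc_def)
    moreover have "\<bar>Im (x $ \<alpha> j)\<bar> < pi" using assms(2) by (simp add: X_def)
    ultimately show ?thesis by (simp add: zc_def abs_less_iff Ln_exp)
  qed
  then have "(\<chi> j. Ln (fst (\<tau> (\<Psi> t x)) $ j / t $ j)) = zc x" by (simp add: vec_eq_iff)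
  then show ?thesis using mix_parts X_coord assms(2) P(7) by (auto simp: log_coords_def)
qed

lemma Psi_log_coords:
  assumes "t \<in> T_complex" "q \<in> QU" "\<And>j. fst (\<tau> q) $ j / t $ j \<notin> \<real>\<^sub>\<le>\<^sub>0"
  shows "\<Psi> t (log_coords t q) = q" "log_coords t q \<in> X"
proof -
  have q: "q \<in> Q" "\<pi> q \<in> U" using assms(2) by (auto simp: QU_Q)
  have w: "snd e (\<pi> q) \<in> W" using q by (auto simp: W_def)
  then have wc: "wc (log_coords t q) = snd e (\<pi> q)" unfolding log_coords_def using W_coord by (intro wc_mix) blast
  have tj: "t $ j \<noteq> 0" for j using assms(1) by (simp add: T_complex_def)
  have nz: "fst (\<tau> q) $ j / t $ j \<noteq> 0" for j using assms(3)[of j] by force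
  have "t * vexp (zc (log_coords t q)) = fst (\<tau> q)"
    using tj nz by (simp add: log_coords_def vexp_def vec_eq_iff exp_Ln)
  then show "\<Psi> t (log_coords t q) = q" using tau_triv_pt(2)[OF q] by (simp add: \<Psi>_def wc)
  have "\<bar>Im (Ln (fst (\<tau> q) $ j / t $ j))\<bar> < pi" for j
    using Im_Ln_less_pi[OF assms(3)] mpi_less_Im_Ln[OF nz] by (simp add: abs_less_iff minus_less_iff)
  moreover have "log_coords t q $ \<alpha> j = Ln (fst (\<tau> q) $ j / t $ j)" for j by (simp add: log_coords_def)
  moreover have "log_coords t q \<in> coord_space (midx M)" unfolding log_coords_def by (rule mix_coord_space)
  ultimately show "log_coords t q \<in> X" using w by (simp add: X_def wc)
qed

lemma fst_E:
  assumes "t \<in> T_complex"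
  shows "fst (E t) = {q \<in> QU. \<forall>j. fst (\<tau> q) $ j / t $ j \<notin> \<real>\<^sub>\<le>\<^sub>0}"
proof (intro equalityI subsetI)
  fix q assume "q \<in> fst (E t)"
  then obtain x where x: "x \<in> X" "q = \<Psi> t x" by (auto simp: E_def)
  note P = Psi_facts[OF assms X_W[OF x(1)]]
  have "fst (\<tau> q) $ j / t $ j \<notin> \<real>\<^sub>\<le>\<^sub>0" for j
  proof
    have "t $ j \<noteq> 0" using assms by (simp add: T_complex_def)
    then have eq: "fst (\<tau> q) $ j / t $ j = exp (x $ \<alpha> j)" by (simp add: P(2) x(2) vexp_def zc_def)
    assume "fst (\<tau> q) $ j / t $ j \<in> \<real>\<^sub>\<le>\<^sub>0"
    then have "Im (Ln (exp (x $ \<alpha> j))) = pi"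
      unfolding eq by (metis Im_Ln_eq_pi complex_nonpos_Reals_iff exp_not_eq_zero less_eq_real_def complex_eq_iff zero_complex.sel)
    moreover have "\<bar>Im (x $ \<alpha> j)\<bar> < pi" using x by (simp add: X_def)
    ultimately show False by (simp add: abs_less_iff Ln_exp)
  qed
  then show "q \<in> {q \<in> QU. \<forall>j. fst (\<tau> q) $ j / t $ j \<notin> \<real>\<^sub>\<le>\<^sub>0}" using P(8) x(2) by simp
next
  fix q assume "q \<in> {q \<in> QU. \<forall>j. fst (\<tau> q) $ j / t $ j \<notin> \<real>\<^sub>\<le>\<^sub>0}"
  then have "\<Psi> t (log_coords t q) = q" "log_coords t q \<in> X" using Psi_log_coords[OF assms] by auto
  then show "q \<in> fst (E t)" unfolding E_def by (metis fst_conv image_eqI)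
qed

lemma snd_E: "snd (E t) = log_coords t" by (simp add: E_def)

lemma cimage_E: "t \<in> T_complex \<Longrightarrow> cimage (E t) = X"
  using log_coords_Psi by (force simp: cimage_def E_def)

lemma cinv_E:
  assumes "t \<in> T_complex" "x \<in> X" shows "cinv (E t) x = \<Psi> t x"
proof -
  have "inj_on (log_coords t) (\<Psi> t ` X)" by (rule inj_on_inverseI[where g = "\<Psi> t"]) (use log_coords_Psi[OF assms(1)] in auto)
  then show ?thesis unfolding cinv_def E_def fst_conv snd_conv
    by (rule inv_into_f_eq) (use log_coords_Psi[OF assms] assms in auto)
qed

lemma Psi_continuous:
  assumes t: "t \<in> T_complex"
  shows "continuous_map (top_of_set X) (mtop M) (\<Psi> t)"
proof -
  have "continuous_on X (\<lambda>x. join_vec (t * vexp (zc x)) (wc x) $ s)" for s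
  proof (cases s)
    case (Inl j)
    then show ?thesis by (auto simp: join_vec_def vexp_def zc_def intro!: continuous_intros)
  next
    case (Inr b)
    then show ?thesis by (auto simp: join_vec_def intro!: continuous_intros continuous_wc)
  qed
  then have "continuous_on X (\<lambda>x. join_vec (t * vexp (zc x)) (wc x))"
    using continuous_on_vec_lambda[of X "\<lambda>s x. join_vec (t * vexp (zc x)) (wc x) $ s"] by simp
  then have "continuous_map (top_of_set X) (top_of_set triv_dom) (\<lambda>x. join_vec (t * vexp (zc x)) (wc x))"
    using join_triv_dom[OF t X_W] by (auto simp: continuous_map_in_subtopology)
  from continuous_map_compose[OF this triv_pt_continuous]
  show ?thesis by (simp add: \<Psi>_def[abs_def] comp_def)
qed

lemma fst_E_open:
  assumes t: "t \<in> T_complex"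
  shows "openin (mtop M) (fst (E t))"
proof -
  let ?O = "{z \<in> T_complex. \<forall>j. z $ j / t $ j \<notin> \<real>\<^sub>\<le>\<^sub>0}"
  have tj: "t $ j \<noteq> 0" for j using t by (simp add: T_complex_def)
  have "?O = T_complex \<inter> (\<Inter>j. (\<lambda>z. z $ j / t $ j) -` (- \<real>\<^sub>\<le>\<^sub>0))" by auto
  moreover have "open ((\<lambda>z :: complex ^ 'n. z $ j / t $ j) -` (- \<real>\<^sub>\<le>\<^sub>0))" for j
    by (intro open_vimage continuous_intros) (use tj in auto)
  then have "open (\<Inter>j. (\<lambda>z :: complex ^ 'n. z $ j / t $ j) -` (- \<real>\<^sub>\<le>\<^sub>0))"
    by (intro open_INT) auto
  ultimately have O: "openin (top_of_set T_complex) ?O" by (auto simp: openin_open)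
  have UV: "openin (subtopology (mtop B) V) U" using U_open U_e(2) by (auto simp: openin_subtopology intro: exI[of _ U])
  have "openin (prod_topology (top_of_set T_complex) (subtopology (mtop B) V)) (?O \<times> U)"
    using O UV by (simp add: openin_prod_Times_iff)
  from openin_continuous_map_preimage[OF tau_continuous this]
  have "openin (subtopology (mtop M) Q) {q \<in> topspace (subtopology (mtop M) Q). \<tau> q \<in> ?O \<times> U}" .
  moreover have "{q \<in> topspace (subtopology (mtop M) Q). \<tau> q \<in> ?O \<times> U} = fst (E t)"
    unfolding fst_E[OF t] using tau_in tau_snd by (auto simp: QU_Q mem_Times_iff Q_def)
  ultimately show ?thesis using openin_open_subtopology[OF Q_open] by simp
qed

lemma log_coords_continuous:
  assumes t: "t \<in> T_complex"
  shows "continuous_map (subtopology (mtop M) (fst (E t))) euclidean (log_coords t)"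
proof -
  let ?S = "subtopology (mtop M) (fst (E t))"
  let ?O = "{z \<in> T_complex. \<forall>j. z $ j / t $ j \<notin> \<real>\<^sub>\<le>\<^sub>0}"
  have tj: "t $ j \<noteq> 0" for j using t by (simp add: T_complex_def)
  have sub: "fst (E t) \<subseteq> Q" using fst_E[OF t] by (auto simp: QU_Q)
  have tau: "continuous_map ?S (prod_topology (top_of_set T_complex) (subtopology (mtop B) V)) \<tau>"
    using continuous_map_from_subtopology_mono[OF tau_continuous sub] .
  have 1: "continuous_map ?S (top_of_set ?O) (fst \<circ> \<tau>)"
  proof -
    have "continuous_map ?S (top_of_set T_complex) (fst \<circ> \<tau>)"
      using continuous_map_compose[OF tau continuous_map_fst] .
    then show ?thesis using fst_E[OF t] by (auto simp: continuous_map_in_subtopology)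
  qed
  have "continuous_map ?S (subtopology (mtop B) (fst e)) \<pi>"
    using continuous_map_from_subtopology[OF pi_continuous, of "fst (E t)"] fst_E[OF t] U_e(1)
    by (auto simp: continuous_map_in_subtopology QU_def)
  from continuous_map_compose[OF this continuous_map_chart[OF e_chart]]
  have 2: "continuous_map ?S euclidean (snd e \<circ> \<pi>)" by (simp add: continuous_map_in_subtopology)
  have "prod_topology (top_of_set ?O) (euclidean :: (complex ^ 'r) topology) = top_of_set (?O \<times> UNIV)"
    using subtopology_Times[of "euclidean :: (complex ^ 'n) topology" "euclidean :: (complex ^ 'r) topology" ?O UNIV]
    by (simp add: euclidean_product_topology)
  moreover have "continuous_map ?S (prod_topology (top_of_set ?O) euclidean) (\<lambda>q. ((fst \<circ> \<tau>) q, (snd e \<circ> \<pi>) q))"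
    unfolding continuous_map_paired using 1 2 by blast
  ultimately have pair: "continuous_map ?S (top_of_set (?O \<times> UNIV)) (\<lambda>q. ((fst \<circ> \<tau>) q, (snd e \<circ> \<pi>) q))" by metis
  have "continuous_on (?O \<times> UNIV) (\<lambda>(z, w). mix (\<chi> j. Ln (z $ j / t $ j)) w $ a)" for a
  proof -
    consider j where "a = \<alpha> j" | b where "b \<in> midx B" "a = \<gamma> b" | "a \<notin> midx M" by (auto simp: idx)
    then show ?thesis
    proof cases
      case 1
      then show ?thesis using tj by (auto simp: split_beta intro!: continuous_intros continuous_on_Ln)
    next
      case 2
      then show ?thesis by (auto simp: split_beta intro!: continuous_intros)
    next
      case 3
      then have "mix z w $ a = 0" for z w using mix_coord_space[of z w] by (simp add: coord_space_def)
      then show ?thesis by (simp add: split_beta)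
    qed
  qed
  then have "continuous_on (?O \<times> UNIV) (\<lambda>(z, w). mix (\<chi> j. Ln (z $ j / t $ j)) w)"
    using continuous_on_vec_lambda[of "?O \<times> UNIV" "\<lambda>a (z, w). mix (\<chi> j. Ln (z $ j / t $ j)) w $ a"]
    by (simp add: split_beta)
  then have "continuous_map (top_of_set (?O \<times> UNIV)) euclidean (\<lambda>(z, w). mix (\<chi> j. Ln (z $ j / t $ j)) w)" by simp
  from continuous_map_compose[OF pair this] show ?thesis by (simp add: log_coords_def[abs_def] comp_def)
qed

lemma E_is_chart:
  assumes t: "t \<in> T_complex"
  shows "is_chart (mtop M) (midx M) (E t)"
  unfolding is_chart_def cimage_E[OF t]
proof (intro conjI fst_E_open[OF t] X_copen)
  have top: "topspace (subtopology (mtop M) (fst (E t))) = fst (E t)"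
    using fst_E_open[OF t] openin_subset by force
  have "homeomorphic_maps (subtopology (mtop M) (fst (E t))) (top_of_set X) (log_coords t) (\<Psi> t)"
    unfolding homeomorphic_maps_def top
  proof (intro conjI ballI)
    show "continuous_map (subtopology (mtop M) (fst (E t))) (top_of_set X) (log_coords t)"
      using log_coords_continuous[OF t] log_coords_Psi[OF t] by (auto simp: continuous_map_in_subtopology E_def)
    show "continuous_map (top_of_set X) (subtopology (mtop M) (fst (E t))) (\<Psi> t)"
      using Psi_continuous[OF t] by (auto simp: continuous_map_in_subtopology E_def)
  qed (use log_coords_Psi[OF t] in \<open>auto simp: E_def\<close>)
  then show "homeomorphic_map (subtopology (mtop M) (fst (E t))) (top_of_set X) (snd (E t))"
    unfolding snd_E using homeomorphic_map_maps by blast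
qed

text \<open>By maximality of the atlas it suffices that \<open>E t\<close> is compatible with all charts.\<close>

lemma E_mem:
  assumes t: "t \<in> T_complex"
  shows "E t \<in> mcharts M"
proof -
  note Ec = E_is_chart[OF t]
  have tj: "t $ j \<noteq> 0" for j using t by (simp add: T_complex_def)
  have "compatible (midx M) (E t) c" if c: "c \<in> mcharts M" for c
    unfolding compatible_def holo_vec_def
  proof (intro conjI allI)
    note cc = cm_chart[OF M c]
    fix j
    let ?S = "snd (E t) ` (fst (E t) \<inter> fst c)"
    have oS: "copen (midx M) ?S" by (rule chart_open_image[OF Ec]) (use cc in \<open>auto simp: is_chart_def\<close>)
    have SX: "x \<in> X" "\<Psi> t x \<in> fst c" if "x \<in> ?S" for x
      using that log_coords_Psi[OF t] by (auto simp: E_def)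
    have jh: "hol (midx M) ?S (\<lambda>x. join_vec (t * vexp (zc x)) (wc x) $ s)" for s
    proof (cases s)
      case (Inl i)
      have "hol (midx M) ?S (\<lambda>x. t $ i * exp (x $ \<alpha> i))"
        by (intro hol_mult hol_const hol_exp hol_nth oS)
      then show ?thesis using Inl by (simp add: join_vec_def vexp_def zc_def)
    next
      case (Inr b)
      then show ?thesis using hol_nth[OF oS] hol_const[OF oS]
        by (cases "b \<in> midx B") (simp_all add: join_vec_def wc_def)
    qed
    have "hol (midx M) ?S (\<lambda>x. snd c (triv_pt (join_vec (t * vexp (zc x)) (wc x))) $ j)"
      by (rule hol_compose[OF jh triv_pt_hol(2)[OF c]]) (use SX join_triv_dom[OF t X_W] in \<open>auto simp: \<Psi>_def\<close>)
    then have "hol (midx M) ?S (\<lambda>x. (snd c \<circ> cinv (E t)) x $ j)"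
      by (rule hol_cong) (use SX cinv_E[OF t] in \<open>auto simp: \<Psi>_def\<close>)
    then show "holo_fun (midx M) ?S (\<lambda>x. (snd c \<circ> cinv (E t)) x $ j)" using holo_fun_hol[OF oS] by blast
    let ?T = "snd c ` (fst (E t) \<inter> fst c)"
    have oT: "copen (midx M) (snd c ` (fst c \<inter> fst (E t)))" by (rule chart_open_image[OF cc fst_E_open[OF t]])
    have lh: "hol (midx M) (snd c ` (fst c \<inter> fst (E t))) (\<lambda>x. local_triv (cinv c x) $ s)" for s
      by (rule hol_subset[OF local_triv_hol[OF c] oT]) (use fst_E[OF t] in auto)
    have "hol (midx M) (snd c ` (fst c \<inter> fst (E t))) (\<lambda>x. log_coords t (cinv c x) $ j)"
    proof -
      consider i where "j = \<alpha> i" | b where "b \<in> midx B" "j = \<gamma> b" | "j \<notin> midx M" by (auto simp: idx)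
      then show ?thesis
      proof cases
        case 1
        have lt: "local_triv (cinv c x) $ Inl i = fst (\<tau> (cinv c x)) $ i" for x by (simp add: local_triv_def join_vec_def)
        have "hol (midx M) (snd c ` (fst c \<inter> fst (E t))) (\<lambda>x. Ln (inverse (t $ i) * local_triv (cinv c x) $ Inl i))"
          by (intro hol_Ln hol_mult hol_const oT lh)
            (use fst_E[OF t] cinv_snd[OF cc] in \<open>auto simp: lt divide_inverse mult.commute\<close>)
        then show ?thesis using 1 by (simp add: log_coords_def lt divide_inverse mult.commute)
      next
        case 2
        have "local_triv (cinv c x) $ Inr b = snd e (\<pi> (cinv c x)) $ b" for x by (simp add: local_triv_def join_vec_def)
        then show ?thesis using 2 lh[of "Inr b"] by (simp add: log_coords_def)
      next
        case 3
        then have "log_coords t q $ j = 0" for q using mix_coord_space by (auto simp: log_coords_def coord_space_def)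
        then show ?thesis using hol_const[OF oT, of 0] by simp
      qed
    qed
    then show "holo_fun (midx M) (snd c ` (fst (E t) \<inter> fst c)) (\<lambda>x. (snd (E t) \<circ> cinv c) x $ j)"
      using holo_fun_hol[OF oT] by (simp add: snd_E Int_commute comp_def)
  qed
  then show ?thesis using M Ec unfolding complex_manifold_def by blast
qed

end

section \<open>Invariance in logarithmic coordinates\<close>

lemma T_compact_complex: "t \<in> T_compact \<Longrightarrow> t \<in> T_complex"
  by (auto simp: T_compact_def T_complex_def) (metis norm_zero zero_neq_one)

lemma hol_has_field_derivative:
  assumes "hol I S f" "x \<in> S" "a \<in> I"
  shows "((\<lambda>\<zeta>. f (x + axis a \<zeta>)) has_field_derivative pd a f x) (at 0)"
proof -
  have x: "x \<in> coord_space I" using copen_subset[OF smooth_open[OF hol_smooth[OF assms(1)]]] assms(2) by blast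
  have c: "cproj I (x + axis a \<zeta>) = x + axis a \<zeta>" for \<zeta>
    using x assms(3) by (intro cproj_id coord_space_add) auto
  have "((\<lambda>\<zeta>. x + axis a \<zeta>) has_derivative axis a) (at 0)"
    using has_derivative_add[OF has_derivative_const bounded_linear_imp_has_derivative[OF bounded_linear_axis]] by fastforce
  moreover have "((\<lambda>y. f (cproj I y)) has_derivative (\<lambda>v. ddir (cproj I v) f x)) (at (x + axis a 0))"
    using smooth_ddir_derivative[OF hol_smooth[OF assms(1)] assms(2)] by (simp add: axis_def zero_vec_def[symmetric])
  ultimately have "((\<lambda>\<zeta>. f (cproj I (x + axis a \<zeta>))) has_derivative (\<lambda>\<zeta>. ddir (cproj I (axis a \<zeta>)) f x)) (at 0)"
    by (rule has_derivative_compose)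
  moreover have "ddir (cproj I (axis a \<zeta>)) f x = pd a f x * \<zeta>" for \<zeta>
  proof -
    have "cproj I (axis a \<zeta>) = \<zeta> *s axis a 1" using assms(3) by (auto simp: vec_eq_iff axis_def)
    then show ?thesis using hol_ddir_smult[OF assms(1,2), of "axis a 1" \<zeta>] assms(3) hol_ddir_axis(1)[OF assms] by simp
  qed
  ultimately show ?thesis by (simp add: c has_field_derivative_def)
qed

context kaehler_bundle
begin

lemma pres_id: "preserves_form M \<omega> id"
  using kaehler by (simp add: kaehler_form_def)

lemma form_smooth:
  assumes "c \<in> mcharts M" "a \<in> midx M" "b \<in> midx M"
  shows "smooth_in (midx M) (cimage c) (\<lambda>x. \<omega> c x a b)"
  using kaehler assms by (intro smooth_fun_imp_smooth_in cimage_copen[OF M]) (auto simp: kaehler_form_def)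

lemma herm:
  assumes "c \<in> mcharts M" "x \<in> cimage c" "a \<in> midx M" "b \<in> midx M"
  shows "\<omega> c x b a = cnj (\<omega> c x a b)"
  using kaehler assms unfolding kaehler_form_def by blast

lemma hsum_pos:
  assumes "c \<in> mcharts M" "x \<in> cimage c" "u \<in> coord_space (midx M)" "u \<noteq> 0"
  shows "0 < Re (hsum (midx M) (\<omega> c x) u u)"
proof -
  have "0 < kmetric (midx M) (\<omega> c x) u u" using kaehler assms unfolding kaehler_form_def by blast
  moreover have "kmetric (midx M) (\<omega> c x) u u = 2 * Re (hsum (midx M) (\<omega> c x) u u)"
    by (rule kmetric_hsum) (rule herm[OF assms(1,2)])
  ultimately show ?thesis by simp
qed

lemma det_pos:
  assumes c: "c \<in> mcharts M" "x \<in> cimage c" and N: "N \<subseteq> midx M"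
  shows "Im (det_on N (\<omega> c x)) = 0" "0 < Re (det_on N (\<omega> c x))"
proof -
  have "Im (det_on N (\<omega> c x)) = 0 \<and> 0 < Re (det_on N (\<omega> c x))"
  proof (rule det_on_positive)
    show "\<omega> c x b a = cnj (\<omega> c x a b)" if "a \<in> N" "b \<in> N" for a b using herm[OF c] N that by blast
    fix u :: "'d \<Rightarrow> complex" assume u: "\<exists>a\<in>N. u a \<noteq> 0"
    define v :: "complex ^ 'd" where "v = (\<chi> a. if a \<in> N then u a else 0)"
    have "v \<in> coord_space (midx M)" using N by (auto simp: v_def coord_space_def)
    moreover have "v \<noteq> 0" using u by (auto simp: v_def vec_eq_iff)
    ultimately have "0 < Re (hsum (midx M) (\<omega> c x) v v)" by (rule hsum_pos[OF c])
    also have "hsum (midx M) (\<omega> c x) v v = (\<Sum>a\<in>N. \<Sum>b\<in>N. \<omega> c x a b * u a * cnj (u b))"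
    proof -
      have "hsum (midx M) (\<omega> c x) v v = (\<Sum>a\<in>N. \<Sum>b\<in>midx M. \<omega> c x a b * v $ a * cnj (v $ b))"
        unfolding hsum_def by (rule sum.mono_neutral_right) (use N in \<open>auto simp: v_def\<close>)
      also have "\<dots> = (\<Sum>a\<in>N. \<Sum>b\<in>N. \<omega> c x a b * v $ a * cnj (v $ b))"
        by (intro sum.cong refl sum.mono_neutral_right) (use N in \<open>auto simp: v_def\<close>)
      also have "\<dots> = (\<Sum>a\<in>N. \<Sum>b\<in>N. \<omega> c x a b * u a * cnj (u b))"
        by (intro sum.cong refl) (auto simp: v_def)
      finally show ?thesis .
    qed
    finally show "0 < Re (\<Sum>a\<in>N. \<Sum>b\<in>N. \<omega> c x a b * u a * cnj (u b))" .
  qed simp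
  then show "Im (det_on N (\<omega> c x)) = 0" "0 < Re (det_on N (\<omega> c x))" by auto
qed

lemma det_nz:
  assumes "c \<in> mcharts M" "x \<in> cimage c" shows "det_on (midx M) (\<omega> c x) \<noteq> 0"
  using det_pos(2)[OF assms order_refl] by force

text \<open>A symmetry of the form that is a translation in coordinates has the identity as its derivative.\<close>

lemma coeff_translation:
  assumes pres: "preserves_form M \<omega> f" and c: "c \<in> mcharts M" "c' \<in> mcharts M"
    and S: "copen (midx M) S" "S \<subseteq> cimage c" "x \<in> S"
    and f: "\<And>y. y \<in> S \<Longrightarrow> f (cinv c y) \<in> fst c' \<and> snd c' (f (cinv c y)) = y + k"
    and ab: "a \<in> midx M" "b \<in> midx M"
  shows "\<omega> c' (x + k) a b = \<omega> c x a b"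
proof -
  define F where "F = snd c' \<circ> f \<circ> cinv c"
  have xc: "x \<in> cimage c" using S by blast
  have d: "ddir u F x = u" if u: "u \<in> coord_space (midx M)" for u
  proof -
    have "ddir u F x = ddir u (\<lambda>y. y + k) x" by (rule ddir_cong[OF S(1,3) u]) (use f in \<open>auto simp: F_def\<close>)
    also have "\<dots> = ddir u (\<lambda>y. y) x + ddir u (\<lambda>y. k) x"
      by (rule ddir_add[OF smooth_linear[OF S(1) bounded_linear_ident] smooth_const[OF S(1)] S(3) u])
    finally show ?thesis by (simp add: ddir_const ddir_linear_fun[OF bounded_linear_ident])
  qed
  have Fx: "F x = x + k" using f S by (simp add: F_def)
  have eq: "form2 (midx M) (\<omega> c' (x + k)) u v = form2 (midx M) (\<omega> c x) u v"
    if uv: "u \<in> coord_space (midx M)" "v \<in> coord_space (midx M)" for u v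
    using pres[unfolded preserves_form_def Let_def F_def[symmetric], rule_format, OF c cinv_in[OF xc] conjunct1[OF f[OF S(3)]], unfolded snd_cinv[OF xc], OF uv]
    unfolding F_def[symmetric] d[OF uv(1)] d[OF uv(2)] Fx .
  have ax: "axis a 1 \<in> coord_space (midx M)" "axis b 1 \<in> coord_space (midx M)" "\<i> *s axis b 1 \<in> coord_space (midx M)"
    using ab by (auto intro: coord_space_smult)
  have "hsum (midx M) (\<omega> c' (x + k)) (axis a 1) (axis b 1) = hsum (midx M) (\<omega> c x) (axis a 1) (axis b 1)"
    unfolding hsum_form2 using eq[OF ax(1,2)] eq[OF ax(1,3)] by simp
  then show ?thesis using hsum_axis[OF ab] by simp
qed

end

context adapted
begin

lemma zc_add: "zc (x + y) = zc x + zc y" by (simp add: zc_def vec_eq_iff)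
lemma wc_add: "wc (x + y) = wc x + wc y" by (simp add: wc_def vec_eq_iff)
lemma wc_mix0 [simp]: "wc (mix z 0) = 0" by (simp add: wc_def vec_eq_iff)
lemma vexp_add: "vexp (a + b) = vexp a * vexp b" by (simp add: vexp_def vec_eq_iff exp_add)
lemma vexp_0 [simp]: "vexp 0 = 1" by (simp add: vexp_def vec_eq_iff)

lemma mix_add: "mix z w + mix z' w' = mix (z + z') (w + w')"
  by (simp add: mix_def vec_eq_iff)

lemma mix_scaleR: "r *\<^sub>R mix z w = mix (r *\<^sub>R z) (r *\<^sub>R w)"
  by (simp add: mix_def vec_eq_iff)

lemma mix_axis: "mix (axis i \<zeta>) 0 = axis (\<alpha> i) \<zeta>"
  by (auto simp: mix_def vec_eq_iff axis_def alpha_inj)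

lemma tor_vexp: "tor i \<zeta> = vexp (axis i \<zeta>)"
  by (auto simp: tor_def vexp_def vec_eq_iff axis_def)

lemma act_Psi:
  assumes "s \<in> T_complex" "t \<in> T_complex" "wc x \<in> W"
  shows "act s (\<Psi> t x) = \<Psi> (s * t) x"
proof -
  have "act s (\<Psi> t x) = tinv (s * (t * vexp (zc x)), cinv e (wc x))"
    unfolding Psi_facts(1)[OF assms(2,3)]
    by (rule act_tinv) (use assms T_complex_mult vexp_T cinv_W(1) U_e(2) in auto)
  then show ?thesis using Psi_facts(1)[OF T_complex_mult[OF assms(1,2)] assms(3)] by (simp add: mult.assoc)
qed

lemma Psi_shift: "\<Psi> t (x + mix z 0) = \<Psi> (t * vexp z) x"
  by (simp add: \<Psi>_def zc_add wc_add vexp_add mult_ac)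

lemma act_vexp_Psi:
  assumes "t \<in> T_complex" "wc x \<in> W"
  shows "act (vexp z) (\<Psi> t x) = \<Psi> t (x + mix z 0)"
  using act_Psi[OF vexp_T assms] by (simp add: Psi_shift mult.commute)

lemma vexp_compact: "(\<And>j. Re (z $ j) = 0) \<Longrightarrow> vexp z \<in> T_compact"
  by (simp add: vexp_def T_compact_def)

lemma shift_copen: "copen (midx M) {y \<in> X. y + mix z 0 \<in> X}"
proof -
  obtain X0 where X0: "open X0" "X = coord_space (midx M) \<inter> X0" using X_copen openin_open by blast
  have "{y \<in> X. y + mix z 0 \<in> X} = coord_space (midx M) \<inter> (X0 \<inter> (\<lambda>y. y + mix z 0) -` X0)"
    using X0 by (auto intro!: coord_space_add mix_coord_space)
  moreover have "open (X0 \<inter> (\<lambda>y. y + mix z 0) -` X0)"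
    by (intro open_Int open_vimage X0 continuous_intros)
  ultimately show ?thesis using openin_open by blast
qed

text \<open>In terms of the charts \<open>E t\<close> and \<open>E (s * t)\<close> the action of \<open>s\<close> is the identity of \<open>X\<close>.\<close>

lemma coeff_torus:
  assumes s: "s \<in> T_compact" and t: "t \<in> T_complex" and x: "x \<in> X" and ab: "a \<in> midx M" "b \<in> midx M"
  shows "\<omega> (E (s * t)) x a b = \<omega> (E t) x a b"
proof -
  note s' = T_compact_complex[OF s]
  have "\<omega> (E (s * t)) (x + 0) a b = \<omega> (E t) x a b"
  proof (rule coeff_translation[OF invariant[OF s] E_mem[OF t] E_mem[OF T_complex_mult[OF s' t]] X_copen _ x _ ab])
    show "X \<subseteq> cimage (E t)" using cimage_E[OF t] by simp
    fix y assume y: "y \<in> X"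
    have "act s (cinv (E t) y) = \<Psi> (s * t) y" using cinv_E[OF t y] act_Psi[OF s' t X_W[OF y]] by simp
    then show "act s (cinv (E t) y) \<in> fst (E (s * t)) \<and> snd (E (s * t)) (act s (cinv (E t) y)) = y + 0"
      using log_coords_Psi[OF T_complex_mult[OF s' t] y] y by (simp add: E_def)
  qed
  then show ?thesis by simp
qed

lemma coeff_imaginary:
  assumes z: "\<And>j. Re (z $ j) = 0" and t: "t \<in> T_complex" and x: "x \<in> X" "x + mix z 0 \<in> X" and ab: "a \<in> midx M" "b \<in> midx M"
  shows "\<omega> (E t) (x + mix z 0) a b = \<omega> (E t) x a b"
proof (rule coeff_translation[OF invariant[OF vexp_compact[OF z]] E_mem[OF t] E_mem[OF t] shift_copen[of z] _ _ _ ab])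
  show "{y \<in> X. y + mix z 0 \<in> X} \<subseteq> cimage (E t)" using cimage_E[OF t] by auto
  show "x \<in> {y \<in> X. y + mix z 0 \<in> X}" using x by simp
  fix y assume y: "y \<in> {y \<in> X. y + mix z 0 \<in> X}"
  then have "act (vexp z) (cinv (E t) y) = \<Psi> t (y + mix z 0)" using cinv_E[OF t] act_vexp_Psi[OF t X_W] by simp
  then show "act (vexp z) (cinv (E t) y) \<in> fst (E t) \<and> snd (E t) (act (vexp z) (cinv (E t) y)) = y + mix z 0"
    using log_coords_Psi[OF t] y by (simp add: E_def)
qed

lemma eventually_axis_X:
  assumes x: "x \<in> S" and S: "copen (midx M) S" and a: "a \<in> midx M"
  shows "eventually (\<lambda>\<zeta>. x + axis a \<zeta> \<in> S) (nhds 0)"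
proof -
  obtain X0 where X0: "open X0" "S = coord_space (midx M) \<inter> X0" using S openin_open by blast
  have "open ((\<lambda>\<zeta>. x + axis a \<zeta>) -` X0)"
    by (intro open_vimage X0 continuous_intros linear_continuous_on[OF bounded_linear_axis])
  moreover have "0 \<in> (\<lambda>\<zeta>. x + axis a \<zeta>) -` X0" using x X0 by (simp add: axis_def zero_vec_def[symmetric])
  ultimately have "eventually (\<lambda>\<zeta>. \<zeta> \<in> (\<lambda>\<zeta>. x + axis a \<zeta>) -` X0) (nhds 0)" by (rule eventually_nhds_in_open)
  then show ?thesis
    by (rule eventually_mono) (use x X0 a in \<open>auto intro!: coord_space_add\<close>)
qed

text \<open>In \<open>E t\<close> the \<open>i\<close>-th factor of the torus translates the \<open>i\<close>-th coordinate.  Its generators in an arbitrary chart are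
  therefore the images of constant fields under the transition map.\<close>

lemma act_tor_chart:
  assumes t: "t \<in> T_complex" and c: "c \<in> mcharts M" and y: "y \<in> overlap c (E t)"
  shows "eventually (\<lambda>\<zeta>. snd c (act (tor i \<zeta>) (cinv c y)) = chart_map (E t) c (chart_map c (E t) y + axis (\<alpha> i) \<zeta>)) (nhds 0)"
proof -
  define x where "x = chart_map c (E t) y"
  have xo: "x \<in> overlap (E t) c" "cinv (E t) x = cinv c y"
    using trans_overlap[OF M c E_mem[OF t] y] by (auto simp: x_def)
  have xX: "x \<in> X" using xo overlap_subset cimage_E[OF t] by blast
  have "cinv c y = \<Psi> t x" using xo cinv_E[OF t xX] by simp
  then have *: "act (tor i \<zeta>) (cinv c y) = \<Psi> t (x + axis (\<alpha> i) \<zeta>)" for \<zeta>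
    using act_vexp_Psi[OF t X_W[OF xX]] by (simp add: tor_vexp mix_axis)
  have "eventually (\<lambda>\<zeta>. x + axis (\<alpha> i) \<zeta> \<in> X) (nhds 0)"
    by (rule eventually_axis_X[OF xX X_copen]) simp
  then show ?thesis unfolding x_def[symmetric]
    by (rule eventually_mono) (simp add: * chart_map_def cinv_E[OF t])
qed

lemma Z_field_chart:
  assumes t: "t \<in> T_complex" and c: "c \<in> mcharts M" and y: "y \<in> overlap c (E t)"
  shows "fst (Z_field act i c y) $ b = pd (\<alpha> i) (\<lambda>z. chart_map (E t) c z $ b) (chart_map c (E t) y)"
proof -
  have xo: "chart_map c (E t) y \<in> overlap (E t) c" using trans_overlap[OF M c E_mem[OF t] y] by auto
  have "((\<lambda>\<zeta>. chart_map (E t) c (chart_map c (E t) y + axis (\<alpha> i) \<zeta>) $ b) has_field_derivative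
     pd (\<alpha> i) (\<lambda>z. chart_map (E t) c z $ b) (chart_map c (E t) y)) (at 0)"
    by (rule hol_has_field_derivative[OF trans_hol[OF M E_mem[OF t] c] xo]) simp
  then have "((\<lambda>\<zeta>. snd c (act (tor i \<zeta>) (cinv c y)) $ b) has_field_derivative
     pd (\<alpha> i) (\<lambda>z. chart_map (E t) c z $ b) (chart_map c (E t) y)) (at 0)"
    by (subst DERIV_cong_ev[OF refl _ refl]) (use act_tor_chart[OF t c y, of i] in \<open>auto elim: eventually_mono\<close>)
  then show ?thesis by (simp add: Z_field_def DERIV_imp_deriv)
qed

lemma circle_field_chart:
  assumes t: "t \<in> T_complex" and c: "c \<in> mcharts M" and y: "y \<in> overlap c (E t)"
  shows "circle_field act i c y = ddir (axis (\<alpha> i) \<i>) (chart_map (E t) c) (chart_map c (E t) y)"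
proof -
  have "eventually (\<lambda>\<theta>::real. snd c (act (tor i (\<i> * of_real \<theta>)) (cinv c y)) = chart_map (E t) c (chart_map c (E t) y + axis (\<alpha> i) (\<i> * of_real \<theta>))) (nhds 0)"
    using filterlim_compose[of "\<lambda>\<zeta>. \<zeta>" "nhds 0" "nhds 0" "\<lambda>\<theta>::real. \<i> * of_real \<theta>" "nhds 0"] act_tor_chart[OF t c y, of i]
  proof -
    have "filterlim (\<lambda>\<theta>::real. \<i> * of_real \<theta>) (nhds 0) (nhds 0)"
      by (rule tendsto_eq_intros filterlim_ident | simp)+
    then show ?thesis using act_tor_chart[OF t c y, of i] unfolding filterlim_iff by blast
  qed
  moreover have "axis (\<alpha> i) (\<i> * of_real \<theta>) = \<theta> *\<^sub>R axis (\<alpha> i) \<i>" for \<theta>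
    by (auto simp: axis_def vec_eq_iff scaleR_conv_of_real[where 'a = complex])
  ultimately have "eventually (\<lambda>\<theta>::real. snd c (act (tor i (\<i> * of_real \<theta>)) (cinv c y)) = chart_map (E t) c (chart_map c (E t) y + \<theta> *\<^sub>R axis (\<alpha> i) \<i>)) (nhds 0)"
    by simp
  then show ?thesis unfolding circle_field_def ddir_def
    by (intro vector_derivative_cong_eq) (auto elim: eventually_mono)
qed

lemma overlap_E_self: "t \<in> T_complex \<Longrightarrow> overlap (E t) (E t) = X"
  using cimage_E by (auto simp: overlap_def cimage_def)

lemma circle_field_E:
  assumes t: "t \<in> T_complex" and x: "x \<in> X"
  shows "circle_field act i (E t) x = axis (\<alpha> i) \<i>"
proof -
  have id: "chart_map (E t) (E t) y = y" if "y \<in> X" for y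
    using that cimage_E[OF t] snd_cinv[of y "E t"] by (simp add: chart_map_def)
  have "circle_field act i (E t) x = ddir (axis (\<alpha> i) \<i>) (chart_map (E t) (E t)) x"
    using circle_field_chart[OF t E_mem[OF t], of x i] x overlap_E_self[OF t] id[OF x] by simp
  also have "\<dots> = ddir (axis (\<alpha> i) \<i>) (\<lambda>y. y) x"
    by (rule ddir_cong[OF X_copen x]) (use id in auto)
  finally show ?thesis by (simp add: ddir_linear_fun[OF bounded_linear_ident])
qed

section \<open>The moment map in logarithmic coordinates\<close>

definition "\<phi> t j x = \<Phi> (\<Psi> t x) $ j"

lemma phi_smooth: assumes t: "t \<in> T_complex" shows "smooth_in (midx M) X (\<phi> t j)"
proof -
  have "smooth_in (midx M) X (\<lambda>y. \<Phi> (cinv (E t) y) $ j)"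
    using moment E_mem[OF t] cimage_E[OF t] X_copen unfolding moment_map_def by (metis smooth_fun_imp_smooth_in)
  then show ?thesis by (rule smooth_cong) (simp add: \<phi>_def cinv_E[OF t])
qed

text \<open>The moment map equation, as \<open>\<partial>/\<partial>\<theta>\<^sub>j\<close> has the constant components \<open>axis (\<alpha> j) \<i>\<close> in \<open>E t\<close>.\<close>

lemma phi_ddir:
  assumes t: "t \<in> T_complex" and x: "x \<in> X" and u: "u \<in> coord_space (midx M)"
  shows "complex_of_real (ddir u (\<phi> t j) x)
    = hsum (midx M) (\<omega> (E t) x) (axis (\<alpha> j) 1) u + hsum (midx M) (\<omega> (E t) x) u (axis (\<alpha> j) 1)"
proof -
  have "ddir u (\<lambda>y. \<Phi> (cinv (E t) y) $ j) x = ddir u (\<phi> t j) x"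
    by (rule ddir_cong[OF X_copen x u]) (simp add: \<phi>_def cinv_E[OF t])
  moreover have "form2 (midx M) (\<omega> (E t) x) (circle_field act j (E t) x) u = - of_real (ddir u (\<lambda>y. \<Phi> (cinv (E t) y) $ j) x)"
    using moment E_mem[OF t] cimage_E[OF t] x u unfolding moment_map_def by blast
  ultimately have "complex_of_real (ddir u (\<phi> t j) x) = - form2 (midx M) (\<omega> (E t) x) (axis (\<alpha> j) \<i>) u"
    using circle_field_E[OF t x] by simp
  moreover have "axis (\<alpha> j) \<i> = \<i> *s axis (\<alpha> j) 1" by (auto simp: vec_eq_iff axis_def)
  ultimately show ?thesis by (simp add: form2_hsum hsum_smult algebra_simps)
qed

lemma hsum_axis_left:
  assumes "a \<in> I" shows "hsum I h (axis a 1) u = (\<Sum>b\<in>I. h a b * cnj (u $ b))"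
proof -
  have "hsum I h (axis a 1) u = (\<Sum>c\<in>I. if c = a then (\<Sum>b\<in>I. h a b * cnj (u $ b)) else 0)"
    unfolding hsum_def by (rule sum.cong) (auto simp: axis_def)
  then show ?thesis using assms by simp
qed

lemma hsum_axis_right:
  assumes "b \<in> I" shows "hsum I h u (axis b 1) = (\<Sum>a\<in>I. h a b * u $ a)"
proof -
  have "(\<Sum>d\<in>I. h c d * u $ c * cnj (axis b 1 $ d)) = (\<Sum>d\<in>I. if d = b then h c b * u $ c else 0)" for c
    by (rule sum.cong) (auto simp: axis_def)
  then show ?thesis unfolding hsum_def using assms by simp
qed

lemma phi_wirtinger:
  assumes t: "t \<in> T_complex" and x: "x \<in> X" and b: "b \<in> midx M"
  shows "pdbar b (\<lambda>y. complex_of_real (\<phi> t j y)) x = \<omega> (E t) x (\<alpha> j) b"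
    "pd b (\<lambda>y. complex_of_real (\<phi> t j y)) x = \<omega> (E t) x b (\<alpha> j)"
proof -
  have L: "bounded_linear complex_of_real" by (rule bounded_linear_of_real)
  have d: "ddir u (\<lambda>y. complex_of_real (\<phi> t j y)) x = of_real (ddir u (\<phi> t j) x)" if "u \<in> coord_space (midx M)" for u
    by (rule ddir_bounded_linear[OF L phi_smooth[OF t] x that])
  have i: "axis b \<i> = \<i> *s axis b 1" by (auto simp: vec_eq_iff axis_def)
  have ib: "axis b \<i> \<in> coord_space (midx M)" using b by simp
  have d1: "ddir (axis b 1) (\<lambda>y. complex_of_real (\<phi> t j y)) x = \<omega> (E t) x (\<alpha> j) b + \<omega> (E t) x b (\<alpha> j)"
    using d[of "axis b 1"] phi_ddir[OF t x, of "axis b 1"] hsum_axis[of "\<alpha> j" "midx M" b] hsum_axis[of b "midx M" "\<alpha> j"] b by simp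
  have d2: "ddir (axis b \<i>) (\<lambda>y. complex_of_real (\<phi> t j y)) x = - \<i> * \<omega> (E t) x (\<alpha> j) b + \<i> * \<omega> (E t) x b (\<alpha> j)"
    using d[OF ib] phi_ddir[OF t x ib] hsum_axis[of "\<alpha> j" "midx M" b] hsum_axis[of b "midx M" "\<alpha> j"] b
    unfolding i hsum_smult by simp
  show "pdbar b (\<lambda>y. complex_of_real (\<phi> t j y)) x = \<omega> (E t) x (\<alpha> j) b"
    "pd b (\<lambda>y. complex_of_real (\<phi> t j y)) x = \<omega> (E t) x b (\<alpha> j)"
    unfolding pd_def pdbar_def d1 d2 by (simp_all add: algebra_simps)
qed

text \<open>The derivative along the orbit does not depend on the time \<open>u\<close>, because the moment map equation expresses it by
  coefficients of the form, which are the same along the orbit.\<close>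

lemma orbit_derivative:
  fixes \<theta> :: "real ^ 'n"
  assumes t: "t \<in> T_complex" and x: "x \<in> X"
  defines "z \<equiv> (\<chi> k. \<i> * complex_of_real (\<theta> $ k))"
  shows "((\<lambda>u::real. \<Phi> (\<Psi> (t * vexp (u *\<^sub>R z)) x) $ j) has_real_derivative ddir (mix z 0) (\<phi> t j) x) (at u)"
proof -
  define t' where "t' = vexp (u *\<^sub>R z) * t"
  have s: "vexp (u *\<^sub>R z) \<in> T_compact" by (rule vexp_compact) (simp add: z_def)
  have t': "t' \<in> T_complex" unfolding t'_def using T_complex_mult[OF T_compact_complex[OF s] t] .
  have zc: "mix z 0 \<in> coord_space (midx M)" by (rule mix_coord_space)
  have "((\<lambda>y. \<phi> t' j (cproj (midx M) y)) has_derivative (\<lambda>v. ddir (cproj (midx M) v) (\<phi> t' j) x)) (at x)"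
    by (rule smooth_ddir_derivative[OF phi_smooth[OF t'] x])
  from ddir_cproj(1)[OF zc this] have 1: "((\<lambda>s. \<phi> t' j (x + s *\<^sub>R mix z 0)) has_vector_derivative ddir (mix z 0) (\<phi> t' j) x) (at 0)"
    using x X_coord zc by (auto simp: cproj_id subset_iff)
  have eq: "\<phi> t' j (x + s *\<^sub>R mix z 0) = \<Phi> (\<Psi> (t * vexp ((s + u) *\<^sub>R z)) x) $ j" for s
    by (simp add: \<phi>_def mix_scaleR Psi_shift t'_def scaleR_add_left vexp_add mult_ac)
  have "((\<lambda>s. \<Phi> (\<Psi> (t * vexp ((s + u) *\<^sub>R z)) x) $ j) has_real_derivative ddir (mix z 0) (\<phi> t' j) x) (at 0)"
    using 1 unfolding eq has_real_derivative_iff_has_vector_derivative .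
  then have 2: "((\<lambda>s. \<Phi> (\<Psi> (t * vexp (s *\<^sub>R z)) x) $ j) has_real_derivative ddir (mix z 0) (\<phi> t' j) x) (at u)"
    using DERIV_shift[of "\<lambda>s. \<Phi> (\<Psi> (t * vexp (s *\<^sub>R z)) x) $ j" _ 0 u] by simp
  have "complex_of_real (ddir (mix z 0) (\<phi> t' j) x) = complex_of_real (ddir (mix z 0) (\<phi> t j) x)"
  proof -
    have "hsum (midx M) (\<omega> (E t') x) a b = hsum (midx M) (\<omega> (E t) x) a b" for a b
      unfolding hsum_def t'_def by (intro sum.cong refl) (simp add: coeff_torus[OF s t x])
    then show ?thesis using phi_ddir[OF t' x zc] phi_ddir[OF t x zc] by simp
  qed
  then show ?thesis using 2 by simp
qed

text \<open>Torus orbits are isotropic: along the \<open>k\<close>-th circle \<open>\<phi>\<^sub>j\<close> has constant derivative and is periodic, so that the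
  derivative vanishes, and it is a multiple of \<open>h\<^sub>j\<^sub>k - h\<^sub>k\<^sub>j\<close>.\<close>

lemma fibre_coeff_symmetric:
  assumes t: "t \<in> T_complex" and x: "x \<in> X"
  shows "\<omega> (E t) x (\<alpha> j) (\<alpha> k) = \<omega> (E t) x (\<alpha> k) (\<alpha> j)"
proof -
  define \<theta> :: "real ^ 'n" where "\<theta> = axis k 1"
  define z where "z = (\<chi> k. \<i> * complex_of_real (\<theta> $ k))"
  have zax: "z = axis k \<i>" by (auto simp: z_def \<theta>_def axis_def vec_eq_iff)
  define f where "f u = \<Phi> (\<Psi> (t * vexp (u *\<^sub>R z)) x) $ j" for u :: real
  have der: "(f has_real_derivative ddir (mix z 0) (\<phi> t j) x) (at u)" for u
    unfolding f_def[abs_def] z_def by (rule orbit_derivative[OF t x])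
  have "\<exists>u. 0 < u \<and> u < 2 * pi \<and> f (2 * pi) - f 0 = (2 * pi - 0) * ddir (mix z 0) (\<phi> t j) x"
    by (rule MVT2) (use der in auto)
  then have "f (2 * pi) - f 0 = (2 * pi - 0) * ddir (mix z 0) (\<phi> t j) x" by blast
  moreover have "vexp ((2 * pi) *\<^sub>R z) = 1"
  proof -
    have "exp ((complex_of_real (2 * pi)) * \<i>) = 1" using exp_two_pi_i by (simp add: mult_ac)
    then show ?thesis by (auto simp: zax vexp_def vec_eq_iff axis_def scaleR_conv_of_real[where 'a = complex])
  qed
  then have "f (2 * pi) = f 0" by (simp add: f_def)
  ultimately have "ddir (mix z 0) (\<phi> t j) x = 0" by simp
  moreover have "mix z 0 = \<i> *s axis (\<alpha> k) 1" unfolding zax mix_axis by (auto simp: vec_eq_iff axis_def)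
  ultimately show ?thesis
    using phi_ddir[OF t x mix_coord_space[of z 0], of j]
    by (simp add: hsum_smult hsum_axis)
qed

lemma fibre_coeff_real:
  assumes t: "t \<in> T_complex" and x: "x \<in> X"
  shows "\<omega> (E t) x (\<alpha> j) (\<alpha> k) = of_real (Re (\<omega> (E t) x (\<alpha> j) (\<alpha> k)))"
proof -
  have "\<omega> (E t) x (\<alpha> k) (\<alpha> j) = cnj (\<omega> (E t) x (\<alpha> j) (\<alpha> k))"
    by (rule herm[OF E_mem[OF t]]) (use cimage_E[OF t] x in auto)
  then have "Im (\<omega> (E t) x (\<alpha> j) (\<alpha> k)) = 0"
    using arg_cong[OF fibre_coeff_symmetric[OF t x, of j k], of Im] by simp
  then show ?thesis by (simp add: complex_eq_iff)
qed

lemma moment_invariant_Psi: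
  fixes \<theta> :: "real ^ 'n"
  assumes t: "t \<in> T_complex" and x: "x \<in> X"
  shows "\<Phi> (\<Psi> (t * vexp (\<chi> k. \<i> * complex_of_real (\<theta> $ k))) x) = \<Phi> (\<Psi> t x)"
proof -
  define z where "z = (\<chi> k. \<i> * complex_of_real (\<theta> $ k))"
  have "\<Phi> (\<Psi> (t * vexp z) x) $ j = \<Phi> (\<Psi> t x) $ j" for j
  proof -
    define f where "f u = \<Phi> (\<Psi> (t * vexp (u *\<^sub>R z)) x) $ j" for u :: real
    have "complex_of_real (ddir (mix z 0) (\<phi> t j) x) = 0"
    proof -
      have m: "mix z 0 $ \<alpha> k = \<i> * of_real (\<theta> $ k)" "b \<in> midx B \<Longrightarrow> mix z 0 $ \<gamma> b = 0" for k b by (simp_all add: z_def)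
      show ?thesis
        unfolding phi_ddir[OF t x mix_coord_space] hsum_axis_left[OF alpha_idx] hsum_axis_right[OF alpha_idx] sum_idx
        by (simp add: m z_def sum_negf[symmetric] sum.distrib[symmetric] fibre_coeff_symmetric[OF t x, of j])
    qed
    then have der: "(f has_real_derivative 0) (at u)" for u
      using orbit_derivative[OF t x, of \<theta> j u] unfolding f_def[abs_def] z_def by simp
    have "\<exists>u. 0 < u \<and> u < (1::real) \<and> f 1 - f 0 = (1 - 0) * 0"
      by (rule MVT2) (use der in auto)
    then have "f 1 - f 0 = (1 - 0) * 0" by blast
    then show ?thesis by (simp add: f_def)
  qed
  then show ?thesis by (simp add: vec_eq_iff z_def)
qed

lemma compact_vexp:
  assumes "s \<in> T_compact"
  obtains \<theta> :: "real ^ 'n" where "s = vexp (\<chi> k. \<i> * complex_of_real (\<theta> $ k))"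
proof -
  have "s $ k = exp (\<i> * complex_of_real (Arg (s $ k)))" for k
  proof -
    have "s $ k \<noteq> 0" "cmod (s $ k) = 1" using assms by (auto simp: T_compact_def) (metis norm_zero zero_neq_one)
    then show ?thesis using Arg_eq[of "s $ k"] by simp
  qed
  then show ?thesis by (intro that[of "\<chi> k. Arg (s $ k)"]) (simp add: vexp_def vec_eq_iff)
qed

lemma QU_Psi:
  assumes "q \<in> QU"
  defines "t \<equiv> fst (\<tau> q)" and "x \<equiv> mix 0 (snd e (\<pi> q))"
  shows "t \<in> T_complex" "x \<in> X" "\<Psi> t x = q"
proof -
  have q: "q \<in> Q" "\<pi> q \<in> U" using assms(1) by (auto simp: QU_Q)
  show t: "t \<in> T_complex" unfolding t_def using tau_in[OF q(1)] .
  have w: "snd e (\<pi> q) \<in> W" using q by (auto simp: W_def)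
  then have wc: "wc x = snd e (\<pi> q)" unfolding x_def using W_coord by (intro wc_mix) blast
  show "x \<in> X" using w mix_coord_space wc by (simp add: X_def) (simp add: x_def)
  show "\<Psi> t x = q" using tau_triv_pt(2)[OF q] by (simp add: \<Psi>_def wc t_def) (simp add: x_def)
qed

lemma moment_invariant:
  assumes s: "s \<in> T_compact" and q: "q \<in> QU"
  shows "\<Phi> (act s q) = \<Phi> q"
proof -
  obtain \<theta> :: "real ^ 'n" where \<theta>: "s = vexp (\<chi> k. \<i> * complex_of_real (\<theta> $ k))" by (rule compact_vexp[OF s])
  note P = QU_Psi[OF q]
  have "act s q = \<Psi> (fst (\<tau> q) * s) (mix 0 (snd e (\<pi> q)))"
    using act_Psi[OF T_compact_complex[OF s] P(1) X_W[OF P(2)]] P(3) by (simp add: mult.commute)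
  then show ?thesis using moment_invariant_Psi[OF P(1,2)] P(3) \<theta> by simp
qed

end

section \<open>Smooth implicit functions\<close>

lemma Ck_vec:
  fixes g :: "'a::real_normed_vector \<Rightarrow> 'w::real_normed_vector ^ 'l::finite"
  assumes "\<And>j. Ck k S (\<lambda>x. g x $ j)"
  shows "Ck k S g"
proof -
  have "g = (\<lambda>x. \<Sum>j\<in>UNIV. axis j (g x $ j))" using vec_sum_axis by blast
  moreover have "Ck k S (\<lambda>x. \<Sum>j\<in>UNIV. axis j (g x $ j))"
    by (intro Ck_sum Ck_bounded_linear[OF bounded_linear_axis] assms)
  ultimately show ?thesis by simp
qed

lemma Ck_vec_nth: "Ck k S g \<Longrightarrow> Ck k S (\<lambda>x. g x $ j)"
  by (rule Ck_bounded_linear[OF bounded_linear_vec_nth])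

lemma Ck_det:
  fixes A :: "'a::real_normed_vector \<Rightarrow> real ^ 'n ^ 'n"
  assumes "\<And>i j. Ck k S (\<lambda>x. A x $ i $ j)"
  shows "Ck k S (\<lambda>x. det (A x))"
  unfolding det_def by (intro Ck_sum Ck_mult Ck_const Ck_prod assms)

lemma Ck_frechet_derivative:
  assumes "\<And>k. Ck k S f"
  shows "x \<in> S \<Longrightarrow> (f has_derivative frechet_derivative f (at x)) (at x)"
    "open S \<Longrightarrow> Ck k S (\<lambda>x. frechet_derivative f (at x) v)"
proof -
  show "(f has_derivative frechet_derivative f (at x)) (at x)" if "x \<in> S" for x
    using Ck_differentiable[OF assms[of "Suc 0"] that] frechet_derivative_works by blast
  assume "open S"
  obtain f' where f': "\<And>x. x \<in> S \<Longrightarrow> (f has_derivative f' x) (at x)" "\<And>v. Ck k S (\<lambda>x. f' x v)"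
    using assms[of "Suc k"] by (rule Ck_SucE) blast
  then have "\<And>x. x \<in> S \<Longrightarrow> f' x v = frechet_derivative f (at x) v"
    using frechet_derivative_at by metis
  then show "Ck k S (\<lambda>x. frechet_derivative f (at x) v)"
    by (rule Ck_cong[OF \<open>open S\<close> _ f'(2)])
qed

text \<open>Where the implicit function is known to exist and to be unique, the inverse function theorem makes it
  differentiable; Cramer's rule for its derivative then yields smoothness by bootstrapping.\<close>

lemma implicit_function_Ck:
  fixes \<psi> :: "(real ^ 'n::finite) \<times> 'b::euclidean_space \<Rightarrow> real ^ 'n" and r :: "'b \<Rightarrow> real ^ 'n"
  assumes S: "open S"
    and \<psi>: "\<And>k. Ck k (UNIV \<times> S) \<psi>"
    and eq: "\<And>w. w \<in> S \<Longrightarrow> \<psi> (r w, w) = lam"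
    and uniq: "\<And>w \<rho>. w \<in> S \<Longrightarrow> \<psi> (\<rho>, w) = lam \<Longrightarrow> \<rho> = r w"
    and inv: "\<And>w v. w \<in> S \<Longrightarrow> frechet_derivative \<psi> (at (r w, w)) (v, 0) = 0 \<Longrightarrow> v = 0"
  shows "Ck k S r"
proof -
  define D where "D x = frechet_derivative \<psi> (at x)" for x
  have oU: "open (UNIV \<times> S :: ((real ^ 'n) \<times> 'b) set)" using S by (simp add: open_Times)
  have der: "(\<psi> has_derivative D x) (at x)" if "x \<in> UNIV \<times> S" for x
    unfolding D_def using Ck_frechet_derivative(1)[OF \<psi>] that by blast
  have Dk: "Ck k (UNIV \<times> S) (\<lambda>x. D x v)" for k v
    unfolding D_def by (rule Ck_frechet_derivative(2)[OF \<psi> oU])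
  have lin: "linear (D x)" if "x \<in> UNIV \<times> S" for x using der[OF that] has_derivative_linear by blast
  have diff: "r differentiable (at w0)" if w0: "w0 \<in> S" for w0
  proof -
    define G where "G x = (\<psi> x, snd x)" for x
    define G' where "G' x v = (D x v, snd v)" for x v
    have derG: "(G has_derivative G' x) (at x)" if "x \<in> UNIV \<times> S" for x
      unfolding G_def[abs_def] G'_def by (intro has_derivative_Pair der[OF that] has_derivative_snd has_derivative_ident)
    have bl: "blinfun_apply (Blinfun (G' x)) = G' x" if "x \<in> UNIV \<times> S" for x
      using bounded_linear_Blinfun_apply has_derivative_bounded_linear[OF derG[OF that]] by blast
    let ?x0 = "(r w0, w0)"
    have x0: "?x0 \<in> UNIV \<times> S" using w0 by simp
    have linG: "linear (G' ?x0)" using has_derivative_linear[OF derG[OF x0]] .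
    have "inj (G' ?x0)"
    proof (rule linear_injective_0[OF linG, THEN iffD2], intro allI impI)
      fix v assume "G' ?x0 v = 0"
      then have v: "snd v = 0" "D ?x0 v = 0" by (simp_all add: G'_def zero_prod_def)
      then have "v = (fst v, 0)" by (simp add: prod_eq_iff)
      then have "D ?x0 (fst v, 0) = 0" using v(2) by metis
      then show "v = 0" using inv[OF w0, of "fst v"] v(1) by (simp add: D_def prod_eq_iff)
    qed
    then obtain L where L: "linear L" "\<And>v. L (G' ?x0 v) = v"
      using linear_injective_isomorphism[OF linG] by blast
    have iv: "Blinfun L o\<^sub>L Blinfun (G' ?x0) = id_blinfun"
      by (rule blinfun_eqI)
        (use L bl[OF x0] bounded_linear_Blinfun_apply[of L] in \<open>simp add: linear_conv_bounded_linear\<close>)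
    have cont: "continuous_on (UNIV \<times> S) (\<lambda>x. Blinfun (G' x))"
    proof (rule continuous_on_blinfun_componentwise)
      fix i :: "(real ^ 'n) \<times> 'b"
      have "continuous_on (UNIV \<times> S) (\<lambda>x. G' x i)"
        unfolding G'_def by (intro continuous_intros Ck_continuous[OF Dk])
      then show "continuous_on (UNIV \<times> S) (\<lambda>x. blinfun_apply (Blinfun (G' x)) i)"
        by (rule continuous_on_eq) (use bl in auto)
    qed
    obtain U' V g g' where g: "open U'" "U' \<subseteq> UNIV \<times> S" "?x0 \<in> U'" "open V" "G ?x0 \<in> V" "homeomorphism U' V G g"
      "\<And>y. y \<in> V \<Longrightarrow> (g has_derivative (g' y)) (at y)"
      using inverse_function_theorem[OF oU _ cont x0 iv, of G] derG bl by metis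
    define T where "T = S \<inter> (\<lambda>w. (lam, w)) -` V"
    have "open T" unfolding T_def by (intro open_Int S open_vimage g(4) continuous_intros)
    have "w0 \<in> T" using w0 g(5) eq[OF w0] by (simp add: T_def G_def)
    have rg: "fst (g (lam, w)) = r w" if "w \<in> T" for w
    proof -
      have "(lam, w) \<in> V" using that by (simp add: T_def)
      then have gU: "g (lam, w) \<in> U'" "G (g (lam, w)) = (lam, w)"
        using g(6) by (auto simp: homeomorphism_def)
      then have "snd (g (lam, w)) = w" "\<psi> (g (lam, w)) = lam" by (auto simp: G_def)
      then have "\<psi> (fst (g (lam, w)), w) = lam" by (metis prod.collapse)
      then show ?thesis using uniq that by (auto simp: T_def)
    qed
    have "((\<lambda>w. (lam, w)) has_derivative (\<lambda>v. (0, v))) (at w0)"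
      by (intro has_derivative_Pair has_derivative_const has_derivative_ident)
    moreover have "(g has_derivative g' (lam, w0)) (at (lam, w0))"
      using g(7) \<open>w0 \<in> T\<close> by (simp add: T_def)
    ultimately have "((\<lambda>w. g (lam, w)) has_derivative (\<lambda>v. g' (lam, w0) (0, v))) (at w0)"
      by (rule has_derivative_compose)
    from has_derivative_fst[OF this] have "((\<lambda>w. fst (g (lam, w))) has_derivative (\<lambda>v. fst (g' (lam, w0) (0, v)))) (at w0)" .
    from has_derivative_transform_within_open[OF this \<open>open T\<close> \<open>w0 \<in> T\<close> rg]
    show ?thesis unfolding differentiable_def by blast
  qed
  define R where "R w = frechet_derivative r (at w)" for w
  have derR: "(r has_derivative R w) (at w)" if "w \<in> S" for w
    unfolding R_def using diff[OF that] frechet_derivative_works by blast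
  define P :: "'b \<Rightarrow> real ^ 'n ^ 'n" where "P w = (\<chi> i j. D (r w, w) (axis j 1, 0) $ i)" for w
  have Pv: "P w *v v = D (r w, w) (v, 0)" if w: "w \<in> S" for w v
  proof -
    have l: "linear (D (r w, w))" using lin w by blast
    have "(v, 0 :: 'b) = (\<Sum>j\<in>UNIV. (v $ j) *\<^sub>R (axis j 1, 0))"
    proof (rule prod_eqI)
      have "v = (\<Sum>j\<in>UNIV. (v $ j) *\<^sub>R axis j 1)"
        by (simp add: vec_eq_iff axis_def if_distrib cong: if_cong)
      then show "fst (v, 0 :: 'b) = fst (\<Sum>j\<in>UNIV. (v $ j) *\<^sub>R (axis j (1::real) :: real ^ 'n, 0 :: 'b))" by (simp add: fst_sum)
    qed (simp add: snd_sum)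
    then have "D (r w, w) (v, 0) = (\<Sum>j\<in>UNIV. (v $ j) *\<^sub>R D (r w, w) (axis j 1, 0))"
      by (simp only: linear_sum[OF l] linear_scale[OF l])
    then show ?thesis
      by (simp add: P_def matrix_vector_mult_def vec_eq_iff mult.commute)
  qed
  have detP: "det (P w) \<noteq> 0" if w: "w \<in> S" for w
  proof -
    have "inj ((*v) (P w))"
      by (rule linear_injective_0[THEN iffD2]) (use inv[OF w] Pv[OF w] in \<open>auto simp: D_def\<close>)
    then show ?thesis using det_nz_iff_inj[OF matrix_vector_mul_linear[of "P w"]] by simp
  qed
  define A :: "'b \<Rightarrow> 'b \<Rightarrow> 'n \<Rightarrow> real ^ 'n ^ 'n"
    where "A v w k = (\<chi> i j. if j = k then (- D (r w, w) (0, v)) $ i else P w $ i $ j)" for v w k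
  have Rk: "R w v = (\<chi> k. det (A v w k) / det (P w))" if w: "w \<in> S" for w v
  proof -
    have x: "(r w, w) \<in> UNIV \<times> S" using w by simp
    have l: "linear (D (r w, w))" using lin x by blast
    have "((\<lambda>w. (r w, w)) has_derivative (\<lambda>v. (R w v, v))) (at w)"
      by (intro has_derivative_Pair derR[OF w] has_derivative_ident)
    from has_derivative_compose[OF this der[OF x]]
    have "((\<lambda>w. \<psi> (r w, w)) has_derivative (\<lambda>v. D (r w, w) (R w v, v))) (at w)" .
    from has_derivative_transform_within_open[OF this S w eq]
    have "((\<lambda>w. lam) has_derivative (\<lambda>v. D (r w, w) (R w v, v))) (at w)" .
    then have "(\<lambda>v. D (r w, w) (R w v, v)) = (\<lambda>v. 0)" using has_derivative_const has_derivative_unique by blast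
    then have "D (r w, w) (R w v, v) = 0" by metis
    moreover have "D (r w, w) (R w v, v) = D (r w, w) (R w v, 0) + D (r w, w) (0, v)"
      using linear_add[OF l, of "(R w v, 0)" "(0, v)"] by simp
    ultimately have "P w *v (R w v) = - D (r w, w) (0, v)" unfolding Pv[OF w] by (simp add: eq_neg_iff_add_eq_0)
    then show ?thesis unfolding A_def using cramer[OF detP[OF w], of "R w v" "- D (r w, w) (0, v)"] by blast
  qed
  show ?thesis
  proof (induction k)
    case 0
    have "isCont r w" if "w \<in> S" for w using derR[OF that] has_derivative_continuous by blast
    then show ?case by (simp add: continuous_at_imp_continuous_on)
  next
    case (Suc k)
    have pair: "Ck k S (\<lambda>w. (r w, w))"
    proof -
      have "Ck k S (\<lambda>w. (\<lambda>x. (x, 0)) (r w) + (\<lambda>x. (0, x)) w)"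
        by (intro Ck_add Ck_bounded_linear[OF _ Suc] Ck_linear) (auto intro!: bounded_linear_intros)
      then show ?thesis by simp
    qed
    have DS: "Ck k S (\<lambda>w. D (r w, w) v)" for v
      by (rule Ck_compose[OF Dk pair _ S]) auto
    have PS: "Ck k S (\<lambda>w. P w $ i $ j)" for i j
      unfolding P_def using Ck_vec_nth[OF DS] by simp
    have AS: "Ck k S (\<lambda>w. A v w l $ i $ j)" for v l i j
    proof (cases "j = l")
      case True
      then show ?thesis using Ck_minus[OF Ck_vec_nth[OF DS[of "(0, v)"], of i]] by (simp add: A_def)
    next
      case False
      then show ?thesis using PS by (simp add: A_def)
    qed
    show ?case
    proof (rule Ck_SucI[OF derR])
      fix v
      have "Ck k S (\<lambda>w. det (A v w l) * inverse (det (P w)))" for l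
        by (intro Ck_mult Ck_inverse Ck_det AS PS detP S)
      then have "Ck k S (\<lambda>w. \<chi> l. det (A v w l) / det (P w))"
        by (intro Ck_vec) (simp add: divide_inverse)
      then show "Ck k S (\<lambda>w. R w v)"
        by (rule Ck_cong[OF S, rotated]) (simp add: Rk)
    qed
  qed
qed

section \<open>The level set of the moment map\<close>

context kaehler_bundle
begin

lemma one_T_compact: "(1 :: complex ^ 'n) \<in> T_compact"
  by (simp add: T_compact_def)

lemma topspace_quotient:
  "topspace (quotient_top M act \<Phi> lam) = T_orbit act ` level_set M \<Phi> lam"
proof -
  let ?L = "level_set M \<Phi> lam"
  let ?P = "\<lambda>W. W \<subseteq> T_orbit act ` ?L \<and> openin (subtopology (mtop M) ?L) {q \<in> ?L. T_orbit act q \<in> W}"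
  have L: "?L \<subseteq> topspace (mtop M)" by (auto simp: level_set_def)
  have "istopology ?P"
    unfolding istopology_def
  proof (intro conjI allI impI)
    fix S T assume "?P S" "?P T"
    moreover have "{q \<in> ?L. T_orbit act q \<in> S \<inter> T} = {q \<in> ?L. T_orbit act q \<in> S} \<inter> {q \<in> ?L. T_orbit act q \<in> T}" by auto
    ultimately show "S \<inter> T \<subseteq> T_orbit act ` ?L" "openin (subtopology (mtop M) ?L) {q \<in> ?L. T_orbit act q \<in> S \<inter> T}"
      using openin_Int by (auto simp only:)
  next
    fix K assume K: "\<forall>S\<in>K. ?P S"
    have "{q \<in> ?L. T_orbit act q \<in> \<Union> K} = (\<Union>S\<in>K. {q \<in> ?L. T_orbit act q \<in> S})" by auto
    moreover have "openin (subtopology (mtop M) ?L) (\<Union>S\<in>K. {q \<in> ?L. T_orbit act q \<in> S})"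
      using K by (intro openin_Union) auto
    ultimately show "openin (subtopology (mtop M) ?L) {q \<in> ?L. T_orbit act q \<in> \<Union> K}" by simp
    show "\<Union> K \<subseteq> T_orbit act ` ?L" using K by auto
  qed
  then have op: "openin (quotient_top M act \<Phi> lam) W \<longleftrightarrow> ?P W" for W
    unfolding quotient_top_def Let_def by (simp add: topology_inverse')
  have "{q \<in> ?L. T_orbit act q \<in> T_orbit act ` ?L} = ?L" by auto
  moreover have "openin (subtopology (mtop M) ?L) ?L"
    using openin_topspace[of "subtopology (mtop M) ?L"] L by (simp add: inf.absorb2)
  ultimately have "openin (quotient_top M act \<Phi> lam) (T_orbit act ` ?L)" unfolding op by simp
  then show ?thesis using op unfolding topspace_def by blast
qed

text \<open>Bijectivity of \<open>M\<^sub>\<lambda> \<rightarrow> M\<^sub>r\<^sub>e\<^sub>d\<close> means that every fibre of \<open>\<pi>\<close> meets the level set in exactly one orbit of the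
  compact torus.\<close>

lemma lambda_fibres:
  assumes "lam \<in> Lambda_set M B \<pi> act \<Phi>"
  shows "p \<in> topspace (mtop B) \<Longrightarrow> \<exists>q\<in>level_set M \<Phi> lam. \<pi> q = p"
    and "q \<in> level_set M \<Phi> lam \<Longrightarrow> q' \<in> level_set M \<Phi> lam \<Longrightarrow> \<pi> q = \<pi> q' \<Longrightarrow> \<exists>s\<in>T_compact. q' = act s q"
proof -
  let ?L = "level_set M \<Phi> lam"
  have "topspace (mtop (kaehler_quotient M (midx B) act \<Phi> lam)) = T_orbit act ` ?L"
    using topspace_quotient by (simp add: kaehler_quotient_def Let_def)
  then have bij: "bij_betw (\<lambda>orb. the_elem (\<pi> ` orb)) (T_orbit act ` ?L) (topspace (mtop B))"
    using assms by (simp add: Lambda_set_def biholomorphic_map_def)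
  have el: "the_elem (\<pi> ` T_orbit act q) = \<pi> q" if "q \<in> ?L" for q
  proof -
    have "\<pi> ` T_orbit act q = {\<pi> q}"
      using that pi_act[OF T_compact_complex] one_T_compact by (auto simp: T_orbit_def level_set_def image_iff)
    then show ?thesis by simp
  qed
  show "\<exists>q\<in>?L. \<pi> q = p" if "p \<in> topspace (mtop B)"
    using bij el that unfolding bij_betw_def by (metis (no_types, lifting) imageE)
  assume q: "q \<in> ?L" "q' \<in> ?L" "\<pi> q = \<pi> q'"
  then have "T_orbit act q = T_orbit act q'"
    using bij el unfolding bij_betw_def inj_on_def by (metis imageI)
  moreover have "q' \<in> T_orbit act q'"
    using act_1[of q'] q one_T_compact by (force simp: T_orbit_def level_set_def)
  ultimately show "\<exists>s\<in>T_compact. q' = act s q" by (auto simp: T_orbit_def)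
qed

end

context adapted
begin

definition of_real_vec :: "real ^ 'n \<Rightarrow> complex ^ 'n" where "of_real_vec r = (\<chi> j. complex_of_real (r $ j))"
definition sec :: "real ^ 'n \<Rightarrow> complex ^ 'r \<Rightarrow> complex ^ 'd" where "sec r w = mix (of_real_vec r) w"
text \<open>Being invariant under the compact torus, the level set is determined by its points with positive fibre
  coordinates.  There is one over every \<open>w\<close> (\<open>rad_level\<close>, \<open>level_unique\<close>), and \<open>rad lam w\<close> is the
  vector of logarithms of its fibre coordinates.\<close>

definition rad :: "real ^ 'n \<Rightarrow> complex ^ 'r \<Rightarrow> real ^ 'n" where "rad lam w = (SOME r. \<Phi> (\<Psi> 1 (sec r w)) = lam)"

lemma one_T: "(1 :: complex ^ 'n) \<in> T_complex" by (simp add: T_complex_def)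

lemma sec_X: "w \<in> W \<Longrightarrow> sec r w \<in> X"
  using mix_coord_space W_coord by (auto simp: sec_def X_def of_real_vec_def wc_mix subset_iff)

lemma wc_sec: "w \<in> W \<Longrightarrow> wc (sec r w) = w"
  unfolding sec_def using W_coord by (intro wc_mix) blast

lemma zc_sec: "zc (sec r w) = of_real_vec r" by (simp add: sec_def)

lemma Psi_sec:
  assumes "w \<in> W"
  shows "\<pi> (\<Psi> 1 (sec r w)) = cinv e w" "\<Psi> 1 (sec r w) \<in> QU" "fst (\<tau> (\<Psi> 1 (sec r w))) = vexp (of_real_vec r)"
  using Psi_facts[OF one_T X_W[OF sec_X[OF assms]]] wc_sec[OF assms] by (simp_all add: zc_sec)

text \<open>Both points lie over \<open>w\<close> on the level set, hence on one orbit of the compact torus, and fibre coordinates on such an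
  orbit have the same absolute values.\<close>

lemma level_unique:
  assumes lam: "lam \<in> Lambda_set M B \<pi> act \<Phi>" and w: "w \<in> W"
    and r: "\<Phi> (\<Psi> 1 (sec r w)) = lam" and r': "\<Phi> (\<Psi> 1 (sec r' w)) = lam"
  shows "r = r'"
proof -
  have L: "\<Psi> 1 (sec r w) \<in> level_set M \<Phi> lam" "\<Psi> 1 (sec r' w) \<in> level_set M \<Phi> lam"
    using Psi_sec(2)[OF w] r r' by (auto simp: level_set_def QU_def)
  obtain s where s: "s \<in> T_compact" "\<Psi> 1 (sec r' w) = act s (\<Psi> 1 (sec r w))"
    using lambda_fibres(2)[OF lam L] Psi_sec(1)[OF w] by auto
  have "\<Psi> 1 (sec r' w) = \<Psi> (s * 1) (sec r w)"
    using s(2) act_Psi[OF T_compact_complex[OF s(1)] one_T X_W[OF sec_X[OF w]]] by simp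
  then have "vexp (of_real_vec r') = fst (\<tau> (\<Psi> s (sec r w)))" using Psi_sec(3)[OF w, of r'] by simp
  then have eq: "vexp (of_real_vec r') = s * vexp (of_real_vec r)"
    using Psi_facts(2)[OF T_compact_complex[OF s(1)] X_W[OF sec_X[OF w, of r]]] zc_sec by simp
  have "r' $ j = r $ j" for j
  proof -
    have "exp (complex_of_real (r' $ j)) = s $ j * exp (complex_of_real (r $ j))"
      using arg_cong[OF eq, of "\<lambda>v. v $ j"] by (simp add: vexp_def of_real_vec_def)
    then have "cmod (exp (complex_of_real (r' $ j))) = cmod (s $ j) * cmod (exp (complex_of_real (r $ j)))"
      by (simp add: norm_mult)
    then show ?thesis using s(1) by (simp add: T_compact_def)
  qed
  then show ?thesis by (simp add: vec_eq_iff)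
qed

lemma level_polar:
  assumes q: "q \<in> QU"
  obtains r s where "s \<in> T_compact" "q = \<Psi> s (sec r (snd e (\<pi> q)))" "snd e (\<pi> q) \<in> W"
    "q = act s (\<Psi> 1 (sec r (snd e (\<pi> q))))"
proof -
  have q': "q \<in> Q" "\<pi> q \<in> U" using q by (auto simp: QU_Q)
  have w: "snd e (\<pi> q) \<in> W" using q' by (auto simp: W_def)
  define z where "z = fst (\<tau> q)"
  have z: "z $ j \<noteq> 0" for j using tau_in[OF q'(1)] by (simp add: z_def T_complex_def)
  define r where "r = (\<chi> j. ln (cmod (z $ j)))"
  define s where "s = (\<chi> j. z $ j / of_real (cmod (z $ j)))"
  have s: "s \<in> T_compact" using z by (simp add: T_compact_def s_def norm_divide)
  have "exp (complex_of_real (ln (cmod (z $ j)))) = of_real (cmod (z $ j))" for j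
    using z[of j] by (simp add: exp_of_real)
  then have sz: "s * vexp (of_real_vec r) = z" using z by (simp add: vec_eq_iff s_def vexp_def of_real_vec_def r_def)
  have 1: "q = \<Psi> s (sec r (snd e (\<pi> q)))"
    using tau_triv_pt(2)[OF q'] by (simp add: \<Psi>_def wc_sec[OF w] zc_sec sz) (simp add: z_def)
  show ?thesis
  proof (rule that[OF s 1 w])
    show "q = act s (\<Psi> 1 (sec r (snd e (\<pi> q))))"
      using 1 act_Psi[OF T_compact_complex[OF s] one_T X_W[OF sec_X[OF w]]] by simp
  qed
qed

lemma rad_level:
  assumes lam: "lam \<in> Lambda_set M B \<pi> act \<Phi>" and w: "w \<in> W"
  shows "\<Phi> (\<Psi> 1 (sec (rad lam w) w)) = lam"
proof -
  have "cinv e w \<in> topspace (mtop B)" using cinv_W(1)[OF w] U_e(2) V_top by blast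
  then obtain q where q: "q \<in> level_set M \<Phi> lam" "\<pi> q = cinv e w" using lambda_fibres(1)[OF lam] by blast
  then have qU: "q \<in> QU" using cinv_W(1)[OF w] by (simp add: QU_def level_set_def)
  have sw: "snd e (\<pi> q) = w" using q(2) cinv_W(2)[OF w] by simp
  obtain r s where rs: "s \<in> T_compact" "q = act s (\<Psi> 1 (sec r (snd e (\<pi> q))))" by (rule level_polar[OF qU])
  then have "q = act s (\<Psi> 1 (sec r w))" by (simp add: sw)
  then have "\<Phi> q = \<Phi> (\<Psi> 1 (sec r w))" using moment_invariant[OF rs(1) Psi_sec(2)[OF w]] by simp
  then have "\<Phi> (\<Psi> 1 (sec r w)) = lam" using q by (simp add: level_set_def)
  then show ?thesis unfolding rad_def by (rule someI)
qed

lemma level_over: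
  assumes lam: "lam \<in> Lambda_set M B \<pi> act \<Phi>" and w: "w \<in> W" and q: "q \<in> level_set M \<Phi> lam" "\<pi> q = cinv e w"
  shows "\<exists>s\<in>T_compact. q = \<Psi> s (sec (rad lam w) w) \<and> q = act s (\<Psi> 1 (sec (rad lam w) w))"
proof -
  have "\<Psi> 1 (sec (rad lam w) w) \<in> level_set M \<Phi> lam"
    using Psi_sec(2)[OF w] rad_level[OF lam w] by (auto simp: level_set_def QU_def)
  then obtain s where s: "s \<in> T_compact" "q = act s (\<Psi> 1 (sec (rad lam w) w))"
    using lambda_fibres(2)[OF lam _ q(1)] Psi_sec(1)[OF w] q(2) by metis
  then show ?thesis using act_Psi[OF T_compact_complex[OF s(1)] one_T X_W[OF sec_X[OF w]]] by auto
qed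

lemma bounded_linear_sec: "bounded_linear (\<lambda>(\<rho>, w). sec \<rho> (cproj (midx B) w))"
proof -
  have c: "of_real_vec (a + b) = of_real_vec a + of_real_vec b" "of_real_vec (r *\<^sub>R a) = r *\<^sub>R of_real_vec a" for a b r
    by (simp_all add: of_real_vec_def vec_eq_iff scaleR_conv_of_real[where 'a = complex])
  have "linear (\<lambda>(\<rho>, w). sec \<rho> (cproj (midx B) w))"
    by (rule linearI) (auto simp: sec_def c mix_add mix_scaleR cproj_add cproj_scaleR)
  then show ?thesis by (simp add: linear_conv_bounded_linear)
qed

text \<open>The derivative of the moment map along real fibre directions is twice the fibre block of the form, which is symmetric
  and positive definite.\<close>

lemma fibre_derivative_injective:
  assumes x: "x \<in> X" and v: "\<And>j. ddir (mix (of_real_vec v) 0) (\<phi> 1 j) x = 0"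
  shows "v = 0"
proof (rule ccontr)
  assume "v \<noteq> 0"
  let ?u = "mix (of_real_vec v) 0"
  let ?h = "\<omega> (E 1) x"
  have u: "?u \<in> coord_space (midx M)" by (rule mix_coord_space)
  have m: "?u $ \<alpha> k = of_real (v $ k)" "b \<in> midx B \<Longrightarrow> ?u $ \<gamma> b = 0" for k b by (simp_all add: of_real_vec_def)
  have "(\<Sum>k\<in>UNIV. ?h (\<alpha> j) (\<alpha> k) * of_real (v $ k)) = 0" for j
  proof -
    have "(\<Sum>k\<in>UNIV. ?h (\<alpha> j) (\<alpha> k) * of_real (v $ k)) + (\<Sum>k\<in>UNIV. ?h (\<alpha> k) (\<alpha> j) * of_real (v $ k)) = 0"
      using phi_ddir[OF one_T x u, of j] v[of j]
      by (simp add: hsum_axis_left[OF alpha_idx] hsum_axis_right[OF alpha_idx] sum_idx of_real_vec_def)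
    moreover have "(\<Sum>k\<in>UNIV. ?h (\<alpha> k) (\<alpha> j) * of_real (v $ k)) = (\<Sum>k\<in>UNIV. ?h (\<alpha> j) (\<alpha> k) * of_real (v $ k))"
      by (intro sum.cong refl) (simp only: fibre_coeff_symmetric[OF one_T x, of j])
    ultimately show ?thesis by simp
  qed
  moreover have "hsum (midx M) ?h ?u ?u = (\<Sum>j\<in>UNIV. of_real (v $ j) * (\<Sum>k\<in>UNIV. ?h (\<alpha> j) (\<alpha> k) * of_real (v $ k)))"
    by (simp add: hsum_def sum_idx of_real_vec_def sum_distrib_left mult_ac)
  ultimately have "hsum (midx M) ?h ?u ?u = 0" by simp
  moreover have "?u \<noteq> 0"
  proof
    assume "?u = 0"
    then have "?u $ \<alpha> k = 0" for k by (simp only: zero_index)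
    then show False using \<open>v \<noteq> 0\<close> by (simp add: of_real_vec_def vec_eq_iff)
  qed
  ultimately show False using hsum_pos[OF E_mem[OF one_T] _ u] cimage_E[OF one_T] x by fastforce
qed

text \<open>The implicit function theorem for \<open>(\<rho>, w) \<mapsto> \<Phi>(\<Psi> 1 (sec \<rho> w))\<close>; the projection of \<open>w\<close> makes its domain open.\<close>

lemma rad_smooth:
  assumes lam: "lam \<in> Lambda_set M B \<pi> act \<Phi>"
  shows "smooth_in (midx B) W (rad lam)"
  unfolding smooth_in_def
proof (intro conjI allI W_copen)
  fix k
  define S where "S = cproj (midx B) -` W"
  define \<psi> where "\<psi> = (\<lambda>(\<rho>, w). \<Phi> (\<Psi> 1 (sec \<rho> (cproj (midx B) w))))"
  have S: "open S" unfolding S_def by (rule copen_thick[OF W_copen])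
  have oU: "open (UNIV \<times> S :: ((real ^ 'n) \<times> (complex ^ 'r)) set)" using S by (simp add: open_Times)
  have SW: "cproj (midx B) w \<in> W" if "w \<in> S" for w using that by (simp add: S_def)
  have secI: "sec \<rho> w \<in> coord_space (midx M)" for \<rho> w by (simp add: sec_def mix_coord_space)
  have psij: "\<psi> x $ j = \<phi> 1 j (cproj (midx M) ((\<lambda>(\<rho>, w). sec \<rho> (cproj (midx B) w)) x))" for x j
    by (simp add: \<psi>_def \<phi>_def split_beta cproj_id[OF secI])
  have \<psi>k: "Ck k (UNIV \<times> S) \<psi>" for k
  proof (rule Ck_vec)
    fix j
    have "Ck k (cproj (midx M) -` X) (\<lambda>x. \<phi> 1 j (cproj (midx M) x))" using phi_smooth[OF one_T] smooth_in_def by blast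
    then show "Ck k (UNIV \<times> S) (\<lambda>x. \<psi> x $ j)"
      unfolding psij
      by (rule Ck_compose[OF _ Ck_linear[OF bounded_linear_sec]])
        (use oU SW sec_X in \<open>auto simp: cproj_id[OF secI]\<close>)
  qed
  show "Ck k (cproj (midx B) -` W) (\<lambda>x. rad lam (cproj (midx B) x))"
    unfolding S_def[symmetric]
  proof (rule implicit_function_Ck[OF S \<psi>k, where lam = lam])
    show "\<psi> (rad lam (cproj (midx B) w), w) = lam" if "w \<in> S" for w
      using rad_level[OF lam SW[OF that]] by (simp add: \<psi>_def)
    show "\<rho> = rad lam (cproj (midx B) w)" if "w \<in> S" "\<psi> (\<rho>, w) = lam" for w \<rho>
      using level_unique[OF lam SW[OF that(1)] _ rad_level[OF lam SW[OF that(1)]]] that(2) by (simp add: \<psi>_def)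
    fix w v assume w: "w \<in> S" and D0: "frechet_derivative \<psi> (at (rad lam (cproj (midx B) w), w)) (v, 0) = 0"
    let ?x = "(rad lam (cproj (midx B) w), w)"
    let ?y = "sec (rad lam (cproj (midx B) w)) (cproj (midx B) w)"
    have y: "?y \<in> X" using sec_X[OF SW[OF w]] .
    have der: "(\<psi> has_derivative frechet_derivative \<psi> (at ?x)) (at ?x)"
      by (rule Ck_frechet_derivative(1)[OF \<psi>k]) (use w in auto)
    have "ddir (mix (of_real_vec v) 0) (\<phi> 1 j) ?y = 0" for j
    proof -
      have "((\<lambda>x. \<phi> 1 j (cproj (midx M) ((\<lambda>(\<rho>, w). sec \<rho> (cproj (midx B) w)) x))) has_derivative
          (\<lambda>d. ddir (cproj (midx M) ((\<lambda>(\<rho>, w). sec \<rho> (cproj (midx B) w)) d)) (\<phi> 1 j) ?y)) (at ?x)"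
        by (rule has_derivative_compose[OF bounded_linear_imp_has_derivative[OF bounded_linear_sec]])
          (use smooth_ddir_derivative[OF phi_smooth[OF one_T] y] in simp)
      then have 1: "((\<lambda>x. \<psi> x $ j) has_derivative (\<lambda>d. ddir (cproj (midx M) ((\<lambda>(\<rho>, w). sec \<rho> (cproj (midx B) w)) d)) (\<phi> 1 j) ?y)) (at ?x)"
        unfolding psij .
      have 2: "((\<lambda>x. \<psi> x $ j) has_derivative (\<lambda>d. frechet_derivative \<psi> (at ?x) d $ j)) (at ?x)"
        by (rule bounded_linear.has_derivative[OF bounded_linear_vec_nth der])
      have "(\<lambda>d. ddir (cproj (midx M) ((\<lambda>(\<rho>, w). sec \<rho> (cproj (midx B) w)) d)) (\<phi> 1 j) ?y) = (\<lambda>d. frechet_derivative \<psi> (at ?x) d $ j)"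
        by (rule has_derivative_unique[OF 1 2])
      from fun_cong[OF this, of "(v, 0)"]
      have "ddir (cproj (midx M) (sec v (cproj (midx B) 0))) (\<phi> 1 j) ?y = 0" using D0 by simp
      moreover have "cproj (midx B) 0 = 0" by (simp add: vec_eq_iff)
      ultimately show ?thesis unfolding cproj_id[OF secI] by (simp add: sec_def)
    qed
    then show "v = 0" by (rule fibre_derivative_injective[OF y])
  qed
qed

end

section \<open>Calculus along the level set\<close>

lemma hsum_add:
  "hsum I h (u + u') v = hsum I h u v + hsum I h u' v" "hsum I h u (v + v') = hsum I h u v + hsum I h u v'"
  by (simp_all add: hsum_def algebra_simps sum.distrib)

lemma ddbar_cong:
  assumes "copen I S" "x \<in> S" "\<And>y. y \<in> S \<Longrightarrow> u y = v y"
  shows "ddbar I u x a b = ddbar I v x a b"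
proof (cases "a \<in> I \<and> b \<in> I")
  case True
  have "pdbar b (\<lambda>y. complex_of_real (u y)) y = pdbar b (\<lambda>y. complex_of_real (v y)) y" if "y \<in> S" for y
    by (rule wirtinger_cong(2)[OF that _ assms(1)]) (use True assms(3) in auto)
  then have "pd a (pdbar b (\<lambda>y. complex_of_real (u y))) x = pd a (pdbar b (\<lambda>y. complex_of_real (v y))) x"
    using wirtinger_cong(1)[OF assms(2) _ assms(1), of a] True by blast
  then show ?thesis by (simp add: ddbar_def)
qed (auto simp: ddbar_def)

lemma ddbar_lincomb:
  assumes u: "smooth_in I S u" and v: "smooth_in I S v" and x: "x \<in> S"
  shows "ddbar I (\<lambda>y. r + s * u y + t * v y) x a b = of_real s * ddbar I u x a b + of_real t * ddbar I v x a b"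
proof (cases "a \<in> I \<and> b \<in> I")
  case True
  then have ab: "a \<in> I" "b \<in> I" by auto
  note o = smooth_open[OF u]
  let ?u = "\<lambda>y. complex_of_real (u y)" and ?v = "\<lambda>y. complex_of_real (v y)"
  have su: "smooth_in I S ?u" and sv: "smooth_in I S ?v" using u v smooth_of_real by blast+
  have 1: "pdbar b (\<lambda>y. complex_of_real (r + s * u y + t * v y)) y = of_real s * pdbar b ?u y + of_real t * pdbar b ?v y"
    if y: "y \<in> S" for y
  proof -
    have s1: "smooth_in I S (\<lambda>y. of_real s * ?u y)" and s2: "smooth_in I S (\<lambda>y. of_real t * ?v y)"
      by (intro smooth_mult smooth_const o su sv)+
    have "pdbar b (\<lambda>y. complex_of_real r + of_real s * ?u y + of_real t * ?v y) y = of_real s * pdbar b ?u y + of_real t * pdbar b ?v y"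
      unfolding wirtinger_add(2)[OF y ab(2) smooth_add[OF smooth_const[OF o] s1] s2] wirtinger_add(2)[OF y ab(2) smooth_const[OF o] s1]
        wirtinger_cmult(2)[OF su y ab(2)] wirtinger_cmult(2)[OF sv y ab(2)] by simp
    then show ?thesis by simp
  qed
  have s1: "smooth_in I S (\<lambda>y. of_real s * pdbar b ?u y)" and s2: "smooth_in I S (\<lambda>y. of_real t * pdbar b ?v y)"
    by (intro smooth_mult smooth_const o smooth_pd(2)[OF su ab(2)] smooth_pd(2)[OF sv ab(2)])+
  have "pd a (pdbar b (\<lambda>y. complex_of_real (r + s * u y + t * v y))) x = pd a (\<lambda>y. of_real s * pdbar b ?u y + of_real t * pdbar b ?v y) x"
    by (rule wirtinger_cong(1)[OF x ab(1) o 1])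
  also have "\<dots> = of_real s * pd a (pdbar b ?u) x + of_real t * pd a (pdbar b ?v) x"
    unfolding wirtinger_add(1)[OF x ab(1) s1 s2] wirtinger_cmult(1)[OF smooth_pd(2)[OF su ab(2)] x ab(1)]
      wirtinger_cmult(1)[OF smooth_pd(2)[OF sv ab(2)] x ab(1)] ..
  finally show ?thesis using True by (simp add: ddbar_def)
qed (auto simp: ddbar_def)

context adapted
begin

text \<open>Invariance under imaginary translations of the fibre coordinates, by which the compact torus acts.\<close>

definition torus_inv :: "(complex ^ 'd \<Rightarrow> 'w::real_normed_vector) \<Rightarrow> bool" where
  "torus_inv u \<longleftrightarrow> (\<forall>x z. x \<in> X \<longrightarrow> x + mix z 0 \<in> X \<longrightarrow> (\<forall>j. Re (z $ j) = 0) \<longrightarrow> u (x + mix z 0) = u x)"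

lemma iminvD: "torus_inv u \<Longrightarrow> x \<in> X \<Longrightarrow> x + mix z 0 \<in> X \<Longrightarrow> (\<And>j. Re (z $ j) = 0) \<Longrightarrow> u (x + mix z 0) = u x"
  by (simp add: torus_inv_def)

lemma torus_inv_ddir:
  assumes u: "torus_inv u" and v: "v \<in> coord_space (midx M)"
  shows "torus_inv (ddir v u)"
  unfolding torus_inv_def
proof (intro allI impI)
  fix x z assume x: "x \<in> X" "x + mix z 0 \<in> X" and z: "\<forall>j. Re (z $ j) = 0"
  have "ddir v u (x + mix z 0) = ddir v (\<lambda>y. u (y + mix z 0)) x"
    by (simp add: ddir_def algebra_simps)
  also have "\<dots> = ddir v u x"
    by (rule ddir_cong[OF shift_copen[of z] _ v]) (use x z iminvD[OF u] in auto)
  finally show "ddir v u (x + mix z 0) = ddir v u x" .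
qed

lemma torus_inv_pdbar:
  assumes u: "torus_inv u" and b: "b \<in> midx M"
  shows "torus_inv (pdbar b u)"
  using torus_inv_ddir[OF u, of "axis b 1"] torus_inv_ddir[OF u, of "axis b \<i>"] b
  by (simp add: torus_inv_def pdbar_def)

lemma torus_inv_flat:
  assumes u: "torus_inv u" and x: "x \<in> X"
  shows "ddir (axis (\<alpha> k) \<i>) u x = 0"
proof -
  have ax: "axis (\<alpha> k) \<i> \<in> coord_space (midx M)" by simp
  have "t *\<^sub>R axis (\<alpha> k) \<i> = mix (axis k (\<i> * of_real t)) 0" for t
    unfolding mix_axis by (auto simp: vec_eq_iff axis_def scaleR_conv_of_real[where 'a = complex])
  then have "u (x + t *\<^sub>R axis (\<alpha> k) \<i>) = u x" if "x + t *\<^sub>R axis (\<alpha> k) \<i> \<in> X" for t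
    using iminvD[OF u x, of "axis k (\<i> * of_real t)"] that by (simp add: axis_def)
  then have "eventually (\<lambda>t. u (x + t *\<^sub>R axis (\<alpha> k) \<i>) = u x) (nhds 0)"
    using copen_line[OF X_copen x ax] by (auto elim: eventually_mono)
  then have "ddir (axis (\<alpha> k) \<i>) u x = vector_derivative (\<lambda>t. u x) (at 0)"
    unfolding ddir_def by (intro vector_derivative_cong_eq) (auto elim: eventually_mono)
  then show ?thesis by simp
qed

lemma torus_inv_phi: "t \<in> T_complex \<Longrightarrow> torus_inv (\<phi> t j)"
  unfolding torus_inv_def
proof (intro allI impI)
  fix x z assume t: "t \<in> T_complex" and x: "x \<in> X" "x + mix z 0 \<in> X" and z: "\<forall>j. Re (z $ j) = 0"
  have "z = (\<chi> k. \<i> * complex_of_real ((\<chi> k. Im (z $ k)) $ k))" using z by (simp add: vec_eq_iff complex_eq_iff)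
  then show "\<phi> t j (x + mix z 0) = \<phi> t j x"
    using moment_invariant_Psi[OF t x(1), of "\<chi> k. Im (z $ k)"] by (simp add: \<phi>_def Psi_shift)
qed

definition "logdet t x = ln (Re (det_on (midx M) (\<omega> (E t) x)))"

lemma coeff_smooth: "t \<in> T_complex \<Longrightarrow> a \<in> midx M \<Longrightarrow> b \<in> midx M \<Longrightarrow> smooth_in (midx M) X (\<lambda>x. \<omega> (E t) x a b)"
  using form_smooth[OF E_mem] cimage_E by metis

lemma X_cimage: "t \<in> T_complex \<Longrightarrow> x \<in> X \<Longrightarrow> x \<in> cimage (E t)" using cimage_E by simp

lemma det_smooth:
  assumes "t \<in> T_complex" "N \<subseteq> midx M"
  shows "smooth_in (midx M) X (\<lambda>x. Re (det_on N (\<omega> (E t) x)))"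
  by (intro smooth_Re smooth_det_on X_copen coeff_smooth) (use assms in auto)

lemma logdet_smooth: "t \<in> T_complex \<Longrightarrow> smooth_in (midx M) X (logdet t)"
  unfolding logdet_def[abs_def]
  by (intro smooth_ln det_smooth) (use det_pos(2)[OF E_mem X_cimage] in auto)

lemma torus_inv_logdet: "t \<in> T_complex \<Longrightarrow> torus_inv (logdet t)"
  unfolding torus_inv_def
proof (intro allI impI)
  fix x z assume t: "t \<in> T_complex" and x: "x \<in> X" "x + mix z 0 \<in> X" and z: "\<forall>j. Re (z $ j) = 0"
  have "det_on (midx M) (\<omega> (E t) (x + mix z 0)) = det_on (midx M) (\<omega> (E t) x)"
    by (rule det_on_cong) (use coeff_imaginary[OF _ t x] z in auto)
  then show "logdet t (x + mix z 0) = logdet t x" by (simp add: logdet_def)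
qed

lemma torus_inv_of_real: "torus_inv u \<Longrightarrow> torus_inv (\<lambda>x. complex_of_real (u x))"
  by (simp add: torus_inv_def)

text \<open>An invariant function has no derivative along \<open>Im \<zeta>\<^sub>k\<close>, so its real derivative along \<open>\<zeta>\<^sub>k\<close> is twice the
  holomorphic one.\<close>

lemma torus_inv_fibre_real:
  assumes "torus_inv u" "x \<in> X"
  shows "ddir (axis (\<alpha> k) 1) u x = 2 * pd (\<alpha> k) u x"
  using torus_inv_flat[OF assms] by (simp add: pd_def)

section \<open>Divergence of the generators\<close>

text \<open>In \<open>E t\<close> the field \<open>Z\<^sub>i\<close> has constant coefficients, so only the derivative of the density \<open>det h\<close> contributes;
  \<open>coord_div_transition\<close> covers the other charts.\<close>

lemma divergence_E:
  assumes t: "t \<in> T_complex" and x: "x \<in> X"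
  shows "divergence M \<omega> (Z_field act i) (\<Psi> t x) = pd (\<alpha> i) (\<lambda>y. complex_of_real (logdet t y)) x"
proof -
  let ?I = "midx M"
  let ?q = "\<Psi> t x"
  have q: "?q \<in> fst (E t)" "snd (E t) ?q = x" using x log_coords_Psi[OF t x] by (auto simp: E_def)
  have top: "?q \<in> topspace (mtop M)" using Psi_facts(4)[OF t X_W[OF x]] .
  have ovq: "snd c ?q \<in> overlap c (E t)" "chart_map (E t) c x = snd c ?q" "x \<in> overlap (E t) c" if c: "c \<in> mcharts M" "?q \<in> fst c" for c
  proof -
    show "snd c ?q \<in> overlap c (E t)" using c q by (auto intro: overlap_memI)
    show "chart_map (E t) c x = snd c ?q" using trans_snd[OF M E_mem[OF t] q(1)] q(2) by simp
    show "x \<in> overlap (E t) c" using overlap_memI[OF q(1) c(2)] q(2) by simp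
  qed
  have dE: "det_on ?I (\<omega> (E t) y) = complex_of_real (Re (det_on ?I (\<omega> (E t) y)))" if "y \<in> X" for y
    using det_pos(1)[OF E_mem[OF t] X_cimage[OF t that] order_refl] by (simp add: complex_eq_iff)
  have ai: "\<alpha> i \<in> ?I" by simp
  have val: "pd (\<alpha> i) (\<lambda>y. det_on ?I (\<omega> (E t) y)) x / det_on ?I (\<omega> (E t) x) = pd (\<alpha> i) (\<lambda>y. complex_of_real (logdet t y)) x"
  proof -
    have pos: "0 < Re (det_on ?I (\<omega> (E t) y))" if "y \<in> X" for y
      using det_pos(2)[OF E_mem[OF t] X_cimage[OF t that] order_refl] .
    have "pd (\<alpha> i) (\<lambda>y. complex_of_real (logdet t y)) x
      = pd (\<alpha> i) (\<lambda>y. complex_of_real (Re (det_on ?I (\<omega> (E t) y)))) x / complex_of_real (Re (det_on ?I (\<omega> (E t) x)))"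
      unfolding logdet_def by (rule wirtinger_ln(1)[OF x ai det_smooth[OF t order_refl] pos])
    also have "pd (\<alpha> i) (\<lambda>y. complex_of_real (Re (det_on ?I (\<omega> (E t) y)))) x = pd (\<alpha> i) (\<lambda>y. det_on ?I (\<omega> (E t) y)) x"
      by (rule wirtinger_cong(1)[OF x ai X_copen]) (use dE in simp)
    also have "complex_of_real (Re (det_on ?I (\<omega> (E t) x))) = det_on ?I (\<omega> (E t) x)" using dE[OF x] by simp
    finally show ?thesis by simp
  qed
  show ?thesis
  proof (rule divergence_eqI[OF M top form_smooth det_nz])
    fix c assume c: "c \<in> mcharts M" "?q \<in> fst c"
    note Zf = Z_field_chart[OF t c(1)]
    have "coord_div ?I (\<lambda>y. det_on ?I (\<omega> c y)) (\<lambda>y. fst (Z_field act i c y)) (chart_map (E t) c x)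
      = pd (\<alpha> i) (\<lambda>y. det_on ?I (\<omega> (E t) y)) x / det_on ?I (\<omega> (E t) x)"
      by (rule coord_div_transition(1)[OF M c(1) E_mem[OF t] pres_id form_smooth det_nz ai ovq(3)[OF c] Zf])
    then show "coord_div ?I (\<lambda>y. det_on ?I (\<omega> c y)) (\<lambda>y. fst (Z_field act i c y)) (snd c ?q) = pd (\<alpha> i) (\<lambda>y. complex_of_real (logdet t y)) x"
      using ovq(2)[OF c] val by simp
    have "hol ?I (overlap c (E t)) (\<lambda>y. fst (Z_field act i c y) $ b)" if "b \<in> ?I" for b
      by (rule coord_div_transition(2)[OF M c(1) E_mem[OF t] pres_id form_smooth det_nz ai ovq(3)[OF c] Zf that])
    then show "\<exists>S. S \<subseteq> cimage c \<and> snd c ?q \<in> S \<and> copen ?I S \<and> (\<forall>b\<in>?I. hol ?I S (\<lambda>y. fst (Z_field act i c y) $ b))"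
      using overlap_subset ovq(1)[OF c] overlap_copen[OF M c(1) E_mem[OF t]] by blast
  qed (auto simp: Z_field_def)
qed

lemma einstein_logdet:
  assumes ke: "kaehler_einstein M \<omega> \<kappa>" and t: "t \<in> T_complex" and x: "x \<in> X" and ab: "a \<in> midx M" "b \<in> midx M"
  shows "pd a (pdbar b (\<lambda>y. complex_of_real (logdet t y))) x = - of_real \<kappa> * \<omega> (E t) x a b"
proof -
  have "ricci_form M \<omega> (E t) x a b = of_real \<kappa> * \<omega> (E t) x a b"
    using ke E_mem[OF t] X_cimage[OF t x] ab unfolding kaehler_einstein_def by blast
  then have "- pd a (pdbar b (\<lambda>y. complex_of_real (logdet t y))) x = of_real \<kappa> * \<omega> (E t) x a b"
    using ab by (simp add: ricci_form_def ddbar_def logdet_def)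
  then show ?thesis by (simp add: minus_equation_iff[of "pd _ _ _"])
qed

text \<open>\<open>div Z\<^sub>i + \<kappa> \<phi>\<^sub>i\<close> is holomorphic by the Einstein equation and the moment map equation, and real by
  torus invariance; hence it is locally constant.\<close>

lemma divergence_locally_constant:
  assumes ke: "kaehler_einstein M \<omega> \<kappa>" and q: "q \<in> QU"
  shows "\<exists>N. openin (mtop M) N \<and> q \<in> N \<and> (\<forall>q'\<in>N. divergence M \<omega> (Z_field act i) q' + of_real (\<kappa> * \<Phi> q' $ i)
     = divergence M \<omega> (Z_field act i) q + of_real (\<kappa> * \<Phi> q $ i))"
    and "Im (divergence M \<omega> (Z_field act i) q) = 0"
proof -
  let ?I = "midx M"
  define t where "t = fst (\<tau> q)"
  define x0 where "x0 = mix 0 (snd e (\<pi> q))"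
  have P: "t \<in> T_complex" "x0 \<in> X" "\<Psi> t x0 = q" unfolding t_def x0_def by (rule QU_Psi[OF q])+
  note t = P(1)
  let ?L = "\<lambda>y. complex_of_real (logdet t y)" and ?p = "\<lambda>y. complex_of_real (\<phi> t i y)"
  have Ls: "smooth_in ?I X ?L" and ps: "smooth_in ?I X ?p" using smooth_of_real[OF logdet_smooth[OF t]] smooth_of_real[OF phi_smooth[OF t]] by blast+
  have ai: "\<alpha> i \<in> ?I" by simp
  define g where "g y = pd (\<alpha> i) ?L y + of_real \<kappa> * ?p y" for y
  have gs: "smooth_in ?I X g" unfolding g_def by (intro smooth_add smooth_pd(1)[OF Ls ai] smooth_mult smooth_const X_copen ps)
  have real: "pd (\<alpha> i) ?L y = of_real (ddir (axis (\<alpha> i) 1) (logdet t) y / 2)" if y: "y \<in> X" for y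
  proof -
    have b: "bounded_linear complex_of_real" by (rule bounded_linear_of_real)
    show ?thesis
      using torus_inv_fibre_real[OF torus_inv_of_real[OF torus_inv_logdet[OF t]] y, of i]
        ddir_bounded_linear[OF b logdet_smooth[OF t] y, of "axis (\<alpha> i) 1"] by simp
  qed
  have gr: "g y = complex_of_real (Re (g y))" if "y \<in> X" for y unfolding g_def real[OF that] by simp
  have pb: "pdbar b g y = 0" if y: "y \<in> X" and b: "b \<in> ?I" for y b
  proof -
    have "pdbar b g y = pdbar b (pd (\<alpha> i) ?L) y + of_real \<kappa> * pdbar b ?p y"
      unfolding g_def using wirtinger_add(2)[OF y b smooth_pd(1)[OF Ls ai] smooth_mult[OF smooth_const[OF X_copen] ps]]
        wirtinger_cmult(2)[OF ps y b] by simp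
    also have "pdbar b (pd (\<alpha> i) ?L) y = pd (\<alpha> i) (pdbar b ?L) y"
      using wirtinger_symmetric(2)[OF Ls y ai b] by simp
    finally show ?thesis unfolding einstein_logdet[OF ke t y ai b] phi_wirtinger(1)[OF t y b] by simp
  qed
  \<comment> \<open>\<open>g\<close> is real, so its holomorphic derivatives are conjugate to the antiholomorphic ones.\<close>
  have p0: "pd b g y = 0" if y: "y \<in> X" and b: "b \<in> ?I" for y b
  proof -
    have "pd b g y = pd b (\<lambda>y. cnj (g y)) y"
      by (rule wirtinger_cong(1)[OF y b X_copen]) (metis gr complex_cnj_complex_of_real)
    then show ?thesis using wirtinger_cnj(1)[OF y b gs] pb[OF y b] by simp
  qed
  have der: "((\<lambda>y. g (cproj ?I y)) has_derivative (\<lambda>v. 0)) (at y)" if y: "y \<in> X" for y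
  proof -
    have "ddir (cproj ?I v) g y = 0" for v
      using ddir_wirtinger[OF gs y, of "cproj ?I v"] pb[OF y] p0[OF y] by simp
    then show ?thesis using smooth_ddir_derivative[OF gs y] by simp
  qed
  \<comment> \<open>A convex neighbourhood, on which vanishing of the derivative implies constancy.\<close>
  obtain X0 where X0: "open X0" "X = coord_space ?I \<inter> X0" using X_copen openin_open by blast
  then obtain r where r: "r > 0" "ball x0 r \<subseteq> X0" using P(2) open_contains_ball by blast
  define S where "S = coord_space ?I \<inter> ball x0 r"
  have SX: "S \<subseteq> X" using X0 r by (auto simp: S_def)
  have "convex (coord_space ?I)"
    unfolding convex_def by (auto intro!: coord_space_add coord_space_scaleR)
  then have "convex S" unfolding S_def by (intro convex_Int convex_ball)
  then obtain k where k: "\<And>y. y \<in> S \<Longrightarrow> g (cproj ?I y) = k"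
    using has_derivative_zero_constant[of S "\<lambda>y. g (cproj ?I y)"] der SX has_derivative_at_withinI
    by (metis (no_types, lifting) subsetD)
  have k': "g y = k" if "y \<in> S" for y using k[OF that] that by (simp add: S_def cproj_id)
  define N where "N = {q' \<in> topspace (subtopology (mtop M) (fst (E t))). log_coords t q' \<in> ball x0 r}"
  have "openin (subtopology (mtop M) (fst (E t))) N"
    unfolding N_def by (rule openin_continuous_map_preimage[OF log_coords_continuous[OF t]]) simp
  then have N: "openin (mtop M) N" using openin_open_subtopology[OF fst_E_open[OF t]] by simp
  have dv: "divergence M \<omega> (Z_field act i) (\<Psi> t y) + of_real (\<kappa> * \<Phi> (\<Psi> t y) $ i) = g y" if "y \<in> X" for y
    using divergence_E[OF t that, of i] by (simp add: g_def \<phi>_def)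
  have "q \<in> N" using P log_coords_Psi[OF t P(2)] r Psi_facts(4)[OF t X_W[OF P(2)]] by (auto simp: N_def E_def)
  moreover have "divergence M \<omega> (Z_field act i) q' + of_real (\<kappa> * \<Phi> q' $ i) = k" if q': "q' \<in> N" for q'
  proof -
    obtain y where y: "y \<in> X" "q' = \<Psi> t y" using q' by (auto simp: N_def E_def)
    then have "y \<in> S" using q' log_coords_Psi[OF t y(1)] X_coord by (auto simp: N_def S_def)
    then show ?thesis using dv[OF y(1)] k' y(2) by simp
  qed
  ultimately show "\<exists>N. openin (mtop M) N \<and> q \<in> N \<and> (\<forall>q'\<in>N. divergence M \<omega> (Z_field act i) q' + of_real (\<kappa> * \<Phi> q' $ i)
     = divergence M \<omega> (Z_field act i) q + of_real (\<kappa> * \<Phi> q $ i))" using N by metis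
  show "Im (divergence M \<omega> (Z_field act i) q) = 0"
    using divergence_E[OF t P(2), of i] unfolding P(3) real[OF P(2)]
    by (simp only: Im_complex_of_real)
qed

section \<open>Functions on the base\<close>

text \<open>The graph \<open>Re \<zeta> = r(w)\<close>, \<open>Im \<zeta> = 0\<close> over the base.\<close>

definition "level_pt lam w = sec (rad lam w) w"

lemma level_pt_X: "w \<in> W \<Longrightarrow> level_pt lam w \<in> X" by (simp add: level_pt_def sec_X)

lemma bounded_linear_fibre: "bounded_linear (\<lambda>\<rho>. mix (of_real_vec \<rho>) 0)"
proof -
  have c: "of_real_vec (a + b) = of_real_vec a + of_real_vec b" "of_real_vec (r *\<^sub>R a) = r *\<^sub>R of_real_vec a" for a b r
    by (simp_all add: of_real_vec_def vec_eq_iff scaleR_conv_of_real[where 'a = complex])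
  have "linear (\<lambda>\<rho>. mix (of_real_vec \<rho>) 0)"
    by (rule linearI) (simp_all add: c mix_add mix_scaleR)
  then show ?thesis by (simp add: linear_conv_bounded_linear)
qed

lemma bounded_linear_base: "bounded_linear (mix 0)"
proof -
  have "linear (mix 0)" by (rule linearI) (auto simp: mix_add mix_scaleR)
  then show ?thesis by (simp add: linear_conv_bounded_linear)
qed

lemma level_pt_split: "level_pt lam w = mix (of_real_vec (rad lam w)) 0 + mix 0 w"
  by (simp add: level_pt_def sec_def mix_add)

lemma mix_of_real_vec_sum: "mix (of_real_vec \<rho>) 0 = (\<Sum>k\<in>UNIV. (\<rho> $ k) *\<^sub>R axis (\<alpha> k) 1)"
proof -
  have "mix (of_real_vec \<rho>) 0 $ a = (\<Sum>k\<in>UNIV. ((\<rho> $ k) *\<^sub>R axis (\<alpha> k) (1::complex)) $ a)" for a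
  proof -
    have "(\<Sum>k\<in>UNIV. ((\<rho> $ k) *\<^sub>R axis (\<alpha> k) (1::complex)) $ a) = (\<Sum>k\<in>UNIV. if a = \<alpha> k then complex_of_real (\<rho> $ k) else 0)"
      by (rule sum.cong) (auto simp: axis_def scaleR_conv_of_real[where 'a = complex])
    also have "\<dots> = mix (of_real_vec \<rho>) 0 $ a"
    proof (cases "a \<in> range \<alpha>")
      case True
      then obtain j where j: "a = \<alpha> j" by blast
      have "(\<Sum>k\<in>UNIV. if a = \<alpha> k then complex_of_real (\<rho> $ k) else 0) = (\<Sum>k\<in>UNIV. if k = j then complex_of_real (\<rho> $ j) else 0)"
        by (rule sum.cong) (auto simp: j)
      then show ?thesis by (simp add: j of_real_vec_def)
    next
      case False
      then have "mix (of_real_vec \<rho>) 0 $ a = 0" by (simp add: mix_def)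
      moreover have "(\<Sum>k\<in>UNIV. if a = \<alpha> k then complex_of_real (\<rho> $ k) else 0) = 0"
        by (rule sum.neutral) (use False in auto)
      ultimately show ?thesis by simp
    qed
    finally show ?thesis by simp
  qed
  then show ?thesis by (simp add: vec_eq_iff)
qed

lemma mix_base_axis: "b \<in> midx B \<Longrightarrow> mix 0 (axis b c) = axis (\<gamma> b) c"
proof -
  assume b: "b \<in> midx B"
  have "mix 0 (axis b c) $ a = axis (\<gamma> b) c $ a" for a
  proof -
    consider j where "a = \<alpha> j" | b' where "b' \<in> midx B" "a = \<gamma> b'" | "a \<notin> midx M" by (auto simp: idx)
    then show ?thesis
    proof cases
      case 1 then show ?thesis using b by (simp add: axis_def)
    next
      case 2 then show ?thesis using b gamma_eq by (auto simp: axis_def)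
    next
      case 3
      then have "mix 0 (axis b c) $ a = 0" using mix_coord_space[of 0 "axis b c"] by (simp add: coord_space_def)
      moreover have "a \<noteq> \<gamma> b" using 3 b by auto
      ultimately show ?thesis by (simp add: axis_def)
    qed
  qed
  then show ?thesis by (simp add: vec_eq_iff)
qed

context
  fixes lam :: "real ^ 'n"
  assumes lam: "lam \<in> Lambda_set M B \<pi> act \<Phi>"
begin

definition "crad k w = complex_of_real (rad lam w $ k)"

lemma rad_nth_smooth: "smooth_in (midx B) W (\<lambda>w. rad lam w $ k)"
  using smooth_vec_nth[OF rad_smooth[OF lam]] .

lemma crad_smooth: "smooth_in (midx B) W (crad k)"
  unfolding crad_def[abs_def] by (rule smooth_of_real[OF rad_nth_smooth])

lemma level_pt_smooth: "smooth_in (midx B) W (level_pt lam)"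
  unfolding level_pt_split[abs_def]
  by (intro smooth_add smooth_bounded_linear[OF bounded_linear_fibre rad_smooth[OF lam]] smooth_linear[OF W_copen bounded_linear_base])

lemma ddir_level:
  fixes u :: "complex ^ 'd \<Rightarrow> complex"
  assumes u: "smooth_in (midx M) X u" and w: "w \<in> W" and b: "b \<in> midx B"
  shows "ddir (axis b c) (\<lambda>w. u (level_pt lam w)) w
    = (\<Sum>k\<in>UNIV. ddir (axis b c) (crad k) w * ddir (axis (\<alpha> k) 1) u (level_pt lam w)) + ddir (axis (\<gamma> b) c) u (level_pt lam w)"
proof -
  have v: "axis b c \<in> coord_space (midx B)" using b by simp
  have x: "level_pt lam w \<in> X" using level_pt_X[OF w] .
  define \<rho> where "\<rho> = ddir (axis b c) (rad lam) w"
  have "ddir (axis b c) (level_pt lam) w = mix (of_real_vec \<rho>) 0 + mix 0 (axis b c)"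
    unfolding level_pt_split[abs_def] \<rho>_def
    using ddir_add[OF smooth_bounded_linear[OF bounded_linear_fibre rad_smooth[OF lam]] smooth_linear[OF W_copen bounded_linear_base] w v]
      ddir_bounded_linear[OF bounded_linear_fibre rad_smooth[OF lam] w v] ddir_linear_fun[OF bounded_linear_base]
    by simp
  then have "ddir (axis b c) (\<lambda>w. u (level_pt lam w)) w = ddir (mix (of_real_vec \<rho>) 0 + mix 0 (axis b c)) u (level_pt lam w)"
    using ddir_compose[OF level_pt_smooth u level_pt_X w v] by simp
  also have "\<dots> = ddir (mix (of_real_vec \<rho>) 0) u (level_pt lam w) + ddir (mix 0 (axis b c)) u (level_pt lam w)"
    by (rule ddir_linear(1)[OF u x]) (rule mix_coord_space)+
  also have "ddir (mix (of_real_vec \<rho>) 0) u (level_pt lam w) = (\<Sum>k\<in>UNIV. (\<rho> $ k) *\<^sub>R ddir (axis (\<alpha> k) 1) u (level_pt lam w))"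
    unfolding mix_of_real_vec_sum by (rule ddir_sum_dir[OF u x]) auto
  also have "\<dots> = (\<Sum>k\<in>UNIV. ddir (axis b c) (crad k) w * ddir (axis (\<alpha> k) 1) u (level_pt lam w))"
  proof (rule sum.cong[OF refl])
    fix k
    have L: "bounded_linear complex_of_real" by (rule bounded_linear_of_real)
    have "ddir (axis b c) (crad k) w = of_real (\<rho> $ k)"
      unfolding crad_def[abs_def] \<rho>_def
      using ddir_bounded_linear[OF L rad_nth_smooth w v] ddir_bounded_linear[OF bounded_linear_vec_nth rad_smooth[OF lam] w v] by simp
    then show "(\<rho> $ k) *\<^sub>R ddir (axis (\<alpha> k) 1) u (level_pt lam w) = ddir (axis b c) (crad k) w * ddir (axis (\<alpha> k) 1) u (level_pt lam w)"
      by (simp add: scaleR_conv_of_real)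
  qed
  finally show ?thesis using mix_base_axis[OF b] by simp
qed

text \<open>The chain rule along the graph.  By \<open>torus_inv_fibre_real\<close> the dependence on \<open>r\<^sub>k\<close> enters with twice the
  holomorphic derivative, also in the antiholomorphic case.\<close>

lemma wirtinger_level:
  fixes u :: "complex ^ 'd \<Rightarrow> complex"
  assumes u: "smooth_in (midx M) X u" "torus_inv u" and w: "w \<in> W" and b: "b \<in> midx B"
  shows "pd b (\<lambda>w. u (level_pt lam w)) w = pd (\<gamma> b) u (level_pt lam w) + (\<Sum>k\<in>UNIV. 2 * pd b (crad k) w * pd (\<alpha> k) u (level_pt lam w))"
    "pdbar b (\<lambda>w. u (level_pt lam w)) w = pdbar (\<gamma> b) u (level_pt lam w) + (\<Sum>k\<in>UNIV. 2 * pdbar b (crad k) w * pd (\<alpha> k) u (level_pt lam w))"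
proof -
  let ?s = "\<lambda>c. \<Sum>k\<in>UNIV. ddir (axis b c) (crad k) w * (2 * pd (\<alpha> k) u (level_pt lam w))"
  have d: "ddir (axis b c) (\<lambda>w. u (level_pt lam w)) w = ?s c + ddir (axis (\<gamma> b) c) u (level_pt lam w)" for c
    using ddir_level[OF u(1) w b] torus_inv_fibre_real[OF u(2) level_pt_X[OF w]] by simp
  have "(\<Sum>k\<in>UNIV. 2 * pd b (crad k) w * pd (\<alpha> k) u (level_pt lam w)) = (?s 1 - \<i> * ?s \<i>) / 2"
    "(\<Sum>k\<in>UNIV. 2 * pdbar b (crad k) w * pd (\<alpha> k) u (level_pt lam w)) = (?s 1 + \<i> * ?s \<i>) / 2"
    unfolding sum_distrib_left sum_subtractf[symmetric] sum.distrib[symmetric] sum_divide_distrib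
    by (rule sum.cong, simp, simp add: pd_def pdbar_def field_simps)+
  then show "pd b (\<lambda>w. u (level_pt lam w)) w = pd (\<gamma> b) u (level_pt lam w) + (\<Sum>k\<in>UNIV. 2 * pd b (crad k) w * pd (\<alpha> k) u (level_pt lam w))"
    "pdbar b (\<lambda>w. u (level_pt lam w)) w = pdbar (\<gamma> b) u (level_pt lam w) + (\<Sum>k\<in>UNIV. 2 * pdbar b (crad k) w * pd (\<alpha> k) u (level_pt lam w))"
    unfolding pd_def[of b "\<lambda>w. u (level_pt lam w)"] pdbar_def[of b "\<lambda>w. u (level_pt lam w)"] d pd_def[of "\<gamma> b"] pdbar_def[of "\<gamma> b"]
    by (simp_all add: add_divide_distrib diff_divide_distrib algebra_simps)
qed

abbreviation "h_level_pt w \<equiv> \<omega> (E 1) (level_pt lam w)"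

text \<open>The \<open>\<zeta>\<^sub>k\<close>-component of the vector over \<open>\<partial>/\<partial>w\<^sub>a\<close> in the maximal complex subspace of the tangent space of the level
  set.\<close>

definition "lift_coeff w a k = 2 * pd a (crad k) w"

text \<open>Differentiating \<open>\<phi>\<^sub>j = \<lambda>\<^sub>j\<close> along the level set.\<close>

lemma lift_coeff_eq:
  assumes w: "w \<in> W" and a: "a \<in> midx B"
  shows "h_level_pt w (\<gamma> a) (\<alpha> j) + (\<Sum>k\<in>UNIV. lift_coeff w a k * h_level_pt w (\<alpha> k) (\<alpha> j)) = 0"
proof -
  let ?p = "\<lambda>y. complex_of_real (\<phi> 1 j y)"
  have "pd a (\<lambda>w. ?p (level_pt lam w)) w = pd (\<gamma> a) ?p (level_pt lam w) + (\<Sum>k\<in>UNIV. 2 * pd a (crad k) w * pd (\<alpha> k) ?p (level_pt lam w))"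
    by (rule wirtinger_level(1)[OF smooth_of_real[OF phi_smooth[OF one_T]] torus_inv_of_real[OF torus_inv_phi[OF one_T]] w a])
  moreover have "pd a (\<lambda>w. ?p (level_pt lam w)) w = pd a (\<lambda>w. complex_of_real (lam $ j)) w"
    by (rule wirtinger_cong(1)[OF w a W_copen]) (simp add: \<phi>_def level_pt_def rad_level[OF lam])
  ultimately show ?thesis
    using phi_wirtinger(2)[OF one_T level_pt_X[OF w]] a by (simp add: lift_coeff_def)
qed

text \<open>The Schur complement of the fibre block of the form, which is the reduced form (\<open>reduced_form_eq\<close>).\<close>

definition "schur w a b = h_level_pt w (\<gamma> a) (\<gamma> b) + (\<Sum>k\<in>UNIV. lift_coeff w a k * h_level_pt w (\<alpha> k) (\<gamma> b))"

lemma h_level_pt_herm: "w \<in> W \<Longrightarrow> a \<in> midx M \<Longrightarrow> b \<in> midx M \<Longrightarrow> h_level_pt w b a = cnj (h_level_pt w a b)"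
  using herm[OF E_mem[OF one_T] X_cimage[OF one_T level_pt_X]] by blast

lemma det_split:
  assumes w: "w \<in> W"
  shows "det_on (midx M) (h_level_pt w) = det_on (range \<alpha>) (h_level_pt w) * det_on (midx B) (schur w)"
proof -
  define m' where "m' a k = lift_coeff w (inv_into (midx B) \<gamma> a) (inv \<alpha> k)" for a k
  have m': "m' (\<gamma> a) (\<alpha> k) = lift_coeff w a k" if "a \<in> midx B" for a k
    using that gamma_inj alpha_inj by (simp add: m'_def)
  have sumN: "(\<Sum>k\<in>range \<alpha>. f k) = (\<Sum>k\<in>UNIV. f (\<alpha> k))" for f :: "'d \<Rightarrow> complex"
    by (simp add: sum.reindex alpha_inj)
  have "det_on (range \<alpha> \<union> \<gamma> ` midx B) (h_level_pt w) = det_on (range \<alpha>) (h_level_pt w) * det_on (\<gamma> ` midx B) (\<lambda>a b. h_level_pt w a b + (\<Sum>k\<in>range \<alpha>. m' a k * h_level_pt w k b))"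
  proof (rule det_on_schur[OF disj])
    show "h_level_pt w b a = cnj (h_level_pt w a b)" if "a \<in> range \<alpha> \<union> \<gamma> ` midx B" "b \<in> range \<alpha> \<union> \<gamma> ` midx B" for a b
      using h_level_pt_herm[OF w] that unfolding idx[symmetric] by blast
    show "h_level_pt w a j + (\<Sum>k\<in>range \<alpha>. m' a k * h_level_pt w k j) = 0" if "a \<in> \<gamma> ` midx B" "j \<in> range \<alpha>" for a j
      using that lift_coeff_eq[OF w] unfolding sumN by (auto simp: m')
  qed
  also have "det_on (\<gamma> ` midx B) (\<lambda>a b. h_level_pt w a b + (\<Sum>k\<in>range \<alpha>. m' a k * h_level_pt w k b)) = det_on (midx B) (schur w)"
    unfolding det_on_image[OF gamma_inj] by (rule det_on_cong) (simp add: sumN m' schur_def)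
  finally show ?thesis by (simp add: idx)
qed

lemma log_det_schur:
  assumes w: "w \<in> W"
  shows "ln (Re (det_on (midx B) (schur w))) = logdet 1 (level_pt lam w) - ln (Re (det_on (range \<alpha>) (h_level_pt w)))"
proof -
  note p = det_pos[OF E_mem[OF one_T] X_cimage[OF one_T level_pt_X[OF w]]]
  have N: "range \<alpha> \<subseteq> midx M" by auto
  obtain d n where dn: "det_on (midx M) (h_level_pt w) = complex_of_real d" "d > 0" "det_on (range \<alpha>) (h_level_pt w) = complex_of_real n" "n > 0"
    using p[OF order_refl] p[OF N] that[of "Re (det_on (midx M) (h_level_pt w))" "Re (det_on (range \<alpha>) (h_level_pt w))"]
    by (simp add: complex_eq_iff)
  have "det_on (midx B) (schur w) = complex_of_real (d / n)"
    using det_split[OF w] dn by (simp add: field_simps)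
  then show ?thesis using dn by (simp add: logdet_def ln_div)
qed

section \<open>The reduced form\<close>

definition "lift w p = mix (\<chi> k. \<Sum>a\<in>midx B. p $ a * lift_coeff w a k) p"

text \<open>By \<open>lift_coeff_eq\<close> a lift is orthogonal to the fibre, so only the base component of \<open>v\<close> matters.\<close>

lemma hsum_lift:
  assumes w: "w \<in> W"
  shows "hsum (midx M) (h_level_pt w) (lift w p) v = hsum (midx B) (schur w) p (wc v)"
proof -
  have col: "(\<Sum>a\<in>midx M. h_level_pt w a b * lift w p $ a) = (\<Sum>a\<in>midx B. p $ a * (h_level_pt w (\<gamma> a) b + (\<Sum>k\<in>UNIV. lift_coeff w a k * h_level_pt w (\<alpha> k) b)))" for b
  proof -
    have "(\<Sum>k\<in>UNIV. h_level_pt w (\<alpha> k) b * (\<Sum>a\<in>midx B. p $ a * lift_coeff w a k)) = (\<Sum>a\<in>midx B. \<Sum>k\<in>UNIV. p $ a * (lift_coeff w a k * h_level_pt w (\<alpha> k) b))"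
      unfolding sum_distrib_left by (subst sum.swap) (simp add: mult_ac)
    then show ?thesis
      by (simp add: sum_idx lift_def distrib_left sum.distrib sum_distrib_left mult_ac)
  qed
  have "hsum (midx M) (h_level_pt w) (lift w p) v = (\<Sum>b\<in>midx M. (\<Sum>a\<in>midx M. h_level_pt w a b * lift w p $ a) * cnj (v $ b))"
    unfolding hsum_def sum_distrib_right by (rule sum.swap)
  also have "\<dots> = (\<Sum>b\<in>midx B. (\<Sum>a\<in>midx B. p $ a * schur w a b) * cnj (v $ \<gamma> b))"
    unfolding col by (subst sum_idx) (simp add: lift_coeff_eq[OF w] schur_def)
  also have "\<dots> = hsum (midx B) (schur w) p (wc v)"
    unfolding hsum_def sum_distrib_right by (subst sum.swap) (simp add: wc_def mult_ac)
  finally show ?thesis .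
qed

lemma hsum_fibre:
  "hsum (midx M) h (mix \<xi> 0) (mix \<eta> 0) = (\<Sum>k\<in>UNIV. \<Sum>j\<in>UNIV. h (\<alpha> k) (\<alpha> j) * \<xi> $ k * cnj (\<eta> $ j))"
  by (simp add: hsum_def sum_idx)

lemma phi_ddir_Re:
  assumes w: "w \<in> W" and u: "u \<in> coord_space (midx M)"
  shows "ddir u (\<phi> 1 j) (level_pt lam w) = 2 * Re (hsum (midx M) (h_level_pt w) u (axis (\<alpha> j) 1))"
proof -
  have "hsum (midx M) (h_level_pt w) (axis (\<alpha> j) 1) u = cnj (hsum (midx M) (h_level_pt w) u (axis (\<alpha> j) 1))"
    by (rule hsum_cnj) (rule h_level_pt_herm[OF w])
  then have "complex_of_real (ddir u (\<phi> 1 j) (level_pt lam w)) = complex_of_real (2 * Re (hsum (midx M) (h_level_pt w) u (axis (\<alpha> j) 1)))"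
    using phi_ddir[OF one_T level_pt_X[OF w] u, of j] by (simp add: complex_eq_iff)
  then show ?thesis by (simp only: of_real_eq_iff)
qed

lemma wc_axis: "wc (axis (\<alpha> j) c) = 0"
  using wc_mix0[of "axis j c"] by (simp add: mix_axis)

lemma lift_tangent:
  assumes w: "w \<in> W"
  shows "lift w p \<in> coord_space (midx M)" "ddir (lift w p) (\<phi> 1 j) (level_pt lam w) = 0"
proof -
  show l: "lift w p \<in> coord_space (midx M)" unfolding lift_def by (rule mix_coord_space)
  show "ddir (lift w p) (\<phi> 1 j) (level_pt lam w) = 0"
    unfolding phi_ddir_Re[OF w l] hsum_lift[OF w] wc_axis by (simp add: hsum_def)
qed

text \<open>Subtracting the lift leaves a vector of the fibre.  It is still annihilated by the real parts of the products with the
  fibre directions, and since the fibre block is real and nondegenerate its real part vanishes: it is tangent to the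
  torus orbit.\<close>

lemma tangent_decomposition:
  assumes w: "w \<in> W" and u: "u \<in> coord_space (midx M)" and tan: "\<And>j. ddir u (\<phi> 1 j) (level_pt lam w) = 0"
  obtains \<xi> where "u = lift w (wc u) + mix \<xi> 0" "\<And>k. Re (\<xi> $ k) = 0"
proof -
  define \<xi> where "\<xi> = zc u - (\<chi> k. \<Sum>a\<in>midx B. wc u $ a * lift_coeff w a k)"
  have dec: "u = lift w (wc u) + mix \<xi> 0"
    using mix_parts[OF u] by (simp add: lift_def mix_add \<xi>_def)
  define v where "v = (\<chi> k. Re (\<xi> $ k))"
  have "ddir (mix (of_real_vec v) 0) (\<phi> 1 j) (level_pt lam w) = 0" for j
  proof -
    have "hsum (midx M) (h_level_pt w) u (axis (\<alpha> j) 1) = hsum (midx M) (h_level_pt w) (mix \<xi> 0) (axis (\<alpha> j) 1)"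
    proof -
      have "hsum (midx M) (h_level_pt w) (lift w (wc u)) (axis (\<alpha> j) 1) = 0"
        unfolding hsum_lift[OF w] wc_axis by (simp add: hsum_def)
      moreover have "hsum (midx M) (h_level_pt w) u (axis (\<alpha> j) 1) = hsum (midx M) (h_level_pt w) (lift w (wc u) + mix \<xi> 0) (axis (\<alpha> j) 1)"
        by (rule arg_cong[OF dec, of "\<lambda>z. hsum (midx M) (h_level_pt w) z (axis (\<alpha> j) 1)"])
      ultimately show ?thesis by (simp only: hsum_add(1) add_0)
    qed
    then have "Re (hsum (midx M) (h_level_pt w) (mix \<xi> 0) (axis (\<alpha> j) 1)) = 0"
      using tan[of j] phi_ddir_Re[OF w u, of j] by simp
    moreover have "Re (hsum (midx M) (h_level_pt w) (mix \<xi> 0) (axis (\<alpha> j) 1)) = Re (hsum (midx M) (h_level_pt w) (mix (of_real_vec v) 0) (axis (\<alpha> j) 1))"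
    proof -
      have "Re (h_level_pt w (\<alpha> k) (\<alpha> j) * \<xi> $ k) = Re (h_level_pt w (\<alpha> k) (\<alpha> j) * of_real_vec v $ k)" for k
      proof -
        have "Im (h_level_pt w (\<alpha> k) (\<alpha> j)) = Im (complex_of_real (Re (h_level_pt w (\<alpha> k) (\<alpha> j))))"
          by (rule arg_cong[OF fibre_coeff_real[OF one_T level_pt_X[OF w, of lam], of k j], of Im])
        then show ?thesis by (simp add: of_real_vec_def v_def)
      qed
      then show ?thesis
        unfolding hsum_axis_right[OF alpha_idx] sum_idx by simp
    qed
    ultimately show ?thesis using phi_ddir_Re[OF w mix_coord_space] by simp
  qed
  then have "v = 0" by (rule fibre_derivative_injective[OF level_pt_X[OF w]])
  then have "Re (\<xi> $ k) = 0" for k by (simp add: v_def vec_eq_iff)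
  then show ?thesis using that dec by blast
qed

text \<open>The parts tangent to the torus orbit do not contribute: they are orthogonal to the lifts, and the form vanishes on
  two of them as the orbit is isotropic.\<close>

lemma form_on_tangent:
  assumes w: "w \<in> W" and u: "u \<in> coord_space (midx M)" "\<And>j. ddir u (\<phi> 1 j) (level_pt lam w) = 0"
    and v: "v \<in> coord_space (midx M)" "\<And>j. ddir v (\<phi> 1 j) (level_pt lam w) = 0"
  shows "form2 (midx B) (schur w) (wc u) (wc v) = form2 (midx M) (h_level_pt w) u v"
proof -
  let ?H = "hsum (midx M) (h_level_pt w)"
  have herm': "?H b a = cnj (?H a b)" for a b by (rule hsum_cnj) (rule h_level_pt_herm[OF w])
  have zero: "?H (lift w p) (mix \<xi> 0) = 0" "?H (mix \<xi> 0) (lift w p) = 0" for p \<xi>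
  proof -
    show "?H (lift w p) (mix \<xi> 0) = 0" unfolding hsum_lift[OF w] by (simp add: hsum_def)
    then show "?H (mix \<xi> 0) (lift w p) = 0" using herm'[of "lift w p" "mix \<xi> 0"] by simp
  qed
  obtain \<xi> where xi: "u = lift w (wc u) + mix \<xi> 0" "\<And>k. Re (\<xi> $ k) = 0" by (rule tangent_decomposition[OF w u]) blast
  obtain \<eta> where eta: "v = lift w (wc v) + mix \<eta> 0" "\<And>k. Re (\<eta> $ k) = 0" by (rule tangent_decomposition[OF w v]) blast
  have im: "\<xi> $ k * cnj (\<eta> $ j) = of_real (Im (\<xi> $ k)) * of_real (Im (\<eta> $ j))"
    "\<eta> $ k * cnj (\<xi> $ j) = of_real (Im (\<eta> $ k)) * of_real (Im (\<xi> $ j))" for k j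
    using xi(2) eta(2) by (simp_all add: complex_eq_iff)
  have "?H (mix \<xi> 0) (mix \<eta> 0) = (\<Sum>k\<in>UNIV. \<Sum>j\<in>UNIV. h_level_pt w (\<alpha> k) (\<alpha> j) * of_real (Im (\<xi> $ k)) * of_real (Im (\<eta> $ j)))"
    unfolding hsum_fibre by (intro sum.cong refl) (simp only: mult.assoc im)
  also have "\<dots> = (\<Sum>j\<in>UNIV. \<Sum>k\<in>UNIV. h_level_pt w (\<alpha> j) (\<alpha> k) * of_real (Im (\<eta> $ j)) * of_real (Im (\<xi> $ k)))"
  proof (subst sum.swap, intro sum.cong refl)
    fix j k
    show "h_level_pt w (\<alpha> k) (\<alpha> j) * of_real (Im (\<xi> $ k)) * of_real (Im (\<eta> $ j)) = h_level_pt w (\<alpha> j) (\<alpha> k) * of_real (Im (\<eta> $ j)) * of_real (Im (\<xi> $ k))"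
      using fibre_coeff_symmetric[OF one_T level_pt_X[OF w, of lam], of k j] by (simp add: mult_ac)
  qed
  also have "\<dots> = ?H (mix \<eta> 0) (mix \<xi> 0)"
    unfolding hsum_fibre by (intro sum.cong refl) (simp only: mult.assoc im)
  finally have sym: "?H (mix \<xi> 0) (mix \<eta> 0) = ?H (mix \<eta> 0) (mix \<xi> 0)" .
  have z0: "hsum (midx B) (schur w) p 0 = 0" for p by (simp add: hsum_def)
  have wl: "wc (lift w (wc y)) = wc y" for y unfolding lift_def by (rule wc_mix[OF wc_coord])
  have "?H u v = hsum (midx B) (schur w) (wc u) (wc v) + ?H (mix \<xi> 0) (mix \<eta> 0)"
  proof -
    have "?H u v = ?H (lift w (wc u) + mix \<xi> 0) (lift w (wc v) + mix \<eta> 0)" using xi(1) eta(1) by metis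
    then show ?thesis by (simp add: hsum_add zero hsum_lift[OF w] wl z0)
  qed
  moreover have "?H v u = hsum (midx B) (schur w) (wc v) (wc u) + ?H (mix \<eta> 0) (mix \<xi> 0)"
  proof -
    have "?H v u = ?H (lift w (wc v) + mix \<eta> 0) (lift w (wc u) + mix \<xi> 0)" using xi(1) eta(1) by metis
    then show ?thesis by (simp add: hsum_add zero hsum_lift[OF w] wl z0)
  qed
  ultimately show ?thesis by (simp add: form2_hsum sym)
qed

lemma bounded_linear_wc: "bounded_linear wc"
proof -
  have "linear wc" by (rule linearI) (auto simp: wc_def vec_eq_iff)
  then show ?thesis by (simp add: linear_conv_bounded_linear)
qed

lemma h_level_pt_torus:
  assumes "w \<in> W" "s \<in> T_compact"
  shows "hsum (midx M) (\<omega> (E s) (level_pt lam w)) u v = hsum (midx M) (h_level_pt w) u v"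
  unfolding hsum_def using coeff_torus[OF assms(2) one_T level_pt_X[OF assms(1)]] by (intro sum.cong refl) simp

lemma ddir_chart_base:
  assumes s: "s \<in> T_complex" and c: "c \<in> mcharts M" and y: "y \<in> overlap c (E s)" and u: "u \<in> coord_space (midx M)"
  shows "ddir u (snd e \<circ> \<pi> \<circ> cinv c) y = wc (ddir u (chart_map c (E s)) y)"
    "ddir u (\<lambda>y. \<Phi> (cinv c y) $ j) y = ddir (ddir u (chart_map c (E s)) y) (\<phi> s j) (chart_map c (E s) y)"
proof -
  let ?G = "chart_map c (E s)"
  note Es = E_mem[OF s]
  have G: "?G z \<in> X" "cinv c z = \<Psi> s (?G z)" if z: "z \<in> overlap c (E s)" for z
  proof -
    show "?G z \<in> X" using trans_overlap(1)[OF M c Es z] overlap_subset cimage_E[OF s] by blast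
    then show "cinv c z = \<Psi> s (?G z)" using trans_overlap(3)[OF M c Es z] cinv_E[OF s] by simp
  qed
  have "ddir u (snd e \<circ> \<pi> \<circ> cinv c) y = ddir u (\<lambda>z. wc (?G z)) y"
    by (rule ddir_cong[OF overlap_copen[OF M c Es] y u]) (use G Psi_facts(7)[OF s X_W] in auto)
  then show "ddir u (snd e \<circ> \<pi> \<circ> cinv c) y = wc (ddir u ?G y)"
    using ddir_bounded_linear[OF bounded_linear_wc trans_smooth[OF M c Es] y u] by simp
  have "ddir u (\<lambda>y. \<Phi> (cinv c y) $ j) y = ddir u (\<lambda>z. \<phi> s j (?G z)) y"
    by (rule ddir_cong[OF overlap_copen[OF M c Es] y u]) (simp add: G \<phi>_def)
  then show "ddir u (\<lambda>y. \<Phi> (cinv c y) $ j) y = ddir (ddir u ?G y) (\<phi> s j) (?G y)"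
    using ddir_compose[OF trans_smooth[OF M c Es] phi_smooth[OF s] G(1) y u] by simp
qed

text \<open>Every point of the level set over \<open>w\<close> is \<open>\<Psi> s (level_pt lam w)\<close> for some \<open>s\<close> in the compact torus, so it has in \<open>E s\<close>
  the coordinates and form coefficients that \<open>\<Psi> 1 (level_pt lam w)\<close> has in \<open>E 1\<close>.  Uniqueness holds because every
  base vector has a lift tangent to the level set.\<close>

lemma reduced_form_eq:
  assumes w: "w \<in> W"
  shows "reduced_form M B \<pi> \<omega> \<Phi> lam e w = (\<lambda>a b. if a \<in> midx B \<and> b \<in> midx B then schur w a b else 0)"
    (is "_ = ?S")
proof -
  have f2: "form2 (midx B) ?S p p' = form2 (midx B) (schur w) p p'" for p p'
    by (simp add: form2_hsum hsum_def)
  let ?x = "level_pt lam w"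
  note x = level_pt_X[OF w, of lam]
  show ?thesis
    unfolding reduced_form_def Let_def
  proof (rule the_equality, intro conjI allI impI ballI)
    show "?S a b = 0" if "\<not> (a \<in> midx B \<and> b \<in> midx B)" for a b using that by auto
    fix q c u v
    assume q: "q \<in> level_set M \<Phi> lam" "\<pi> q = cinv e w" and c: "c \<in> mcharts M" "q \<in> fst c"
      and u: "u \<in> level_tangent M \<Phi> c (snd c q)" and v: "v \<in> level_tangent M \<Phi> c (snd c q)"
    obtain s where s: "s \<in> T_compact" "q = \<Psi> s ?x" using level_over[OF lam w q] by (auto simp: level_pt_def)
    note s' = T_compact_complex[OF s(1)]
    have qE: "q \<in> fst (E s)" "snd (E s) q = ?x" using s(2) x log_coords_Psi[OF s' x] by (auto simp: E_def)
    let ?y = "snd c q" and ?G = "chart_map c (E s)"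
    have y: "?y \<in> overlap c (E s)" using c qE by (auto intro: overlap_memI)
    have Gy: "?G ?y = ?x" using trans_snd[OF M c, of "E s"] qE(2) by simp
    have uv: "u \<in> coord_space (midx M)" "v \<in> coord_space (midx M)" using u v by (auto simp: level_tangent_def)
    have phs: "ddir z (\<phi> s j) ?x = ddir z (\<phi> 1 j) ?x" if z: "z \<in> coord_space (midx M)" for z j
    proof -
      have "complex_of_real (ddir z (\<phi> s j) ?x) = complex_of_real (ddir z (\<phi> 1 j) ?x)"
        unfolding phi_ddir[OF s' x z] phi_ddir[OF one_T x z] h_level_pt_torus[OF w s(1)] ..
      then show ?thesis by (simp only: of_real_eq_iff)
    qed
    have tan: "ddir (ddir z ?G ?y) (\<phi> 1 j) ?x = 0" "ddir z ?G ?y \<in> coord_space (midx M)"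
      if z: "z \<in> level_tangent M \<Phi> c ?y" for z j
    proof -
      have zc: "z \<in> coord_space (midx M)" using z by (simp add: level_tangent_def)
      show d: "ddir z ?G ?y \<in> coord_space (midx M)" by (rule trans_ddir(2)[OF M c(1) E_mem[OF s'] y zc])
      show "ddir (ddir z ?G ?y) (\<phi> 1 j) ?x = 0"
        using ddir_chart_base(2)[OF s' c(1) y zc, of j] z phs[OF d, of j] by (simp add: Gy level_tangent_def)
    qed
    have "form2 (midx B) (schur w) (wc (ddir u ?G ?y)) (wc (ddir v ?G ?y)) = form2 (midx M) (h_level_pt w) (ddir u ?G ?y) (ddir v ?G ?y)"
      by (rule form_on_tangent[OF w tan(2)[OF u] tan(1)[OF u] tan(2)[OF v] tan(1)[OF v]])
    also have "\<dots> = form2 (midx M) (\<omega> (E s) ?x) (ddir u ?G ?y) (ddir v ?G ?y)"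
      unfolding form2_hsum h_level_pt_torus[OF w s(1)] ..
    also have "\<dots> = form2 (midx M) (\<omega> c ?y) u v"
      using preserves_trans[OF M pres_id c(1) E_mem[OF s'] y uv] by (simp add: Gy)
    finally show "form2 (midx B) ?S (ddir u (snd e \<circ> \<pi> \<circ> cinv c) ?y) (ddir v (snd e \<circ> \<pi> \<circ> cinv c) ?y) = form2 (midx M) (\<omega> c ?y) u v"
      unfolding f2 ddir_chart_base(1)[OF s' c(1) y uv(1)] ddir_chart_base(1)[OF s' c(1) y uv(2)] .
  next
    fix h' assume h': "(\<forall>a b. \<not> (a \<in> midx B \<and> b \<in> midx B) \<longrightarrow> h' a b = 0) \<and>
        (\<forall>q\<in>level_set M \<Phi> lam. \<pi> q = cinv e w \<longrightarrow>
           (\<forall>c\<in>mcharts M. q \<in> fst c \<longrightarrow>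
              (\<forall>u\<in>level_tangent M \<Phi> c (snd c q). \<forall>v\<in>level_tangent M \<Phi> c (snd c q).
                 form2 (midx B) h' (ddir u (snd e \<circ> \<pi> \<circ> cinv c) (snd c q)) (ddir v (snd e \<circ> \<pi> \<circ> cinv c) (snd c q))
                 = form2 (midx M) (\<omega> c (snd c q)) u v)))"
    let ?q = "\<Psi> 1 ?x"
    have q: "?q \<in> level_set M \<Phi> lam" "\<pi> ?q = cinv e w"
      using Psi_sec[OF w] rad_level[OF lam w] by (auto simp: level_set_def QU_def level_pt_def)
    have qE: "?q \<in> fst (E 1)" "snd (E 1) ?q = ?x" using x log_coords_Psi[OF one_T x] by (auto simp: E_def)
    have y: "?x \<in> overlap (E 1) (E 1)" using overlap_E_self[OF one_T] x by simp
    have id: "chart_map (E 1) (E 1) z = z" if "z \<in> X" for z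
      using that cimage_E[OF one_T] snd_cinv[of z "E 1"] by (simp add: chart_map_def)
    have did: "ddir u (chart_map (E 1) (E 1)) ?x = u" if u: "u \<in> coord_space (midx M)" for u
    proof -
      have "ddir u (chart_map (E 1) (E 1)) ?x = ddir u (\<lambda>y. y) ?x" by (rule ddir_cong[OF X_copen x u id])
      then show ?thesis by (simp add: ddir_linear_fun[OF bounded_linear_ident])
    qed
    have lt: "lift w p \<in> level_tangent M \<Phi> (E 1) ?x" for p
      using lift_tangent[OF w] ddir_chart_base(2)[OF one_T E_mem[OF one_T] y] did id[OF x] by (simp add: level_tangent_def)
    have "form2 (midx B) h' p p' = form2 (midx B) (schur w) p p'" if p: "p \<in> coord_space (midx B)" "p' \<in> coord_space (midx B)" for p p'
    proof -
      have wl: "wc (lift w p) = p" "wc (lift w p') = p'" unfolding lift_def using wc_mix p by auto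
      have dl: "ddir (lift w p) (snd e \<circ> \<pi> \<circ> cinv (E 1)) ?x = p"
        if "p \<in> coord_space (midx B)" for p
      proof -
        have "wc (lift w p) = p" unfolding lift_def using wc_mix that by auto
        then show ?thesis using ddir_chart_base(1)[OF one_T E_mem[OF one_T] y lift_tangent(1)[OF w]] did[OF lift_tangent(1)[OF w]] by simp
      qed
      have "form2 (midx B) h' p p' = form2 (midx M) (h_level_pt w) (lift w p) (lift w p')"
        using h' q E_mem[OF one_T] qE lt[of p] lt[of p'] dl[OF p(1)] dl[OF p(2)] by fastforce
      also have "\<dots> = form2 (midx B) (schur w) p p'"
        using form_on_tangent[OF w lift_tangent lift_tangent, OF w w w w, of p p'] wl by simp
      finally show ?thesis .
    qed
    note eq = this
    show "h' = ?S"
    proof (intro ext)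
      fix a b
      show "h' a b = ?S a b"
      proof (cases "a \<in> midx B \<and> b \<in> midx B")
        case True
        then have ax: "axis a 1 \<in> coord_space (midx B)" "axis b 1 \<in> coord_space (midx B)" "\<i> *s axis b 1 \<in> coord_space (midx B)"
          by (auto intro: coord_space_smult)
        have "hsum (midx B) h' (axis a 1) (axis b 1) = hsum (midx B) (schur w) (axis a 1) (axis b 1)"
          unfolding hsum_form2 eq[OF ax(1,2)] eq[OF ax(1,3)] ..
        then show ?thesis using True hsum_axis[of a "midx B" b] by simp
      next
        case False
        then show ?thesis using h' by auto
      qed
    qed
  qed
qed

section \<open>The effective potential\<close>

lemma orbit_gram_eq:
  assumes s: "s \<in> T_compact" and w: "w \<in> W"
  shows "orbit_gram M act \<omega> (\<Psi> s (level_pt lam w)) = (\<chi> j k. 2 * Re (h_level_pt w (\<alpha> j) (\<alpha> k)))"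
proof -
  let ?x = "level_pt lam w" and ?q = "\<Psi> s (level_pt lam w)"
  note s' = T_compact_complex[OF s] and x = level_pt_X[OF w, of lam]
  have qE: "?q \<in> fst (E s)" "snd (E s) ?q = ?x" using x log_coords_Psi[OF s' x] by (auto simp: E_def)
  define c where "c = (SOME c. c \<in> mcharts M \<and> ?q \<in> fst c)"
  have "\<exists>c. c \<in> mcharts M \<and> ?q \<in> fst c" using E_mem[OF s'] qE(1) by blast
  then have c: "c \<in> mcharts M" "?q \<in> fst c" unfolding c_def by (metis (mono_tags, lifting) someI_ex)+
  let ?F = "chart_map (E s) c"
  have y: "snd c ?q \<in> overlap c (E s)" and xo: "?x \<in> overlap (E s) c" using c qE by (auto intro: overlap_memI dest: overlap_memI[OF qE(1)])
  have F: "?F ?x = snd c ?q" using trans_snd[OF M E_mem[OF s'] qE(1), of c] qE(2) by simp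
  have G: "chart_map c (E s) (snd c ?q) = ?x" using trans_snd[OF M c, of "E s"] qE(2) by simp
  have circ: "circle_field act j c (snd c ?q) = ddir (axis (\<alpha> j) \<i>) ?F ?x" for j
    using circle_field_chart[OF s' c(1) y, of j] by (simp add: G)
  have ax: "axis (\<alpha> j) \<i> \<in> coord_space (midx M)" for j by simp
  have "kmetric (midx M) (\<omega> c (snd c ?q)) (circle_field act j c (snd c ?q)) (circle_field act k c (snd c ?q)) = 2 * Re (h_level_pt w (\<alpha> j) (\<alpha> k))" for j k
  proof -
    have "form2 (midx M) (\<omega> c (?F ?x)) (ddir (axis (\<alpha> j) \<i>) ?F ?x) (ddir (\<i> *s axis (\<alpha> k) \<i>) ?F ?x)
      = form2 (midx M) (\<omega> (E s) ?x) (axis (\<alpha> j) \<i>) (\<i> *s axis (\<alpha> k) \<i>)"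
      by (rule preserves_trans[OF M pres_id E_mem[OF s'] c(1) xo ax coord_space_smult[OF ax]])
    then have "kmetric (midx M) (\<omega> c (snd c ?q)) (circle_field act j c (snd c ?q)) (circle_field act k c (snd c ?q))
      = kmetric (midx M) (\<omega> (E s) ?x) (axis (\<alpha> j) \<i>) (axis (\<alpha> k) \<i>)"
      unfolding kmetric_def circ F trans_ddir(3)[OF M E_mem[OF s'] c(1) xo ax] by simp
    also have "\<dots> = kmetric (midx M) (h_level_pt w) (axis (\<alpha> j) \<i>) (axis (\<alpha> k) \<i>)"
      unfolding kmetric_def form2_hsum h_level_pt_torus[OF w s] ..
    also have "\<dots> = 2 * Re (hsum (midx M) (h_level_pt w) (axis (\<alpha> j) \<i>) (axis (\<alpha> k) \<i>))"
      by (rule kmetric_hsum) (rule h_level_pt_herm[OF w])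
    also have "hsum (midx M) (h_level_pt w) (axis (\<alpha> j) \<i>) (axis (\<alpha> k) \<i>) = h_level_pt w (\<alpha> j) (\<alpha> k)"
    proof -
      have "axis (\<alpha> l) \<i> = \<i> *s axis (\<alpha> l) 1" for l by (auto simp: vec_eq_iff axis_def)
      then show ?thesis by (simp add: hsum_smult hsum_axis)
    qed
    finally show ?thesis .
  qed
  then show ?thesis unfolding orbit_gram_def Let_def c_def[symmetric] by (simp add: vec_eq_iff)
qed

lemma gram_det:
  assumes w: "w \<in> W"
  shows "det (\<chi> j k. 2 * Re (h_level_pt w (\<alpha> j) (\<alpha> k))) = 2 ^ CARD('n) * Re (det_on (range \<alpha>) (h_level_pt w))"
proof -
  have r: "complex_of_real (Re (h_level_pt w (\<alpha> j) (\<alpha> k))) = h_level_pt w (\<alpha> j) (\<alpha> k)" for j k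
    using fibre_coeff_real[OF one_T level_pt_X[OF w, of lam], of j k] by simp
  have "det_on (range \<alpha>) (h_level_pt w) = det_on UNIV (\<lambda>j k. h_level_pt w (\<alpha> j) (\<alpha> k))"
    by (rule det_on_image[OF alpha_inj])
  also have "complex_of_real (2 ^ CARD('n)) * \<dots> = complex_of_real (det (\<chi> j k. 2 * Re (h_level_pt w (\<alpha> j) (\<alpha> k))))"
    unfolding det_def det_on_def by (simp add: sum_distrib_left prod.distrib r mult_ac)
  finally have "complex_of_real (det (\<chi> j k. 2 * Re (h_level_pt w (\<alpha> j) (\<alpha> k)))) = complex_of_real (2 ^ CARD('n)) * det_on (range \<alpha>) (h_level_pt w)"
    by simp
  from arg_cong[OF this, of Re] show ?thesis by simp
qed

lemma point_over_Psi:
  assumes w: "w \<in> W"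
  obtains s where "s \<in> T_compact" "point_over M \<pi> \<Phi> lam (cinv e w) = \<Psi> s (level_pt lam w)"
proof -
  have "\<exists>q. q \<in> level_set M \<Phi> lam \<and> \<pi> q = cinv e w"
    using Psi_sec(1,2)[OF w] rad_level[OF lam w] by (auto simp: level_set_def QU_def)
  then have "point_over M \<pi> \<Phi> lam (cinv e w) \<in> level_set M \<Phi> lam \<and> \<pi> (point_over M \<pi> \<Phi> lam (cinv e w)) = cinv e w"
    unfolding point_over_def by (rule someI_ex)
  then show ?thesis using that level_over[OF lam w] by (auto simp: level_pt_def)
qed

text \<open>The Gram matrix of the generators is constant along the orbit, so the integral for the orbit volume is the square root
  of its determinant times the volume of the cube.\<close>

lemma log_V_eff:
  "\<exists>K. \<forall>w\<in>W. ln (V_eff M \<pi> act \<omega> \<Phi> lam (cinv e w)) = K + 1 / 2 * ln (Re (det_on (range \<alpha>) (h_level_pt w)))"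
proof -
  define C where "C = measure lborel (cbox 0 (\<chi> i. 2 * pi) :: (real ^ 'n) set)"
  have C: "C > 0" unfolding C_def
    by (rule content_pos_lt) (auto simp: Basis_vec_def inner_axis)
  have "ln (V_eff M \<pi> act \<omega> \<Phi> lam (cinv e w)) = (ln C + real CARD('n) * ln 2 / 2) + 1 / 2 * ln (Re (det_on (range \<alpha>) (h_level_pt w)))"
    if w: "w \<in> W" for w
  proof -
    let ?d = "Re (det_on (range \<alpha>) (h_level_pt w))"
    have d: "?d > 0" by (rule det_pos(2)[OF E_mem[OF one_T] X_cimage[OF one_T level_pt_X[OF w]]]) auto
    obtain s where s: "s \<in> T_compact" "point_over M \<pi> \<Phi> lam (cinv e w) = \<Psi> s (level_pt lam w)" by (rule point_over_Psi[OF w])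
    have "orbit_gram M act \<omega> (act (\<chi> i. cis (\<theta> $ i)) (\<Psi> s (level_pt lam w))) = (\<chi> j k. 2 * Re (h_level_pt w (\<alpha> j) (\<alpha> k)))" for \<theta> :: "real ^ 'n"
    proof -
      have t: "(\<chi> i. cis (\<theta> $ i)) \<in> T_compact" by (simp add: T_compact_def)
      have "act (\<chi> i. cis (\<theta> $ i)) (\<Psi> s (level_pt lam w)) = \<Psi> ((\<chi> i. cis (\<theta> $ i)) * s) (level_pt lam w)"
        by (rule act_Psi[OF T_compact_complex[OF t] T_compact_complex[OF s(1)] X_W[OF level_pt_X[OF w]]])
      moreover have "(\<chi> i. cis (\<theta> $ i)) * s \<in> T_compact" using s(1) by (simp add: T_compact_def norm_mult)
      ultimately show ?thesis using orbit_gram_eq[OF _ w] by simp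
    qed
    then have "V_eff M \<pi> act \<omega> \<Phi> lam (cinv e w) = C * sqrt (2 ^ CARD('n) * ?d)"
      unfolding V_eff_def level_pullback_def s(2) orbit_volume_def by (simp add: gram_det[OF w] C_def)
    then show ?thesis using C d by (simp add: ln_mult ln_sqrt ln_realpow field_simps)
  qed
  then show ?thesis by blast
qed

section \<open>The curvature of the line bundles\<close>

lemma section_exists: "nonvanishing_section M B \<pi> act i U (\<lambda>q. inverse (fst (\<tau> q) $ i))"
  unfolding nonvanishing_section_def
proof (intro conjI ballI U_open)
  fix c assume c: "c \<in> mcharts M"
  note cc = cm_chart[OF M c]
  have set: "fst c \<inter> \<pi> -` U = fst c \<inter> QU" using chart_topspace[OF cc] by (auto simp: QU_def)
  have "local_triv (cinv c x) $ Inl i \<noteq> 0" if "x \<in> snd c ` (fst c \<inter> QU)" for x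
    using that cinv_snd[OF cc] tau_in by (auto simp: local_triv_def join_vec_def T_complex_def QU_Q)
  then have "hol (midx M) (snd c ` (fst c \<inter> QU)) (\<lambda>x. inverse (local_triv (cinv c x) $ Inl i))"
    by (intro hol_inverse local_triv_hol[OF c])
  then show "holo_fun (midx M) (snd c ` (fst c \<inter> \<pi> -` U)) ((\<lambda>q. inverse (fst (\<tau> q) $ i)) \<circ> cinv c)"
    unfolding set using holo_fun_hol[OF chart_open_image[OF cc QU_open]] by (simp add: local_triv_def join_vec_def comp_def)
next
  fix q assume "q \<in> topspace (mtop M) \<inter> \<pi> -` U"
  then have q: "q \<in> Q" by (auto simp: Q_def U_def)
  show "inverse (fst (\<tau> q) $ i) \<noteq> 0" using tau_in[OF q] by (simp add: T_complex_def)
  fix a assume a: "a \<in> (T_complex :: (complex ^ 'n) set)"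
  show "inverse (fst (\<tau> (act a q)) $ i) = inverse (a $ i) * inverse (fst (\<tau> q) $ i)"
    using tau_act[of q] q a by (simp add: Q_def)
qed

text \<open>Let \<open>g\<close> be the value of the section at \<open>\<zeta> = 0\<close>.  Equivariance gives \<open>\<bar>s\<bar>\<^sup>2 = exp (-2 r\<^sub>i) \<bar>g\<bar>\<^sup>2\<close> on the level set,
  and \<open>log \<bar>g\<bar>\<^sup>2\<close> is pluriharmonic.\<close>

lemma section_curvature:
  assumes s: "nonvanishing_section M B \<pi> act i V' s" and w: "w \<in> W" "cinv e w \<in> V'"
  shows "- ddbar (midx B) (\<lambda>y. ln (level_pullback M \<pi> \<Phi> lam (\<lambda>q. (cmod (s q))\<^sup>2) (cinv e y))) w a b
    = 2 * ddbar (midx B) (\<lambda>w. rad lam w $ i) w a b"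
proof -
  have V': "openin (mtop B) V'" using s by (simp add: nonvanishing_section_def)
  define S where "S = snd e ` (fst e \<inter> (V \<inter> V'))"
  have So: "copen (midx B) S" unfolding S_def by (rule chart_open_image[OF e_chart openin_Int[OF V V']])
  have SW: "y \<in> W" "cinv e y \<in> V'" if "y \<in> S" for y
    using that cinv_snd[OF e_chart] by (auto simp: S_def W_def U_def)
  have wS: "w \<in> S" unfolding S_def using cinv_W[OF w(1)] w(2) U_e by (metis IntI image_eqI)
  define O' where "O' = {q \<in> topspace (mtop M). \<pi> q \<in> V'}"
  have O': "openin (mtop M) O'" unfolding O'_def by (rule openin_continuous_map_preimage[OF pi_continuous V'])
  note E1 = E_mem[OF one_T]
  let ?D = "snd (E 1) ` (fst (E 1) \<inter> O')"
  have Do: "copen (midx M) ?D" by (rule chart_open_image[OF cm_chart[OF M E1] O'])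
  have "fst (E 1) \<inter> \<pi> -` V' = fst (E 1) \<inter> O'" using chart_topspace[OF cm_chart[OF M E1]] by (auto simp: O'_def)
  then have sh: "hol (midx M) ?D (s \<circ> cinv (E 1))"
    using s E1 holo_fun_hol[OF Do] unfolding nonvanishing_section_def by metis
  have PE: "\<Psi> 1 (sec 0 y) \<in> fst (E 1)" "snd (E 1) (\<Psi> 1 (sec 0 y)) = sec 0 y" "\<Psi> 1 (sec 0 y) \<in> O'" if "y \<in> S" for y
    using SW[OF that] sec_X[of y 0] log_coords_Psi[OF one_T, of "sec 0 y"] Psi_sec[of y 0] by (auto simp: E_def O'_def QU_def)
  have secD: "sec 0 y \<in> ?D" if "y \<in> S" for y using PE[OF that] by (metis IntI image_eqI)
  define g where "g y = s (\<Psi> 1 (sec 0 y))" for y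
  have jh: "hol (midx B) S (\<lambda>y. sec 0 y $ a)" for a
  proof -
    consider j where "a = \<alpha> j" | b' where "b' \<in> midx B" "a = \<gamma> b'" | "a \<notin> midx M" by (auto simp: idx)
    then show ?thesis
    proof cases
      case 1 then show ?thesis using hol_const[OF So, of 0] by (simp add: sec_def of_real_vec_def)
    next
      case 2 then show ?thesis using hol_nth[OF So] by (simp add: sec_def)
    next
      case 3
      then have "sec 0 y $ a = 0" for y using mix_coord_space by (auto simp: sec_def coord_space_def)
      then show ?thesis using hol_const[OF So, of 0] by simp
    qed
  qed
  have "hol (midx B) S (\<lambda>y. (s \<circ> cinv (E 1)) (sec 0 y))"
    by (rule hol_compose[OF jh sh secD])
  then have gh: "hol (midx B) S g"
    by (rule hol_cong) (use cinv_E[OF one_T sec_X] SW in \<open>simp add: g_def\<close>)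
  have g0: "g y \<noteq> 0" if "y \<in> S" for y
    using s PE(3)[OF that] unfolding nonvanishing_section_def g_def O'_def by auto
  have gs: "smooth_in (midx B) S (\<lambda>y. ln ((cmod (g y))\<^sup>2))"
  proof (rule smooth_ln)
    have "(\<lambda>y. (cmod (g y))\<^sup>2) = (\<lambda>y. Re (g y * cnj (g y)))" by (auto simp: complex_mult_cnj cmod_power2)
    then show "smooth_in (midx B) S (\<lambda>y. (cmod (g y))\<^sup>2)" using smooth_Re[OF smooth_mult[OF hol_smooth[OF gh] smooth_cnj[OF hol_smooth[OF gh]]]] by simp
  qed (use g0 in auto)
  have val: "ln (level_pullback M \<pi> \<Phi> lam (\<lambda>q. (cmod (s q))\<^sup>2) (cinv e y)) = 0 + (- 2) * (rad lam y $ i) + 1 * ln ((cmod (g y))\<^sup>2)"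
    if y: "y \<in> S" for y
  proof -
    note yW = SW(1)[OF y]
    obtain s' where s': "s' \<in> T_compact" "point_over M \<pi> \<Phi> lam (cinv e y) = \<Psi> s' (level_pt lam y)" by (rule point_over_Psi[OF yW])
    define a where "a = s' * vexp (of_real_vec (rad lam y))"
    have aT: "a \<in> T_complex" unfolding a_def by (rule T_complex_mult[OF T_compact_complex[OF s'(1)] vexp_T])
    have "level_pt lam y = sec 0 y + mix (of_real_vec (rad lam y)) 0"
      by (simp add: level_pt_def sec_def mix_add of_real_vec_def vec_eq_iff[of "_ + _"]) (simp add: mix_def vec_eq_iff)
    then have "\<Psi> s' (level_pt lam y) = \<Psi> a (sec 0 y)" by (simp add: Psi_shift a_def)
    also have "\<dots> = act a (\<Psi> 1 (sec 0 y))" using act_Psi[OF aT one_T X_W[OF sec_X[OF yW]]] by simp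
    finally have "s (\<Psi> s' (level_pt lam y)) = inverse (a $ i) * g y"
      using s PE(3)[OF y] aT unfolding nonvanishing_section_def g_def O'_def by auto
    moreover have "cmod (a $ i) = exp (rad lam y $ i)"
      using s'(1) by (simp add: a_def vexp_def of_real_vec_def norm_mult T_compact_def)
    ultimately have "(cmod (s (\<Psi> s' (level_pt lam y))))\<^sup>2 = (inverse (exp (rad lam y $ i)))\<^sup>2 * (cmod (g y))\<^sup>2"
      by (simp add: norm_mult norm_inverse power_mult_distrib)
    also have "(inverse (exp (rad lam y $ i)))\<^sup>2 = exp (- 2 * (rad lam y $ i))"
      by (simp add: exp_minus[symmetric] exp_double[symmetric])
    finally show ?thesis
      using g0[OF y] unfolding level_pullback_def s'(2) by (simp add: ln_mult)
  qed
  have "ddbar (midx B) (\<lambda>y. ln (level_pullback M \<pi> \<Phi> lam (\<lambda>q. (cmod (s q))\<^sup>2) (cinv e y))) w a b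
    = ddbar (midx B) (\<lambda>y. 0 + (- 2) * (rad lam y $ i) + 1 * ln ((cmod (g y))\<^sup>2)) w a b"
    by (rule ddbar_cong[OF So wS val])
  also have "\<dots> = of_real (- 2) * ddbar (midx B) (\<lambda>y. rad lam y $ i) w a b + of_real 1 * ddbar (midx B) (\<lambda>y. ln ((cmod (g y))\<^sup>2)) w a b"
    by (rule ddbar_lincomb[OF smooth_subset[OF rad_nth_smooth So] gs wS]) (use SW in auto)
  finally show ?thesis using pluriharmonic_log_norm[OF gh g0 wS] by simp
qed

lemma line_curvature_eq:
  assumes w: "w \<in> W"
  shows "line_curvature M B \<pi> act \<Phi> i lam e w = (\<lambda>a b. 2 * ddbar (midx B) (\<lambda>w. rad lam w $ i) w a b)"
  unfolding line_curvature_def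
proof (rule the_equality, intro allI impI)
  fix V' s assume "nonvanishing_section M B \<pi> act i V' s \<and> cinv e w \<in> V'"
  then show "(\<lambda>a b. 2 * ddbar (midx B) (\<lambda>w. rad lam w $ i) w a b)
    = (\<lambda>a b. - ddbar (midx B) (\<lambda>y. ln (level_pullback M \<pi> \<Phi> lam (\<lambda>q. (cmod (s q))\<^sup>2) (cinv e y))) w a b)"
    using section_curvature[OF _ w, of i V' s] by (auto intro!: ext)
next
  fix h assume "\<forall>V s. nonvanishing_section M B \<pi> act i V s \<and> cinv e w \<in> V \<longrightarrow>
    h = (\<lambda>a b. - ddbar (midx B) (\<lambda>y. ln (level_pullback M \<pi> \<Phi> lam (\<lambda>q. (cmod (s q))\<^sup>2) (cinv e y))) w a b)"
  then have "h = (\<lambda>a b. - ddbar (midx B) (\<lambda>y. ln (level_pullback M \<pi> \<Phi> lam (\<lambda>q. (cmod (inverse (fst (\<tau> q) $ i)))\<^sup>2) (cinv e y))) w a b)"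
    using section_exists cinv_W(1)[OF w] by blast
  then show "h = (\<lambda>a b. 2 * ddbar (midx B) (\<lambda>w. rad lam w $ i) w a b)"
    unfolding section_curvature[OF section_exists w cinv_W(1)[OF w]] .
qed

section \<open>The reduced Einstein equation\<close>

context
  fixes \<kappa> :: real and c :: "real ^ 'n"
  assumes ke: "kaehler_einstein M \<omega> \<kappa>"
    and div: "\<And>i q. q \<in> topspace (mtop M) \<Longrightarrow>
      of_real (\<kappa> * \<Phi> q $ i) = - divergence M \<omega> (Z_field act i) q + of_real (c $ i)"
begin

text \<open>Differentiating twice by \<open>wirtinger_level\<close>: the first derivative along \<open>\<zeta>\<^sub>k\<close> is the divergence of \<open>Z\<^sub>k\<close>, which on the
  level set has the constant value \<open>c\<^sub>k - \<kappa> \<lambda>\<^sub>k\<close>, and the second derivatives are \<open>-\<kappa>\<close> times the form and combine to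
  the Schur complement.\<close>

lemma ddbar_logdet_level:
  assumes w: "w \<in> W" and ab: "a \<in> midx B" "b \<in> midx B"
  shows "ddbar (midx B) (\<lambda>w. logdet 1 (level_pt lam w)) w a b
    = - of_real \<kappa> * schur w a b + (\<Sum>k\<in>UNIV. 2 * of_real (c $ k - \<kappa> * lam $ k) * ddbar (midx B) (\<lambda>w. rad lam w $ k) w a b)"
proof -
  let ?L = "\<lambda>y. complex_of_real (logdet 1 y)"
  let ?v = "pdbar (\<gamma> b) ?L"
  let ?q = "\<lambda>k. complex_of_real (c $ k - \<kappa> * lam $ k)"
  have Ls: "smooth_in (midx M) X ?L" and Li: "torus_inv ?L"
    using smooth_of_real[OF logdet_smooth[OF one_T]] torus_inv_of_real[OF torus_inv_logdet[OF one_T]] .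
  have gb: "\<gamma> b \<in> midx M" "\<gamma> a \<in> midx M" using ab by auto
  have vs: "smooth_in (midx M) X ?v" and vi: "torus_inv ?v" using smooth_pd(2)[OF Ls gb(1)] torus_inv_pdbar[OF Li gb(1)] .
  have pk: "pd (\<alpha> k) ?L (level_pt lam y) = ?q k" if y: "y \<in> W" for k y
  proof -
    have "\<Psi> 1 (level_pt lam y) \<in> topspace (mtop M)" using Psi_facts(4)[OF one_T X_W[OF level_pt_X[OF y]]] .
    from div[OF this, of k] show ?thesis
      using divergence_E[OF one_T level_pt_X[OF y], of k lam] rad_level[OF lam y] by (simp add: level_pt_def algebra_simps)
  qed
  have 1: "pdbar b (\<lambda>w. ?L (level_pt lam w)) y = ?v (level_pt lam y) + (\<Sum>k\<in>UNIV. (2 * ?q k) * pdbar b (crad k) y)" if y: "y \<in> W" for y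
    unfolding wirtinger_level(2)[OF Ls Li y ab(2)] pk[OF y] by (intro arg_cong2[where f = "(+)"] refl sum.cong) (simp only: mult_ac)
  have vl: "smooth_in (midx B) W (\<lambda>y. ?v (level_pt lam y))" by (rule smooth_compose[OF level_pt_smooth vs level_pt_X])
  have rs: "smooth_in (midx B) W (\<lambda>y. (2 * ?q k) * pdbar b (crad k) y)" for k
    by (intro smooth_mult smooth_const W_copen smooth_pd(2)[OF crad_smooth ab(2)])
  have "pd a (pdbar b (\<lambda>w. ?L (level_pt lam w))) w = pd a (\<lambda>y. ?v (level_pt lam y) + (\<Sum>k\<in>UNIV. (2 * ?q k) * pdbar b (crad k) y)) w"
    by (rule wirtinger_cong(1)[OF w ab(1) W_copen 1])
  also have "\<dots> = pd a (\<lambda>y. ?v (level_pt lam y)) w + (\<Sum>k\<in>UNIV. pd a (\<lambda>y. (2 * ?q k) * pdbar b (crad k) y) w)"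
    unfolding wirtinger_add(1)[OF w ab(1) vl smooth_sum[OF W_copen rs]] wirtinger_sum(1)[OF w ab(1) W_copen rs] ..
  also have "pd a (\<lambda>y. ?v (level_pt lam y)) w = - of_real \<kappa> * schur w a b"
  proof -
    have "pd a (\<lambda>y. ?v (level_pt lam y)) w = pd (\<gamma> a) ?v (level_pt lam w) + (\<Sum>k\<in>UNIV. 2 * pd a (crad k) w * pd (\<alpha> k) ?v (level_pt lam w))"
      by (rule wirtinger_level(1)[OF vs vi w ab(1)])
    also have "\<dots> = - of_real \<kappa> * h_level_pt w (\<gamma> a) (\<gamma> b) + (\<Sum>k\<in>UNIV. lift_coeff w a k * (- of_real \<kappa> * h_level_pt w (\<alpha> k) (\<gamma> b)))"
      unfolding einstein_logdet[OF ke one_T level_pt_X[OF w] gb(2) gb(1)] einstein_logdet[OF ke one_T level_pt_X[OF w] alpha_idx gb(1)] lift_coeff_def ..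
    also have "\<dots> = - of_real \<kappa> * schur w a b"
      by (simp add: schur_def sum_negf sum_distrib_left algebra_simps)
    finally show ?thesis .
  qed
  also have "(\<Sum>k\<in>UNIV. pd a (\<lambda>y. (2 * ?q k) * pdbar b (crad k) y) w) = (\<Sum>k\<in>UNIV. 2 * ?q k * ddbar (midx B) (\<lambda>w. rad lam w $ k) w a b)"
    unfolding wirtinger_cmult(1)[OF smooth_pd(2)[OF crad_smooth ab(2)] w ab(1)] using ab by (simp add: ddbar_def crad_def[abs_def])
  finally show ?thesis using ab by (simp add: ddbar_def)
qed

text \<open>Split the logarithm of the determinant of the reduced form into \<open>log det h\<close> on the level set, whose second derivatives
  are \<open>ddbar_logdet_level\<close>, and the logarithm of the fibre determinant, which is that of \<open>V\<^sub>e\<^sub>f\<^sub>f\<^sup>2\<close> up to a constant.\<close>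

lemma reduced_einstein:
  assumes w: "w \<in> W" and ab: "a \<in> midx B" "b \<in> midx B"
  shows "ricci_form B (reduced_form M B \<pi> \<omega> \<Phi> lam) e w a b
     - 2 * ddbar (midx B) (\<lambda>y. ln (V_eff M \<pi> act \<omega> \<Phi> lam (cinv e y))) w a b
     + (\<Sum>i\<in>UNIV. of_real (c $ i) * line_curvature M B \<pi> act \<Phi> i lam e w a b)
     = of_real \<kappa> * (reduced_form M B \<pi> \<omega> \<Phi> lam e w a b
         + (\<Sum>i\<in>UNIV. of_real (lam $ i) * line_curvature M B \<pi> act \<Phi> i lam e w a b))"
proof -
  define F where "F w = logdet 1 (level_pt lam w)" for w
  define G where "G w = ln (Re (det_on (range \<alpha>) (h_level_pt w)))" for w
  define R where "R k = ddbar (midx B) (\<lambda>w. rad lam w $ k) w a b" for k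
  have Fs: "smooth_in (midx B) W F" unfolding F_def[abs_def] by (rule smooth_compose[OF level_pt_smooth logdet_smooth[OF one_T] level_pt_X])
  have N: "range \<alpha> \<subseteq> midx M" by auto
  have Gs: "smooth_in (midx B) W G"
    unfolding G_def[abs_def]
  proof (rule smooth_ln)
    show "smooth_in (midx B) W (\<lambda>w. Re (det_on (range \<alpha>) (h_level_pt w)))" by (rule smooth_compose[OF level_pt_smooth det_smooth[OF one_T N] level_pt_X])
    show "0 < Re (det_on (range \<alpha>) (h_level_pt w))" if "w \<in> W" for w
      by (rule det_pos(2)[OF E_mem[OF one_T] X_cimage[OF one_T level_pt_X[OF that]] N])
  qed
  have "ddbar (midx B) (\<lambda>y. ln (Re (det_on (midx B) (reduced_form M B \<pi> \<omega> \<Phi> lam e y)))) w a b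
    = ddbar (midx B) (\<lambda>y. 0 + 1 * F y + (- 1) * G y) w a b"
  proof (rule ddbar_cong[OF W_copen w])
    fix y assume y: "y \<in> W"
    have "det_on (midx B) (reduced_form M B \<pi> \<omega> \<Phi> lam e y) = det_on (midx B) (schur y)"
      unfolding reduced_form_eq[OF y] by (rule det_on_cong) simp
    then show "ln (Re (det_on (midx B) (reduced_form M B \<pi> \<omega> \<Phi> lam e y))) = 0 + 1 * F y + (- 1) * G y"
      using log_det_schur[OF y] by (simp add: F_def G_def)
  qed
  also have "\<dots> = of_real 1 * ddbar (midx B) F w a b + of_real (- 1) * ddbar (midx B) G w a b"
    by (rule ddbar_lincomb[OF Fs Gs w])
  finally have ric: "ricci_form B (reduced_form M B \<pi> \<omega> \<Phi> lam) e w a b = - (ddbar (midx B) F w a b - ddbar (midx B) G w a b)"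
    by (simp add: ricci_form_def)
  obtain K where K: "\<And>y. y \<in> W \<Longrightarrow> ln (V_eff M \<pi> act \<omega> \<Phi> lam (cinv e y)) = K + 1 / 2 * G y"
    using log_V_eff by (auto simp: G_def)
  have "ddbar (midx B) (\<lambda>y. ln (V_eff M \<pi> act \<omega> \<Phi> lam (cinv e y))) w a b = ddbar (midx B) (\<lambda>y. K + 1 / 2 * G y + 0 * G y) w a b"
    by (rule ddbar_cong[OF W_copen w]) (simp add: K)
  also have "\<dots> = of_real (1 / 2) * ddbar (midx B) G w a b + of_real 0 * ddbar (midx B) G w a b"
    by (rule ddbar_lincomb[OF Gs Gs w])
  finally have V: "2 * ddbar (midx B) (\<lambda>y. ln (V_eff M \<pi> act \<omega> \<Phi> lam (cinv e y))) w a b = ddbar (midx B) G w a b" by (simp add: mult.commute)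
  have F: "ddbar (midx B) F w a b = - of_real \<kappa> * schur w a b + (\<Sum>k\<in>UNIV. 2 * of_real (c $ k - \<kappa> * lam $ k) * R k)"
    using ddbar_logdet_level[OF w ab] by (simp add: F_def[abs_def] R_def)
  have red: "reduced_form M B \<pi> \<omega> \<Phi> lam e w a b = schur w a b" using reduced_form_eq[OF w] ab by simp
  have lc: "line_curvature M B \<pi> act \<Phi> i lam e w a b = 2 * R i" for i using line_curvature_eq[OF w] by (simp add: R_def)
  have "(\<Sum>k\<in>UNIV. 2 * of_real (c $ k - \<kappa> * lam $ k) * R k)
    = (\<Sum>i\<in>UNIV. of_real (c $ i) * (2 * R i)) - of_real \<kappa> * (\<Sum>i\<in>UNIV. of_real (lam $ i) * (2 * R i))"
    by (simp add: sum_subtractf[symmetric] sum_distrib_left algebra_simps)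
  then show ?thesis unfolding ric V F red lc by (simp add: algebra_simps)
qed

end

end

end

section \<open>Globalisation\<close>

context kaehler_bundle
begin

lemma adapted_exists:
  assumes e: "e \<in> mcharts B" and p: "p \<in> fst e"
  obtains V \<tau> \<alpha> \<gamma> where "adapted M B \<pi> act \<omega> \<Phi> V \<tau> e \<alpha> \<gamma>" "p \<in> V"
proof -
  have "p \<in> topspace (mtop B)" using chart_topspace[OF cm_chart[OF B e]] p by blast
  then obtain V \<tau> where V: "openin (mtop B) V" "p \<in> V"
    "biholomorphic_map (open_sub M (\<pi> -` V)) (prod_man T_complex_man (open_sub B V)) \<tau>"
    "\<forall>q\<in>topspace (mtop M) \<inter> \<pi> -` V. snd (\<tau> q) = \<pi> q \<and> (\<forall>a\<in>T_complex. \<tau> (act a q) = (a * fst (\<tau> q), \<pi> q))"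
    using principal unfolding principal_bundle_def by meson
  interpret t: trivialization M B \<pi> act \<omega> \<Phi> V \<tau> e
    by unfold_locales (use V e in auto)
  have "card (midx M) = card ((UNIV :: 'n set) <+> midx B)"
    using t.dimension[of p] p V(2) by (simp add: t.U_def card_Plus)
  then obtain f where f: "bij_betw f ((UNIV :: 'n set) <+> midx B) (midx M)"
    using finite_same_card_bij[of "(UNIV :: 'n set) <+> midx B" "midx M"] by auto
  have "adapted M B \<pi> act \<omega> \<Phi> V \<tau> e (\<lambda>j. f (Inl j)) (\<lambda>b. f (Inr b))"
  proof unfold_locales
    have inj: "f x = f y \<longleftrightarrow> x = y" if "x \<in> UNIV <+> midx B" "y \<in> UNIV <+> midx B" for x y
      using f that by (auto simp: bij_betw_def inj_on_def)
    show "inj (\<lambda>j. f (Inl j))" using inj by (auto simp: inj_def)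
    show "inj_on (\<lambda>b. f (Inr b)) (midx B)" using inj by (auto simp: inj_on_def)
    show "range (\<lambda>j. f (Inl j)) \<inter> (\<lambda>b. f (Inr b)) ` midx B = {}" using inj by force
    show "midx M = range (\<lambda>j. f (Inl j)) \<union> (\<lambda>b. f (Inr b)) ` midx B"
      using f unfolding bij_betw_def Plus_def by (auto simp: image_Un image_image)
  qed
  then show ?thesis using that V(2) by blast
qed

lemma divergence_constant:
  assumes conn: "connected_space (mtop M)" and ke: "kaehler_einstein M \<omega> \<kappa>"
  shows "\<exists>c :: real. \<forall>q\<in>topspace (mtop M). of_real (\<kappa> * \<Phi> q $ i) = - divergence M \<omega> (Z_field act i) q + of_real c"
proof (cases "topspace (mtop M) = {}")
  case False
  define f where "f q = divergence M \<omega> (Z_field act i) q + of_real (\<kappa> * \<Phi> q $ i)" for q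
  have loc: "(\<exists>N. openin (mtop M) N \<and> q \<in> N \<and> (\<forall>q'\<in>N. f q' = f q)) \<and> Im (f q) = 0" if q: "q \<in> topspace (mtop M)" for q
  proof -
    obtain e where e: "e \<in> mcharts B" "\<pi> q \<in> fst e" using chart_exists[OF B pi_top[OF q]] by blast
    obtain V \<tau> \<alpha> \<gamma> where a: "adapted M B \<pi> act \<omega> \<Phi> V \<tau> e \<alpha> \<gamma>" "\<pi> q \<in> V"
      by (rule adapted_exists[OF e])
    interpret a: adapted M B \<pi> act \<omega> \<Phi> V \<tau> e \<alpha> \<gamma> by (rule a(1))
    have "q \<in> a.QU" using q e a(2) by (simp add: a.QU_def a.U_def)
    from a.divergence_locally_constant[OF ke this, of i] show ?thesis by (simp add: f_def)
  qed
  obtain q0 where q0: "q0 \<in> topspace (mtop M)" using False by blast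
  let ?A = "{q \<in> topspace (mtop M). f q = f q0}"
  have "openin (mtop M) ?A"
    unfolding openin_subopen[of _ ?A]
  proof (intro ballI)
    fix q assume q: "q \<in> ?A"
    obtain N where N: "openin (mtop M) N" "q \<in> N" "\<forall>q'\<in>N. f q' = f q" using loc[of q] q by blast
    have "x \<in> ?A" if "x \<in> N" for x
    proof -
      have "f x = f q" using N(3) that by (rule bspec)
      then have "f x = f q0" using q by simp
      then show ?thesis using openin_subset[OF N(1)] that by blast
    qed
    then have "N \<subseteq> ?A" by (rule subsetI)
    then show "\<exists>N. openin (mtop M) N \<and> q \<in> N \<and> N \<subseteq> ?A" using N by blast
  qed
  moreover have "openin (mtop M) (topspace (mtop M) - ?A)"
    unfolding openin_subopen[of _ "topspace (mtop M) - ?A"]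
  proof (intro ballI)
    fix q assume q: "q \<in> topspace (mtop M) - ?A"
    obtain N where N: "openin (mtop M) N" "q \<in> N" "\<forall>q'\<in>N. f q' = f q" using loc[of q] q by blast
    have "x \<in> topspace (mtop M) - ?A" if "x \<in> N" for x
    proof -
      have "f x = f q" using N(3) that by (rule bspec)
      then have "f x \<noteq> f q0" using q by simp
      then show ?thesis using openin_subset[OF N(1)] that by blast
    qed
    then have "N \<subseteq> topspace (mtop M) - ?A" by (rule subsetI)
    then show "\<exists>N. openin (mtop M) N \<and> q \<in> N \<and> N \<subseteq> topspace (mtop M) - ?A" using N by blast
  qed
  ultimately have "?A = {} \<or> ?A = topspace (mtop M)"
    using conn unfolding connected_space_clopen_in closedin_def by blast
  then have all: "f q = f q0" if "q \<in> topspace (mtop M)" for q using q0 that by blast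
  have "f q0 = of_real (Re (f q0))" using loc[OF q0] by (simp add: complex_eq_iff)
  then have "of_real (\<kappa> * \<Phi> q $ i) = - divergence M \<omega> (Z_field act i) q + of_real (Re (f q0))" if "q \<in> topspace (mtop M)" for q
    using all[OF that] by (simp add: f_def algebra_simps)
  then show ?thesis by blast
qed auto

end

theorem mainTheorem1:
  fixes M :: "('m, 'd::finite) cman"
    and B :: "('b, 'r::finite) cman"
    and \<pi> :: "'m \<Rightarrow> 'b"
    and act :: "complex ^ 'n::finite \<Rightarrow> 'm \<Rightarrow> 'm"
    and \<omega> :: "('m, 'd) form11"
    and \<Phi> :: "'m \<Rightarrow> real ^ 'n"
    and \<kappa> :: real
  assumes "complex_manifold M" and "connected_space (mtop M)"
    and "complex_manifold B"
    and "principal_bundle M B \<pi> act"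
    and "\<forall>t\<in>T_compact. preserves_form M \<omega> (act t)"
    and "moment_map M act \<omega> \<Phi>"
    and "kaehler_einstein M \<omega> \<kappa>"
  shows "\<exists>c :: real ^ 'n.
    (\<forall>lam \<in> Lambda_set M B \<pi> act \<Phi>.
       \<forall>e \<in> mcharts B. \<forall>x \<in> cimage e. \<forall>a \<in> midx B. \<forall>b \<in> midx B.
         ricci_form B (reduced_form M B \<pi> \<omega> \<Phi> lam) e x a b
         - 2 * ddbar (midx B) (\<lambda>y. ln (V_eff M \<pi> act \<omega> \<Phi> lam (cinv e y))) x a b
         + (\<Sum>i\<in>UNIV. of_real (c $ i) * line_curvature M B \<pi> act \<Phi> i lam e x a b)
         = of_real \<kappa> * (reduced_form M B \<pi> \<omega> \<Phi> lam e x a b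
             + (\<Sum>i\<in>UNIV. of_real (lam $ i) * line_curvature M B \<pi> act \<Phi> i lam e x a b))) \<and>
    (\<forall>i. \<forall>q \<in> topspace (mtop M).
       of_real (\<kappa> * \<Phi> q $ i) = - divergence M \<omega> (Z_field act i) q + of_real (c $ i))"
proof -
  have "kaehler_form M \<omega>" using assms(7) by (simp add: kaehler_einstein_def)
  then interpret kaehler_bundle M B \<pi> act \<omega> \<Phi>
    using assms by unfold_locales auto
  obtain c' where c': "\<And>i q. q \<in> topspace (mtop M) \<Longrightarrow>
      of_real (\<kappa> * \<Phi> q $ i) = - divergence M \<omega> (Z_field act i) q + of_real (c' i)"
    using divergence_constant[OF assms(2,7)] by metis
  define c :: "real ^ 'n" where "c = (\<chi> i. c' i)"
  have c: "of_real (\<kappa> * \<Phi> q $ i) = - divergence M \<omega> (Z_field act i) q + of_real (c $ i)"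
    if "q \<in> topspace (mtop M)" for i q using c'[OF that] by (simp add: c_def)
  show ?thesis
  proof (intro exI[of _ c] conjI ballI allI)
    show "of_real (\<kappa> * \<Phi> q $ i) = - divergence M \<omega> (Z_field act i) q + of_real (c $ i)"
      if "q \<in> topspace (mtop M)" for i q by (rule c[OF that])
    fix lam e x a b
    assume lam: "lam \<in> Lambda_set M B \<pi> act \<Phi>" and e: "e \<in> mcharts B" and x: "x \<in> cimage e"
      and ab: "a \<in> midx B" "b \<in> midx B"
    obtain V \<tau> \<alpha> \<gamma> where ad: "adapted M B \<pi> act \<omega> \<Phi> V \<tau> e \<alpha> \<gamma>" "cinv e x \<in> V"
      by (rule adapted_exists[OF e cinv_in[OF x]])
    interpret ad: adapted M B \<pi> act \<omega> \<Phi> V \<tau> e \<alpha> \<gamma> by (rule ad(1))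
    have "x \<in> ad.W"
      unfolding ad.W_def ad.U_def using cinv_in[OF x] ad(2) snd_cinv[OF x] by (metis IntI image_eqI)
    then show "ricci_form B (reduced_form M B \<pi> \<omega> \<Phi> lam) e x a b
         - 2 * ddbar (midx B) (\<lambda>y. ln (V_eff M \<pi> act \<omega> \<Phi> lam (cinv e y))) x a b
         + (\<Sum>i\<in>UNIV. of_real (c $ i) * line_curvature M B \<pi> act \<Phi> i lam e x a b)
         = of_real \<kappa> * (reduced_form M B \<pi> \<omega> \<Phi> lam e x a b
             + (\<Sum>i\<in>UNIV. of_real (lam $ i) * line_curvature M B \<pi> act \<Phi> i lam e x a b))"
      using ad.reduced_einstein[OF lam assms(7) c _ ab] by blast
  qed
qed

end
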